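(* Let $w_0>0$, $\ell>1$, $(\phi_0,a_0)\in\mathcal{H}_{w_0}^{\ell+2}\times\mathcal{H}_{w_0}^{\ell+1}$, and let $(\phi_0^\varepsilon,a_0^\varepsilon)_{\varepsilon\in(0,1]}$ be bounded in $\mathcal{H}_{w_0}^{\ell+1}\times\mathcal{H}_{w_0}^{\ell}$, with $\phi_0,\phi_0^\varepsilon$ real-valued and $a_0,a_0^\varepsilon$ complex-valued, such that $$r_0^\varepsilon:=\|\phi_0^\varepsilon-\phi_0\|_{\mathcal{H}_{w_0}^{\ell+1}}+\|a_0^\varepsilon-a_0\|_{\mathcal{H}_{w_0}^{\ell}}\longrightarrow0\quad\text{as }\varepsilon\to0.$$ Then, provided $M=M(\ell+1)>0$ is sufficiently large (i.e. for all $M\ge M_0$, for some $M_0>0$ independent of $\varepsilon$), with $w(t)=w_0-Mt$ and $0<T<w_0/M$, the system $$ (\mathrm{S}_\varepsilon)\quad\begin{cases} \partial_t \phi^\varepsilon + \frac12(\partial_x\phi^\varepsilon)^2+\frac12 g(|a^\varepsilon|^2)\partial_x\phi^\varepsilon+f(|a^\varepsilon|^2)=0, & \phi^\varepsilon_{|t=0}=\phi_0^\varepsilon,\\ \partial_t a^\varepsilon+\partial_x\phi^\varepsilon\,\partial_x a^\varepsilon+\frac12 a^\varepsilon\partial_x^2\phi^\varepsilon+\frac12\partial_x\big(g(|a^\varepsilon|^2)a^\varepsilon\big)=\frac{i\varepsilon}{2}\partial_x^2a^\varepsilon, & a^\varepsilon_{|t=0}=a_0^\varepsilon, \end{cases}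 $$ has a unique solution $(\phi^\varepsilon,a^\varepsilon)\in X_{w,T}^\ell$ for each $\varepsilon\in(0,1]$, the limit system $$ (\mathrm{S}_0)\quad\begin{cases} \partial_t \phi + \frac12(\partial_x\phi)^2+\frac12 g(|a|^2)\partial_x\phi+f(|a|^2)=0, & \phi_{|t=0}=\phi_0,\\ \partial_t a+\partial_x\phi\,\partial_x a+\frac12 a\,\partial_x^2\phi+\frac12\partial_x\big(g(|a|^2)a\big)=0, & a_{|t=0}=a_0, \end{cases} $$ has a unique solution $(\phi,a)\in X_{w,T}^{\ell+1}$, and there is an $\varepsilon$-independent constant $C>0$ such that for all $\varepsilon\in(0,1]$, $$|||\phi^\varepsilon-\phi|||_{\ell+1,T}+|||a^\varepsilon-a|||_{\ell,T}\le C\,(r_0^\varepsilon+\varepsilon).$$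
   Context: Nonlinearities: $g(s)=\alpha s^\gamma$ and $f(s)=\lambda s^\sigma$, where $\alpha,\lambda\in\mathbb{R}$ and $\gamma,\sigma$ are positive integers, fixed throughout. All systems are posed for $(t,x)\in[0,T]\times\mathbb{R}$. Fourier transform: $\hat\psi(\xi)=\mathcal{F}\psi(\xi)=\frac{1}{\sqrt{2\pi}}\int_{\mathbb{R}}e^{-ix\xi}\psi(x)\,dx$, and $\langle\xi\rangle=\sqrt{1+\xi^2}$. For $w\ge0$ and $\ell\ge0$, $\mathcal{H}_w^\ell=\{\psi\in L^2(\mathbb{R}):\|\psi\|_{\mathcal{H}_w^\ell}<\infty\}$ with $\|\psi\|_{\mathcal{H}_w^\ell}^2=\int_{\mathbb{R}}\langle\xi\rangle^{2\ell}e^{2w\langle\xi\rangle}|\hat\psi(\xi)|^2\,d\xi$. For a time-dependent weight $w(t)=w_0-Mt$ with $w_0,M>0$ and $0<T<w_0/M$: $C([0,T],\mathcal{H}_w^\ell)$ is the set of $\psi$ such that $\mathcal{F}^{-1}\big(e^{w(t)\langle\xi\rangle}\hat\psi\big)\in C([0,T],H^\ell(\mathbb{R}))$ (Fourier transform in $x$); $L^2_T\mathcal{H}_w^\ell$ is the set of $\psi$ such that $\int_0^T\|\psi(t)\|_{\mathcal{H}_{w(t)}^\ell}^2dt<\infty$. Set $Y_{w,T}^\ell=C([0,T],\mathcal{H}_w^\ell)\cap L^2_T\mathcal{H}_w^{\ell+1/2}$ and $X_{w,T}^\ell=Y_{w,T}^{\ell+1}\times Y_{w,T}^\ell$. For $0\le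 t\le T$, $$|||\psi|||_{\ell,t}^2=\max\Big(\sup_{0\le s\le t}\|\psi(s)\|_{\mathcal{H}_{w(s)}^\ell}^2,\ 2M\int_0^t\|\psi(s)\|_{\mathcal{H}_{w(s)}^{\ell+1/2}}^2ds\Big).$$ The constant $M(\ell+1)$ is the (sufficiently large) constant furnished by the local well-posedness theory at regularity $\ell+1$: for $k>1$ and a family of initial data bounded in $\mathcal{H}_{w_0}^{k+1}\times\mathcal{H}_{w_0}^{k}$, the systems $(\mathrm{S}_\varepsilon)$, $\varepsilon\in[0,1]$, have unique solutions in $X_{w,T}^k$ when $w(t)=w_0-Mt$, $M=M(k)$ is sufficiently large and $T=T(k)<w_0/M$; $k\mapsto M(k)$ is taken to be increasing. *)

theory Defs
  imports "HOL-Analysis.Analysis"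
begin

(* Elements of L^2(R) are represented by Borel functions on the line, not by classes modulo null sets. *)
definition L2 :: "(real \<Rightarrow> complex) set" where
  "L2 = {\<psi>. \<psi> \<in> borel_measurable lborel \<and> integrable lborel (\<lambda>x. (cmod (\<psi> x))\<^sup>2)}"

definition truncated_fourier :: "real \<Rightarrow> (real \<Rightarrow> complex) \<Rightarrow> real \<Rightarrow> complex" where
  "truncated_fourier R \<psi> \<xi> =
     complex_of_real (1 / sqrt (2 * pi)) *
       (LINT x:{-R..R}|lborel. exp (- \<i> * complex_of_real (x * \<xi>)) * \<psi> x)"

(* The Fourier-Plancherel transform: the L^2 limit of the transforms of the truncations of \<psi>
   (for an integrable \<psi>, the usual integral).  The limit determines a function up to a null set;
   SOME picks a representative, on which nothing below depends. *)
definition fourier :: "(real \<Rightarrow> complex) \<Rightarrow> real \<Rightarrow> complex" where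
  "fourier \<psi> = (SOME h. h \<in> L2 \<and>
     ((\<lambda>R. \<integral>\<^sup>+\<xi>. ennreal ((cmod (truncated_fourier R \<psi> \<xi> - h \<xi>))\<^sup>2) \<partial>lborel) \<longlongrightarrow> 0) at_top)"

definition inv_fourier :: "(real \<Rightarrow> complex) \<Rightarrow> real \<Rightarrow> complex" where
  "inv_fourier h = (SOME \<psi>. \<psi> \<in> L2 \<and> (AE \<xi> in lborel. fourier \<psi> \<xi> = h \<xi>))"

definition jap :: "real \<Rightarrow> real" where
  "jap \<xi> = sqrt (1 + \<xi>\<^sup>2)"

definition ennsqrt :: "ennreal \<Rightarrow> ennreal" where
  "ennsqrt x = (if x = top then top else ennreal (sqrt (enn2real x)))"

definition H_normsq :: "real \<Rightarrow> real \<Rightarrow> (real \<Rightarrow> complex) \<Rightarrow> ennreal" where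
  "H_normsq w l \<psi> =
     (\<integral>\<^sup>+\<xi>. ennreal (jap \<xi> powr (2 * l) * exp (2 * w * jap \<xi>) * (cmod (fourier \<psi> \<xi>))\<^sup>2) \<partial>lborel)"

definition H_norm :: "real \<Rightarrow> real \<Rightarrow> (real \<Rightarrow> complex) \<Rightarrow> ennreal" where
  "H_norm w l \<psi> = ennsqrt (H_normsq w l \<psi>)"

(* For w = 0 this is the Sobolev space H^l(R). *)
definition H_space :: "real \<Rightarrow> real \<Rightarrow> (real \<Rightarrow> complex) set" where
  "H_space w l = {\<psi> \<in> L2. H_norm w l \<psi> < top}"

(* Time-dependent functions are written \<psi> t x; only their values for 0 \<le> t \<le> T matter. *)
definition lifted :: "(real \<Rightarrow> real) \<Rightarrow> (real \<Rightarrow> real \<Rightarrow> complex) \<Rightarrow> real \<Rightarrow> real \<Rightarrow> complex" where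
  "lifted w \<psi> t = inv_fourier (\<lambda>\<xi>. complex_of_real (exp (w t * jap \<xi>)) * fourier (\<psi> t) \<xi>)"

definition C_H :: "(real \<Rightarrow> real) \<Rightarrow> real \<Rightarrow> real \<Rightarrow> (real \<Rightarrow> real \<Rightarrow> complex) set" where
  "C_H w T l = {\<psi>.
     (\<forall>t\<in>{0..T}. \<psi> t \<in> L2 \<and>
        (\<lambda>\<xi>. complex_of_real (exp (w t * jap \<xi>)) * fourier (\<psi> t) \<xi>) \<in> L2 \<and>
        lifted w \<psi> t \<in> H_space 0 l) \<and>
     (\<forall>s\<in>{0..T}. ((\<lambda>t. H_norm 0 l (\<lambda>x. lifted w \<psi> t x - lifted w \<psi> s x)) \<longlongrightarrow> 0)
        (at s within {0..T}))}"

(* Measurability in time is not required here: in Y_space it follows from membership in C_H. *)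
definition L2_H :: "(real \<Rightarrow> real) \<Rightarrow> real \<Rightarrow> real \<Rightarrow> (real \<Rightarrow> real \<Rightarrow> complex) set" where
  "L2_H w T l = {\<psi>.
     (AE t in lborel. t \<in> {0..T} \<longrightarrow> \<psi> t \<in> L2) \<and>
     (\<integral>\<^sup>+t\<in>{0..T}. H_normsq (w t) l (\<psi> t) \<partial>lborel) < top}"

definition Y_space :: "(real \<Rightarrow> real) \<Rightarrow> real \<Rightarrow> real \<Rightarrow> (real \<Rightarrow> real \<Rightarrow> complex) set" where
  "Y_space w T l = C_H w T l \<inter> L2_H w T (l + 1/2)"

definition X_space ::
  "(real \<Rightarrow> real) \<Rightarrow> real \<Rightarrow> real \<Rightarrow> ((real \<Rightarrow> real \<Rightarrow> complex) \<times> (real \<Rightarrow> real \<Rightarrow> complex)) set" where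
  "X_space w T l = Y_space w T (l + 1) \<times> Y_space w T l"

definition weight :: "real \<Rightarrow> real \<Rightarrow> real \<Rightarrow> real" where
  "weight w0 M t = w0 - M * t"

definition triple_norm :: "real \<Rightarrow> real \<Rightarrow> real \<Rightarrow> real \<Rightarrow> (real \<Rightarrow> real \<Rightarrow> complex) \<Rightarrow> ennreal" where
  "triple_norm w0 M l t \<psi> = ennsqrt (max
     (SUP s\<in>{0..t}. H_normsq (weight w0 M s) l (\<psi> s))
     (ennreal (2 * M) * (\<integral>\<^sup>+s\<in>{0..t}. H_normsq (weight w0 M s) (l + 1/2) (\<psi> s) \<partial>lborel)))"

definition Dx :: "(real \<Rightarrow> real \<Rightarrow> complex) \<Rightarrow> real \<Rightarrow> real \<Rightarrow> complex" where
  "Dx u t x = vector_derivative (u t) (at x)"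

(* One-sided at the end points of the time interval. *)
definition Dt :: "real \<Rightarrow> (real \<Rightarrow> real \<Rightarrow> complex) \<Rightarrow> real \<Rightarrow> real \<Rightarrow> complex" where
  "Dt T u t x = vector_derivative (\<lambda>s. u s x) (at t within {0..T})"

definition power_nl :: "real \<Rightarrow> nat \<Rightarrow> real \<Rightarrow> real" where
  "power_nl c n s = c * s ^ n"

(* Classical solutions of the system with parameter \<epsilon>, the limit system being \<epsilon> = 0.  As the weight
   is positive on [0,T], elements of X_space are analytic in x up to null sets, and differentiability
   selects the continuous representatives. *)
definition solves_system ::
  "(real \<Rightarrow> real) \<Rightarrow> (real \<Rightarrow> real) \<Rightarrow> real \<Rightarrow> real \<Rightarrow>
   (real \<Rightarrow> real \<Rightarrow> complex) \<Rightarrow> (real \<Rightarrow> real \<Rightarrow> complex) \<Rightarrow> bool" where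
  "solves_system g f \<epsilon> T \<phi> a \<longleftrightarrow> (\<forall>t\<in>{0..T}. \<forall>x.
     (\<lambda>s. \<phi> s x) differentiable (at t within {0..T}) \<and>
     (\<lambda>s. a s x) differentiable (at t within {0..T}) \<and>
     \<phi> t differentiable (at x) \<and> Dx \<phi> t differentiable (at x) \<and>
     a t differentiable (at x) \<and> Dx a t differentiable (at x) \<and>
     Dt T \<phi> t x + 1/2 * (Dx \<phi> t x)\<^sup>2
       + 1/2 * complex_of_real (g ((cmod (a t x))\<^sup>2)) * Dx \<phi> t x
       + complex_of_real (f ((cmod (a t x))\<^sup>2)) = 0 \<and>
     Dt T a t x + Dx \<phi> t x * Dx a t x + 1/2 * a t x * Dx (Dx \<phi>) t x
       + 1/2 * Dx (\<lambda>t x. complex_of_real (g ((cmod (a t x))\<^sup>2)) * a t x) t x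
       = \<i> * complex_of_real \<epsilon> / 2 * Dx (Dx a) t x)"

(* The initial data are elements of L^2, hence attained almost everywhere. *)
definition X_solution ::
  "(real \<Rightarrow> real) \<Rightarrow> (real \<Rightarrow> real) \<Rightarrow> real \<Rightarrow> (real \<Rightarrow> real) \<Rightarrow> real \<Rightarrow> real \<Rightarrow>
   (real \<Rightarrow> complex) \<Rightarrow> (real \<Rightarrow> complex) \<Rightarrow>
   (real \<Rightarrow> real \<Rightarrow> complex) \<Rightarrow> (real \<Rightarrow> real \<Rightarrow> complex) \<Rightarrow> bool" where
  "X_solution g f \<epsilon> w T l \<phi>0 a0 \<phi> a \<longleftrightarrow>
     (\<phi>, a) \<in> X_space w T l \<and> solves_system g f \<epsilon> T \<phi> a \<and>
     (AE x in lborel. \<phi> 0 x = \<phi>0 x) \<and> (AE x in lborel. a 0 x = a0 x)"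

(* The solution has a real-valued phase, and is unique even among pairs with a complex-valued phase. *)
definition unique_X_solution ::
  "(real \<Rightarrow> real) \<Rightarrow> (real \<Rightarrow> real) \<Rightarrow> real \<Rightarrow> (real \<Rightarrow> real) \<Rightarrow> real \<Rightarrow> real \<Rightarrow>
   (real \<Rightarrow> complex) \<Rightarrow> (real \<Rightarrow> complex) \<Rightarrow>
   (real \<Rightarrow> real \<Rightarrow> complex) \<Rightarrow> (real \<Rightarrow> real \<Rightarrow> complex) \<Rightarrow> bool" where
  "unique_X_solution g f \<epsilon> w T l \<phi>0 a0 \<phi> a \<longleftrightarrow>
     X_solution g f \<epsilon> w T l \<phi>0 a0 \<phi> a \<and>
     (\<forall>t\<in>{0..T}. \<forall>x. \<phi> t x \<in> \<real>) \<and>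
     (\<forall>\<phi>' a'. X_solution g f \<epsilon> w T l \<phi>0 a0 \<phi>' a' \<longrightarrow>
        (\<forall>t\<in>{0..T}. \<forall>x. \<phi>' t x = \<phi> t x \<and> a' t x = a t x))"

end

theory Submission
 imports Defs "HOL-Probability.Probability"
begin

text \<open>
 For almost every frequency \<open>\<xi>\<close> the system is an ordinary differential equation in time. Multiply Fourier transforms by
 \<open>exp (\<rho> * jap \<xi>)\<close>: since \<open>jap\<close> is subadditive, pointwise majorants of the factors give majorants of products by convolution,
 and the weighted \<open>L2\<close> norms are algebra norms. For the decreasing weight \<open>\<rho> t = w0 - m * t\<close> integration in time gains a
 factor \<open>1 / (m * jap \<xi>)\<close>, which pays for the derivative lost in the nonlinearity and is small for large \<open>m\<close>; the dispersive
 term only contributes factors of modulus one, so that all constants are uniform in \<open>\<epsilon>\<close>. Picard iteration then converges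
 monotonically on the level of majorants. The choice \<open>m = M / 2\<close> leaves room for the time-integrated norm.

 The difference of two solutions is estimated by the same gain; the term \<open>\<epsilon> * \<xi>\<^sup>2 / 2\<close> acting on the limit is a source
 term of size \<open>\<epsilon>\<close>, at the price of one more derivative of the limit. For uniqueness, the Fourier transform of a classical solution in
 the class is shown to solve the same differential equation with an exponentially decaying majorant, so that the same estimate applies.
\<close>

text \<open>The factor \<open>1 / (m * jap \<xi>)\<close> comes from integrating an exponential in
  time at one fixed frequency, so it requires a bound of the nonlinearity at that frequency which is
  uniform in time. The norms of the class are bounds at each single time, with the supremum outside
  the frequency integral. This obstacle is met by majorants that do not depend on time: the supremum
  moves inside the integral, and both convolution and Duhamel's formula preserve this form.
  Iteration produces such majorants. An arbitrary solution of the class has none to begin with, and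
  finding one, at some smaller exponential rate, is the bulk of the uniqueness proof. The gain
  exactly compensates the derivative that the equations lose, so that smallness comes from
  \<open>1 / m\<close> alone and the time is limited only by the sign of the weight. The dispersive
  source contains two derivatives of the limit amplitude and is measured in order
  \<open>l - 1\<close>, which is the reason for the order \<open>l + 1\<close> of the limit
  solution.\<close>

abbreviation Borel :: "('a::topological_space \<Rightarrow> 'b::topological_space) \<Rightarrow> bool" where
 "Borel u \<equiv> u \<in> borel_measurable borel"

abbreviation fdiff (infixl "\<ominus>" 65) where "u \<ominus> v \<equiv> \<lambda>x. u x - v x"
abbreviation fsum (infixl "\<oplus>" 65) where "u \<oplus> v \<equiv> \<lambda>x. u x + v x"
abbreviation eq_AE (infix "\<doteq>" 50) where "u \<doteq> v \<equiv> AE x in lborel. u x = v x"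

type_synonym cfun = "real \<Rightarrow> complex"
type_synonym cpath = "real \<Rightarrow> real \<Rightarrow> complex"
type_synonym nnfun = "real \<Rightarrow> ennreal"

abbreviation jmeas :: "cpath \<Rightarrow> bool" where
 "jmeas u \<equiv> case_prod u \<in> borel_measurable (borel \<Otimes>\<^sub>M borel)"

lemma L2_measurable [measurable_dest]: "\<psi> \<in> L2 \<Longrightarrow> Borel \<psi>"
 by (simp add: L2_def)

section \<open>Plancherel transform\<close>

definition n2 :: "cfun \<Rightarrow> ennreal" where
 "n2 f = (\<integral>\<^sup>+x. ennreal ((cmod (f x))\<^sup>2) \<partial>lborel)"

lemma L2_iff: "\<psi> \<in> L2 \<longleftrightarrow> Borel \<psi> \<and> n2 \<psi> < top"
 by (auto simp: L2_def n2_def integrable_iff_bounded)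

lemma ennreal_sum_sq: "((a::ennreal) + b)\<^sup>2 \<le> 2 * a\<^sup>2 + 2 * b\<^sup>2"
proof (cases "a = top \<or> b = top")
 case True then show ?thesis by (auto simp: ennreal_mult_eq_top_iff power2_eq_square)
next
 case False
 then obtain x y where "a = ennreal x" "b = ennreal y" "x \<ge> 0" "y \<ge> 0"
  by (metis ennreal_cases)
 moreover have "(x + y)\<^sup>2 \<le> 2 * x\<^sup>2 + 2 * y\<^sup>2"
  using zero_le_power2[of "x - y"] by (simp add: power2_eq_square algebra_simps)
 ultimately show ?thesis
  by (simp flip: ennreal_plus ennreal_numeral add: ennreal_power flip: ennreal_mult)
qed

lemma n2_add:
 assumes [measurable]: "Borel f" "Borel g"
 shows "n2 (f \<oplus> g) \<le> 2 * n2 f + 2 * n2 g"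
proof -
 have "n2 (f \<oplus> g) \<le> (\<integral>\<^sup>+x. 2 * ennreal ((cmod (f x))\<^sup>2) + 2 * ennreal ((cmod (g x))\<^sup>2) \<partial>lborel)"
  unfolding n2_def
 proof (intro nn_integral_mono)
  fix x
  have "ennreal ((cmod (f x + g x))\<^sup>2) \<le> (ennreal (cmod (f x)) + ennreal (cmod (g x)))\<^sup>2"
   by (simp flip: ennreal_plus add: ennreal_power ennreal_leI norm_triangle_ineq power_mono)
  also have "... \<le> 2 * ennreal ((cmod (f x))\<^sup>2) + 2 * ennreal ((cmod (g x))\<^sup>2)"
   using ennreal_sum_sq[of "ennreal (cmod (f x))" "ennreal (cmod (g x))"] by (simp add: ennreal_power)
  finally show "ennreal ((cmod (f x + g x))\<^sup>2) \<le> ..." .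
 qed
 also have "... = 2 * n2 f + 2 * n2 g"
  unfolding n2_def by (simp add: nn_integral_add nn_integral_cmult)
 finally show ?thesis .
qed

lemma n2_uminus [simp]: "n2 (\<lambda>x. - f x) = n2 f"
 by (simp add: n2_def)

lemma n2_diff:
 assumes [measurable]: "Borel f" "Borel g"
 shows "n2 (f \<ominus> g) \<le> 2 * n2 f + 2 * n2 g"
 using n2_add[of f "\<lambda>x. - g x"] by simp

lemma n2_cong_AE: "f \<doteq> g \<Longrightarrow> n2 f = n2 g"
 unfolding n2_def by (intro nn_integral_cong_AE) auto

lemma n2_reflect:
 assumes [measurable]: "Borel f"
 shows "n2 (\<lambda>x. f (- x)) = n2 f"
 unfolding n2_def using nn_integral_real_affine[of "\<lambda>x. ennreal ((cmod (f x))\<^sup>2)" "-1" 0] by simp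

lemma n2_0_iff:
 assumes [measurable]: "Borel f" "Borel g"
 shows "n2 (f \<ominus> g) = 0 \<longleftrightarrow> (f \<doteq> g)"
 unfolding n2_def by (subst nn_integral_0_iff_AE) auto

lemma AE_reflect:
 assumes "AE x in lborel. P (x::real)" shows "AE x in lborel. P (- x)"
proof -
 obtain N where N: "N \<in> sets lborel" "emeasure lborel N = 0" "{x. \<not> P x} \<subseteq> N"
  using assms by (auto simp: eventually_ae_filter null_sets_def)
 have [measurable]: "N \<in> sets borel" using N by simp
 have "AE x in lborel. x \<notin> N" using N by (simp add: AE_iff_null_sets null_sets_def AE_not_in)
 from AE_borel_affine[OF _ _ this, of "-1" 0] have "AE x in lborel. - x \<notin> N" by simp
 then show ?thesis using N by (auto elim!: eventually_mono)
qed

lemma AE_translate_reflect: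
 assumes "AE x in lborel. P (x::real)" shows "AE x in lborel. P (t - x)"
proof -
 obtain N where N: "N \<in> sets lborel" "emeasure lborel N = 0" "{x. \<not> P x} \<subseteq> N"
  using assms by (auto simp: eventually_ae_filter null_sets_def)
 have [measurable]: "N \<in> sets borel" using N by simp
 have "AE x in lborel. x \<notin> N" using N by (simp add: AE_iff_null_sets null_sets_def AE_not_in)
 from AE_borel_affine[OF _ _ this, of "-1" t] have "AE x in lborel. t - x \<notin> N" by simp
 then show ?thesis using N by (auto elim!: eventually_mono)
qed

lemma L2_diff: "f \<in> L2 \<Longrightarrow> g \<in> L2 \<Longrightarrow> (f \<ominus> g) \<in> L2"
 unfolding L2_iff using n2_diff[of f g]
 by (auto simp: ennreal_mult_less_top less_top[symmetric] top_unique ennreal_mult_eq_top_iff)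

lemma L2_reflect: "f \<in> L2 \<Longrightarrow> (\<lambda>x. f (- x)) \<in> L2"
 unfolding L2_iff using n2_reflect[of f] by auto

text \<open>The squared errors have summable integrals, so by monotone convergence their sum is
  finite at almost every point, and its terms tend to zero there.\<close>

lemma AE_tendsto_of_summable_n2:
 fixes f :: "nat \<Rightarrow> real \<Rightarrow> complex"
 assumes [measurable]: "\<And>n. Borel (f n)" "Borel g"
  and le: "\<And>n. n2 (f n \<ominus> g) \<le> ennreal ((1/2)^n)"
 shows "AE x in lborel. (\<lambda>n. f n x) \<longlonglongrightarrow> g x"
proof -
 have "(\<integral>\<^sup>+x. (\<Sum>n. ennreal ((cmod (f n x - g x))\<^sup>2)) \<partial>lborel) = (\<Sum>n. n2 (f n \<ominus> g))"
  unfolding n2_def by (simp add: nn_integral_suminf)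
 also have "... \<le> (\<Sum>n. ennreal ((1/2)^n))" by (intro suminf_le le) auto
 also have "... < top" by (simp add: suminf_ennreal2 less_top[symmetric])
 finally have "AE x in lborel. (\<Sum>n. ennreal ((cmod (f n x - g x))\<^sup>2)) \<noteq> \<infinity>"
  by (intro nn_integral_PInf_AE) auto
 then show ?thesis
 proof eventually_elim
  case (elim x)
  have "summable (\<lambda>n. (cmod (f n x - g x))\<^sup>2)"
   using elim by (intro summable_suminf_not_top) auto
  then have "(\<lambda>n. (cmod (f n x - g x))\<^sup>2) \<longlonglongrightarrow> 0" by (rule summable_LIMSEQ_zero)
  then have "(\<lambda>n. sqrt ((cmod (f n x - g x))\<^sup>2)) \<longlonglongrightarrow> sqrt 0" by (intro tendsto_real_sqrt)
  then show ?case by (simp add: LIM_zero_iff tendsto_norm_zero_iff)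
 qed
qed

text \<open>Riesz-Fischer with a rate. The ratio 1/8 leaves room for the weight \<open>4^n\<close>:
  the weighted squared increments still have summable integrals, so at almost every point the
  increments are at most \<open>sqrt S * (1/2)^n\<close> and the telescoping series converges.
  Fatou's lemma passes the rate to the limit.\<close>

lemma L2_complete_fast:
 fixes f :: "nat \<Rightarrow> real \<Rightarrow> complex"
 assumes [measurable]: "\<And>n. Borel (f n)"
  and le: "\<And>n m. n \<le> m \<Longrightarrow> n2 (f n \<ominus> f m) \<le> ennreal ((1/8)^n)"
 obtains g where "Borel g" "\<And>n. n2 (f n \<ominus> g) \<le> ennreal ((1/8)^n)"
  "AE x in lborel. (\<lambda>n. f n x) \<longlonglongrightarrow> g x"
proof -
 define d where "d n x = (cmod (f n x - f (Suc n) x))\<^sup>2" for n x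
 have [measurable]: "Borel (d n)" for n unfolding d_def by measurable
 have dn: "d n x \<ge> 0" for n x by (simp add: d_def)
 have "(\<integral>\<^sup>+x. (\<Sum>n. ennreal (4^n * d n x)) \<partial>lborel) = (\<Sum>n. (\<integral>\<^sup>+x. ennreal (4^n * d n x) \<partial>lborel))"
  by (intro nn_integral_suminf) auto
 also have "... = (\<Sum>n. ennreal (4^n) * n2 (f n \<ominus> f (Suc n)))"
  unfolding n2_def d_def by (intro suminf_cong) (simp add: ennreal_mult nn_integral_cmult)
 also have "... \<le> (\<Sum>n. ennreal (4^n) * ennreal ((1/8)^n))"
  by (intro suminf_le mult_left_mono le) auto
 also have "... = (\<Sum>n. ennreal ((1/2)^n))"
  by (intro suminf_cong) (simp flip: ennreal_mult power_mult_distrib)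
 also have "... < top" by (simp add: suminf_ennreal2 less_top[symmetric])
 finally have "AE x in lborel. (\<Sum>n. ennreal (4^n * d n x)) \<noteq> \<infinity>"
  by (intro nn_integral_PInf_AE) auto
 then have conv: "AE x in lborel. convergent (\<lambda>n. f n x)"
 proof eventually_elim
  case (elim x)
  have s: "summable (\<lambda>n. 4^n * d n x)"
   using elim dn by (intro summable_suminf_not_top) auto
  define S where "S = (\<Sum>n. 4^n * d n x)"
  have "4^n * d n x \<le> S" for n
   unfolding S_def using sum_le_suminf[OF s, of "{n}"] dn by auto
  then have "d n x \<le> S * (1/4)^n" for n by (simp add: field_simps power_divide)
  then have "cmod (f n x - f (Suc n) x) \<le> sqrt (S * (1/4)^n)" for n
   unfolding d_def by (intro real_le_rsqrt) auto
  then have *: "norm (f (Suc n) x - f n x) \<le> sqrt S * (1/2)^n" for n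
   by (simp add: real_sqrt_mult real_sqrt_power norm_minus_commute real_sqrt_divide)
  have "summable (\<lambda>n. f (Suc n) x - f n x)"
   by (rule summable_comparison_test'[where N=0, OF _ *]) (auto intro!: summable_mult)
  then have "summable (\<lambda>n. f (Suc n) x - f n x)" .
  then obtain l where "(\<lambda>n. \<Sum>k<n. f (Suc k) x - f k x) \<longlonglongrightarrow> l" by (auto simp: summable_def sums_def)
  then have "(\<lambda>n. f n x - f 0 x) \<longlonglongrightarrow> l"
   by (simp only: sum_lessThan_telescope[of "\<lambda>k. f k x"])
  then have "(\<lambda>n. (f n x - f 0 x) + f 0 x) \<longlonglongrightarrow> l + f 0 x" by (intro tendsto_intros)
  then show ?case by (auto simp: convergent_def)
 qed
 define g where "g x = lim (\<lambda>n. f n x)" for x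
 have [measurable]: "Borel g" unfolding g_def by measurable
 have lim: "AE x in lborel. (\<lambda>n. f n x) \<longlonglongrightarrow> g x"
  using conv by eventually_elim (simp add: g_def convergent_LIMSEQ_iff)
 have "n2 (f n \<ominus> g) \<le> ennreal ((1/8)^n)" for n
 proof -
  have "n2 (f n \<ominus> g) = (\<integral>\<^sup>+x. liminf (\<lambda>m. ennreal ((cmod (f n x - f m x))\<^sup>2)) \<partial>lborel)"
   unfolding n2_def
  proof (intro nn_integral_cong_AE, use lim in eventually_elim)
   case (elim x)
   have "(\<lambda>m. ennreal ((cmod (f n x - f m x))\<^sup>2)) \<longlonglongrightarrow> ennreal ((cmod (f n x - g x))\<^sup>2)"
    by (intro tendsto_intros elim)
   then show ?case by (metis lim_imp_Liminf sequentially_bot)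
  qed
  also have "... \<le> liminf (\<lambda>m. n2 (f n \<ominus> f m))"
   unfolding n2_def by (intro nn_integral_liminf) auto
  also have "... \<le> ennreal ((1/8)^n)"
   by (intro Liminf_le) (auto intro!: eventually_sequentiallyI[of n] le)
  finally show ?thesis .
 qed
 with lim show thesis by (intro that[of g]) auto
qed

section \<open>The Fourier integral of integrable functions\<close>

definition FT :: "cfun \<Rightarrow> real \<Rightarrow> complex" where
 "FT u \<xi> = complex_of_real (1 / sqrt (2 * pi)) * (LINT x|lborel. exp (- \<i> * complex_of_real (x * \<xi>)) * u x)"

lemma FT_measurable [measurable (raw)]:
 assumes [measurable]: "case_prod u \<in> borel_measurable (M \<Otimes>\<^sub>M borel)" "v \<in> borel_measurable M"
 shows "(\<lambda>t. FT (u t) (v t)) \<in> borel_measurable M"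
 unfolding FT_def by measurable

lemma truncated_fourier_FT: "truncated_fourier R \<psi> = FT (\<lambda>x. indicator {-R..R} x *\<^sub>R \<psi> x)"
 by (simp add: truncated_fourier_def FT_def set_lebesgue_integral_def fun_eq_iff)

lemma cmod_exp_i [simp]: "cmod (exp (- (\<i> * complex_of_real x))) = 1" "cmod (exp (\<i> * complex_of_real x)) = 1"
 "cmod (exp (- (\<i> * (complex_of_real x * complex_of_real y)))) = 1"
 "cmod (exp (\<i> * (complex_of_real x * complex_of_real y))) = 1"
 by (simp_all add: norm_exp_eq_Re)

lemma integrable_exp_mult [simp]:
 assumes "integrable lborel u"
 shows "integrable lborel (\<lambda>x. exp (- (\<i> * (complex_of_real x * complex_of_real y))) * u x)"
  "integrable lborel (\<lambda>x. exp (\<i> * (complex_of_real x * complex_of_real y)) * u x)"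
 using assms by (auto intro!: Bochner_Integration.integrable_bound[OF assms] simp: norm_mult)

lemma FT_diff:
 assumes "integrable lborel u" "integrable lborel v"
 shows "FT (u \<ominus> v) \<xi> = FT u \<xi> - FT v \<xi>"
 using assms by (simp add: FT_def ring_distribs)

lemma FT_bound:
 assumes "integrable lborel u"
 shows "cmod (FT u \<xi>) \<le> (LINT x|lborel. cmod (u x))"
proof -
 have "cmod (FT u \<xi>) \<le> 1 / sqrt (2 * pi) * (LINT x|lborel. cmod (exp (- \<i> * complex_of_real (x * \<xi>)) * u x))"
  unfolding FT_def by (subst norm_mult, intro mult_mono integral_norm_bound) (auto simp: norm_divide)
 also have "... \<le> 1 * (LINT x|lborel. cmod (u x))"
  using pi_ge_two by (intro mult_mono integral_nonneg) (auto simp: norm_mult real_le_rsqrt)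
 finally show ?thesis by simp
qed

lemma integrable_prod_mult:
 fixes u v :: "real \<Rightarrow> 'b::{real_normed_field, banach, second_countable_topology}"
 assumes u: "integrable lborel u" and v: "integrable lborel v"
 shows "integrable (lborel \<Otimes>\<^sub>M lborel) (\<lambda>(x,y). u x * v y)"
proof (rule lborel_pair.Fubini_integrable)
 have [measurable]: "Borel u" "Borel v"
  using assms by auto
 show "(\<lambda>(x,y). u x * v y) \<in> borel_measurable (lborel \<Otimes>\<^sub>M lborel)" by measurable
 show "integrable lborel (\<lambda>x. LINT y|lborel. norm (case (x, y) of (x, y) \<Rightarrow> u x * v y))"
  using assms by (simp add: norm_mult)
 show "AE x in lborel. integrable lborel (\<lambda>y. case (x, y) of (x, y) \<Rightarrow> u x * v y)"
  using v by simp
qed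

text \<open>Fubini's theorem: the kernel is symmetric in \<open>x\<close> and \<open>\<xi>\<close>,
  so the transform can be moved from one factor to the other.\<close>

lemma FT_mult_formula:
 assumes u: "integrable lborel u" and v: "integrable lborel v"
 shows "(LINT \<xi>|lborel. FT u \<xi> * v \<xi>) = (LINT x|lborel. u x * FT v x)"
proof -
 have [measurable]: "Borel u" "Borel v"
  using assms by auto
 have "integrable (lborel \<Otimes>\<^sub>M lborel) (\<lambda>(\<xi>,x). v \<xi> * u x)"
  by (rule integrable_prod_mult[OF v u])
 then have int: "integrable (lborel \<Otimes>\<^sub>M lborel) (\<lambda>(\<xi>,x). exp (- \<i> * complex_of_real (x * \<xi>)) * u x * v \<xi>)"
  by (rule Bochner_Integration.integrable_bound) (auto simp: norm_mult split: prod.splits)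
 have "(LINT \<xi>|lborel. FT u \<xi> * v \<xi>) = complex_of_real (1 / sqrt (2 * pi)) *
   (LINT \<xi>|lborel. LINT x|lborel. exp (- \<i> * complex_of_real (x * \<xi>)) * u x * v \<xi>)"
  unfolding FT_def mult.assoc[of "complex_of_real (1 / sqrt (2 * pi))"] by simp
 also have "... = complex_of_real (1 / sqrt (2 * pi)) *
   (LINT x|lborel. LINT \<xi>|lborel. exp (- \<i> * complex_of_real (x * \<xi>)) * u x * v \<xi>)"
  using lborel_pair.Fubini_integral[OF int] by simp
 also have "(LINT x|lborel. LINT \<xi>|lborel. exp (- \<i> * complex_of_real (x * \<xi>)) * u x * v \<xi>)
   = (LINT x|lborel. u x * (LINT \<xi>|lborel. exp (- \<i> * complex_of_real (\<xi> * x)) * v \<xi>))"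
  by (subst integral_mult_right_zero[symmetric]) (simp add: mult_ac)
 also have "complex_of_real (1 / sqrt (2 * pi)) * ... = (LINT x|lborel. u x * FT v x)"
  unfolding FT_def by (subst integral_mult_right_zero[symmetric]) (simp add: mult_ac)
 finally show ?thesis .
qed

text \<open>The inverse Fourier integral; with the symmetric normalization it is the forward
  integral at the reflected point.\<close>

definition IF :: "cfun \<Rightarrow> real \<Rightarrow> complex" where
 "IF h x = FT h (- x)"

lemma IF_measurable [measurable (raw)]:
 assumes [measurable]: "case_prod u \<in> borel_measurable (M \<Otimes>\<^sub>M borel)" "v \<in> borel_measurable M"
 shows "(\<lambda>t. IF (u t) (v t)) \<in> borel_measurable M"
 unfolding IF_def by measurable

lemma IF_FT_reflect: "IF h = FT (\<lambda>x. h (- x))"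
proof
 fix x
 show "IF h x = FT (\<lambda>x. h (- x)) x"
  unfolding IF_def FT_def by (subst lborel_integral_real_affine[of "-1" _ 0]) auto
qed

lemma integrable_reflect_iff [simp]:
 fixes h :: "real \<Rightarrow> 'b::{banach, second_countable_topology}"
 shows "integrable lborel (\<lambda>x. h (- x)) \<longleftrightarrow> integrable lborel h"
 using lborel_integrable_real_affine_iff[of "-1" h 0] by simp

lemma cnj_measurable [measurable]: "Borel cnj"
 by (intro borel_measurable_continuous_onI continuous_intros)

section \<open>Gaussian regularization and the contraction property\<close>

definition gk :: "real \<Rightarrow> real \<Rightarrow> real" where
 "gk e s = std_normal_density (s / e) / e"

lemma gk_measurable [measurable]: "Borel (gk e)"
 unfolding gk_def by measurable

lemma gk_nonneg [simp]: "e > 0 \<Longrightarrow> 0 \<le> gk e s"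
 by (simp add: gk_def normal_density_nonneg)

lemma gk_even: "gk e (- s) = gk e s"
 by (simp add: gk_def normal_density_def)

lemma nn_integral_gk:
 assumes "e > 0"
 shows "(\<integral>\<^sup>+x. ennreal (gk e (x - t)) \<partial>lborel) = 1"
proof -
 have "(\<integral>\<^sup>+x. ennreal (gk e (x - t)) \<partial>lborel) = ennreal e * (\<integral>\<^sup>+x. ennreal (gk e (t + e * x - t)) \<partial>lborel)"
  using nn_integral_real_affine[of "\<lambda>x. ennreal (gk e (x - t))" e t] assms by simp
 also have "... = (\<integral>\<^sup>+x. ennreal (std_normal_density x) \<partial>lborel)"
  using assms by (subst nn_integral_cmult[symmetric]) (auto simp: gk_def normal_density_nonneg simp flip: ennreal_mult)
 also have "... = 1"
  using prob_space.emeasure_space_1[OF prob_space_normal_density[of 1 0]] by (simp add: emeasure_density)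
 finally show ?thesis .
qed

text \<open>The characteristic function of the standard normal distribution, which stands in for a
  direct computation of the Gaussian transform.\<close>

lemma integral_gauss_exp:
 "(LINT y|lborel. exp (\<i> * complex_of_real (t * y)) * complex_of_real (std_normal_density y))
  = complex_of_real (exp (- t\<^sup>2 / 2))"
proof -
 have "char std_normal_distribution t = (LINT y|lborel. std_normal_density y *\<^sub>R exp (\<i> * complex_of_real (t * y)))"
  unfolding char_def by (subst integral_density) (auto simp: normal_density_nonneg)
 then show ?thesis
  by (simp add: char_std_normal_distribution scaleR_conv_of_real mult.commute)
qed

text \<open>Rescaling by \<open>e\<close> reduces to the normal density. The character with
  frequency \<open>c\<close> is included because the multiplication formula will be applied to a
  damped character.\<close>

lemma FT_gauss:
 assumes e: "e > 0"
 shows "FT (\<lambda>x. exp (- \<i> * complex_of_real (x * c)) * complex_of_real (exp (- (e * x)\<^sup>2 / 2))) \<xi>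
  = complex_of_real (sqrt (2 * pi) * gk e (c + \<xi>))"
proof -
 have "(LINT x|lborel. exp (- \<i> * complex_of_real (x * \<xi>)) *
   (exp (- \<i> * complex_of_real (x * c)) * complex_of_real (exp (- (e * x)\<^sup>2 / 2))))
  = complex_of_real (1 / e) * (LINT y|lborel. exp (- \<i> * complex_of_real (y / e * \<xi>)) *
   (exp (- \<i> * complex_of_real (y / e * c)) * complex_of_real (exp (- y\<^sup>2 / 2))))"
  using e by (subst lborel_integral_real_affine[of "1/e" _ 0]) (auto simp: scaleR_conv_of_real)
 also have "(LINT y|lborel. exp (- \<i> * complex_of_real (y / e * \<xi>)) *
   (exp (- \<i> * complex_of_real (y / e * c)) * complex_of_real (exp (- y\<^sup>2 / 2))))
  = complex_of_real (sqrt (2 * pi)) * (LINT y|lborel. exp (\<i> * complex_of_real (- (c + \<xi>) / e * y)) * complex_of_real (std_normal_density y))"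
  by (subst integral_mult_right_zero[symmetric])
    (auto intro!: Bochner_Integration.integral_cong simp: std_normal_density_def field_simps mult_exp_exp diff_divide_distrib)
 also have "... = complex_of_real (sqrt (2 * pi)) * complex_of_real (exp (- ((c + \<xi>) / e)\<^sup>2 / 2))"
  unfolding integral_gauss_exp by (simp add: power_divide power2_eq_square algebra_simps)
 finally show ?thesis
  by (simp add: FT_def gk_def std_normal_density_def)
qed

lemma integrable_gauss:
 assumes e: "e > 0"
 shows "integrable lborel (\<lambda>x. complex_of_real (exp (- (e * x)\<^sup>2 / 2)))"
proof -
 have "integrable lborel (\<lambda>x. std_normal_density x)"
  using integrable_normal_moment[of 1 0 0] by simp
 then have "integrable lborel (\<lambda>x. sqrt (2*pi) * std_normal_density (0 + e * x))"
  using e by (intro integrable_mult_right lborel_integrable_real_affine) auto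
 then show ?thesis by (simp add: std_normal_density_def)
qed

lemma IF_bounded_measurable:
 assumes "integrable lborel h"
 shows "Borel (IF h)" "cmod (IF h x) \<le> (LINT x|lborel. cmod (h x))"
proof -
 have [measurable]: "Borel h" using assms by auto
 show "Borel (IF h)" unfolding IF_def[abs_def] by measurable
qed (simp add: IF_def FT_bound[OF assms])

text \<open>The multiplication formula moves the transform from \<open>k\<close> to a damped
  character, whose transform is a translated Gaussian. Damping the inverse transform of
  \<open>k\<close> thus amounts to smoothing \<open>k\<close> with an approximate identity.\<close>

lemma FT_regularized_inversion:
 assumes e: "e > 0" and k: "integrable lborel k"
 shows "FT (\<lambda>x. complex_of_real (exp (- (e * x)\<^sup>2 / 2)) * IF k x) \<xi>
  = (LINT \<eta>|lborel. k \<eta> * complex_of_real (gk e (\<xi> - \<eta>)))"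
proof -
 let ?v = "\<lambda>x. exp (- \<i> * complex_of_real (x * \<xi>)) * complex_of_real (exp (- (e * x)\<^sup>2 / 2))"
 have [measurable]: "Borel k" using k by auto
 have v: "integrable lborel ?v"
  using integrable_gauss[OF e] by auto
 have "FT (\<lambda>x. complex_of_real (exp (- (e * x)\<^sup>2 / 2)) * IF k x) \<xi>
  = complex_of_real (1 / sqrt (2 * pi)) * (LINT x|lborel. FT (\<lambda>x. k (- x)) x * ?v x)"
  unfolding IF_FT_reflect FT_def[of "\<lambda>x. complex_of_real (exp (- (e * x)\<^sup>2 / 2)) * FT (\<lambda>x. k (- x)) x"]
  by (simp add: mult_ac)
 also have "... = complex_of_real (1 / sqrt (2 * pi)) * (LINT x|lborel. k (- x) * FT ?v x)"
  by (subst FT_mult_formula) (use v k in auto)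
 also have "... = (LINT x|lborel. k (- x) * complex_of_real (gk e (\<xi> + x)))"
  unfolding FT_gauss[OF e]
  by (subst integral_mult_right_zero[symmetric]) (auto intro!: Bochner_Integration.integral_cong)
 also have "... = (LINT x|lborel. k x * complex_of_real (gk e (\<xi> - x)))"
  by (subst lborel_integral_real_affine[of "-1" _ 0]) auto
 finally show ?thesis .
qed

text \<open>One half of Plancherel's identity, by duality: the squared modulus of
  \<open>FT \<psi>\<close> is its product with the inverse transform of the conjugate of
  \<open>\<psi>\<close>. Damped by a Gaussian, this becomes by the multiplication formula the
  pairing of \<open>\<psi>\<close> with a smoothing of that conjugate. The inequality of geometric
  and arithmetic means and the unit mass of \<open>gk\<close> in either variable bound the pairing
  by \<open>n2 \<psi>\<close>; Fatou's lemma removes the damping.\<close>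

lemma FT_contraction:
 assumes int: "integrable lborel \<psi>"
 shows "n2 (FT \<psi>) \<le> n2 \<psi>"
proof -
 define k where "k x = cnj (\<psi> x)" for x
 have [measurable]: "Borel \<psi>" "Borel k"
  using int unfolding k_def by auto
 have k: "integrable lborel k" using int unfolding k_def by simp
 have cF: "cnj (FT \<psi> x) = IF k x" for x
 proof -
  have "cnj (FT \<psi> x) = complex_of_real (1 / sqrt (2 * pi)) * cnj (LINT y|lborel. exp (- \<i> * complex_of_real (y * x)) * \<psi> y)"
   by (simp add: FT_def)
  also have "cnj (LINT y|lborel. exp (- \<i> * complex_of_real (y * x)) * \<psi> y) =
    (LINT y|lborel. cnj (exp (- \<i> * complex_of_real (y * x)) * \<psi> y))"
   by (simp only: Bochner_Integration.integral_cnj)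
  finally show ?thesis by (simp add: IF_def FT_def k_def exp_cnj)
 qed
 have reg: "(\<integral>\<^sup>+x. ennreal ((cmod (FT \<psi> x))\<^sup>2 * exp (- (e * x)\<^sup>2 / 2)) \<partial>lborel) \<le> n2 \<psi>" if e: "e > 0" for e
 proof -
  let ?g = "\<lambda>x. complex_of_real (exp (- (e * x)\<^sup>2 / 2)) * IF k x"
  have intg: "integrable lborel ?g"
   by (rule Bochner_Integration.integrable_bound[OF integrable_mult_left[OF integrable_gauss[OF e], of "complex_of_real (LINT x|lborel. cmod (k x))"]])
     (use IF_bounded_measurable[OF k] in \<open>auto simp: norm_mult intro!: mult_left_mono order_trans[OF _ abs_ge_self]\<close>)
  have eqsq: "FT \<psi> x * ?g x = complex_of_real ((cmod (FT \<psi> x))\<^sup>2 * exp (- (e * x)\<^sup>2 / 2))" for x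
   by (simp add: cF[symmetric] complex_norm_square mult_ac del: of_real_power)
  have "integrable lborel (\<lambda>x. FT \<psi> x * ?g x)"
   by (rule Bochner_Integration.integrable_bound[OF integrable_mult_right[OF intg, of "complex_of_real (LINT x|lborel. cmod (\<psi> x))"]])
     (use FT_bound[OF int] in \<open>auto simp: norm_mult intro!: mult_right_mono order_trans[OF _ abs_ge_self]\<close>)
  then have i1: "integrable lborel (\<lambda>x. (cmod (FT \<psi> x))\<^sup>2 * exp (- (e * x)\<^sup>2 / 2))"
   unfolding eqsq complex_of_real_integrable_eq .
  have "(\<integral>\<^sup>+x. ennreal ((cmod (FT \<psi> x))\<^sup>2 * exp (- (e * x)\<^sup>2 / 2)) \<partial>lborel)
   = ennreal (LINT x|lborel. (cmod (FT \<psi> x))\<^sup>2 * exp (- (e * x)\<^sup>2 / 2))"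
   by (intro nn_integral_eq_integral i1) auto
  also have "... \<le> ennreal (cmod (LINT x|lborel. FT \<psi> x * ?g x))"
   unfolding eqsq by (simp del: of_real_mult of_real_power add: ennreal_leI)
  also have "(LINT x|lborel. FT \<psi> x * ?g x) = (LINT x|lborel. \<psi> x * FT ?g x)"
   by (rule FT_mult_formula[OF int intg])
  also have "ennreal (cmod ...) \<le> (\<integral>\<^sup>+x. ennreal (cmod (\<psi> x * FT ?g x)) \<partial>lborel)"
   by (cases "integrable lborel (\<lambda>x. \<psi> x * FT ?g x)") (auto simp: integral_norm_bound_ennreal not_integrable_integral_eq)
  also have "... \<le> (\<integral>\<^sup>+x. \<integral>\<^sup>+y. ennreal (cmod (\<psi> x)) * ennreal (cmod (k y)) * ennreal (gk e (x - y)) \<partial>lborel \<partial>lborel)"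
  proof (intro nn_integral_mono)
   fix x
   have "ennreal (cmod (LINT y|lborel. k y * complex_of_real (gk e (x - y))))
     \<le> (\<integral>\<^sup>+y. ennreal (cmod (k y * complex_of_real (gk e (x - y)))) \<partial>lborel)"
    by (cases "integrable lborel (\<lambda>y. k y * complex_of_real (gk e (x - y)))")
      (auto simp: integral_norm_bound_ennreal not_integrable_integral_eq)
   then have "ennreal (cmod (\<psi> x)) * ennreal (cmod (LINT y|lborel. k y * complex_of_real (gk e (x - y))))
     \<le> ennreal (cmod (\<psi> x)) * (\<integral>\<^sup>+y. ennreal (cmod (k y)) * ennreal (gk e (x - y)) \<partial>lborel)"
    using e by (intro mult_left_mono) (auto simp: norm_mult ennreal_mult)
   also have "... = (\<integral>\<^sup>+y. ennreal (cmod (\<psi> x)) * ennreal (cmod (k y)) * ennreal (gk e (x - y)) \<partial>lborel)"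
    by (subst nn_integral_cmult[symmetric]) (auto simp: mult_ac)
   finally show "ennreal (cmod (\<psi> x * FT ?g x)) \<le> ..."
    unfolding FT_regularized_inversion[OF e k] by (simp add: norm_mult ennreal_mult)
  qed
  also have "... \<le> (\<integral>\<^sup>+x. \<integral>\<^sup>+y. ennreal ((cmod (\<psi> x))\<^sup>2 / 2) * ennreal (gk e (x - y)) + ennreal ((cmod (\<psi> y))\<^sup>2 / 2) * ennreal (gk e (x - y)) \<partial>lborel \<partial>lborel)"
  proof (intro nn_integral_mono)
   fix x y
   have "cmod (\<psi> x) * cmod (k y) \<le> (cmod (\<psi> x))\<^sup>2 / 2 + (cmod (\<psi> y))\<^sup>2 / 2"
    using zero_le_power2[of "cmod (\<psi> x) - cmod (\<psi> y)"] by (simp add: k_def power2_eq_square algebra_simps)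
   then have "ennreal (cmod (\<psi> x)) * ennreal (cmod (k y)) \<le> ennreal ((cmod (\<psi> x))\<^sup>2 / 2) + ennreal ((cmod (\<psi> y))\<^sup>2 / 2)"
    by (simp flip: ennreal_mult ennreal_plus add: ennreal_leI)
   then show "ennreal (cmod (\<psi> x)) * ennreal (cmod (k y)) * ennreal (gk e (x - y)) \<le>
     ennreal ((cmod (\<psi> x))\<^sup>2 / 2) * ennreal (gk e (x - y)) + ennreal ((cmod (\<psi> y))\<^sup>2 / 2) * ennreal (gk e (x - y))"
    unfolding distrib_right[symmetric] by (rule mult_right_mono) auto
  qed
  also have "... = (\<integral>\<^sup>+x. \<integral>\<^sup>+y. ennreal ((cmod (\<psi> x))\<^sup>2 / 2) * ennreal (gk e (x - y)) \<partial>lborel \<partial>lborel)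
    + (\<integral>\<^sup>+x. \<integral>\<^sup>+y. ennreal ((cmod (\<psi> y))\<^sup>2 / 2) * ennreal (gk e (x - y)) \<partial>lborel \<partial>lborel)"
   by (simp add: nn_integral_add)
  also have "(\<integral>\<^sup>+x. \<integral>\<^sup>+y. ennreal ((cmod (\<psi> x))\<^sup>2 / 2) * ennreal (gk e (x - y)) \<partial>lborel \<partial>lborel)
    = (\<integral>\<^sup>+x. ennreal ((cmod (\<psi> x))\<^sup>2 / 2) \<partial>lborel)"
  proof (intro nn_integral_cong)
   fix x
   have "(\<integral>\<^sup>+y. ennreal (gk e (x - y)) \<partial>lborel) = (\<integral>\<^sup>+y. ennreal (gk e (y - x)) \<partial>lborel)"
    by (metis gk_even minus_diff_eq)
   then show "(\<integral>\<^sup>+y. ennreal ((cmod (\<psi> x))\<^sup>2 / 2) * ennreal (gk e (x - y)) \<partial>lborel) = ennreal ((cmod (\<psi> x))\<^sup>2 / 2)"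
    by (simp add: nn_integral_cmult nn_integral_gk[OF e])
  qed
  also have "(\<integral>\<^sup>+x. \<integral>\<^sup>+y. ennreal ((cmod (\<psi> y))\<^sup>2 / 2) * ennreal (gk e (x - y)) \<partial>lborel \<partial>lborel)
    = (\<integral>\<^sup>+y. \<integral>\<^sup>+x. ennreal ((cmod (\<psi> y))\<^sup>2 / 2) * ennreal (gk e (x - y)) \<partial>lborel \<partial>lborel)"
   by (rule lborel_pair.Fubini'[symmetric]) measurable
  also have "... = (\<integral>\<^sup>+x. ennreal ((cmod (\<psi> x))\<^sup>2 / 2) \<partial>lborel)"
   by (simp add: nn_integral_cmult nn_integral_gk[OF e])
  also have "(\<integral>\<^sup>+x. ennreal ((cmod (\<psi> x))\<^sup>2 / 2) \<partial>lborel) + (\<integral>\<^sup>+x. ennreal ((cmod (\<psi> x))\<^sup>2 / 2) \<partial>lborel) = n2 \<psi>"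
   unfolding n2_def by (subst nn_integral_add[symmetric]) (auto simp flip: ennreal_plus)
  finally show ?thesis .
 qed
 have "n2 (FT \<psi>) = (\<integral>\<^sup>+x. liminf (\<lambda>n. ennreal ((cmod (FT \<psi> x))\<^sup>2 * exp (- (1 / real (Suc n) * x)\<^sup>2 / 2))) \<partial>lborel)"
  unfolding n2_def
 proof (intro nn_integral_cong)
  fix x
  have "(\<lambda>n. 1 / real (Suc n)) \<longlonglongrightarrow> 0" by (rule LIMSEQ_Suc[OF lim_1_over_n])
  then have "(\<lambda>n. ennreal ((cmod (FT \<psi> x))\<^sup>2 * exp (- (1 / real (Suc n) * x)\<^sup>2 / 2))) \<longlonglongrightarrow> ennreal ((cmod (FT \<psi> x))\<^sup>2 * exp (- (0 * x)\<^sup>2 / 2))"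
   by (intro tendsto_intros) auto
  then show "ennreal ((cmod (FT \<psi> x))\<^sup>2) = liminf (\<lambda>n. ennreal ((cmod (FT \<psi> x))\<^sup>2 * exp (- (1 / real (Suc n) * x)\<^sup>2 / 2)))"
   using lim_imp_Liminf[OF sequentially_bot] by fastforce
 qed
 also have "... \<le> liminf (\<lambda>n. \<integral>\<^sup>+x. ennreal ((cmod (FT \<psi> x))\<^sup>2 * exp (- (1 / real (Suc n) * x)\<^sup>2 / 2)) \<partial>lborel)"
  by (intro nn_integral_liminf) auto
 also have "... \<le> n2 \<psi>"
  by (intro Liminf_le always_eventually allI reg) simp_all
 finally show ?thesis .
qed

lemma ennreal_tendsto_0I:
 fixes f g :: "_ \<Rightarrow> ennreal"
 assumes "\<And>x. f x \<le> g x" "(g \<longlongrightarrow> 0) F"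
 shows "(f \<longlongrightarrow> 0) F"
 by (rule tendsto_sandwich[OF _ _ tendsto_const assms(2)]) (auto intro!: always_eventually assms(1))

lemma n2_tendsto_unique:
 assumes [measurable]: "\<And>r. Borel (f r)" "Borel g" "Borel h"
  and g: "((\<lambda>r. n2 (f r \<ominus> g)) \<longlongrightarrow> 0) F" and h: "((\<lambda>r. n2 (f r \<ominus> h)) \<longlongrightarrow> 0) F"
  and F: "F \<noteq> bot"
 shows "g \<doteq> h"
proof -
 have "n2 (g \<ominus> h) \<le> 2 * n2 (f r \<ominus> h) + 2 * n2 (f r \<ominus> g)" for r
  using n2_diff[of "\<lambda>x. f r x - h x" "\<lambda>x. f r x - g x"] by simp
 moreover have "((\<lambda>r. 2 * n2 (f r \<ominus> h) + 2 * n2 (f r \<ominus> g)) \<longlongrightarrow> 2 * 0 + 2 * 0) F"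
  by (intro tendsto_intros ennreal_tendsto_cmult g h) auto
 ultimately have "n2 (g \<ominus> h) \<le> 2 * 0 + 2 * 0"
  using F tendsto_lowerbound[of "\<lambda>r. 2 * n2 (f r \<ominus> h) + 2 * n2 (f r \<ominus> g)" "2 * 0 + 2 * 0" F "n2 (g \<ominus> h)"]
  by (simp del: add_0 add_0_right mult_zero_right)
 then show ?thesis using n2_0_iff[of g h] by simp
qed

section \<open>Extension of the transform to L2\<close>

lemma integrable_indicator_L2:
 assumes "\<psi> \<in> L2"
 shows "integrable lborel (\<lambda>x. indicator {-R..R::real} x *\<^sub>R \<psi> x)"
proof (rule Bochner_Integration.integrable_bound)
 have [measurable]: "Borel \<psi>" using assms by (simp add: L2_measurable)
 show "integrable lborel (\<lambda>x. indicator {-R..R} x + (cmod (\<psi> x))\<^sup>2)"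
  using assms by (intro Bochner_Integration.integrable_add integrable_real_indicator) (auto simp: L2_def emeasure_lborel_Icc_eq)
 show "AE x in lborel. norm (indicator {-R..R} x *\<^sub>R \<psi> x) \<le> norm (indicator {-R..R} x + (cmod (\<psi> x))\<^sup>2)"
 proof (intro AE_I2)
  fix x
  have "cmod (\<psi> x) \<le> 1 + (cmod (\<psi> x))\<^sup>2"
   using zero_le_power2[of "cmod (\<psi> x) - 1"] norm_ge_zero[of "\<psi> x"] unfolding power2_eq_square
   by (simp only: algebra_simps)
  then show "norm (indicator {-R..R} x *\<^sub>R \<psi> x) \<le> norm (indicator {-R..R} x + (cmod (\<psi> x))\<^sup>2)"
   by (auto simp: indicator_def)
 qed
 show "(\<lambda>x. indicator {-R..R} x *\<^sub>R \<psi> x) \<in> borel_measurable lborel" by measurable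
qed

lemma n2_mono: "(\<And>x. cmod (f x) \<le> cmod (g x)) \<Longrightarrow> n2 f \<le> n2 g"
 unfolding n2_def by (intro nn_integral_mono ennreal_leI power_mono) auto

lemma L2_indicator: "\<psi> \<in> L2 \<Longrightarrow> (\<lambda>x. indicator {-R..R::real} x *\<^sub>R \<psi> x) \<in> L2"
 unfolding L2_iff
 by (intro conjI le_less_trans[OF n2_mono[of "\<lambda>x. indicator {-R..R::real} x *\<^sub>R \<psi> x" \<psi>]]) (auto simp: indicator_def)

lemma n2_truncation:
 assumes "\<psi> \<in> L2"
 shows "((\<lambda>R. n2 (\<lambda>x. indicator {-R..R::real} x *\<^sub>R \<psi> x - \<psi> x)) \<longlongrightarrow> 0) at_top"
proof -
 have [measurable]: "Borel \<psi>" using assms by (simp add: L2_measurable)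
 have int: "integrable lborel (\<lambda>x. (cmod (\<psi> x))\<^sup>2)" using assms by (simp add: L2_def)
 have "((\<lambda>R. LINT x|lborel. (cmod (indicator {-R..R::real} x *\<^sub>R \<psi> x - \<psi> x))\<^sup>2) \<longlongrightarrow> (LINT x|(lborel::real measure). 0)) at_top"
 proof (rule integral_dominated_convergence_at_top[where w="\<lambda>x. (cmod (\<psi> x))\<^sup>2"])
  show "\<forall>\<^sub>F R in at_top. AE x in lborel. norm ((cmod (indicator {-R..R::real} x *\<^sub>R \<psi> x - \<psi> x))\<^sup>2) \<le> (cmod (\<psi> x))\<^sup>2"
   by (intro always_eventually allI AE_I2) (auto simp: indicator_def)
  show "AE x in lborel. ((\<lambda>R. (cmod (indicator {-R..R} x *\<^sub>R \<psi> x - \<psi> x))\<^sup>2) \<longlongrightarrow> 0) at_top"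
  proof (intro AE_I2 tendsto_eventually)
   fix x :: real
   show "\<forall>\<^sub>F R in at_top. (cmod (indicator {-R..R} x *\<^sub>R \<psi> x - \<psi> x))\<^sup>2 = 0"
    using eventually_ge_at_top[of "\<bar>x\<bar>"] by eventually_elim (auto simp: indicator_def)
  qed
 qed (use int in auto)
 then have "((\<lambda>R. ennreal (LINT x|lborel. (cmod (indicator {-R..R::real} x *\<^sub>R \<psi> x - \<psi> x))\<^sup>2)) \<longlongrightarrow> ennreal 0) at_top"
  by (intro tendsto_ennrealI) simp
 moreover have "ennreal (LINT x|lborel. (cmod (indicator {-R..R::real} x *\<^sub>R \<psi> x - \<psi> x))\<^sup>2) = n2 (\<lambda>x. indicator {-R..R::real} x *\<^sub>R \<psi> x - \<psi> x)" for R
  unfolding n2_def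
  by (intro nn_integral_eq_integral[symmetric] Bochner_Integration.integrable_bound[OF int]) (auto simp: indicator_def)
 ultimately show ?thesis by simp
qed

lemma truncated_fourier_measurable:
 "\<psi> \<in> L2 \<Longrightarrow> Borel (truncated_fourier R \<psi>)"
 unfolding truncated_fourier_FT using L2_measurable[of \<psi>] by measurable

lemma truncated_fourier_contraction:
 assumes "\<psi> \<in> L2"
 shows "n2 (truncated_fourier R \<psi>) \<le> n2 (\<lambda>x. indicator {-R..R::real} x *\<^sub>R \<psi> x)"
 unfolding truncated_fourier_FT by (intro FT_contraction integrable_indicator_L2 assms)

text \<open>Truncations of \<open>\<psi>\<close> converge in L2, and the contraction property
  applied to differences makes their transforms Cauchy. A fast sequence of radii supplies the limit;
  the triangle inequality extends the convergence to all radii.\<close>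

lemma fourier_exists:
 assumes \<psi>: "\<psi> \<in> L2"
 shows "\<exists>h. h \<in> L2 \<and> ((\<lambda>R. n2 (truncated_fourier R \<psi> \<ominus> h)) \<longlongrightarrow> 0) at_top"
proof -
 let ?c = "\<lambda>R x. indicator {-R..R::real} x *\<^sub>R \<psi> x"
 note [measurable] = L2_measurable[OF \<psi>] truncated_fourier_measurable[OF \<psi>]
 have dc: "n2 (truncated_fourier R \<psi> \<ominus> truncated_fourier S \<psi>) \<le> 2 * n2 (\<lambda>x. ?c R x - \<psi> x) + 2 * n2 (\<lambda>x. ?c S x - \<psi> x)" for R S
 proof -
  have "n2 (truncated_fourier R \<psi> \<ominus> truncated_fourier S \<psi>) = n2 (FT (\<lambda>x. ?c R x - ?c S x))"
   unfolding truncated_fourier_FT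
    FT_diff[OF integrable_indicator_L2[OF \<psi>] integrable_indicator_L2[OF \<psi>], symmetric] ..
  also have "... \<le> n2 (\<lambda>x. ?c R x - ?c S x)"
   by (intro FT_contraction Bochner_Integration.integrable_diff integrable_indicator_L2 \<psi>)
  also have "... \<le> 2 * n2 (\<lambda>x. ?c R x - \<psi> x) + 2 * n2 (\<lambda>x. ?c S x - \<psi> x)"
   using n2_diff[of "\<lambda>x. ?c R x - \<psi> x" "\<lambda>x. ?c S x - \<psi> x"] by simp
  finally show ?thesis .
 qed
 \<comment> \<open>A quarter of the rate, because \<open>dc\<close> doubles each of two
   errors.\<close>
 have "\<exists>r. \<forall>R\<ge>r. n2 (\<lambda>x. ?c R x - \<psi> x) \<le> ennreal ((1/8)^n / 4)" for n
  using order_tendstoD(2)[OF n2_truncation[OF \<psi>], of "ennreal ((1/8)^n / 4)"]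
  by (auto simp: eventually_at_top_linorder intro: less_imp_le)
 then obtain r0 where r0: "\<And>n R. R \<ge> r0 n \<Longrightarrow> n2 (\<lambda>x. ?c R x - \<psi> x) \<le> ennreal ((1/8)^n / 4)" by metis
 \<comment> \<open>Summing absolute values makes the radii increase with \<open>n\<close> while each
   stays above \<open>r0 n\<close>; the Cauchy estimate for all later indices uses both
   properties.\<close>
 define r where "r n = (\<Sum>k\<le>n. \<bar>r0 k\<bar>)" for n
 have r: "r n \<ge> r0 n" for n
  unfolding r_def using member_le_sum[of n "{..n}" "\<lambda>k. \<bar>r0 k\<bar>"] by auto
 have rm: "r n \<le> r m" if "n \<le> m" for n m
  unfolding r_def using that by (intro sum_mono2) auto
 have four: "2 * ennreal (x / 4) + 2 * ennreal (x / 4) = ennreal x" if "x \<ge> 0" for x :: real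
  using that by (simp flip: ennreal_numeral ennreal_mult ennreal_plus)
 have R8: "n2 (truncated_fourier R \<psi> \<ominus> truncated_fourier S \<psi>) \<le> ennreal ((1/8)^n)"
  if "R \<ge> r n" "S \<ge> r n" for R S n
 proof -
  have "2 * n2 (\<lambda>x. ?c R x - \<psi> x) + 2 * n2 (\<lambda>x. ?c S x - \<psi> x) \<le> 2 * ennreal ((1/8)^n / 4) + 2 * ennreal ((1/8)^n / 4)"
   using that r[of n] by (intro add_mono mult_left_mono r0) auto
  then show ?thesis using dc[of R S] four[of "(1/8)^n"] by simp
 qed
 obtain h where h[measurable]: "Borel h" and hn: "\<And>n. n2 (truncated_fourier (r n) \<psi> \<ominus> h) \<le> ennreal ((1/8)^n)"
  by (rule L2_complete_fast[of "\<lambda>n. truncated_fourier (r n) \<psi>"]) (auto intro!: R8 rm)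
 have hL: "h \<in> L2"
 proof -
  have "n2 h \<le> 2 * n2 (truncated_fourier (r 0) \<psi>) + 2 * n2 (truncated_fourier (r 0) \<psi> \<ominus> h)"
   using n2_diff[of "truncated_fourier (r 0) \<psi>" "\<lambda>x. truncated_fourier (r 0) \<psi> x - h x"] by simp
  also have "... < top"
   using truncated_fourier_contraction[OF \<psi>, of "r 0"] L2_indicator[OF \<psi>, of "r 0"] hn[of 0]
   by (auto simp: L2_iff ennreal_mult_less_top intro: le_less_trans)
  finally show ?thesis by (simp add: L2_iff)
 qed
 have "((\<lambda>R. n2 (truncated_fourier R \<psi> \<ominus> h)) \<longlongrightarrow> 0) at_top"
 proof (rule order_tendstoI)
  fix a :: ennreal assume "0 < a"
  have "(\<lambda>n. ennreal (4 * (1/8)^n)) \<longlonglongrightarrow> ennreal (4 * 0)"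
   by (intro tendsto_intros LIMSEQ_power_zero) auto
  then have "\<forall>\<^sub>F n in sequentially. ennreal (4 * (1/8)^n) < a"
   using \<open>0 < a\<close> by (intro order_tendstoD) auto
  then obtain n where n: "ennreal (4 * (1/8)^n) < a" by (auto simp: eventually_sequentially)
  have "n2 (truncated_fourier R \<psi> \<ominus> h) < a" if "R \<ge> r n" for R
  proof -
   have "n2 (truncated_fourier R \<psi> \<ominus> h) \<le>
     2 * n2 (truncated_fourier R \<psi> \<ominus> truncated_fourier (r n) \<psi>) + 2 * n2 (truncated_fourier (r n) \<psi> \<ominus> h)"
    using n2_add[of "\<lambda>\<xi>. truncated_fourier R \<psi> \<xi> - truncated_fourier (r n) \<psi> \<xi>" "\<lambda>x. truncated_fourier (r n) \<psi> x - h x"] by simp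
   also have "... \<le> 2 * ennreal ((1/8)^n) + 2 * ennreal ((1/8)^n)"
    using that by (intro add_mono mult_left_mono R8 hn) auto
   also have "... = ennreal (4 * (1/8)^n)" by (simp flip: ennreal_numeral ennreal_mult ennreal_plus)
   finally show ?thesis using n by simp
  qed
  then show "\<forall>\<^sub>F R in at_top. n2 (truncated_fourier R \<psi> \<ominus> h) < a"
   by (auto simp: eventually_at_top_linorder)
 qed auto
 with hL show ?thesis by blast
qed

lemma fourier_props:
 assumes "\<psi> \<in> L2"
 shows fourier_L2: "fourier \<psi> \<in> L2"
  and fourier_tendsto: "((\<lambda>R. n2 (truncated_fourier R \<psi> \<ominus> fourier \<psi>)) \<longlongrightarrow> 0) at_top"
 using someI_ex[OF fourier_exists[OF assms]] by (simp_all add: fourier_def n2_def)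

lemma fourier_measurable [measurable]: "\<psi> \<in> L2 \<Longrightarrow> Borel (fourier \<psi>)"
 by (intro L2_measurable fourier_L2)

text \<open>\<open>fourier\<close> is chosen by \<open>SOME\<close> among functions that agree
  almost everywhere, so it can only be identified through the uniqueness of the L2 limit.\<close>

lemma fourier_unique:
 assumes "\<psi> \<in> L2" "Borel h" "((\<lambda>R. n2 (truncated_fourier R \<psi> \<ominus> h)) \<longlongrightarrow> 0) at_top"
 shows "fourier \<psi> \<doteq> h"
 by (rule n2_tendsto_unique[OF truncated_fourier_measurable[OF assms(1)] fourier_measurable[OF assms(1)] assms(2) fourier_tendsto[OF assms(1)] assms(3)])
   simp

text \<open>The truncated transforms are integrals and coincide as functions, so that
  \<open>SOME\<close> is applied to the same predicate; this gives equality at every point.\<close>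

lemma fourier_cong_AE:
 assumes "\<psi> \<doteq> \<psi>'" and "\<psi> \<in> L2" "\<psi>' \<in> L2"
 shows "fourier \<psi> = fourier \<psi>'"
proof -
 note [measurable] = L2_measurable[OF assms(2)] L2_measurable[OF assms(3)]
 have "truncated_fourier R \<psi> = truncated_fourier R \<psi>'" for R
  unfolding truncated_fourier_FT FT_def fun_eq_iff
  by (intro allI arg_cong2[of _ _ _ _ "(*)"] refl integral_cong_AE) (use assms in auto)
 then show ?thesis by (simp add: fourier_def)
qed

lemma fourier_FT:
 assumes \<psi>: "\<psi> \<in> L2" and int: "integrable lborel \<psi>"
 shows "fourier \<psi> \<doteq> FT \<psi>"
proof (rule fourier_unique[OF \<psi>])
 note [measurable] = L2_measurable[OF \<psi>] truncated_fourier_measurable[OF \<psi>]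
 show "Borel (FT \<psi>)" by measurable
 have le: "n2 (truncated_fourier R \<psi> \<ominus> FT \<psi>) \<le> n2 (\<lambda>x. indicator {-R..R::real} x *\<^sub>R \<psi> x - \<psi> x)" for R
  using FT_contraction[OF Bochner_Integration.integrable_diff[OF integrable_indicator_L2[OF \<psi>, of R] int]]
  unfolding truncated_fourier_FT FT_diff[OF integrable_indicator_L2[OF \<psi>] int, symmetric] .
 show "((\<lambda>R. n2 (truncated_fourier R \<psi> \<ominus> FT \<psi>)) \<longlongrightarrow> 0) at_top"
  by (rule ennreal_tendsto_0I[OF le n2_truncation[OF \<psi>]])
qed

lemma fourier_diff:
 assumes "\<psi> \<in> L2" "\<theta> \<in> L2"
 shows "AE \<xi> in lborel. fourier (\<psi> \<ominus> \<theta>) \<xi> = fourier \<psi> \<xi> - fourier \<theta> \<xi>"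
proof (rule fourier_unique[OF L2_diff[OF assms]])
 note [measurable] = fourier_measurable[OF assms(1)] fourier_measurable[OF assms(2)]
  truncated_fourier_measurable[OF assms(1)] truncated_fourier_measurable[OF assms(2)]
 show "Borel (fourier \<psi> \<ominus> fourier \<theta>)" by measurable
 have eq: "truncated_fourier R (\<psi> \<ominus> \<theta>) \<xi> = truncated_fourier R \<psi> \<xi> - truncated_fourier R \<theta> \<xi>" for R \<xi>
  unfolding truncated_fourier_FT
  using FT_diff[OF integrable_indicator_L2[OF assms(1), of R] integrable_indicator_L2[OF assms(2), of R]]
  by (simp add: scaleR_diff_right)
 have le: "n2 (\<lambda>\<xi>. truncated_fourier R (\<psi> \<ominus> \<theta>) \<xi> - (fourier \<psi> \<xi> - fourier \<theta> \<xi>))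
  \<le> 2 * n2 (truncated_fourier R \<psi> \<ominus> fourier \<psi>) + 2 * n2 (truncated_fourier R \<theta> \<ominus> fourier \<theta>)" for R
  using n2_diff[of "\<lambda>\<xi>. truncated_fourier R \<psi> \<xi> - fourier \<psi> \<xi>" "\<lambda>\<xi>. truncated_fourier R \<theta> \<xi> - fourier \<theta> \<xi>"]
  by (simp add: eq algebra_simps)
 have "((\<lambda>R. 2 * n2 (truncated_fourier R \<psi> \<ominus> fourier \<psi>) + 2 * n2 (truncated_fourier R \<theta> \<ominus> fourier \<theta>)) \<longlongrightarrow> 2 * 0 + 2 * 0) at_top"
  by (intro tendsto_intros ennreal_tendsto_cmult fourier_tendsto assms) auto
 then show "((\<lambda>R. n2 (\<lambda>\<xi>. truncated_fourier R (\<psi> \<ominus> \<theta>) \<xi> - (fourier \<psi> \<xi> - fourier \<theta> \<xi>))) \<longlongrightarrow> 0) at_top"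
  by (intro ennreal_tendsto_0I[OF le]) simp
qed

text \<open>The constant is not sharp and comes from the two-term inequality \<open>n2_diff\<close>;
  the lemma is applied only to sequences that tend to zero.\<close>

lemma fourier_contraction:
 assumes "\<psi> \<in> L2" shows "n2 (fourier \<psi>) \<le> 4 * n2 \<psi>"
proof -
 note [measurable] = fourier_measurable[OF assms] truncated_fourier_measurable[OF assms] L2_measurable[OF assms]
 have le: "n2 (fourier \<psi>) \<le> 2 * n2 \<psi> + 2 * n2 (truncated_fourier R \<psi> \<ominus> fourier \<psi>)" for R
 proof -
  have "n2 (truncated_fourier R \<psi>) \<le> n2 \<psi>"
   using truncated_fourier_contraction[OF assms, of R] n2_mono[of "\<lambda>x. indicator {-R..R} x *\<^sub>R \<psi> x" \<psi>]
   by (auto simp: indicator_def intro: order_trans)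
  then have "2 * n2 (truncated_fourier R \<psi>) \<le> 2 * n2 \<psi>" by (intro mult_left_mono) auto
  then show ?thesis
   using n2_diff[of "truncated_fourier R \<psi>" "\<lambda>\<xi>. truncated_fourier R \<psi> \<xi> - fourier \<psi> \<xi>"]
   by (auto intro: order_trans add_right_mono)
 qed
 have "((\<lambda>R. 2 * n2 \<psi> + 2 * n2 (truncated_fourier R \<psi> \<ominus> fourier \<psi>)) \<longlongrightarrow> 2 * n2 \<psi> + 2 * 0) at_top"
  by (intro tendsto_intros ennreal_tendsto_cmult fourier_tendsto assms) auto
 then have "n2 (fourier \<psi>) \<le> 2 * n2 \<psi> + 2 * 0"
  by (rule tendsto_lowerbound) (auto intro!: always_eventually le)
 also have "2 * n2 \<psi> + 2 * 0 \<le> 4 * n2 \<psi>" by (simp add: mult_right_mono)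
 finally show ?thesis .
qed

section \<open>Fourier inversion\<close>

lemma IF_L2:
 assumes "h \<in> L2" "integrable lborel h" shows "IF h \<in> L2"
proof -
 have "n2 (FT h) \<le> n2 h" by (rule FT_contraction[OF assms(2)])
 moreover have [measurable]: "Borel (FT h)" "Borel h"
  using assms by (auto intro: FT_measurable L2_measurable)
 moreover have "n2 (IF h) = n2 (FT h)"
  using n2_reflect[of "FT h"] by (simp add: IF_def[abs_def])
 ultimately show ?thesis
  using assms by (auto simp: L2_iff IF_bounded_measurable intro: le_less_trans)
qed

text \<open>The positive and negative parts are densities of finite measures with the same
  distribution function, hence of the same measure, and densities are unique up to null
  sets.\<close>

lemma AE_0_of_integral_Iic_real:
 fixes f :: "real \<Rightarrow> real"
 assumes f: "integrable lborel f" and 0: "\<And>b. (LINT x:{..b}|lborel. f x) = 0"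
 shows "AE x in lborel. f x = 0"
proof -
 have [measurable]: "Borel f" using f by auto
 define M where "M = density lborel (\<lambda>x. ennreal (max 0 (f x)))"
 define N where "N = density lborel (\<lambda>x. ennreal (max 0 (- f x)))"
 have i1: "integrable lborel (\<lambda>x. max 0 (f x))" "integrable lborel (\<lambda>x. max 0 (- f x))"
  using f by auto
 have e: "emeasure M A = ennreal (LINT x:A|lborel. max 0 (f x))" "emeasure N A = ennreal (LINT x:A|lborel. max 0 (- f x))"
  if [measurable]: "A \<in> sets borel" for A
 proof -
  have "emeasure M A = (\<integral>\<^sup>+x. ennreal (indicator A x * max 0 (f x)) \<partial>lborel)"
   unfolding M_def by (subst emeasure_density) (auto intro!: nn_integral_cong simp: indicator_def)
  also have "... = ennreal (LINT x|lborel. indicator A x * max 0 (f x))"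
   using integrable_mult_indicator[of A lborel, OF _ i1(1)] by (intro nn_integral_eq_integral) auto
  finally show "emeasure M A = ennreal (LINT x:A|lborel. max 0 (f x))" by (simp add: set_lebesgue_integral_def)
  have "emeasure N A = (\<integral>\<^sup>+x. ennreal (indicator A x * max 0 (- f x)) \<partial>lborel)"
   unfolding N_def by (subst emeasure_density) (auto intro!: nn_integral_cong simp: indicator_def)
  also have "... = ennreal (LINT x|lborel. indicator A x * max 0 (- f x))"
   using integrable_mult_indicator[of A lborel, OF _ i1(2)] by (intro nn_integral_eq_integral) auto
  finally show "emeasure N A = ennreal (LINT x:A|lborel. max 0 (- f x))" by (simp add: set_lebesgue_integral_def)
 qed
 have si: "set_integrable lborel A (\<lambda>x. max 0 (f x))" "set_integrable lborel A (\<lambda>x. max 0 (- f x))" if "A \<in> sets borel" for A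
  using that unfolding set_integrable_def by (auto intro!: integrable_mult_indicator i1 simp del: real_scaleR_def)
 have "(LINT x:{..b}|lborel. max 0 (f x)) - (LINT x:{..b}|lborel. max 0 (- f x)) = (LINT x:{..b}|lborel. f x)" for b
  by (subst set_integral_diff(2)[symmetric, OF si]) (auto intro!: set_lebesgue_integral_cong simp: max_def)
 then have eq: "(LINT x:{..b}|lborel. max 0 (f x)) = (LINT x:{..b}|lborel. max 0 (- f x))" for b
  using 0 by simp
 have fin: "finite_borel_measure M" "finite_borel_measure N"
  using e[of UNIV] by (auto simp: finite_borel_measure_def finite_borel_measure_axioms_def M_def N_def intro!: finite_measureI)
 have "M = N"
  by (rule cdf_unique'[OF fin]) (auto simp: cdf_def measure_def e eq)
 then have "AE x in lborel. ennreal (max 0 (f x)) = ennreal (max 0 (- f x))"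
  unfolding M_def N_def by (subst (asm) sigma_finite_measure.density_unique_iff[OF sigma_finite_lborel]) auto
 then show ?thesis by eventually_elim (auto simp: max_def split: if_splits)
qed

lemma AE_0_of_integral_Iic:
 fixes f :: cfun
 assumes f: "integrable lborel f" and 0: "\<And>b. (LINT x:{..b}|lborel. f x) = 0"
 shows "AE x in lborel. f x = 0"
proof -
 have i: "integrable lborel (\<lambda>x. indicator {..b} x *\<^sub>R f x)" for b :: real
  using f by (intro integrable_mult_indicator) auto
 have "(LINT x:{..b}|lborel. Re (f x)) = Re (LINT x:{..b}|lborel. f x)"
  "(LINT x:{..b}|lborel. Im (f x)) = Im (LINT x:{..b}|lborel. f x)" for b
  unfolding set_lebesgue_integral_def using integral_Re[OF i[of b]] integral_Im[OF i[of b]] by auto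
 then have "AE x in lborel. Re (f x) = 0" "AE x in lborel. Im (f x) = 0"
  using f 0 by (auto intro!: AE_0_of_integral_Iic_real)
 then show ?thesis by eventually_elim (simp add: complex_eq_iff)
qed

text \<open>Cauchy-Schwarz against the indicator of a bounded interval. Interval integrals are the
  weak sense in which two limits are compared in the inversion formula.\<close>

lemma integral_n2_tendsto:
 fixes f :: "nat \<Rightarrow> real \<Rightarrow> complex"
 assumes f: "\<And>n. f n \<in> L2" and g: "g \<in> L2" and lim: "(\<lambda>n. n2 (f n \<ominus> g)) \<longlonglongrightarrow> 0"
 shows "(\<lambda>n. LINT x:{a..b::real}|lborel. f n x) \<longlonglongrightarrow> (LINT x:{a..b}|lborel. g x)"
proof -
 note [measurable] = L2_measurable[OF f] L2_measurable[OF g]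
 have iL2: "integrable lborel (\<lambda>x. indicator {a..b::real} x *\<^sub>R \<psi> x)" if "\<psi> \<in> L2" for \<psi>
 proof -
  have "integrable lborel (\<lambda>x. indicator {a..b::real} x *\<^sub>R (indicator {-(\<bar>a\<bar>+\<bar>b\<bar>)..\<bar>a\<bar>+\<bar>b\<bar>} x *\<^sub>R \<psi> x))"
   by (intro integrable_mult_indicator integrable_indicator_L2 that) auto
  then show ?thesis by (rule Bochner_Integration.integrable_cong[THEN iffD1, rotated -1]) (auto simp: indicator_def)
 qed
 let ?d = "\<lambda>n. \<integral>\<^sup>+x. ennreal (cmod (f n x - g x)) * indicator {a..b} x \<partial>lborel"
 have le: "ennreal (cmod ((LINT x:{a..b}|lborel. f n x) - (LINT x:{a..b}|lborel. g x))) \<le> ?d n" for n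
 proof -
  have "(LINT x:{a..b}|lborel. f n x) - (LINT x:{a..b}|lborel. g x) = (LINT x|lborel. indicator {a..b} x *\<^sub>R (f n x - g x))"
   unfolding set_lebesgue_integral_def using iL2[OF f, of n] iL2[OF g] by (simp add: scaleR_diff_right)
  also have "ennreal (cmod ...) \<le> (\<integral>\<^sup>+x. ennreal (cmod (indicator {a..b} x *\<^sub>R (f n x - g x))) \<partial>lborel)"
   using iL2[OF f, of n] iL2[OF g] by (intro integral_norm_bound_ennreal) (simp add: scaleR_diff_right)
  also have "... = ?d n" by (intro nn_integral_cong) (auto simp: indicator_def)
  finally show ?thesis .
 qed
 have "(?d n)\<^sup>2 \<le> n2 (f n \<ominus> g) * (\<integral>\<^sup>+x. (indicator {a..b} x)\<^sup>2 \<partial>lborel)" for n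
  using Cauchy_Schwarz_nn_integral[of "\<lambda>x. ennreal (cmod (f n x - g x))" lborel "indicator {a..b}"]
  by (simp add: n2_def ennreal_power)
 also have "(\<integral>\<^sup>+x. (indicator {a..b} x)\<^sup>2 \<partial>lborel) = (\<integral>\<^sup>+x. indicator {a..b} x \<partial>(lborel :: real measure))"
  by (intro nn_integral_cong) (auto simp: indicator_def)
 also have "... = emeasure lborel {a..b}" by simp
 finally have sq: "(?d n)\<^sup>2 \<le> n2 (f n \<ominus> g) * emeasure lborel {a..b}" for n .
 have fin: "emeasure lborel {a..b} < top" by (simp add: emeasure_lborel_Icc_eq)
 have "(\<lambda>n. emeasure lborel {a..b} * n2 (f n \<ominus> g)) \<longlonglongrightarrow> emeasure lborel {a..b} * 0"
  using fin by (intro ennreal_tendsto_cmult lim)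
 then have "(\<lambda>n. (?d n)\<^sup>2) \<longlonglongrightarrow> 0"
  by (intro ennreal_tendsto_0I[OF sq]) (simp add: mult.commute)
 then have "(\<lambda>n. ennreal ((cmod ((LINT x:{a..b}|lborel. f n x) - (LINT x:{a..b}|lborel. g x)))\<^sup>2)) \<longlonglongrightarrow> ennreal 0"
  unfolding ennreal_0 by (rule ennreal_tendsto_0I[rotated]) (auto intro!: power_mono le simp flip: ennreal_power)
 then have "(\<lambda>n. (cmod ((LINT x:{a..b}|lborel. f n x) - (LINT x:{a..b}|lborel. g x)))\<^sup>2) \<longlonglongrightarrow> 0"
  by (subst (asm) tendsto_ennreal_iff) auto
 then have "(\<lambda>n. cmod ((LINT x:{a..b}|lborel. f n x) - (LINT x:{a..b}|lborel. g x))) \<longlonglongrightarrow> 0"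
  using tendsto_real_sqrt by fastforce
 then show ?thesis by (simp add: LIM_zero_iff tendsto_norm_zero_iff)
qed

text \<open>The substitution \<open>\<xi> = \<eta> + e * y\<close> moves the parameter
  \<open>e\<close> into the indicator of the interval. What remains is a fixed integrable function
  on the plane, so dominated convergence applies; the indicators converge off the two
  endpoints.\<close>

lemma gk_smoothing_tendsto:
 assumes h: "integrable lborel h"
 shows "(\<lambda>n. LINT \<xi>:{a..b}|lborel. (LINT \<eta>|lborel. h \<eta> * complex_of_real (gk (1 / real (Suc n)) (\<xi> - \<eta>))))
  \<longlonglongrightarrow> (LINT \<xi>:{a..b::real}|lborel. h \<xi>)"
proof -
 have [measurable]: "Borel h" using h by auto
 let ?N = "\<lambda>y. complex_of_real (std_normal_density y)"
 have iN: "integrable lborel ?N"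
  using integrable_normal_moment[of 1 0 0] by simp
 have N1: "(LINT y|lborel. ?N y) = 1"
  using integral_gauss_exp[of 0] by simp
 have ip: "integrable (lborel \<Otimes>\<^sub>M lborel) (\<lambda>(\<eta>,y). h \<eta> * ?N y)"
  by (rule integrable_prod_mult[OF h iN])
 let ?F = "\<lambda>e p. case p of (\<eta>, y) \<Rightarrow> indicator {a..b} (\<eta> + e * y) *\<^sub>R (h \<eta> * ?N y)"
 have iF: "integrable (lborel \<Otimes>\<^sub>M lborel) (?F e)" for e
  by (rule Bochner_Integration.integrable_bound[OF ip]) (auto simp: indicator_def split: prod.splits)
 have eq: "(LINT \<xi>:{a..b}|lborel. (LINT \<eta>|lborel. h \<eta> * complex_of_real (gk e (\<xi> - \<eta>)))) = (LINT p|(lborel \<Otimes>\<^sub>M lborel). ?F e p)"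
  if e: "e > 0" for e
 proof -
  let ?G = "\<lambda>p. case p of (\<xi>, \<eta>) \<Rightarrow> indicator {a..b} \<xi> *\<^sub>R (h \<eta> * complex_of_real (gk e (\<xi> - \<eta>)))"
  have ig: "integrable lborel (\<lambda>\<xi>. gk e (\<xi> - \<eta>))" for \<eta>
   using nn_integral_gk[OF e, of \<eta>] e by (intro integrableI_bounded) auto
  have igeq: "(LINT \<xi>|lborel. gk e (\<xi> - \<eta>)) = 1" for \<eta>
   using nn_integral_gk[OF e, of \<eta>] nn_integral_eq_integral[OF ig[of \<eta>]] e by simp
  have "integrable (lborel \<Otimes>\<^sub>M lborel) (\<lambda>(\<eta>,\<xi>). ?G (\<xi>, \<eta>))"
  proof (rule lborel_pair.Fubini_integrable)
   show "(\<lambda>(\<eta>,\<xi>). ?G (\<xi>, \<eta>)) \<in> borel_measurable (lborel \<Otimes>\<^sub>M lborel)" by measurable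
   have "(LINT \<xi>|lborel. norm (case (\<eta>, \<xi>) of (\<eta>, \<xi>) \<Rightarrow> ?G (\<xi>, \<eta>))) \<le> cmod (h \<eta>)" for \<eta>
   proof -
    have "(LINT \<xi>|lborel. norm (case (\<eta>, \<xi>) of (\<eta>, \<xi>) \<Rightarrow> ?G (\<xi>, \<eta>))) \<le> (LINT \<xi>|lborel. cmod (h \<eta>) * gk e (\<xi> - \<eta>))"
     using e by (intro integral_mono' integrable_mult_right ig) (auto simp: norm_mult indicator_def)
    also have "... = cmod (h \<eta>)" using igeq by simp
    finally show ?thesis .
   qed
   then show "integrable lborel (\<lambda>\<eta>. LINT \<xi>|lborel. norm (case (\<eta>, \<xi>) of (\<eta>, \<xi>) \<Rightarrow> ?G (\<xi>, \<eta>)))"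
    by (intro Bochner_Integration.integrable_bound[OF h]) auto
   show "AE \<eta> in lborel. integrable lborel (\<lambda>\<xi>. case (\<eta>, \<xi>) of (\<eta>, \<xi>) \<Rightarrow> ?G (\<xi>, \<eta>))"
   proof (intro AE_I2)
    fix \<eta>
    show "integrable lborel (\<lambda>\<xi>. case (\<eta>, \<xi>) of (\<eta>, \<xi>) \<Rightarrow> ?G (\<xi>, \<eta>))"
     using e by (intro Bochner_Integration.integrable_bound[OF integrable_mult_right[OF ig[of \<eta>], of "cmod (h \<eta>)"]])
       (auto simp: norm_mult indicator_def)
   qed
  qed
  then have iG: "integrable (lborel \<Otimes>\<^sub>M lborel) ?G"
   using lborel_pair.integrable_product_swap_iff[of ?G] by (simp add: case_prod_unfold)
  have "(LINT \<xi>:{a..b}|lborel. (LINT \<eta>|lborel. h \<eta> * complex_of_real (gk e (\<xi> - \<eta>)))) = (LINT \<xi>|lborel. LINT \<eta>|lborel. ?G (\<xi>, \<eta>))"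
   unfolding set_lebesgue_integral_def by simp
  also have "... = (LINT \<eta>|lborel. LINT \<xi>|lborel. ?G (\<xi>, \<eta>))"
   using lborel_pair.Fubini_integral[of "\<lambda>x y. ?G (x, y)"] iG by simp
  also have "... = (LINT \<eta>|lborel. LINT y|lborel. ?F e (\<eta>, y))"
  proof (rule Bochner_Integration.integral_cong[OF refl])
   fix \<eta>
   have "(LINT \<xi>|lborel. ?G (\<xi>, \<eta>)) = e *\<^sub>R (LINT y|lborel. ?G (\<eta> + e * y, \<eta>))"
    using lborel_integral_real_affine[of e "\<lambda>\<xi>. ?G (\<xi>, \<eta>)" \<eta>] e by simp
   also have "... = (LINT y|lborel. e *\<^sub>R ?G (\<eta> + e * y, \<eta>))"
    by (rule integral_scaleR_right[symmetric])
   also have "... = (LINT y|lborel. ?F e (\<eta>, y))"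
    using e by (intro Bochner_Integration.integral_cong) (auto simp: gk_def indicator_def scaleR_conv_of_real)
   finally show "(LINT \<xi>|lborel. ?G (\<xi>, \<eta>)) = (LINT y|lborel. ?F e (\<eta>, y))" .
  qed
  also have "... = (LINT p|(lborel \<Otimes>\<^sub>M lborel). ?F e p)"
   using lborel_pair.integral_fst'[OF iF[of e]] by simp
  finally show ?thesis .
 qed
 have AEab: "AE \<eta> in lborel. \<eta> \<noteq> a \<and> \<eta> \<noteq> b"
  using AE_lborel_singleton[of a] AE_lborel_singleton[of b] by eventually_elim auto
 have AEp: "AE p in lborel \<Otimes>\<^sub>M (lborel :: real measure). (fst p :: real) \<noteq> a \<and> fst p \<noteq> b"
 proof (rule lborel_pair.AE_pair_measure)
  have "{p \<in> space (lborel \<Otimes>\<^sub>M lborel). (fst p :: real) \<noteq> a \<and> fst p \<noteq> b} = (- {a, b}) \<times> (UNIV :: real set)"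
   by (auto simp: space_pair_measure)
  also have "... \<in> sets (lborel \<Otimes>\<^sub>M lborel)" by (intro pair_measureI) auto
  finally show "{p \<in> space (lborel \<Otimes>\<^sub>M lborel). (fst p :: real) \<noteq> a \<and> fst p \<noteq> b} \<in> sets (lborel \<Otimes>\<^sub>M (lborel :: real measure))" .
 next
  show "AE x in lborel. AE y in (lborel :: real measure). fst (x, y) \<noteq> a \<and> fst (x, y) \<noteq> b"
   by (rule eventually_mono[OF AEab]) simp
 qed
 have "(\<lambda>n. LINT p|(lborel \<Otimes>\<^sub>M lborel). ?F (1 / real (Suc n)) p) \<longlonglongrightarrow> (LINT p|(lborel \<Otimes>\<^sub>M lborel). ?F 0 p)"
 proof (rule integral_dominated_convergence[where w="\<lambda>p. norm (case p of (\<eta>,y) \<Rightarrow> h \<eta> * ?N y)"])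
  show "integrable (lborel \<Otimes>\<^sub>M lborel) (\<lambda>p. norm (case p of (\<eta>,y) \<Rightarrow> h \<eta> * ?N y))"
   by (intro integrable_norm ip)
  show "AE p in lborel \<Otimes>\<^sub>M lborel. (\<lambda>n. ?F (1 / real (Suc n)) p) \<longlonglongrightarrow> ?F 0 p"
   using AEp
  proof eventually_elim
   case (elim p)
   obtain \<eta> y where p: "p = (\<eta>, y)" by (cases p)
   have lim: "(\<lambda>n. \<eta> + 1 / real (Suc n) * y) \<longlonglongrightarrow> \<eta> + 0 * y"
    by (intro tendsto_intros LIMSEQ_Suc[OF lim_1_over_n])
   have "\<forall>\<^sub>F n in sequentially. indicator {a..b} (\<eta> + 1 / real (Suc n) * y) = (indicator {a..b} \<eta> :: real)"
   proof -
    consider "\<eta> < a" | "a < \<eta>" "\<eta> < b" | "b < \<eta>" using elim p by fastforce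
    then show ?thesis
    proof cases
     case 1
     then have "\<forall>\<^sub>F n in sequentially. \<eta> + 1 / real (Suc n) * y < a"
      using order_tendstoD(2)[OF lim, of a] by simp
     then show ?thesis by eventually_elim (use 1 in \<open>auto simp: indicator_def\<close>)
    next
     case 2
     have "\<forall>\<^sub>F n in sequentially. \<eta> + 1 / real (Suc n) * y < b" "\<forall>\<^sub>F n in sequentially. a < \<eta> + 1 / real (Suc n) * y"
      using order_tendstoD(2)[OF lim, of b] order_tendstoD(1)[OF lim, of a] 2 by simp_all
     then show ?thesis by eventually_elim (use 2 in \<open>auto simp: indicator_def\<close>)
    next
     case 3
     then have "\<forall>\<^sub>F n in sequentially. b < \<eta> + 1 / real (Suc n) * y"
      using order_tendstoD(1)[OF lim, of b] by simp
     then show ?thesis by eventually_elim (use 3 in \<open>auto simp: indicator_def\<close>)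
    qed
   qed
   then have "\<forall>\<^sub>F n in sequentially. ?F (1 / real (Suc n)) p = ?F 0 p"
    by eventually_elim (simp add: p)
   then show ?case by (rule tendsto_eventually)
  qed
 qed (auto simp: indicator_def split: prod.splits)
 moreover have "(LINT p|(lborel \<Otimes>\<^sub>M lborel). ?F 0 p) = (LINT \<eta>|lborel. LINT y|lborel. ?F 0 (\<eta>, y))"
  using lborel_pair.integral_fst'[OF iF[of 0]] by simp
 moreover have "... = (LINT \<xi>:{a..b}|lborel. h \<xi>)"
  unfolding set_lebesgue_integral_def using N1 by simp
 ultimately show ?thesis by (simp add: eq)
qed

text \<open>The Gaussian damping of \<open>IF h\<close> converges to it in L2, so the transforms
  converge in L2 to \<open>fourier (IF h)\<close>. These transforms are Gaussian smoothings of
  \<open>h\<close>, whose interval integrals converge to those of \<open>h\<close>. Hence both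
  functions have the same integrals over all bounded intervals.\<close>

lemma fourier_IF:
 assumes hL: "h \<in> L2" and h: "integrable lborel h"
 shows "fourier (IF h) \<doteq> h"
proof -
 define \<psi> where "\<psi> = IF h"
 have \<psi>: "\<psi> \<in> L2" unfolding \<psi>_def by (rule IF_L2[OF hL h])
 note [measurable] = L2_measurable[OF \<psi>] L2_measurable[OF hL] L2_measurable[OF fourier_L2[OF \<psi>]]
 define e where "e n = 1 / real (Suc n)" for n
 have e: "e n > 0" for n by (simp add: e_def)
 define \<psi>e where "\<psi>e n x = complex_of_real (exp (- (e n * x)\<^sup>2 / 2)) * \<psi> x" for n x
 have [measurable]: "Borel (\<psi>e n)" for n unfolding \<psi>e_def by measurable
 have ie: "integrable lborel (\<psi>e n)" for n
  unfolding \<psi>e_def \<psi>_def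
  by (rule Bochner_Integration.integrable_bound[OF integrable_mult_left[OF integrable_gauss[OF e[of n]], of "complex_of_real (LINT x|lborel. cmod (h x))"]])
    (use IF_bounded_measurable[OF h] in \<open>auto simp: norm_mult intro!: mult_left_mono order_trans[OF _ abs_ge_self]\<close>)
 have small: "cmod (\<psi>e n x) \<le> cmod (\<psi> x)" for n x
  by (auto simp: \<psi>e_def norm_mult intro!: mult_left_le_one_le)
 have eL: "\<psi>e n \<in> L2" for n
  using \<psi> n2_mono[of "\<psi>e n" \<psi>, OF small] by (auto simp: L2_iff intro: le_less_trans)
 have int: "integrable lborel (\<lambda>x. (cmod (\<psi> x))\<^sup>2)" using \<psi> by (simp add: L2_def)
 have "(\<lambda>n. LINT x|lborel. (cmod (\<psi>e n x - \<psi> x))\<^sup>2) \<longlonglongrightarrow> (LINT x|(lborel::real measure). 0)"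
 proof (rule integral_dominated_convergence[where w="\<lambda>x. 4 * (cmod (\<psi> x))\<^sup>2"])
  show "AE x in lborel. norm ((cmod (\<psi>e n x - \<psi> x))\<^sup>2) \<le> 4 * (cmod (\<psi> x))\<^sup>2" for n
  proof (intro AE_I2)
   fix x
   have "cmod (\<psi>e n x - \<psi> x) \<le> 2 * cmod (\<psi> x)"
    using norm_triangle_ineq4[of "\<psi>e n x" "\<psi> x"] small[of n x] by linarith
   then have "(cmod (\<psi>e n x - \<psi> x))\<^sup>2 \<le> (2 * cmod (\<psi> x))\<^sup>2" by (intro power_mono) auto
   then show "norm ((cmod (\<psi>e n x - \<psi> x))\<^sup>2) \<le> 4 * (cmod (\<psi> x))\<^sup>2" by (simp add: power_mult_distrib)
  qed
  show "AE x in lborel. (\<lambda>n. (cmod (\<psi>e n x - \<psi> x))\<^sup>2) \<longlonglongrightarrow> 0"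
  proof (intro AE_I2)
   fix x
   have "(\<lambda>n. (cmod (\<psi>e n x - \<psi> x))\<^sup>2) \<longlonglongrightarrow> (cmod (complex_of_real (exp (- (0 * x)\<^sup>2 / 2)) * \<psi> x - \<psi> x))\<^sup>2"
    unfolding \<psi>e_def e_def by (intro tendsto_intros LIMSEQ_Suc[OF lim_1_over_n]) auto
   then show "(\<lambda>n. (cmod (\<psi>e n x - \<psi> x))\<^sup>2) \<longlonglongrightarrow> 0" by simp
  qed
 qed (use int in auto)
 then have "(\<lambda>n. ennreal (LINT x|lborel. (cmod (\<psi>e n x - \<psi> x))\<^sup>2)) \<longlonglongrightarrow> ennreal 0"
  by (intro tendsto_ennrealI) simp
 moreover have "ennreal (LINT x|lborel. (cmod (\<psi>e n x - \<psi> x))\<^sup>2) = n2 (\<psi>e n \<ominus> \<psi>)" for n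
  unfolding n2_def using L2_diff[OF eL \<psi>, of n] by (intro nn_integral_eq_integral[symmetric]) (auto simp: L2_def)
 ultimately have lim: "(\<lambda>n. n2 (\<psi>e n \<ominus> \<psi>)) \<longlonglongrightarrow> 0" by simp
 have le: "n2 (FT (\<psi>e n) \<ominus> fourier \<psi>) \<le> 4 * n2 (\<psi>e n \<ominus> \<psi>)" for n
 proof -
  have "n2 (FT (\<psi>e n) \<ominus> fourier \<psi>) = n2 (fourier (\<psi>e n \<ominus> \<psi>))"
   by (rule n2_cong_AE, use fourier_diff[OF eL \<psi>, of n] fourier_FT[OF eL ie, of n] in eventually_elim) simp
  then show ?thesis using fourier_contraction[OF L2_diff[OF eL \<psi>]] by simp
 qed
 have FTL: "FT (\<psi>e n) \<in> L2" for n
  using FT_contraction[OF ie[of n]] eL[of n] by (auto simp: L2_iff FT_measurable intro: le_less_trans)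
 have "(\<lambda>n. 4 * n2 (\<psi>e n \<ominus> \<psi>)) \<longlonglongrightarrow> 4 * 0"
  by (intro ennreal_tendsto_cmult lim) auto
 then have "(\<lambda>n. n2 (FT (\<psi>e n) \<ominus> fourier \<psi>)) \<longlonglongrightarrow> 0"
  by (intro ennreal_tendsto_0I[OF le]) simp
 then have "(\<lambda>n. LINT \<xi>:{a..b}|lborel. FT (\<psi>e n) \<xi>) \<longlonglongrightarrow> (LINT \<xi>:{a..b}|lborel. fourier \<psi> \<xi>)" for a b
  by (intro integral_n2_tendsto FTL fourier_L2 \<psi>)
 moreover have "(\<lambda>n. LINT \<xi>:{a..b}|lborel. FT (\<psi>e n) \<xi>) \<longlonglongrightarrow> (LINT \<xi>:{a..b}|lborel. h \<xi>)" for a b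
 proof -
  have "FT (\<psi>e n) \<xi> = (LINT \<eta>|lborel. h \<eta> * complex_of_real (gk (e n) (\<xi> - \<eta>)))" for n \<xi>
   unfolding \<psi>e_def[abs_def] \<psi>_def by (rule FT_regularized_inversion[OF e h])
  then show ?thesis using gk_smoothing_tendsto[OF h, of a b] unfolding e_def by (simp only:)
 qed
 ultimately have eqI: "(LINT \<xi>:{a..b}|lborel. fourier \<psi> \<xi>) = (LINT \<xi>:{a..b}|lborel. h \<xi>)" for a b
  by (rule LIMSEQ_unique)
 \<comment> \<open>\<open>fourier \<psi>\<close> is known to be integrable only over bounded sets,
   hence the exhaustion of the line by intervals.\<close>
 have "AE \<xi> in lborel. indicator {-real n..real n} \<xi> *\<^sub>R (fourier \<psi> \<xi> - h \<xi>) = 0" for n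
 proof (rule AE_0_of_integral_Iic)
  have i: "integrable lborel (\<lambda>x. indicator {-R..R} x *\<^sub>R fourier \<psi> x)" "integrable lborel (\<lambda>x. indicator {-R..R} x *\<^sub>R h x)" for R
   by (intro integrable_indicator_L2 fourier_L2 \<psi> hL)+
  then show "integrable lborel (\<lambda>\<xi>. indicator {-real n..real n} \<xi> *\<^sub>R (fourier \<psi> \<xi> - h \<xi>))"
   by (simp add: scaleR_diff_right)
  fix b
  let ?I = "{-real n..min (real n) b}"
  have i': "integrable lborel (\<lambda>x. indicator ?I x *\<^sub>R u x)" if "integrable lborel (\<lambda>x. indicator {-real n..real n} x *\<^sub>R u x)" for u :: cfun
  proof -
   have "integrable lborel (\<lambda>x. indicator {..b} x *\<^sub>R (indicator {-real n..real n} x *\<^sub>R u x))"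
    by (intro integrable_mult_indicator that) auto
   then show ?thesis by (rule Bochner_Integration.integrable_cong[THEN iffD1, rotated -1]) (auto simp: indicator_def)
  qed
  have "(LINT \<xi>:{..b}|lborel. indicator {-real n..real n} \<xi> *\<^sub>R (fourier \<psi> \<xi> - h \<xi>)) = (LINT \<xi>|lborel. indicator ?I \<xi> *\<^sub>R fourier \<psi> \<xi> - indicator ?I \<xi> *\<^sub>R h \<xi>)"
   unfolding set_lebesgue_integral_def by (intro Bochner_Integration.integral_cong) (auto simp: indicator_def)
  also have "... = 0"
   using i'[OF i(1)] i'[OF i(2)] eqI[of "-real n" "min (real n) b"] by (simp add: set_lebesgue_integral_def)
  finally show "(LINT \<xi>:{..b}|lborel. indicator {-real n..real n} \<xi> *\<^sub>R (fourier \<psi> \<xi> - h \<xi>)) = 0" .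
 qed
 then have "AE \<xi> in lborel. \<forall>n. indicator {-real n..real n} \<xi> *\<^sub>R (fourier \<psi> \<xi> - h \<xi>) = 0"
  unfolding AE_all_countable by blast
 then show ?thesis
 proof eventually_elim
  case (elim \<xi>)
  obtain n where "\<bar>\<xi>\<bar> \<le> real n" using real_arch_simple by blast
  then have "\<xi> \<in> {-real n..real n}" by auto
  then show ?case using elim[rule_format, of n] by (simp add: \<psi>_def)
 qed
qed

text \<open>Extension of \<open>fourier_IF\<close> by density, through the truncations of
  \<open>h\<close>; the constant 16 stands for two uses of
  \<open>fourier_contraction\<close>.\<close>

lemma plancherel_inversion:
 assumes h: "h \<in> L2"
 shows "fourier (\<lambda>x. fourier h (- x)) \<doteq> h"
proof -
 define u where "u n x = indicator {-real n..real n} x *\<^sub>R h x" for n :: nat and x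
 have uL: "u n \<in> L2" for n unfolding u_def[abs_def] by (rule L2_indicator[OF h])
 have ui: "integrable lborel (u n)" for n unfolding u_def[abs_def] by (rule integrable_indicator_L2[OF h])
 have lim: "(\<lambda>n. n2 (u n \<ominus> h)) \<longlonglongrightarrow> 0"
  unfolding u_def using filterlim_compose[OF n2_truncation[OF h] filterlim_real_sequentially] by simp
 have FL: "(\<lambda>x. fourier h (- x)) \<in> L2" by (intro L2_reflect fourier_L2 h)
 have I: "IF (u n) \<in> L2" for n by (intro IF_L2 uL ui)
 note [measurable] = L2_measurable[OF fourier_L2[OF FL]] L2_measurable[OF h] L2_measurable[OF uL]
  L2_measurable[OF fourier_L2[OF h]] L2_measurable[OF fourier_L2[OF uL]] L2_measurable[OF FL] L2_measurable[OF I]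
 have "n2 (u n \<ominus> fourier (\<lambda>x. fourier h (- x))) \<le> 16 * n2 (u n \<ominus> h)" for n
 proof -
  have "n2 (u n \<ominus> fourier (\<lambda>x. fourier h (- x))) = n2 (fourier (\<lambda>x. IF (u n) x - fourier h (- x)))"
   by (rule n2_cong_AE, use fourier_diff[OF I FL, of n] fourier_IF[OF uL ui, of n] in eventually_elim) simp
  also have "... \<le> 4 * n2 (\<lambda>x. IF (u n) x - fourier h (- x))"
   by (intro fourier_contraction L2_diff I FL)
  also have "n2 (\<lambda>x. IF (u n) x - fourier h (- x)) = n2 (\<lambda>x. (FT (u n) \<ominus> fourier h) (- x))"
   by (simp add: IF_def)
  also have "... = n2 (FT (u n) \<ominus> fourier h)" by (rule n2_reflect) measurable
  also have "... = n2 (fourier (u n \<ominus> h))"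
   by (rule n2_cong_AE, use fourier_diff[OF uL h, of n] fourier_FT[OF uL ui, of n] in eventually_elim) simp
  also have "... \<le> 4 * n2 (u n \<ominus> h)" by (intro fourier_contraction L2_diff uL h)
  also have "4 * (4 * n2 (u n \<ominus> h)) = 16 * n2 (u n \<ominus> h)" by (simp flip: mult.assoc)
  finally show ?thesis by (simp add: mult_left_mono)
 qed
 moreover have "(\<lambda>n. 16 * n2 (u n \<ominus> h)) \<longlonglongrightarrow> 16 * 0"
  by (intro ennreal_tendsto_cmult lim) auto
 ultimately have "(\<lambda>n. n2 (u n \<ominus> fourier (\<lambda>x. fourier h (- x)))) \<longlonglongrightarrow> 0"
  using ennreal_tendsto_0I[of "\<lambda>n. n2 (u n \<ominus> fourier (\<lambda>x. fourier h (- x)))" "\<lambda>n. 16 * n2 (u n \<ominus> h)"]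
  by simp
 from n2_tendsto_unique[OF _ _ _ this lim] show ?thesis by simp
qed

lemma fourier_surj: "h \<in> L2 \<Longrightarrow> \<exists>\<psi>\<in>L2. fourier \<psi> \<doteq> h"
 using plancherel_inversion L2_reflect[OF fourier_L2] by blast

lemma inv_fourier_props:
 assumes "h \<in> L2"
 shows "inv_fourier h \<in> L2" "fourier (inv_fourier h) \<doteq> h"
 using someI_ex[of "\<lambda>\<psi>. \<psi> \<in> L2 \<and> (fourier \<psi> \<doteq> h)"] fourier_surj[OF assms]
 unfolding inv_fourier_def by blast+

text \<open>By \<open>plancherel_inversion\<close>, transforming twice reflects the argument. When
  the first transform has an integrable version, the second one is an ordinary integral.\<close>

lemma IF_fourier:
 assumes \<psi>: "\<psi> \<in> L2" and h: "Borel h" "fourier \<psi> \<doteq> h" and int: "integrable lborel h"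
 shows "\<psi> \<doteq> IF h"
proof -
 have hL: "h \<in> L2"
  using fourier_L2[OF \<psi>] n2_cong_AE[OF h(2)] h(1) by (simp add: L2_iff)
 have "fourier (\<lambda>x. fourier \<psi> (- x)) = fourier (\<lambda>x. h (- x))"
  by (intro fourier_cong_AE L2_reflect fourier_L2 \<psi> hL) (rule AE_reflect[OF h(2)])
 moreover have "AE x in lborel. fourier (\<lambda>x. h (- x)) x = FT (\<lambda>x. h (- x)) x"
  using int by (intro fourier_FT L2_reflect hL) simp
 ultimately show ?thesis
  using plancherel_inversion[OF \<psi>] by (auto simp: IF_FT_reflect elim!: eventually_elim2)
qed

section \<open>Weighted norms of majorants\<close>

lemma jap_ge1: "1 \<le> jap \<xi>" by (simp add: jap_def)
lemma jap_pos [simp]: "0 < jap \<xi>" using jap_ge1[of \<xi>] by linarith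
lemma jap_nonneg [simp]: "0 \<le> jap \<xi>" using jap_pos[of \<xi>] by linarith
lemma jap_nz [simp]: "jap \<xi> \<noteq> 0" using jap_pos[of \<xi>] by linarith
lemma jap_even [simp]: "jap (- \<xi>) = jap \<xi>" by (simp add: jap_def)
lemma jap_measurable [measurable]: "Borel jap" unfolding jap_def by measurable
lemma abs_le_jap: "\<bar>\<xi>\<bar> \<le> jap \<xi>" unfolding jap_def by (intro real_le_rsqrt) auto
lemma jap_sq: "(jap \<xi>)\<^sup>2 = 1 + \<xi>\<^sup>2" by (simp add: jap_def)

text \<open>\<open>jap x\<close> is the length of the vector \<open>(1, x)\<close>, so this is the
  triangle inequality in the plane; enlarging the first coordinate on the left from 1 to
  \<open>1 + 1\<close> only increases it.\<close>

lemma jap_subadd: "jap (x + y) \<le> jap x + jap y"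
proof -
 have "jap (x + y) \<le> sqrt ((1 + 1)\<^sup>2 + (x + y)\<^sup>2)" by (simp add: jap_def)
 also have "... \<le> jap x + jap y"
  using real_sqrt_sum_squares_triangle_ineq[of 1 1 x y] by (simp add: jap_def)
 finally show ?thesis .
qed

lemma jap_split: "jap \<xi> \<le> jap (\<xi> - \<eta>) + jap \<eta>"
 using jap_subadd[of "\<xi> - \<eta>" \<eta>] by simp

lemma jap_powr_split:
 assumes "p \<ge> 0"
 shows "jap \<xi> powr p \<le> 2 powr p * (jap (\<xi> - \<eta>) powr p + jap \<eta> powr p)"
proof -
 have "jap \<xi> powr p \<le> (2 * max (jap (\<xi> - \<eta>)) (jap \<eta>)) powr p"
  using jap_split[of \<xi> \<eta>] assms by (intro powr_mono2) auto
 also have "... = 2 powr p * (max (jap (\<xi> - \<eta>)) (jap \<eta>)) powr p"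
  by (simp add: powr_mult)
 also have "... \<le> 2 powr p * (jap (\<xi> - \<eta>) powr p + jap \<eta> powr p)"
  by (intro mult_left_mono) (auto simp: max_def)
 finally show ?thesis .
qed

lemma jap_integral_finite: "(\<integral>\<^sup>+\<xi>. ennreal (1 / (jap \<xi>)\<^sup>2) \<partial>lborel) < top"
proof -
 have "integrable lborel (\<lambda>x::real. inverse (1 + x\<^sup>2))"
  using integrable_inverse_1_plus_square by (simp add: set_integrable_def)
 then have "(\<integral>\<^sup>+(x::real). ennreal (norm (inverse (1 + x\<^sup>2))) \<partial>lborel) < \<infinity>"
  by (simp add: integrable_iff_bounded)
 then show ?thesis by (simp add: jap_sq inverse_eq_divide)
qed

text \<open>The price of integrability: Cauchy-Schwarz against \<open>1 / jap\<close> turns one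
  power of \<open>jap\<close> in an L2 norm into an L1 bound with this constant.\<close>

definition Cj :: ennreal where "Cj = (\<integral>\<^sup>+\<xi>. ennreal (1 / (jap \<xi>)\<^sup>2) \<partial>lborel)"

lemma Cj_top: "Cj < top" using jap_integral_finite by (simp add: Cj_def)

text \<open>Majorants of Fourier transforms take values in \<open>ennreal\<close>; \<open>Nsq p\<close> is the squared norm with weight
 \<open>jap powr p\<close>, and \<open>cv\<close> the convolution.\<close>

definition jm :: "real \<Rightarrow> nnfun \<Rightarrow> real \<Rightarrow> ennreal" where
 "jm p V \<xi> = ennreal (jap \<xi> powr p) * V \<xi>"

definition Nsq :: "real \<Rightarrow> nnfun \<Rightarrow> ennreal" where
 "Nsq p V = (\<integral>\<^sup>+\<xi>. (jm p V \<xi>)\<^sup>2 \<partial>lborel)"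

definition cv :: "nnfun \<Rightarrow> nnfun \<Rightarrow> real \<Rightarrow> ennreal" where
 "cv U V \<xi> = (\<integral>\<^sup>+\<eta>. U (\<xi> - \<eta>) * V \<eta> \<partial>lborel)"

definition rf :: "(real \<Rightarrow> 'b) \<Rightarrow> real \<Rightarrow> 'b" where "rf V \<xi> = V (- \<xi>)"

lemma jm_measurable [measurable (raw)]:
 assumes [measurable]: "Borel U" "f \<in> borel_measurable M"
 shows "(\<lambda>x. jm p U (f x)) \<in> borel_measurable M"
 unfolding jm_def by measurable

lemma rf_measurable [measurable]: "Borel V \<Longrightarrow> Borel (rf V)"
 unfolding rf_def[abs_def] by (rule measurable_compose[of uminus borel borel V]) auto

lemma cv_measurable [measurable]:
 assumes [measurable]: "Borel U" "Borel V"
 shows "Borel (cv U V)"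
 unfolding cv_def[abs_def] by measurable

lemma jm_jm: "jm p (jm q V) = jm (p + q) V"
 by (auto simp: jm_def fun_eq_iff powr_add ennreal_mult mult.assoc)

lemma jm_0 [simp]: "jm 0 V = V"
 by (auto simp: jm_def fun_eq_iff)

lemma Nsq_jm: "Nsq p (jm q V) = Nsq (p + q) V"
 by (simp add: Nsq_def jm_jm)

lemma Nsq_mono: "(\<And>\<xi>. U \<xi> \<le> V \<xi>) \<Longrightarrow> Nsq p U \<le> Nsq p V"
 unfolding Nsq_def jm_def by (intro nn_integral_mono power_mono mult_left_mono) auto

lemma Nsq_mono_AE: "AE \<xi> in lborel. U \<xi> \<le> V \<xi> \<Longrightarrow> Nsq p U \<le> Nsq p V"
 unfolding Nsq_def jm_def by (intro nn_integral_mono_AE) (auto intro!: power_mono mult_left_mono elim!: eventually_mono)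

lemma Nsq_mono_p:
 assumes "p \<le> q" shows "Nsq p V \<le> Nsq q V"
 unfolding Nsq_def jm_def
 using assms jap_ge1 by (intro nn_integral_mono power_mono mult_right_mono ennreal_leI powr_mono) auto

lemma Nsq_add:
 assumes [measurable]: "Borel U" "Borel V"
 shows "Nsq p (U \<oplus> V) \<le> 2 * Nsq p U + 2 * Nsq p V"
proof -
 have "Nsq p (U \<oplus> V) \<le> (\<integral>\<^sup>+\<xi>. 2 * (jm p U \<xi>)\<^sup>2 + 2 * (jm p V \<xi>)\<^sup>2 \<partial>lborel)"
  unfolding Nsq_def by (intro nn_integral_mono) (simp add: jm_def distrib_left ennreal_sum_sq)
 also have "... = 2 * Nsq p U + 2 * Nsq p V"
  unfolding Nsq_def by (simp add: nn_integral_add nn_integral_cmult)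
 finally show ?thesis .
qed

lemma Nsq_cmult:
 assumes [measurable]: "Borel V"
 shows "Nsq p (\<lambda>\<xi>. c * V \<xi>) = c\<^sup>2 * Nsq p V"
 unfolding Nsq_def jm_def
 by (subst nn_integral_cmult[symmetric]) (auto intro!: nn_integral_cong simp: power_mult_distrib mult_ac)

lemma Nsq_rf [simp]:
 assumes [measurable]: "Borel V"
 shows "Nsq p (rf V) = Nsq p V"
 unfolding Nsq_def jm_def rf_def
 using nn_integral_real_affine[of "\<lambda>\<xi>. (ennreal (jap \<xi> powr p) * V \<xi>)\<^sup>2" "-1" 0] by simp

lemma Nsq_zero [simp]: "Nsq p (\<lambda>_. 0) = 0"
 by (simp add: Nsq_def jm_def)

lemma nn_integral_translate_reflect:
 fixes V :: nnfun
 assumes [measurable]: "Borel V"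
 shows "(\<integral>\<^sup>+\<eta>. V (\<xi> - \<eta>) \<partial>lborel) = (\<integral>\<^sup>+\<eta>. V \<eta> \<partial>lborel)"
 using nn_integral_real_affine[of V "-1" \<xi>] by simp

lemma cv_commute:
 assumes [measurable]: "Borel U" "Borel V"
 shows "cv U V = cv V U"
proof
 fix \<xi>
 show "cv U V \<xi> = cv V U \<xi>"
  unfolding cv_def
  using nn_integral_translate_reflect[of "\<lambda>\<eta>. U (\<xi> - \<eta>) * V \<eta>" \<xi>] by (simp add: mult.commute)
qed

text \<open>Young's inequality: Cauchy-Schwarz with \<open>U\<close> split into two square roots,
  then Tonelli. The square root \<open>s\<close> sends \<open>top\<close> to 0, so the splitting is
  exact only where \<open>U\<close> is finite; this is why an infinite L1 norm is treated
  separately.\<close>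

lemma young:
 assumes [measurable]: "Borel U" "Borel V"
 shows "(\<integral>\<^sup>+\<xi>. (cv U V \<xi>)\<^sup>2 \<partial>lborel) \<le> (\<integral>\<^sup>+\<xi>. U \<xi> \<partial>lborel)\<^sup>2 * (\<integral>\<^sup>+\<xi>. (V \<xi>)\<^sup>2 \<partial>lborel)"
proof -
 define s where "s x = ennreal (sqrt (enn2real x))" for x :: ennreal
 have [measurable]: "Borel s" unfolding s_def by measurable
 have s: "(s x)\<^sup>2 = x" if "x \<noteq> top" for x
  using that by (cases x) (auto simp: s_def ennreal_power)
 show ?thesis
 proof (cases "(\<integral>\<^sup>+\<xi>. U \<xi> \<partial>lborel) = top")
  case True
  show ?thesis
  \<comment> \<open>The right-hand side is \<open>top * 0 = 0\<close> or \<open>top\<close>; only in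
    the first case is there something to show.\<close>
  proof (cases "(\<integral>\<^sup>+\<xi>. (V \<xi>)\<^sup>2 \<partial>lborel) = 0")
   case True
   then have "AE \<xi> in lborel. V \<xi> = 0" by (subst (asm) nn_integral_0_iff_AE) auto
   then have "cv U V \<xi> = 0" for \<xi>
    unfolding cv_def by (subst nn_integral_0_iff_AE) (auto elim!: eventually_mono)
   then show ?thesis by simp
  next
   case False
   then show ?thesis using True by (simp add: ennreal_mult_eq_top_iff ennreal_top_mult)
  qed
 next
  case False
  then have "AE \<xi> in lborel. U \<xi> \<noteq> \<infinity>" by (intro nn_integral_PInf_AE) auto
  then have fin: "AE \<eta> in lborel. U (\<xi> - \<eta>) \<noteq> \<infinity>" for \<xi> by (rule AE_translate_reflect)
  have "(cv U V \<xi>)\<^sup>2 \<le> (\<integral>\<^sup>+\<xi>. U \<xi> \<partial>lborel) * (\<integral>\<^sup>+\<eta>. U (\<xi> - \<eta>) * (V \<eta>)\<^sup>2 \<partial>lborel)" for \<xi>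
  proof -
   have "cv U V \<xi> = (\<integral>\<^sup>+\<eta>. s (U (\<xi> - \<eta>)) * (s (U (\<xi> - \<eta>)) * V \<eta>) \<partial>lborel)"
    unfolding cv_def by (intro nn_integral_cong_AE, use fin[of \<xi>] in eventually_elim)
     (simp add: s power2_eq_square[symmetric] mult.assoc[symmetric])
   also have "...\<^sup>2 \<le> (\<integral>\<^sup>+\<eta>. (s (U (\<xi> - \<eta>)))\<^sup>2 \<partial>lborel) * (\<integral>\<^sup>+\<eta>. (s (U (\<xi> - \<eta>)) * V \<eta>)\<^sup>2 \<partial>lborel)"
    by (rule Cauchy_Schwarz_nn_integral) measurable
   also have "(\<integral>\<^sup>+\<eta>. (s (U (\<xi> - \<eta>)))\<^sup>2 \<partial>lborel) = (\<integral>\<^sup>+\<eta>. U (\<xi> - \<eta>) \<partial>lborel)"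
    by (intro nn_integral_cong_AE, use fin[of \<xi>] in eventually_elim) (simp add: s)
   also have "... = (\<integral>\<^sup>+\<xi>. U \<xi> \<partial>lborel)" by (rule nn_integral_translate_reflect) measurable
   also have "(\<integral>\<^sup>+\<eta>. (s (U (\<xi> - \<eta>)) * V \<eta>)\<^sup>2 \<partial>lborel) = (\<integral>\<^sup>+\<eta>. U (\<xi> - \<eta>) * (V \<eta>)\<^sup>2 \<partial>lborel)"
    by (intro nn_integral_cong_AE, use fin[of \<xi>] in eventually_elim) (simp add: s power_mult_distrib)
   finally show ?thesis .
  qed
  then have "(\<integral>\<^sup>+\<xi>. (cv U V \<xi>)\<^sup>2 \<partial>lborel) \<le> (\<integral>\<^sup>+\<xi>. (\<integral>\<^sup>+\<xi>. U \<xi> \<partial>lborel) * (\<integral>\<^sup>+\<eta>. U (\<xi> - \<eta>) * (V \<eta>)\<^sup>2 \<partial>lborel) \<partial>lborel)"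
   by (intro nn_integral_mono)
  also have "... = (\<integral>\<^sup>+\<xi>. U \<xi> \<partial>lborel) * (\<integral>\<^sup>+\<xi>. \<integral>\<^sup>+\<eta>. U (\<xi> - \<eta>) * (V \<eta>)\<^sup>2 \<partial>lborel \<partial>lborel)"
   by (rule nn_integral_cmult) measurable
  also have "(\<integral>\<^sup>+\<xi>. \<integral>\<^sup>+\<eta>. U (\<xi> - \<eta>) * (V \<eta>)\<^sup>2 \<partial>lborel \<partial>lborel) = (\<integral>\<^sup>+\<eta>. \<integral>\<^sup>+\<xi>. U (\<xi> - \<eta>) * (V \<eta>)\<^sup>2 \<partial>lborel \<partial>lborel)"
   by (rule lborel_pair.Fubini'[symmetric]) measurable
  also have "... = (\<integral>\<^sup>+\<eta>. (\<integral>\<^sup>+\<xi>. U \<xi> \<partial>lborel) * (V \<eta>)\<^sup>2 \<partial>lborel)"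
  proof (intro nn_integral_cong)
   fix \<eta>
   have "(\<integral>\<^sup>+\<xi>. U (\<xi> - \<eta>) \<partial>lborel) = (\<integral>\<^sup>+\<xi>. U \<xi> \<partial>lborel)"
    using nn_integral_real_affine[of U 1 "-\<eta>"] by simp
   then show "(\<integral>\<^sup>+\<xi>. U (\<xi> - \<eta>) * (V \<eta>)\<^sup>2 \<partial>lborel) = (\<integral>\<^sup>+\<xi>. U \<xi> \<partial>lborel) * (V \<eta>)\<^sup>2"
    by (simp add: nn_integral_multc)
  qed
  also have "... = (\<integral>\<^sup>+\<xi>. U \<xi> \<partial>lborel) * (\<integral>\<^sup>+\<xi>. (V \<xi>)\<^sup>2 \<partial>lborel)"
   by (rule nn_integral_cmult) measurable
  finally show ?thesis by (simp add: power2_eq_square mult.assoc)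
 qed
qed

lemma L1_le_Nsq:
 assumes [measurable]: "Borel V"
 shows "(\<integral>\<^sup>+\<xi>. jm p V \<xi> \<partial>lborel)\<^sup>2 \<le> Cj * Nsq (p + 1) V"
proof -
 have "(\<integral>\<^sup>+\<xi>. jm p V \<xi> \<partial>lborel) = (\<integral>\<^sup>+\<xi>. ennreal (1 / jap \<xi>) * jm (p + 1) V \<xi> \<partial>lborel)"
  by (intro nn_integral_cong) (simp add: jm_def powr_add mult.assoc[symmetric] flip: ennreal_mult)
 also have "...\<^sup>2 \<le> (\<integral>\<^sup>+\<xi>. (ennreal (1 / jap \<xi>))\<^sup>2 \<partial>lborel) * Nsq (p + 1) V"
  unfolding Nsq_def by (rule Cauchy_Schwarz_nn_integral) measurable
 also have "(\<integral>\<^sup>+\<xi>. (ennreal (1 / jap \<xi>))\<^sup>2 \<partial>lborel) = Cj"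
  unfolding Cj_def by (simp add: ennreal_power power_divide)
 finally show ?thesis .
qed

lemma cv_mono: "(\<And>\<xi>. U \<xi> \<le> U' \<xi>) \<Longrightarrow> (\<And>\<xi>. V \<xi> \<le> V' \<xi>) \<Longrightarrow> cv U V \<xi> \<le> cv U' V' \<xi>"
 unfolding cv_def by (intro nn_integral_mono mult_mono) auto

text \<open>One of the frequencies \<open>\<xi> - \<eta>\<close> and \<open>\<eta>\<close> is at
  least comparable to \<open>\<xi>\<close>, and that factor takes the weight.\<close>

lemma jm_cv_le:
 assumes p: "p \<ge> 0" and [measurable]: "Borel U" "Borel V"
 shows "jm p (cv U V) \<xi> \<le> ennreal (2 powr p) * (cv (jm p U) V \<xi> + cv U (jm p V) \<xi>)"
proof -
 have "jm p (cv U V) \<xi> = (\<integral>\<^sup>+\<eta>. ennreal (jap \<xi> powr p) * (U (\<xi> - \<eta>) * V \<eta>) \<partial>lborel)"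
  unfolding jm_def cv_def by (rule nn_integral_cmult[symmetric]) measurable
 also have "... \<le> (\<integral>\<^sup>+\<eta>. ennreal (2 powr p) * (jm p U (\<xi> - \<eta>) * V \<eta> + U (\<xi> - \<eta>) * jm p V \<eta>) \<partial>lborel)"
 proof (intro nn_integral_mono)
  fix \<eta>
  have "ennreal (jap \<xi> powr p) * (U (\<xi> - \<eta>) * V \<eta>) \<le>
   (ennreal (2 powr p) * (ennreal (jap (\<xi> - \<eta>) powr p) + ennreal (jap \<eta> powr p))) * (U (\<xi> - \<eta>) * V \<eta>)"
   using jap_powr_split[OF p, of \<xi> \<eta>]
   by (intro mult_right_mono) (simp_all flip: ennreal_plus ennreal_mult add: ennreal_leI)
  also have "... = ennreal (2 powr p) * (jm p U (\<xi> - \<eta>) * V \<eta> + U (\<xi> - \<eta>) * jm p V \<eta>)"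
   by (simp add: jm_def distrib_left distrib_right mult_ac)
  finally show "ennreal (jap \<xi> powr p) * (U (\<xi> - \<eta>) * V \<eta>) \<le> ..." .
 qed
 also have "... = ennreal (2 powr p) * (cv (jm p U) V \<xi> + cv U (jm p V) \<xi>)"
  unfolding cv_def by (simp add: nn_integral_cmult nn_integral_add)
 finally show ?thesis .
qed

text \<open>The 4 is \<open>2 + 2\<close> from squaring a sum of two terms, \<open>2 powr l\<close>
  comes from splitting the weight, and \<open>Cj\<close> from placing one factor in L1.\<close>

definition Ka :: nnfun where
 "Ka l = 4 * (ennreal (2 powr l))\<^sup>2 * Cj"

lemma Ka_top: "Ka l < top"
 using Cj_top by (auto simp: Ka_def ennreal_mult_less_top ennreal_power)

lemma Nsq_cv_aux:
 assumes p: "p \<ge> 0" and [measurable]: "Borel U" "Borel V"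
  and a: "(\<integral>\<^sup>+\<xi>. (cv (jm p U) V \<xi>)\<^sup>2 \<partial>lborel) \<le> B" and b: "(\<integral>\<^sup>+\<xi>. (cv U (jm p V) \<xi>)\<^sup>2 \<partial>lborel) \<le> B"
 shows "Nsq p (cv U V) \<le> 4 * (ennreal (2 powr p))\<^sup>2 * B"
proof -
 have "Nsq p (cv U V) \<le> (\<integral>\<^sup>+\<xi>. (ennreal (2 powr p) * (cv (jm p U) V \<xi> + cv U (jm p V) \<xi>))\<^sup>2 \<partial>lborel)"
  unfolding Nsq_def by (intro nn_integral_mono power_mono jm_cv_le p) auto
 also have "... \<le> (\<integral>\<^sup>+\<xi>. (ennreal (2 powr p))\<^sup>2 * (2 * (cv (jm p U) V \<xi>)\<^sup>2 + 2 * (cv U (jm p V) \<xi>)\<^sup>2) \<partial>lborel)"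
  unfolding power_mult_distrib by (intro nn_integral_mono mult_left_mono ennreal_sum_sq) auto
 also have "... = (ennreal (2 powr p))\<^sup>2 * (2 * (\<integral>\<^sup>+\<xi>. (cv (jm p U) V \<xi>)\<^sup>2 \<partial>lborel) + 2 * (\<integral>\<^sup>+\<xi>. (cv U (jm p V) \<xi>)\<^sup>2 \<partial>lborel))"
  by (simp add: nn_integral_cmult nn_integral_add)
 also have "... \<le> (ennreal (2 powr p))\<^sup>2 * (2 * B + 2 * B)"
  by (intro mult_left_mono add_mono a b) auto
 also have "2 * B + 2 * B = 4 * B" by (simp flip: distrib_right)
 also have "(ennreal (2 powr p))\<^sup>2 * (4 * B) = 4 * (ennreal (2 powr p))\<^sup>2 * B"
  by (simp only: mult_ac)
 finally show ?thesis .
qed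

text \<open>The factor that receives the weight stays in L2, the other is placed in L1 at the cost
  of one power of \<open>jap\<close>, which \<open>l \<ge> 1\<close> provides.\<close>

lemma Nsq_cv_alg:
 assumes l: "l \<ge> 1" and [measurable]: "Borel U" "Borel V"
 shows "Nsq l (cv U V) \<le> Ka l * (Nsq l U * Nsq l V)"
proof -
 have L1: "(\<integral>\<^sup>+\<xi>. W \<xi> \<partial>lborel)\<^sup>2 \<le> Cj * Nsq l W" if [measurable]: "Borel W" for W
  using L1_le_Nsq[OF that, of 0] mult_left_mono[OF Nsq_mono_p[OF l, of W], of Cj] by simp
 have *: "(\<integral>\<^sup>+\<xi>. (cv W (jm l Z) \<xi>)\<^sup>2 \<partial>lborel) \<le> Cj * (Nsq l W * Nsq l Z)"
  if [measurable]: "Borel W" "Borel Z" for W Z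
  using young[of W "jm l Z"] mult_right_mono[OF L1[of W], of "Nsq l Z"]
  by (simp add: Nsq_def mult.assoc)
 have "Nsq l (cv U V) \<le> 4 * (ennreal (2 powr l))\<^sup>2 * (Cj * (Nsq l U * Nsq l V))"
  using l *[of U V] *[of V U] cv_commute[of V "jm l U"]
  by (intro Nsq_cv_aux) (auto simp: mult.commute)
 then show ?thesis by (simp add: Ka_def mult.assoc)
qed

text \<open>Made for products with one differentiated factor \<open>V\<close>. If the weight of
  order \<open>l - 1\<close> falls on \<open>U\<close>, one power of \<open>jap\<close> is left to
  put the weighted \<open>U\<close> in L1; otherwise \<open>U\<close> itself goes to L1 and
  \<open>V\<close> keeps its order.\<close>

lemma Nsq_cv_mod:
 assumes l: "l \<ge> 1" and [measurable]: "Borel U" "Borel V"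
 shows "Nsq (l - 1) (cv U V) \<le> Ka l * (Nsq l U * Nsq (l - 1) V)"
proof -
 have a: "(\<integral>\<^sup>+\<xi>. (cv (jm (l - 1) U) V \<xi>)\<^sup>2 \<partial>lborel) \<le> Cj * (Nsq l U * Nsq (l - 1) V)"
 proof -
  have "(\<integral>\<^sup>+\<xi>. (cv (jm (l - 1) U) V \<xi>)\<^sup>2 \<partial>lborel) \<le> (\<integral>\<^sup>+\<xi>. jm (l - 1) U \<xi> \<partial>lborel)\<^sup>2 * (\<integral>\<^sup>+\<xi>. (V \<xi>)\<^sup>2 \<partial>lborel)"
   by (rule young) measurable
  also have "... \<le> (Cj * Nsq l U) * Nsq (l - 1) V"
   using L1_le_Nsq[of U "l - 1"] Nsq_mono_p[of 0 "l - 1" V] l by (intro mult_mono) (auto simp: Nsq_def)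
  finally show ?thesis by (simp add: mult.assoc)
 qed
 have b: "(\<integral>\<^sup>+\<xi>. (cv U (jm (l - 1) V) \<xi>)\<^sup>2 \<partial>lborel) \<le> Cj * (Nsq l U * Nsq (l - 1) V)"
 proof -
  have "(\<integral>\<^sup>+\<xi>. (cv U (jm (l - 1) V) \<xi>)\<^sup>2 \<partial>lborel) \<le> (\<integral>\<^sup>+\<xi>. jm 0 U \<xi> \<partial>lborel)\<^sup>2 * Nsq (l - 1) V"
   unfolding Nsq_def jm_0 by (rule young) measurable
  also have "... \<le> (Cj * Nsq l U) * Nsq (l - 1) V"
   using L1_le_Nsq[of U 0] mult_left_mono[OF Nsq_mono_p[OF l, of U], of Cj] by (intro mult_right_mono) auto
  finally show ?thesis by (simp add: mult.assoc)
 qed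
 have "Nsq (l - 1) (cv U V) \<le> 4 * (ennreal (2 powr (l - 1)))\<^sup>2 * (Cj * (Nsq l U * Nsq (l - 1) V))"
  using l a b by (intro Nsq_cv_aux) auto
 also have "... \<le> 4 * (ennreal (2 powr l))\<^sup>2 * (Cj * (Nsq l U * Nsq (l - 1) V))"
  by (intro mult_right_mono mult_left_mono power_mono ennreal_leI powr_mono) auto
 finally show ?thesis by (simp add: Ka_def mult.assoc)
qed

section \<open>The nonlinearities on the Fourier side\<close>

text \<open>If \<open>Y\<close> majorises the transform of \<open>a\<close>, then
  \<open>PV Y k\<close> majorises that of \<open>|a|^(2 * (k + 1))\<close>; the reflection
  \<open>rf\<close> is the effect of complex conjugation on moduli.\<close>

primrec PV :: "nnfun \<Rightarrow> nat \<Rightarrow> real \<Rightarrow> ennreal" where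
 "PV Y 0 = cv Y (rf Y)"
| "PV Y (Suc k) = cv (cv Y (rf Y)) (PV Y k)"

text \<open>Majorant of the nonlinear part of the phase equation, as \<open>QA\<close> is for the
  amplitude equation, with one constant \<open>A\<close> above all coefficients. \<open>X\<close>
  majorises \<open>jap\<close> times the transform of the phase, hence already its first derivative,
  and \<open>jm 1 X\<close> the second. Nonnegative coefficients make both expressions monotone and
  compatible with increasing limits.\<close>

definition QP :: "ennreal \<Rightarrow> nat \<Rightarrow> nat \<Rightarrow> nnfun \<Rightarrow> nnfun \<Rightarrow> real \<Rightarrow> ennreal" where
 "QP A g s X Y \<xi> = A * (cv X X \<xi> + cv (PV Y g) X \<xi> + PV Y s \<xi>)"

definition QA :: "ennreal \<Rightarrow> nat \<Rightarrow> nnfun \<Rightarrow> nnfun \<Rightarrow> real \<Rightarrow> ennreal" where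
 "QA A g X Y \<xi> = A * (cv X (jm 1 Y) \<xi> + cv Y (jm 1 X) \<xi> + jm 1 (cv (PV Y g) Y) \<xi>)"

lemma PV_measurable [measurable]:
 assumes [measurable]: "Borel Y" shows "Borel (PV Y k)"
 by (induction k) simp_all

lemma QP_measurable [measurable]:
 assumes [measurable]: "Borel X" "Borel Y"
 shows "Borel (QP A g s X Y)" "Borel (QA A g X Y)"
 unfolding QP_def[abs_def] QA_def[abs_def] by measurable

text \<open>On the Fourier side, \<open>conv\<close> is the product, \<open>dh\<close> the derivative in \<open>x\<close>, \<open>cj\<close> the complex conjugation and
 \<open>PC a k\<close> the function \<open>|a|^(2 * (k + 1))\<close>. \<open>NP\<close> and \<open>NA\<close> are the nonlinear parts of the time derivatives for the
 exponents \<open>\<gamma> = Suc g\<close> and \<open>\<sigma> = Suc s\<close>; as the phase only enters through its derivative, it is measured through \<open>jc\<close>.\<close>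

definition conv :: "cfun \<Rightarrow> cfun \<Rightarrow> real \<Rightarrow> complex" where
 "conv u v \<xi> = of_real (1 / sqrt (2 * pi)) * (LINT \<eta>|lborel. u (\<xi> - \<eta>) * v \<eta>)"

definition dh :: "cfun \<Rightarrow> real \<Rightarrow> complex" where
 "dh u \<xi> = \<i> * of_real \<xi> * u \<xi>"

definition cj :: "cfun \<Rightarrow> real \<Rightarrow> complex" where
 "cj u \<xi> = cnj (u (- \<xi>))"

definition jc :: "cfun \<Rightarrow> real \<Rightarrow> complex" where
 "jc u \<xi> = of_real (jap \<xi>) * u \<xi>"

primrec PC :: "cfun \<Rightarrow> nat \<Rightarrow> real \<Rightarrow> complex" where
 "PC a 0 = conv a (cj a)"
| "PC a (Suc k) = conv (conv a (cj a)) (PC a k)"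

definition NP :: "real \<Rightarrow> real \<Rightarrow> nat \<Rightarrow> nat \<Rightarrow> cfun \<Rightarrow> cfun \<Rightarrow> real \<Rightarrow> complex" where
 "NP \<alpha> \<beta> g s p a \<xi> = of_real (-1/2) * conv (dh p) (dh p) \<xi> + of_real (-\<alpha>/2) * conv (PC a g) (dh p) \<xi>
   + of_real (-\<beta>) * PC a s \<xi>"

definition NA :: "real \<Rightarrow> nat \<Rightarrow> cfun \<Rightarrow> cfun \<Rightarrow> real \<Rightarrow> complex" where
 "NA \<alpha> g p a \<xi> = of_real (-1) * conv (dh p) (dh a) \<xi> + of_real (-1/2) * conv a (dh (dh p)) \<xi>
   + of_real (-\<alpha>/2) * dh (conv (PC a g) a) \<xi>"

text \<open>\<open>Nsq l (em w h)\<close> is the squared norm of order \<open>l\<close> and weight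
  \<open>w\<close> of a function with transform \<open>h\<close>.\<close>

definition em :: "real \<Rightarrow> cfun \<Rightarrow> real \<Rightarrow> ennreal" where
 "em \<rho> u \<xi> = ennreal (exp (\<rho> * jap \<xi>) * cmod (u \<xi>))"

lemma field_measurable [measurable (raw)]:
 assumes [measurable]: "case_prod u \<in> borel_measurable (M \<Otimes>\<^sub>M borel)" "case_prod v \<in> borel_measurable (M \<Otimes>\<^sub>M borel)"
  "f \<in> borel_measurable M"
 shows conv_measurable: "(\<lambda>t. conv (u t) (v t) (f t)) \<in> borel_measurable M"
  and dh_measurable: "(\<lambda>t. dh (u t) (f t)) \<in> borel_measurable M"
  and cj_measurable: "(\<lambda>t. cj (u t) (f t)) \<in> borel_measurable M"
  and jc_measurable: "(\<lambda>t. jc (u t) (f t)) \<in> borel_measurable M"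
  and em_measurable: "(\<lambda>t. em \<rho> (u t) (f t)) \<in> borel_measurable M"
 unfolding conv_def dh_def cj_def jc_def em_def by measurable

lemma PC_measurable_pair:
 assumes [measurable]: "case_prod u \<in> borel_measurable (M \<Otimes>\<^sub>M borel)"
 shows "case_prod (\<lambda>t. PC (u t) k) \<in> borel_measurable (M \<Otimes>\<^sub>M borel)"
proof (induction k)
 case 0
 show ?case by simp measurable
next
 case (Suc k)
 note [measurable] = Suc
 show ?case by simp measurable
qed

lemma PC_measurable [measurable (raw)]:
 assumes [measurable]: "case_prod u \<in> borel_measurable (M \<Otimes>\<^sub>M borel)" "f \<in> borel_measurable M"
 shows "(\<lambda>t. PC (u t) k (f t)) \<in> borel_measurable M"
proof -
 note [measurable] = PC_measurable_pair[OF assms(1)]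
 show ?thesis by measurable
qed

lemma N_measurable [measurable (raw)]:
 assumes [measurable]: "case_prod p \<in> borel_measurable (M \<Otimes>\<^sub>M borel)" "case_prod a \<in> borel_measurable (M \<Otimes>\<^sub>M borel)"
  "f \<in> borel_measurable M"
 shows NP_measurable: "(\<lambda>t. NP \<alpha> \<beta> g s (p t) (a t) (f t)) \<in> borel_measurable M"
  and NA_measurable: "(\<lambda>t. NA \<alpha> g (p t) (a t) (f t)) \<in> borel_measurable M"
 unfolding NP_def NA_def by measurable

lemma single_measurable [measurable]:
 assumes [measurable]: "Borel u" "Borel v"
 shows "Borel (conv u v)" "Borel (dh u)" "Borel (cj u)"
  "Borel (jc u)" "Borel (em \<rho> u)" "Borel (PC u k)"
 by measurable

text \<open>The factor \<open>1 / sqrt (2 * pi)\<close> of the convolution is at most 1 and is dropped from all majorants.\<close>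

lemma em_conv_gen:
 assumes "\<And>\<eta>. ennreal (exp (\<rho> * jap \<xi>) * cmod (f \<eta>)) \<le> G \<eta>"
 shows "ennreal (exp (\<rho> * jap \<xi>) * cmod (of_real (1 / sqrt (2 * pi)) * (LINT \<eta>|lborel. f \<eta>))) \<le> (\<integral>\<^sup>+\<eta>. G \<eta> \<partial>lborel)"
proof (cases "integrable lborel f")
 case True
 have c: "\<bar>1 / sqrt (2 * pi)\<bar> \<le> 1" using pi_ge_two by (simp add: real_le_rsqrt)
 have "ennreal (exp (\<rho> * jap \<xi>) * cmod (of_real (1 / sqrt (2 * pi)) * (LINT \<eta>|lborel. f \<eta>)))
  \<le> ennreal (exp (\<rho> * jap \<xi>)) * ennreal (cmod (LINT \<eta>|lborel. f \<eta>))"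
  unfolding norm_mult ennreal_mult[symmetric, OF exp_ge_zero norm_ge_zero] norm_of_real
  by (intro ennreal_leI mult_left_mono mult_left_le_one_le) (use c in auto)
 also have "... \<le> ennreal (exp (\<rho> * jap \<xi>)) * (\<integral>\<^sup>+\<eta>. ennreal (cmod (f \<eta>)) \<partial>lborel)"
  by (intro mult_left_mono integral_norm_bound_ennreal True) auto
 also have "... = (\<integral>\<^sup>+\<eta>. ennreal (exp (\<rho> * jap \<xi>) * cmod (f \<eta>)) \<partial>lborel)"
  using True by (subst nn_integral_cmult[symmetric]) (auto simp: ennreal_mult)
 also have "... \<le> (\<integral>\<^sup>+\<eta>. G \<eta> \<partial>lborel)" by (intro nn_integral_mono assms)
 finally show ?thesis .
qed (simp add: not_integrable_integral_eq)

text \<open>Subadditivity of \<open>jap\<close> makes the exponential weight submultiplicative along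
  the decomposition of \<open>\<xi>\<close> into \<open>\<xi> - \<eta>\<close> and
  \<open>\<eta>\<close>. This is where the weight has to be nonnegative, and hence what limits the
  time interval.\<close>

lemma em_submult:
 assumes "\<rho> \<ge> 0"
 shows "ennreal (exp (\<rho> * jap \<xi>) * cmod (x * y)) \<le> ennreal (exp (\<rho> * jap (\<xi> - \<eta>)) * cmod x) * ennreal (exp (\<rho> * jap \<eta>) * cmod y)"
proof -
 have "exp (\<rho> * jap \<xi>) \<le> exp (\<rho> * jap (\<xi> - \<eta>)) * exp (\<rho> * jap \<eta>)"
  using mult_left_mono[OF jap_split[of \<xi> \<eta>] assms] by (simp add: exp_add[symmetric] distrib_left)
 then have "exp (\<rho> * jap \<xi>) * (cmod x * cmod y) \<le> (exp (\<rho> * jap (\<xi> - \<eta>)) * exp (\<rho> * jap \<eta>)) * (cmod x * cmod y)"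
  by (intro mult_right_mono) auto
 then show ?thesis
  by (simp flip: ennreal_mult add: norm_mult mult_ac ennreal_leI)
qed

lemma em_conv:
 assumes "\<rho> \<ge> 0"
 shows "em \<rho> (conv u v) \<xi> \<le> cv (em \<rho> u) (em \<rho> v) \<xi>"
 unfolding em_def conv_def cv_def by (intro em_conv_gen em_submult assms)

lemma cmod_le_em: "\<rho> \<ge> 0 \<Longrightarrow> ennreal (cmod (u \<xi>)) \<le> em \<rho> u \<xi>"
 unfolding em_def by (intro ennreal_leI) (simp add: mult_le_cancel_right1)

lemma em_jc: "em r (jc u) = jm 1 (em r u)"
 by (simp add: fun_eq_iff em_def jm_def jc_def norm_mult mult_ac flip: ennreal_mult)

lemma em_jc_pt: "em r (jc u) \<xi> = ennreal (jap \<xi>) * ennreal (exp (r * jap \<xi>) * cmod (u \<xi>))"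
 by (simp add: em_jc jm_def em_def)

lemma em_le_em_jc: "em r u \<xi> \<le> em r (jc u) \<xi>"
proof -
 have "1 * cmod (u \<xi>) \<le> jap \<xi> * cmod (u \<xi>)" by (intro mult_right_mono jap_ge1) auto
 then show ?thesis by (simp add: em_def jc_def norm_mult ennreal_leI)
qed

lemma em_le_jm_minus_one: "em r (jc u) \<xi> \<le> X \<xi> \<Longrightarrow> em r u \<xi> \<le> jm (-1) X \<xi>"
proof -
 assume "em r (jc u) \<xi> \<le> X \<xi>"
 then have "jm (-1) (em r (jc u)) \<xi> \<le> jm (-1) X \<xi>" by (simp add: jm_def mult_left_mono)
 then show ?thesis by (simp add: em_jc jm_jm)
qed

lemma em_minus_le: "em r (u \<ominus> v) \<xi> \<le> em r u \<xi> + em r v \<xi>"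
 by (simp add: em_def norm_triangle_ineq4 ennreal_leI flip: ennreal_plus distrib_left)

lemma jc_diff: "jc (u \<ominus> v) = (jc u \<ominus> jc v)"
 by (simp add: fun_eq_iff jc_def right_diff_distrib)

lemma em_jc_diff: "em r (jc p \<ominus> jc q) \<xi> = ennreal (jap \<xi>) * ennreal (exp (r * jap \<xi>) * cmod (p \<xi> - q \<xi>))"
proof -
 have "jc p \<xi> - jc q \<xi> = of_real (jap \<xi>) * (p \<xi> - q \<xi>)" by (simp add: jc_def right_diff_distrib)
 then show ?thesis by (simp add: em_def norm_mult mult_ac flip: ennreal_mult)
qed

lemma em_mono_weight: "r \<le> r' \<Longrightarrow> em r u \<xi> \<le> em r' u \<xi>"
 unfolding em_def by (intro ennreal_leI mult_right_mono) (auto intro: mult_right_mono)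

lemma conv_integrable:
 assumes "\<rho> \<ge> 0" and [measurable]: "Borel u" "Borel v"
  and "\<And>\<xi>. em \<rho> u \<xi> \<le> U \<xi>" "\<And>\<xi>. em \<rho> v \<xi> \<le> V \<xi>" "cv U V \<xi> < top"
 shows "integrable lborel (\<lambda>\<eta>. u (\<xi> - \<eta>) * v \<eta>)"
proof -
 have "(\<integral>\<^sup>+\<eta>. ennreal (cmod (u (\<xi> - \<eta>) * v \<eta>)) \<partial>lborel) \<le> cv U V \<xi>"
  unfolding cv_def norm_mult
  by (intro nn_integral_mono) (auto simp: ennreal_mult intro!: mult_mono order_trans[OF cmod_le_em] assms)
 then show ?thesis using assms(6) by (auto simp: integrable_iff_bounded)
qed

text \<open>\<open>U'\<close> majorises \<open>u'\<close> and \<open>U - U'\<close> majorises \<open>u - u'\<close>, written without subtraction. Unlike a Lipschitz bound,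
 this relation passes through every polynomial nonlinearity with the same polynomial acting on the majorants.\<close>

definition Rl :: "real \<Rightarrow> cfun \<Rightarrow> cfun \<Rightarrow> nnfun \<Rightarrow> nnfun \<Rightarrow> bool" where
 "Rl \<rho> u u' U U' \<longleftrightarrow> Borel u \<and> Borel u' \<and>
  Borel U \<and> Borel U' \<and>
  (\<forall>\<xi>. em \<rho> u' \<xi> \<le> U' \<xi> \<and> em \<rho> (u \<ominus> u') \<xi> + U' \<xi> \<le> U \<xi>)"

lemma Rl_dominated:
 assumes "Rl \<rho> u u' U U'"
 shows "em \<rho> u \<xi> \<le> U \<xi>"
proof -
 have "em \<rho> u \<xi> \<le> em \<rho> (u \<ominus> u') \<xi> + em \<rho> u' \<xi>"
  unfolding em_def using norm_triangle_ineq[of "u \<xi> - u' \<xi>" "u' \<xi>"]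
  by (simp flip: ennreal_plus distrib_left add: ennreal_leI)
 also have "... \<le> em \<rho> (u \<ominus> u') \<xi> + U' \<xi>"
  using assms by (intro add_left_mono) (simp add: Rl_def)
 finally show ?thesis using assms by (auto simp: Rl_def intro: order_trans)
qed

text \<open>The decomposition \<open>u * v - u' * v' = (u - u') * v + u' * (v - v')\<close> is
  matched on the majorants by absorbing first \<open>V'\<close> and the bound of
  \<open>v - v'\<close> into \<open>V\<close>, then \<open>U'\<close> and the bound of
  \<open>u - u'\<close> into \<open>U\<close>. Where \<open>cv U V\<close> is infinite there is
  nothing to show; where it is finite, both convolution integrals converge and may be
  subtracted.\<close>

lemma Rl_conv:
 assumes \<rho>: "\<rho> \<ge> 0" and u: "Rl \<rho> u u' U U'" and v: "Rl \<rho> v v' V V'"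
 shows "Rl \<rho> (conv u v) (conv u' v') (cv U V) (cv U' V')"
proof -
 have [measurable]: "Borel u" "Borel u'" "Borel v" "Borel v'"
  "Borel U" "Borel U'" "Borel V" "Borel V'"
  using u v by (auto simp: Rl_def)
 have UV: "em \<rho> u \<xi> \<le> U \<xi>" "em \<rho> v \<xi> \<le> V \<xi>" "em \<rho> u' \<xi> \<le> U' \<xi>" "em \<rho> v' \<xi> \<le> V' \<xi>"
  "em \<rho> (u \<ominus> u') \<xi> + U' \<xi> \<le> U \<xi>" "em \<rho> (v \<ominus> v') \<xi> + V' \<xi> \<le> V \<xi>" for \<xi>
  using u v Rl_dominated[OF u] Rl_dominated[OF v] by (auto simp: Rl_def)
 have "U' \<xi> \<le> em \<rho> (u \<ominus> u') \<xi> + U' \<xi>" "V' \<xi> \<le> em \<rho> (v \<ominus> v') \<xi> + V' \<xi>" for \<xi>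
  by (simp_all add: add_increasing)
 then have le: "U' \<xi> \<le> U \<xi>" "V' \<xi> \<le> V \<xi>" for \<xi>
  using UV(5,6) order_trans by blast+
 have "em \<rho> (conv u' v') \<xi> \<le> cv U' V' \<xi>" for \<xi>
  by (rule order_trans[OF em_conv[OF \<rho>] cv_mono]) (simp_all add: UV)
 moreover have "em \<rho> (conv u v \<ominus> conv u' v') \<xi> + cv U' V' \<xi> \<le> cv U V \<xi>" for \<xi>
 proof (cases "cv U V \<xi> = top")
  case False
  then have fin: "cv U V \<xi> < top" by (simp add: less_top)
  have "cv U' V' \<xi> \<le> cv U V \<xi>" by (intro cv_mono le)
  then have fin': "cv U' V' \<xi> < top" using fin by simp
  have i: "integrable lborel (\<lambda>\<eta>. u (\<xi> - \<eta>) * v \<eta>)" "integrable lborel (\<lambda>\<eta>. u' (\<xi> - \<eta>) * v' \<eta>)"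
   by (rule conv_integrable[OF \<rho> _ _ UV(1,2) fin], simp, simp,
     rule conv_integrable[OF \<rho> _ _ UV(3,4) fin'], simp, simp)
  let ?du = "em \<rho> (u \<ominus> u')" and ?dv = "em \<rho> (v \<ominus> v')"
  have "conv u v \<xi> - conv u' v' \<xi> = of_real (1 / sqrt (2 * pi)) *
    (LINT \<eta>|lborel. u (\<xi> - \<eta>) * v \<eta> - u' (\<xi> - \<eta>) * v' \<eta>)"
   unfolding conv_def using i by (simp add: right_diff_distrib)
  then have "em \<rho> (conv u v \<ominus> conv u' v') \<xi> \<le> (\<integral>\<^sup>+\<eta>. ?du (\<xi> - \<eta>) * V \<eta> + U' (\<xi> - \<eta>) * ?dv \<eta> \<partial>lborel)"
   unfolding em_def[of \<rho> "\<lambda>\<xi>. conv u v \<xi> - conv u' v' \<xi>"]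
  proof (simp only:, intro em_conv_gen)
   fix \<eta>
   have "u (\<xi> - \<eta>) * v \<eta> - u' (\<xi> - \<eta>) * v' \<eta> = (u (\<xi> - \<eta>) - u' (\<xi> - \<eta>)) * v \<eta> + u' (\<xi> - \<eta>) * (v \<eta> - v' \<eta>)"
    by (simp add: algebra_simps)
   then have "ennreal (exp (\<rho> * jap \<xi>) * cmod (u (\<xi> - \<eta>) * v \<eta> - u' (\<xi> - \<eta>) * v' \<eta>))
    \<le> ennreal (exp (\<rho> * jap \<xi>) * cmod ((u (\<xi> - \<eta>) - u' (\<xi> - \<eta>)) * v \<eta>)) + ennreal (exp (\<rho> * jap \<xi>) * cmod (u' (\<xi> - \<eta>) * (v \<eta> - v' \<eta>)))"
    by (simp flip: ennreal_plus distrib_left add: ennreal_leI norm_triangle_ineq)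
   also have "... \<le> ?du (\<xi> - \<eta>) * em \<rho> v \<eta> + em \<rho> u' (\<xi> - \<eta>) * ?dv \<eta>"
    unfolding em_def by (intro add_mono em_submult \<rho>)
   also have "... \<le> ?du (\<xi> - \<eta>) * V \<eta> + U' (\<xi> - \<eta>) * ?dv \<eta>"
    by (intro add_mono mult_mono UV) auto
   finally show "ennreal (exp (\<rho> * jap \<xi>) * cmod (u (\<xi> - \<eta>) * v \<eta> - u' (\<xi> - \<eta>) * v' \<eta>)) \<le> ..." .
  qed
  then have "em \<rho> (conv u v \<ominus> conv u' v') \<xi> + cv U' V' \<xi> \<le>
    (\<integral>\<^sup>+\<eta>. ?du (\<xi> - \<eta>) * V \<eta> + U' (\<xi> - \<eta>) * ?dv \<eta> \<partial>lborel) + (\<integral>\<^sup>+\<eta>. U' (\<xi> - \<eta>) * V' \<eta> \<partial>lborel)"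
   by (simp add: cv_def add_right_mono)
  also have "... = (\<integral>\<^sup>+\<eta>. ?du (\<xi> - \<eta>) * V \<eta> + U' (\<xi> - \<eta>) * ?dv \<eta> + U' (\<xi> - \<eta>) * V' \<eta> \<partial>lborel)"
   by (rule nn_integral_add[symmetric]) measurable
  also have "... \<le> cv U V \<xi>"
   unfolding cv_def
  proof (intro nn_integral_mono)
   fix \<eta>
   have "?du (\<xi> - \<eta>) * V \<eta> + U' (\<xi> - \<eta>) * ?dv \<eta> + U' (\<xi> - \<eta>) * V' \<eta> = ?du (\<xi> - \<eta>) * V \<eta> + U' (\<xi> - \<eta>) * (?dv \<eta> + V' \<eta>)"
    by (simp add: distrib_left add.assoc)
   also have "... \<le> ?du (\<xi> - \<eta>) * V \<eta> + U' (\<xi> - \<eta>) * V \<eta>"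
    by (intro add_left_mono mult_left_mono UV) auto
   also have "... \<le> U (\<xi> - \<eta>) * V \<eta>"
    unfolding distrib_right[symmetric] by (intro mult_right_mono UV) auto
   finally show "?du (\<xi> - \<eta>) * V \<eta> + U' (\<xi> - \<eta>) * ?dv \<eta> + U' (\<xi> - \<eta>) * V' \<eta> \<le> U (\<xi> - \<eta>) * V \<eta>" .
  qed
  finally show ?thesis .
 qed simp
 ultimately show ?thesis by (simp add: Rl_def)
qed

lemma Rl_mult:
 assumes u: "Rl \<rho> u u' U U'" and [measurable]: "Borel c" "Borel C"
  and c: "\<And>\<xi>. ennreal (cmod (c \<xi>)) \<le> C \<xi>"
 shows "Rl \<rho> (\<lambda>\<xi>. c \<xi> * u \<xi>) (\<lambda>\<xi>. c \<xi> * u' \<xi>) (\<lambda>\<xi>. C \<xi> * U \<xi>) (\<lambda>\<xi>. C \<xi> * U' \<xi>)"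
proof -
 have e: "em \<rho> (\<lambda>\<xi>. c \<xi> * w \<xi>) \<xi> \<le> C \<xi> * em \<rho> w \<xi>" for w \<xi>
 proof -
  have "em \<rho> (\<lambda>\<xi>. c \<xi> * w \<xi>) \<xi> = ennreal (cmod (c \<xi>)) * em \<rho> w \<xi>"
   by (simp add: em_def norm_mult mult_ac flip: ennreal_mult)
  also have "... \<le> C \<xi> * em \<rho> w \<xi>" by (intro mult_right_mono c) auto
  finally show ?thesis .
 qed
 have 1: "em \<rho> (\<lambda>\<xi>. c \<xi> * u' \<xi>) \<xi> \<le> C \<xi> * U' \<xi>" for \<xi>
  using u by (intro order_trans[OF e] mult_left_mono) (auto simp: Rl_def)
 have 2: "em \<rho> (\<lambda>\<xi>. c \<xi> * u \<xi> - c \<xi> * u' \<xi>) \<xi> + C \<xi> * U' \<xi> \<le> C \<xi> * U \<xi>" for \<xi>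
 proof -
  have "em \<rho> (\<lambda>\<xi>. c \<xi> * u \<xi> - c \<xi> * u' \<xi>) \<xi> + C \<xi> * U' \<xi> \<le> C \<xi> * em \<rho> (u \<ominus> u') \<xi> + C \<xi> * U' \<xi>"
   using e[of "\<lambda>\<xi>. u \<xi> - u' \<xi>" \<xi>] by (intro add_right_mono) (simp add: right_diff_distrib)
  also have "... \<le> C \<xi> * U \<xi>"
   using u unfolding distrib_left[symmetric] by (intro mult_left_mono) (auto simp: Rl_def)
  finally show ?thesis .
 qed
 show ?thesis using u 1 2 by (auto simp: Rl_def)
qed

lemma Rl_cmult:
 assumes "Rl \<rho> u u' U U'" "\<bar>c\<bar> \<le> C"
 shows "Rl \<rho> (\<lambda>\<xi>. of_real c * u \<xi>) (\<lambda>\<xi>. of_real c * u' \<xi>) (\<lambda>\<xi>. ennreal C * U \<xi>) (\<lambda>\<xi>. ennreal C * U' \<xi>)"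
 using assms by (intro Rl_mult) (auto simp: ennreal_leI)

lemma Rl_add:
 assumes u: "Rl \<rho> u u' U U'" and v: "Rl \<rho> v v' V V'"
 shows "Rl \<rho> (u \<oplus> v) (u' \<oplus> v') (U \<oplus> V) (U' \<oplus> V')"
proof -
 have e: "em \<rho> (w \<oplus> z) \<xi> \<le> em \<rho> w \<xi> + em \<rho> z \<xi>" for w z \<xi>
  by (simp add: em_def norm_triangle_ineq ennreal_leI flip: ennreal_plus distrib_left)
 have 1: "em \<rho> (u' \<oplus> v') \<xi> \<le> U' \<xi> + V' \<xi>" for \<xi>
  using u v by (intro order_trans[OF e] add_mono) (auto simp: Rl_def)
 have 2: "em \<rho> (\<lambda>\<xi>. u \<xi> + v \<xi> - (u' \<xi> + v' \<xi>)) \<xi> + (U' \<xi> + V' \<xi>) \<le> U \<xi> + V \<xi>" for \<xi>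
 proof -
  have "em \<rho> (\<lambda>\<xi>. u \<xi> + v \<xi> - (u' \<xi> + v' \<xi>)) \<xi> + (U' \<xi> + V' \<xi>) \<le>
   (em \<rho> (u \<ominus> u') \<xi> + em \<rho> (v \<ominus> v') \<xi>) + (U' \<xi> + V' \<xi>)"
   using e[of "\<lambda>\<xi>. u \<xi> - u' \<xi>" "\<lambda>\<xi>. v \<xi> - v' \<xi>" \<xi>] by (intro add_right_mono) (simp add: algebra_simps)
  also have "... = (em \<rho> (u \<ominus> u') \<xi> + U' \<xi>) + (em \<rho> (v \<ominus> v') \<xi> + V' \<xi>)" by (simp add: ac_simps)
  also have "... \<le> U \<xi> + V \<xi>" using u v by (intro add_mono) (auto simp: Rl_def)
  finally show ?thesis .
 qed
 show ?thesis using u v 1 2 by (auto simp: Rl_def)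
qed

lemma Rl_cj:
 assumes u: "Rl \<rho> u u' U U'"
 shows "Rl \<rho> (cj u) (cj u') (rf U) (rf U')"
proof -
 have [measurable]: "Borel u" "Borel u'" "Borel U" "Borel U'"
  using u by (auto simp: Rl_def)
 have "em \<rho> (cj u') \<xi> = em \<rho> u' (- \<xi>)" "em \<rho> (cj u \<ominus> cj u') \<xi> = em \<rho> (u \<ominus> u') (- \<xi>)" for \<xi>
  by (simp_all add: em_def cj_def flip: complex_cnj_diff)
 then show ?thesis using u by (simp add: Rl_def rf_def[of U] rf_def[of U'])
qed

lemma Rl_PC:
 assumes "\<rho> \<ge> 0" "Rl \<rho> a a' Y Y'"
 shows "Rl \<rho> (PC a k) (PC a' k) (PV Y k) (PV Y' k)"
 using assms by (induction k) (auto intro!: Rl_conv Rl_cj)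

text \<open>The symbol \<open>\<xi> / jap \<xi>\<close> has modulus at most one, so the first
  derivative of the phase costs nothing beyond the \<open>jap\<close> contained in
  \<open>jc\<close>.\<close>

lemma Rl_dh1:
 assumes "Rl \<rho> (jc p) (jc p') X X'" and "Borel p" "Borel p'"
 shows "Rl \<rho> (dh p) (dh p') X X'"
proof -
 have "Rl \<rho> (\<lambda>\<xi>. (\<i> * of_real (\<xi> / jap \<xi>)) * jc p \<xi>) (\<lambda>\<xi>. (\<i> * of_real (\<xi> / jap \<xi>)) * jc p' \<xi>) (\<lambda>\<xi>. 1 * X \<xi>) (\<lambda>\<xi>. 1 * X' \<xi>)"
  using abs_le_jap by (intro Rl_mult assms) (auto simp: norm_mult norm_divide)
 then show ?thesis by (simp add: dh_def[abs_def] jc_def mult.assoc)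
qed

lemma Rl_dh:
 assumes u: "Rl \<rho> u u' U U'"
 shows "Rl \<rho> (dh u) (dh u') (jm 1 U) (jm 1 U')"
proof -
 have "Rl \<rho> (\<lambda>\<xi>. (\<i> * of_real \<xi>) * u \<xi>) (\<lambda>\<xi>. (\<i> * of_real \<xi>) * u' \<xi>) (\<lambda>\<xi>. ennreal (jap \<xi>) * U \<xi>) (\<lambda>\<xi>. ennreal (jap \<xi>) * U' \<xi>)"
  using abs_le_jap by (intro Rl_mult assms) (auto simp: norm_mult ennreal_leI)
 then show ?thesis by (simp add: dh_def[abs_def] jm_def[abs_def])
qed

lemma Rl_N:
 assumes \<rho>: "\<rho> \<ge> 0" and p: "Rl \<rho> (jc p) (jc p') X X'" and a: "Rl \<rho> a a' Y Y'"
  and m: "Borel p" "Borel p'"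
  and A: "A \<ge> 1" "\<bar>\<alpha>\<bar> \<le> A" "\<bar>\<beta>\<bar> \<le> A"
 shows Rl_NP: "Rl \<rho> (NP \<alpha> \<beta> g s p a) (NP \<alpha> \<beta> g s p' a') (QP (ennreal A) g s X Y) (QP (ennreal A) g s X' Y')"
  and Rl_NA: "Rl \<rho> (NA \<alpha> g p a) (NA \<alpha> g p' a') (QA (ennreal A) g X Y) (QA (ennreal A) g X' Y')"
proof -
 note dp = Rl_dh1[OF p m]
 note Pg = Rl_PC[OF \<rho> a, of g] and Ps = Rl_PC[OF \<rho> a, of s]
 have QP_eq: "QP (ennreal A) g s X Y = (\<lambda>\<xi>. ennreal A * cv X X \<xi> + ennreal A * cv (PV Y g) X \<xi> + ennreal A * PV Y s \<xi>)" for X Y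
  by (simp add: QP_def fun_eq_iff distrib_left)
 have QA_eq: "QA (ennreal A) g X Y = (\<lambda>\<xi>. ennreal A * cv X (jm 1 Y) \<xi> + ennreal A * cv Y (jm 1 X) \<xi> + ennreal A * jm 1 (cv (PV Y g) Y) \<xi>)" for X Y
  by (simp add: QA_def fun_eq_iff distrib_left)
 show "Rl \<rho> (NP \<alpha> \<beta> g s p a) (NP \<alpha> \<beta> g s p' a') (QP (ennreal A) g s X Y) (QP (ennreal A) g s X' Y')"
  unfolding NP_def[abs_def] QP_eq using A by (intro Rl_add Rl_cmult Rl_conv \<rho> dp Pg Ps) auto
 show "Rl \<rho> (NA \<alpha> g p a) (NA \<alpha> g p' a') (QA (ennreal A) g X Y) (QA (ennreal A) g X' Y')"
  unfolding NA_def[abs_def] QA_eq using A by (intro Rl_add Rl_cmult Rl_conv Rl_dh \<rho> dp Pg Ps a) auto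
qed

section \<open>Norm bounds for the nonlinear majorants\<close>

lemma PV_bound:
 assumes l: "l \<ge> 1" and K: "K < top"
 shows "\<exists>C<top. \<forall>Y. Borel Y \<longrightarrow> Nsq l Y \<le> K \<longrightarrow> Nsq l (PV Y k) \<le> C"
proof (induction k)
 case 0
 show ?case
 proof (intro exI[of _ "Ka l * (K * K)"] conjI allI impI)
  show "Ka l * (K * K) < top" using K Ka_top by (simp add: ennreal_mult_less_top)
  fix Y assume [measurable]: "Borel Y" and "Nsq l Y \<le> K"
  then have "Ka l * (Nsq l Y * Nsq l (rf Y)) \<le> Ka l * (K * K)"
   by (intro mult_left_mono mult_mono) auto
  then show "Nsq l (PV Y 0) \<le> Ka l * (K * K)"
   using Nsq_cv_alg[OF l, of Y "rf Y"] by simp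
 qed
next
 case (Suc k)
 then obtain C where C: "C < top" "\<And>Y. Borel Y \<Longrightarrow> Nsq l Y \<le> K \<Longrightarrow> Nsq l (PV Y k) \<le> C" by blast
 show ?case
 proof (intro exI[of _ "Ka l * ((Ka l * (K * K)) * C)"] conjI allI impI)
  show "Ka l * ((Ka l * (K * K)) * C) < top" using K C Ka_top by (simp add: ennreal_mult_less_top)
  fix Y assume [measurable]: "Borel Y" and Y: "Nsq l Y \<le> K"
  then have "Ka l * (Nsq l Y * Nsq l (rf Y)) \<le> Ka l * (K * K)"
   by (intro mult_left_mono mult_mono) auto
  then have "Nsq l (cv Y (rf Y)) \<le> Ka l * (K * K)"
   using Nsq_cv_alg[OF l, of Y "rf Y"] by simp
  then have "Ka l * (Nsq l (cv Y (rf Y)) * Nsq l (PV Y k)) \<le> Ka l * ((Ka l * (K * K)) * C)"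
   using C Y by (intro mult_left_mono mult_mono) auto
  then show "Nsq l (PV Y (Suc k)) \<le> Ka l * ((Ka l * (K * K)) * C)"
   using Nsq_cv_alg[OF l, of "cv Y (rf Y)" "PV Y k"] by simp
 qed
qed

text \<open>The 10 is \<open>2 * (2 + 2) + 2\<close>, from two uses of the two-term
  inequality.\<close>

lemma Nsq_add3:
 assumes [measurable]: "Borel U" "Borel V" "Borel W"
  and "Nsq p U \<le> B" "Nsq p V \<le> B" "Nsq p W \<le> B"
 shows "Nsq p (\<lambda>\<xi>. A * (U \<xi> + V \<xi> + W \<xi>)) \<le> A\<^sup>2 * (10 * B)"
proof -
 have "Nsq p (\<lambda>\<xi>. U \<xi> + V \<xi> + W \<xi>) \<le> 2 * Nsq p (U \<oplus> V) + 2 * Nsq p W" by (rule Nsq_add) measurable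
 also have "... \<le> 2 * (2 * Nsq p U + 2 * Nsq p V) + 2 * Nsq p W" by (intro add_right_mono mult_left_mono Nsq_add) auto
 also have "... \<le> 2 * (2 * B + 2 * B) + 2 * B" by (intro add_mono mult_left_mono assms) auto
 also have "... = 10 * B" by (simp flip: distrib_right add: distrib_left mult.assoc[symmetric])
 finally show ?thesis by (subst Nsq_cmult) (auto intro: mult_left_mono)
qed

text \<open>\<open>QP\<close> is controlled in order \<open>l\<close> by the algebra property.
  \<open>QA\<close> loses one order: two of its terms contain a differentiated factor and use the
  module estimate, the third is itself a derivative.\<close>

lemma Q_bound:
 assumes l: "l \<ge> 1" and K: "K < top" and A: "A < top"
 shows "\<exists>C<top. \<forall>X Y. Borel X \<longrightarrow> Borel Y \<longrightarrow> Nsq l X \<le> K \<longrightarrow> Nsq l Y \<le> K \<longrightarrow>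
  Nsq l (QP A g s X Y) \<le> C \<and> Nsq (l - 1) (QA A g X Y) \<le> C"
proof -
 obtain C1 where C1: "C1 < top" "\<And>Y. Borel Y \<Longrightarrow> Nsq l Y \<le> K \<Longrightarrow> Nsq l (PV Y g) \<le> C1"
  using PV_bound[OF l K, of g] by blast
 obtain C2 where C2: "C2 < top" "\<And>Y. Borel Y \<Longrightarrow> Nsq l Y \<le> K \<Longrightarrow> Nsq l (PV Y s) \<le> C2"
  using PV_bound[OF l K, of s] by blast
 define B where "B = Ka l * (K * K) + Ka l * (C1 * K) + C2"
 have B: "B < top" using C1 C2 K Ka_top by (simp add: B_def ennreal_mult_less_top)
 show ?thesis
 proof (intro exI[of _ "A\<^sup>2 * (10 * B)"] conjI allI impI)
  show "A\<^sup>2 * (10 * B) < top" using A B by (simp add: ennreal_mult_less_top power2_eq_square)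
  fix X Y assume [measurable]: "Borel X" "Borel Y" and X: "Nsq l X \<le> K" and Y: "Nsq l Y \<le> K"
  have le: "Ka l * (K * K) \<le> B" "Ka l * (C1 * K) \<le> B" "C2 \<le> B"
   by (auto simp: B_def add_increasing add_increasing2)
  have 1: "Nsq l (cv X X) \<le> B"
   using Nsq_cv_alg[OF l, of X X] mult_left_mono[OF mult_mono[OF X X], of "Ka l"] le by (auto intro: order_trans)
  have Pg: "Nsq l (PV Y g) \<le> C1" and Ps: "Nsq l (PV Y s) \<le> C2" using C1 C2 Y by auto
  have 2: "Nsq l (cv (PV Y g) X) \<le> B" "Nsq l (cv (PV Y g) Y) \<le> B"
   using Nsq_cv_alg[OF l, of "PV Y g" X] mult_left_mono[OF mult_mono[OF Pg X], of "Ka l"]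
    Nsq_cv_alg[OF l, of "PV Y g" Y] mult_left_mono[OF mult_mono[OF Pg Y], of "Ka l"] le by (auto intro: order_trans)
  have 3: "Nsq l (PV Y s) \<le> B" using Ps le by auto
  have 4: "Nsq (l - 1) (cv X (jm 1 Y)) \<le> B" "Nsq (l - 1) (cv Y (jm 1 X)) \<le> B"
   using Nsq_cv_mod[OF l, of X "jm 1 Y"] Nsq_cv_mod[OF l, of Y "jm 1 X"] mult_left_mono[OF mult_mono[OF X Y], of "Ka l"]
    mult_left_mono[OF mult_mono[OF Y X], of "Ka l"] le by (auto simp: Nsq_jm intro: order_trans)
  show "Nsq l (QP A g s X Y) \<le> A\<^sup>2 * (10 * B)"
   unfolding QP_def[abs_def] by (intro Nsq_add3 1 2 3) measurable
  show "Nsq (l - 1) (QA A g X Y) \<le> A\<^sup>2 * (10 * B)"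
   unfolding QA_def[abs_def] using 2 by (intro Nsq_add3 4) (auto simp: Nsq_jm)
 qed
qed

section \<open>Increasing limits of majorants\<close>

definition up :: "nnfun \<Rightarrow> (nat \<Rightarrow> real \<Rightarrow> ennreal) \<Rightarrow> bool" where
 "up V Vs \<longleftrightarrow> (\<forall>n. Borel (Vs n)) \<and> (\<forall>\<xi>. incseq (\<lambda>n. Vs n \<xi>) \<and> V \<xi> = (SUP n. Vs n \<xi>))"

lemma up_measurable: "up V Vs \<Longrightarrow> Borel V"
proof -
 assume *: "up V Vs"
 then have [measurable]: "\<And>n. Borel (Vs n)" by (simp add: up_def)
 have "V = (\<lambda>\<xi>. SUP n. Vs n \<xi>)" using * by (auto simp: up_def)
 then show ?thesis by simp
qed

lemma SUP_mult_incseq_ennreal: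
 fixes f g :: "nat \<Rightarrow> ennreal"
 assumes "incseq f" "incseq g"
 shows "(SUP n. f n * g n) = (SUP n. f n) * (SUP n. g n)"
proof (rule antisym)
 show "(SUP n. f n * g n) \<le> (SUP n. f n) * (SUP n. g n)"
  by (intro SUP_least mult_mono SUP_upper) auto
 have "(SUP n. f n) * (SUP n. g n) = (SUP i. f i * (SUP n. g n))"
  by (rule SUP_mult_right_ennreal)
 also have "... = (SUP i. SUP j. f i * g j)"
  by (intro SUP_cong refl SUP_mult_left_ennreal)
 also have "... \<le> (SUP n. f n * g n)"
 proof (intro SUP_least)
  fix i j
  have "f i * g j \<le> f (max i j) * g (max i j)"
   using assms by (intro mult_mono) (auto simp: incseq_def)
  also have "... \<le> (SUP n. f n * g n)" by (rule SUP_upper) auto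
  finally show "f i * g j \<le> (SUP n. f n * g n)" .
 qed
 finally show "(SUP n. f n) * (SUP n. g n) \<le> (SUP n. f n * g n)" .
qed

lemma up_cv:
 assumes U: "up U Us" and V: "up V Vs"
 shows "up (cv U V) (\<lambda>n. cv (Us n) (Vs n))"
proof -
 have [measurable]: "\<And>n. Borel (Us n)" "\<And>n. Borel (Vs n)"
  using assms by (auto simp: up_def)
 have "cv U V \<xi> = (\<integral>\<^sup>+\<eta>. (SUP n. Us n (\<xi> - \<eta>) * Vs n \<eta>) \<partial>lborel)" for \<xi>
  unfolding cv_def using U V by (intro nn_integral_cong) (simp add: SUP_mult_incseq_ennreal up_def)
 also have "... \<xi> = (SUP n. cv (Us n) (Vs n) \<xi>)" for \<xi>
  unfolding cv_def using U V
  by (intro nn_integral_monotone_convergence_SUP) (auto simp: up_def incseq_def le_fun_def intro!: mult_mono)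
 finally show ?thesis
  using U V by (auto simp: up_def incseq_def intro!: cv_mono)
qed

lemma up_rf: "up U Us \<Longrightarrow> up (rf U) (\<lambda>n. rf (Us n))"
 by (auto simp: up_def rf_def[of U] rf_def[of "Us _"] intro!: rf_measurable)

lemma up_mult:
 assumes "up U Us" "Borel C"
 shows "up (\<lambda>\<xi>. C \<xi> * U \<xi>) (\<lambda>n \<xi>. C \<xi> * Us n \<xi>)"
 using assms by (auto simp: up_def incseq_def SUP_mult_left_ennreal intro!: mult_left_mono borel_measurable_times_ennreal)

lemma up_add:
 assumes "up U Us" "up V Vs"
 shows "up (U \<oplus> V) (\<lambda>n \<xi>. Us n \<xi> + Vs n \<xi>)"
 using assms by (auto simp: up_def ennreal_SUP_add incseq_def intro!: add_mono borel_measurable_add)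

lemma up_const: "Borel C \<Longrightarrow> up C (\<lambda>n. C)"
 by (auto simp: up_def incseq_def)

lemma up_PV: "up Y Ys \<Longrightarrow> up (PV Y k) (\<lambda>n. PV (Ys n) k)"
 by (induction k) (auto intro!: up_cv up_rf)

lemma up_jm: "up Y Ys \<Longrightarrow> up (jm q Y) (\<lambda>n. jm q (Ys n))"
 unfolding jm_def[abs_def] by (intro up_mult) auto

text \<open>Monotone convergence under the convolution integrals. It makes the limit of the majorant
  iteration a fixed point.\<close>

lemma up_Q:
 assumes X: "up X Xs" and Y: "up Y Ys"
 shows "up (QP A g s X Y) (\<lambda>n. QP A g s (Xs n) (Ys n))" "up (QA A g X Y) (\<lambda>n. QA A g (Xs n) (Ys n))"
 unfolding QP_def[abs_def] QA_def[abs_def] by (intro up_mult up_add up_cv up_PV up_jm X Y; simp)+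

lemma up_Nsq:
 assumes "up V Vs" "\<And>n. Nsq p (Vs n) \<le> K"
 shows "Nsq p V \<le> K"
proof -
 have [measurable]: "\<And>n. Borel (Vs n)" using assms by (auto simp: up_def)
 have j: "up (jm p V) (\<lambda>n. jm p (Vs n))" by (rule up_jm[OF assms(1)])
 have "Nsq p V = (\<integral>\<^sup>+\<xi>. (SUP n. (jm p (Vs n) \<xi>)\<^sup>2) \<partial>lborel)"
  unfolding Nsq_def power2_eq_square using j by (intro nn_integral_cong) (simp add: SUP_mult_incseq_ennreal up_def)
 also have "... = (SUP n. Nsq p (Vs n))"
  unfolding Nsq_def using j
  by (intro nn_integral_monotone_convergence_SUP) (auto simp: up_def incseq_def le_fun_def intro!: power_mono)
 also have "... \<le> K" by (intro SUP_least assms)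
 finally show ?thesis .
qed

section \<open>Picard iteration\<close>

text \<open>\<open>duh \<kappa> y F\<close> is Duhamel's formula for \<open>u' = F - \<i> \<kappa> u\<close>, \<open>u 0 = y\<close>.\<close>

definition Ds :: "real \<Rightarrow> cfun \<Rightarrow> real \<Rightarrow> complex" where
 "Ds \<kappa> F t = (LINT s|lborel. indicator {0..t} s *\<^sub>R (exp (\<i> * of_real (\<kappa> * s)) * F s))"

definition duh :: "real \<Rightarrow> complex \<Rightarrow> cfun \<Rightarrow> real \<Rightarrow> complex" where
 "duh \<kappa> y F t = exp (- \<i> * of_real (\<kappa> * t)) * (y + Ds \<kappa> F t)"

abbreviation duhamel where
 "duhamel \<alpha> \<beta> g s \<epsilon> T p0 a0 p a \<xi> \<equiv> \<forall>t\<in>{0..T}. p t \<xi> = duh 0 (p0 \<xi>) (\<lambda>r. NP \<alpha> \<beta> g s (p r) (a r) \<xi>) t \<and>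
   a t \<xi> = duh (\<epsilon> * \<xi>\<^sup>2 / 2) (a0 \<xi>) (\<lambda>r. NA \<alpha> g (p r) (a r) \<xi>) t"

lemma duh_measurable [measurable (raw)]:
 assumes [measurable]: "\<kappa> \<in> borel_measurable M" "y \<in> borel_measurable M" "case_prod F \<in> borel_measurable (M \<Otimes>\<^sub>M borel)" "t \<in> borel_measurable M"
 shows "(\<lambda>x. duh (\<kappa> x) (y x) (F x) (t x)) \<in> borel_measurable M"
proof -
 have "(\<lambda>x. LINT s|lborel. (if 0 \<le> s \<and> s \<le> t x then exp (\<i> * of_real (\<kappa> x * s)) * F x s else 0)) \<in> borel_measurable M"
  by measurable
 also have "(\<lambda>x. LINT s|lborel. (if 0 \<le> s \<and> s \<le> t x then exp (\<i> * of_real (\<kappa> x * s)) * F x s else 0)) = (\<lambda>x. Ds (\<kappa> x) (F x) (t x))"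
  unfolding Ds_def by (intro ext Bochner_Integration.integral_cong) (auto simp: indicator_def)
 finally have [measurable]: "(\<lambda>x. Ds (\<kappa> x) (F x) (t x)) \<in> borel_measurable M" .
 show ?thesis unfolding duh_def by measurable
qed

text \<open>The origin of the gain; \<open>j\<close> stands for \<open>jap \<xi>\<close>. A bound
  \<open>G\<close> of the forcing with weight \<open>exp ((w0 - m * s) * j)\<close> at all earlier
  times \<open>s\<close> leaves the integral of \<open>exp (- (w0 - m * s) * j)\<close> up to time
  \<open>t\<close>, which is at most \<open>exp (- (w0 - m * t) * j) / (m * j)\<close>; the weight
  at time \<open>t\<close> cancels this exponential.\<close>

lemma Ds_nn_bound:
 assumes m: "m > 0" and j: "j > 0" and t: "t \<ge> 0"
  and G: "\<And>s. s \<in> {0..t} \<Longrightarrow> ennreal (exp ((w0 - m * s) * j) * cmod (F s)) \<le> G"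
 shows "ennreal (exp ((w0 - m * t) * j)) * (\<integral>\<^sup>+s. ennreal (cmod (indicator {0..t} s *\<^sub>R (exp (\<i> * of_real (\<kappa> * s)) * F s))) \<partial>lborel)
  \<le> ennreal (1 / (m * j)) * G"
proof -
 let ?e = "\<lambda>s. exp (- (w0 - m * s) * j)"
 have "(\<integral>\<^sup>+s. ennreal (cmod (indicator {0..t} s *\<^sub>R (exp (\<i> * of_real (\<kappa> * s)) * F s))) \<partial>lborel)
  \<le> (\<integral>\<^sup>+s. G * (ennreal (?e s) * indicator {0..t} s) \<partial>lborel)"
 proof (intro nn_integral_mono)
  fix s
  show "ennreal (cmod (indicator {0..t} s *\<^sub>R (exp (\<i> * of_real (\<kappa> * s)) * F s))) \<le> G * (ennreal (?e s) * indicator {0..t} s)"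
  proof (cases "s \<in> {0..t}")
   case True
   have "?e s * (exp ((w0 - m * s) * j) * cmod (F s)) = cmod (F s)"
    by (simp add: mult.assoc[symmetric] exp_add[symmetric] left_diff_distrib)
   then have "ennreal (cmod (F s)) = ennreal (?e s) * ennreal (exp ((w0 - m * s) * j) * cmod (F s))"
    by (simp flip: ennreal_mult)
   also have "... \<le> ennreal (?e s) * G" by (intro mult_left_mono G True) auto
   finally show ?thesis using True by (simp add: norm_mult mult.commute)
  qed simp
 qed
 also have "... = G * (\<integral>\<^sup>+s. ennreal (?e s) * indicator {0..t} s \<partial>lborel)"
  by (rule nn_integral_cmult) measurable
 also have "(\<integral>\<^sup>+s. ennreal (?e s) * indicator {0..t} s \<partial>lborel) = ennreal (?e t / (m * j) - ?e 0 / (m * j))"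
  by (rule nn_integral_FTC_Icc[OF _ _ _ t]) (use m j in \<open>auto intro!: derivative_eq_intros\<close>)
 also have "... \<le> ennreal (?e t / (m * j))"
  using m j by (intro ennreal_leI) simp
 finally have "(\<integral>\<^sup>+s. ennreal (cmod (indicator {0..t} s *\<^sub>R (exp (\<i> * of_real (\<kappa> * s)) * F s))) \<partial>lborel) \<le> G * ennreal (?e t / (m * j))"
  by (simp add: mult_left_mono)
 then have "ennreal (exp ((w0 - m * t) * j)) * (\<integral>\<^sup>+s. ennreal (cmod (indicator {0..t} s *\<^sub>R (exp (\<i> * of_real (\<kappa> * s)) * F s))) \<partial>lborel)
   \<le> ennreal (exp ((w0 - m * t) * j)) * (G * ennreal (?e t / (m * j)))"
  by (intro mult_left_mono) auto
 also have "... = ennreal (exp ((w0 - m * t) * j) * (?e t / (m * j))) * G"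
  using m j by (subst ennreal_mult) (auto simp: mult_ac)
 also have "exp ((w0 - m * t) * j) * (?e t / (m * j)) = 1 / (m * j)"
  by (simp add: exp_add[symmetric] left_diff_distrib)
 finally show ?thesis .
qed

lemma Ds_bound:
 assumes "m > 0" "j > 0" "t \<ge> 0"
  and "\<And>s. s \<in> {0..t} \<Longrightarrow> ennreal (exp ((w0 - m * s) * j) * cmod (F s)) \<le> G"
 shows "ennreal (exp ((w0 - m * t) * j) * cmod (Ds \<kappa> F t)) \<le> ennreal (1 / (m * j)) * G"
proof (cases "integrable lborel (\<lambda>s. indicator {0..t} s *\<^sub>R (exp (\<i> * of_real (\<kappa> * s)) * F s))")
 case True
 then have "ennreal (exp ((w0 - m * t) * j) * cmod (Ds \<kappa> F t)) \<le> ennreal (exp ((w0 - m * t) * j)) * (\<integral>\<^sup>+s. ennreal (cmod (indicator {0..t} s *\<^sub>R (exp (\<i> * of_real (\<kappa> * s)) * F s))) \<partial>lborel)"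
  unfolding Ds_def ennreal_mult[OF exp_ge_zero norm_ge_zero] by (intro mult_left_mono integral_norm_bound_ennreal) auto
 also have "... \<le> ennreal (1 / (m * j)) * G" by (rule Ds_nn_bound[OF assms])
 finally show ?thesis .
qed (simp add: Ds_def not_integrable_integral_eq)

lemma Ds_integrable:
 assumes m: "m > 0" "j > 0" "t \<ge> 0" and [measurable]: "Borel F"
  and G: "\<And>s. s \<in> {0..t} \<Longrightarrow> ennreal (exp ((w0 - m * s) * j) * cmod (F s)) \<le> G" "G < top"
 shows "integrable lborel (\<lambda>s. indicator {0..t} s *\<^sub>R (exp (\<i> * of_real (\<kappa> * s)) * F s))"
proof -
 let ?I = "(\<integral>\<^sup>+s. ennreal (cmod (indicator {0..t} s *\<^sub>R (exp (\<i> * of_real (\<kappa> * s)) * F s))) \<partial>lborel)"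
 have "ennreal (exp ((w0 - m * t) * j)) * ?I \<le> ennreal (1 / (m * j)) * G"
  by (rule Ds_nn_bound[OF m G(1)])
 also have "... < top" using G(2) by (simp add: ennreal_mult_less_top)
 finally have "?I < top" by (auto simp: ennreal_mult_less_top)
 then show ?thesis by (auto simp: integrable_iff_bounded)
qed

text \<open>Duhamel's formula preserves the relation \<open>Rl\<close> at one frequency. The initial
  value is common to both functions and drops out of their difference. Where \<open>G\<close> is
  finite, so is \<open>G'\<close>, and then \<open>G - G'\<close> is a legitimate bound for the
  difference of the forcings.\<close>

lemma duh_Rl:
 assumes m: "m > 0" "j > 0" "t \<ge> 0" and [measurable]: "Borel F" "Borel F'"
  and a: "\<And>s. s \<in> {0..t} \<Longrightarrow> ennreal (exp ((w0 - m * s) * j) * cmod (F' s)) \<le> G'"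
  and b: "\<And>s. s \<in> {0..t} \<Longrightarrow> ennreal (exp ((w0 - m * s) * j) * cmod (F s - F' s)) + G' \<le> G"
 shows "ennreal (exp ((w0 - m * t) * j) * cmod (duh \<kappa> y F' t)) \<le> ennreal (exp (w0 * j) * cmod y) + ennreal (1 / (m * j)) * G'" (is ?A)
  and "ennreal (exp ((w0 - m * t) * j) * cmod (duh \<kappa> y F t - duh \<kappa> y F' t)) + (ennreal (exp (w0 * j) * cmod y) + ennreal (1 / (m * j)) * G')
   \<le> ennreal (exp (w0 * j) * cmod y) + ennreal (1 / (m * j)) * G" (is ?B)
proof -
 have "ennreal (exp ((w0 - m * t) * j) * cmod (duh \<kappa> y F' t)) \<le> ennreal (exp ((w0 - m * t) * j) * cmod y) + ennreal (exp ((w0 - m * t) * j) * cmod (Ds \<kappa> F' t))"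
  using norm_triangle_ineq[of y "Ds \<kappa> F' t"]
  by (simp add: duh_def norm_mult ennreal_leI flip: ennreal_plus distrib_left)
 also have "... \<le> ennreal (exp (w0 * j) * cmod y) + ennreal (1 / (m * j)) * G'"
  using m by (intro add_mono Ds_bound a ennreal_leI mult_right_mono) (auto simp: algebra_simps)
 finally show ?A .
 show ?B
 proof (cases "G = top")
  case True
  then show ?thesis using m by (simp add: ennreal_mult_top)
 next
  case False
  then have "G < top" by (simp add: less_top)
  moreover have "G' \<le> G" using b[of 0] m by (auto intro: order_trans[rotated] simp: add_increasing)
  ultimately have G: "G < top" "G' < top" by auto
  have bF: "ennreal (exp ((w0 - m * s) * j) * cmod (F s)) \<le> G" if "s \<in> {0..t}" for s
  proof -
   have "ennreal (exp ((w0 - m * s) * j) * cmod (F s)) \<le> ennreal (exp ((w0 - m * s) * j) * cmod (F s - F' s)) + ennreal (exp ((w0 - m * s) * j) * cmod (F' s))"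
    using norm_triangle_ineq[of "F s - F' s" "F' s"] by (simp flip: ennreal_plus distrib_left add: ennreal_leI)
   also have "... \<le> G" using a[OF that] b[OF that] by (auto intro: order_trans add_left_mono)
   finally show ?thesis .
  qed
  have i: "integrable lborel (\<lambda>s. indicator {0..t} s *\<^sub>R (exp (\<i> * of_real (\<kappa> * s)) * F s))"
   "integrable lborel (\<lambda>s. indicator {0..t} s *\<^sub>R (exp (\<i> * of_real (\<kappa> * s)) * F' s))"
   by (rule Ds_integrable[OF m _ bF G(1)], simp, simp, rule Ds_integrable[OF m _ a G(2)], simp, simp)
  have "Ds \<kappa> F t - Ds \<kappa> F' t = Ds \<kappa> (\<lambda>s. F s - F' s) t"
   unfolding Ds_def using i by (simp add: right_diff_distrib scaleR_diff_right)
  then have "ennreal (exp ((w0 - m * t) * j) * cmod (duh \<kappa> y F t - duh \<kappa> y F' t)) = ennreal (exp ((w0 - m * t) * j) * cmod (Ds \<kappa> (\<lambda>s. F s - F' s) t))"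
   unfolding duh_def by (simp flip: right_diff_distrib add: norm_mult)
  also have "... \<le> ennreal (1 / (m * j)) * (G - G')"
  proof (intro Ds_bound m)
   fix s assume "s \<in> {0..t}"
   from b[OF this] show "ennreal (exp ((w0 - m * s) * j) * cmod (F s - F' s)) \<le> G - G'"
    using ennreal_minus_mono[OF _ order_refl, of "ennreal (exp ((w0 - m * s) * j) * cmod (F s - F' s)) + G'" G G'] G
    by (simp add: ennreal_add_diff_cancel_right)
  qed
  finally have "ennreal (exp ((w0 - m * t) * j) * cmod (duh \<kappa> y F t - duh \<kappa> y F' t)) + (ennreal (exp (w0 * j) * cmod y) + ennreal (1 / (m * j)) * G')
   \<le> ennreal (1 / (m * j)) * (G - G') + (ennreal (exp (w0 * j) * cmod y) + ennreal (1 / (m * j)) * G')"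
   by (rule add_right_mono)
  also have "... = ennreal (exp (w0 * j) * cmod y) + ennreal (1 / (m * j)) * ((G - G') + G')"
   by (simp only: distrib_left distrib_right ac_simps)
  also have "(G - G') + G' = G" using \<open>G' \<le> G\<close> by (simp add: diff_add_cancel_ennreal)
  finally show ?thesis .
 qed
qed

section \<open>The Picard map and its majorant map\<close>

type_synonym fld = "cpath \<times> cpath"
type_synonym mjr = "nnfun \<times> nnfun"

definition stp :: "real \<Rightarrow> real \<Rightarrow> nat \<Rightarrow> nat \<Rightarrow> real \<Rightarrow> cfun \<Rightarrow> cfun \<Rightarrow> fld \<Rightarrow> fld" where
 "stp \<alpha> \<beta> g s \<epsilon> p0 a0 = (\<lambda>(p, a).
   (\<lambda>t \<xi>. duh 0 (p0 \<xi>) (\<lambda>r. NP \<alpha> \<beta> g s (p r) (a r) \<xi>) t,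
   \<lambda>t \<xi>. duh (\<epsilon> * \<xi>\<^sup>2 / 2) (a0 \<xi>) (\<lambda>r. NA \<alpha> g (p r) (a r) \<xi>) t))"

text \<open>The gain \<open>1 / (m * jap \<xi>)\<close> leaves the factor \<open>jm (-1)\<close>
  only for the amplitude; for the phase it is cancelled by the \<open>jap\<close> of
  \<open>jc\<close>.\<close>

definition maj :: "ennreal \<Rightarrow> nat \<Rightarrow> nat \<Rightarrow> real \<Rightarrow> nnfun \<Rightarrow> nnfun \<Rightarrow> mjr \<Rightarrow> mjr" where
 "maj A g s m X0 Y0 = (\<lambda>(X, Y).
   (\<lambda>\<xi>. X0 \<xi> + ennreal (1 / m) * QP A g s X Y \<xi>,
   \<lambda>\<xi>. Y0 \<xi> + ennreal (1 / m) * jm (-1) (QA A g X Y) \<xi>))"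

text \<open>One pair of majorants serves all times, each time with its own weight.\<close>

definition RR :: "real \<Rightarrow> real \<Rightarrow> real \<Rightarrow> fld \<Rightarrow> fld \<Rightarrow> mjr \<Rightarrow> mjr \<Rightarrow> bool" where
 "RR w0 m T u u' V V' \<longleftrightarrow>
  jmeas (fst u) \<and> jmeas (snd u) \<and>
  jmeas (fst u') \<and> jmeas (snd u') \<and>
  (\<forall>t\<in>{0..T}. Rl (w0 - m * t) (jc (fst u t)) (jc (fst u' t)) (fst V) (fst V') \<and>
   Rl (w0 - m * t) (snd u t) (snd u' t) (snd V) (snd V'))"

lemma stp_measurable:
 assumes [measurable]: "Borel p0" "Borel a0"
  "jmeas p" "jmeas a"
 shows "case_prod (fst (stp \<alpha> \<beta> g s \<epsilon> p0 a0 (p, a))) \<in> borel_measurable (borel \<Otimes>\<^sub>M borel)"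
  and "case_prod (snd (stp \<alpha> \<beta> g s \<epsilon> p0 a0 (p, a))) \<in> borel_measurable (borel \<Otimes>\<^sub>M borel)"
 unfolding stp_def prod.case fst_conv snd_conv by measurable

lemma maj_measurable:
 assumes [measurable]: "Borel X0" "Borel Y0"
  "Borel X" "Borel Y"
 shows "Borel (fst (maj A g s m X0 Y0 (X, Y)))" "Borel (snd (maj A g s m X0 Y0 (X, Y)))"
 unfolding maj_def prod.case fst_conv snd_conv by measurable

lemma section_meas:
 assumes [measurable]: "jmeas p"
 shows "Borel (p t)"
 by measurable

text \<open>Combines \<open>Rl_N\<close> for the nonlinearities at each time with
  \<open>duh_Rl\<close> for the integration in time; \<open>m * T \<le> w0\<close> keeps the weights
  nonnegative.\<close>

lemma RR_step:
 assumes m: "m > 0" "0 \<le> T" "m * T \<le> w0" and [measurable]: "Borel p0" "Borel a0"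
  and A: "A \<ge> 1" "\<bar>\<alpha>\<bar> \<le> A" "\<bar>\<beta>\<bar> \<le> A"
  and R: "RR w0 m T u u' V V'"
 shows "RR w0 m T (stp \<alpha> \<beta> g s \<epsilon> p0 a0 u) (stp \<alpha> \<beta> g s \<epsilon> p0 a0 u')
  (maj (ennreal A) g s m (em w0 (jc p0)) (em w0 a0) V) (maj (ennreal A) g s m (em w0 (jc p0)) (em w0 a0) V')"
proof -
 let ?M = "maj (ennreal A) g s m (em w0 (jc p0)) (em w0 a0)" and ?S = "stp \<alpha> \<beta> g s \<epsilon> p0 a0"
 obtain p a p' a' X Y X' Y' where e: "u = (p, a)" "u' = (p', a')" "V = (X, Y)" "V' = (X', Y')" by (metis surj_pair)
 have [measurable]: "jmeas p" "jmeas a"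
   "jmeas p'" "jmeas a'"
  using R by (auto simp: RR_def e)
 have Rl: "Rl (w0 - m * t) (jc (p t)) (jc (p' t)) X X'" "Rl (w0 - m * t) (a t) (a' t) Y Y'" if "t \<in> {0..T}" for t
  using R that by (auto simp: RR_def e)
 have [measurable]: "Borel X" "Borel X'" "Borel Y" "Borel Y'"
  using Rl[of 0] m by (auto simp: Rl_def)
 have \<rho>: "w0 - m * t \<ge> 0" if "t \<in> {0..T}" for t
 proof -
  have "m * t \<le> m * T" using that m by (intro mult_left_mono) auto
  then show ?thesis using m by linarith
 qed
 have N: "Rl (w0 - m * t) (NP \<alpha> \<beta> g s (p t) (a t)) (NP \<alpha> \<beta> g s (p' t) (a' t)) (QP (ennreal A) g s X Y) (QP (ennreal A) g s X' Y')"
  "Rl (w0 - m * t) (NA \<alpha> g (p t) (a t)) (NA \<alpha> g (p' t) (a' t)) (QA (ennreal A) g X Y) (QA (ennreal A) g X' Y')"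
  if "t \<in> {0..T}" for t
  by (rule Rl_N[OF \<rho>[OF that] Rl[OF that] _ _ A]; simp)+
 have jp: "jap \<xi> powr -1 = 1 / jap \<xi>" for \<xi> by (simp add: powr_minus divide_inverse)
 have sm: "case_prod (fst (?S (p, a))) \<in> borel_measurable (borel \<Otimes>\<^sub>M borel)"
  "case_prod (snd (?S (p, a))) \<in> borel_measurable (borel \<Otimes>\<^sub>M borel)"
  "case_prod (fst (?S (p', a'))) \<in> borel_measurable (borel \<Otimes>\<^sub>M borel)"
  "case_prod (snd (?S (p', a'))) \<in> borel_measurable (borel \<Otimes>\<^sub>M borel)"
  by (rule stp_measurable; measurable)+
 note sec = sm[THEN section_meas]
 have mm: "Borel (fst (?M (X, Y)))"
  "Borel (snd (?M (X, Y)))"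
  "Borel (fst (?M (X', Y')))"
  "Borel (snd (?M (X', Y')))"
  by (rule maj_measurable; measurable)+
 show ?thesis
  unfolding RR_def
 proof (intro conjI ballI)
  fix t assume t: "t \<in> {0..T}"
  have sub: "s \<in> {0..t} \<Longrightarrow> s \<in> {0..T}" for s using t by auto
  have P: "ennreal (exp ((w0 - m * t) * jap \<xi>) * cmod (duh 0 (p0 \<xi>) (\<lambda>r. NP \<alpha> \<beta> g s (p' r) (a' r) \<xi>) t))
    \<le> ennreal (exp (w0 * jap \<xi>) * cmod (p0 \<xi>)) + ennreal (1 / (m * jap \<xi>)) * QP (ennreal A) g s X' Y' \<xi>"
   "ennreal (exp ((w0 - m * t) * jap \<xi>) * cmod (duh 0 (p0 \<xi>) (\<lambda>r. NP \<alpha> \<beta> g s (p r) (a r) \<xi>) t - duh 0 (p0 \<xi>) (\<lambda>r. NP \<alpha> \<beta> g s (p' r) (a' r) \<xi>) t))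
    + (ennreal (exp (w0 * jap \<xi>) * cmod (p0 \<xi>)) + ennreal (1 / (m * jap \<xi>)) * QP (ennreal A) g s X' Y' \<xi>)
    \<le> ennreal (exp (w0 * jap \<xi>) * cmod (p0 \<xi>)) + ennreal (1 / (m * jap \<xi>)) * QP (ennreal A) g s X Y \<xi>" for \<xi>
   using t N(1)[OF sub] by (intro duh_Rl m(1) jap_pos; force simp: Rl_def em_def)+
  have Q: "ennreal (exp ((w0 - m * t) * jap \<xi>) * cmod (duh (\<epsilon> * \<xi>\<^sup>2 / 2) (a0 \<xi>) (\<lambda>r. NA \<alpha> g (p' r) (a' r) \<xi>) t))
    \<le> ennreal (exp (w0 * jap \<xi>) * cmod (a0 \<xi>)) + ennreal (1 / (m * jap \<xi>)) * QA (ennreal A) g X' Y' \<xi>"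
   "ennreal (exp ((w0 - m * t) * jap \<xi>) * cmod (duh (\<epsilon> * \<xi>\<^sup>2 / 2) (a0 \<xi>) (\<lambda>r. NA \<alpha> g (p r) (a r) \<xi>) t - duh (\<epsilon> * \<xi>\<^sup>2 / 2) (a0 \<xi>) (\<lambda>r. NA \<alpha> g (p' r) (a' r) \<xi>) t))
    + (ennreal (exp (w0 * jap \<xi>) * cmod (a0 \<xi>)) + ennreal (1 / (m * jap \<xi>)) * QA (ennreal A) g X' Y' \<xi>)
    \<le> ennreal (exp (w0 * jap \<xi>) * cmod (a0 \<xi>)) + ennreal (1 / (m * jap \<xi>)) * QA (ennreal A) g X Y \<xi>" for \<xi>
   using t N(2)[OF sub] by (intro duh_Rl m(1) jap_pos; force simp: Rl_def em_def)+
  have mj: "ennreal (1 / (m * jap \<xi>)) = ennreal (1 / m) * ennreal (jap \<xi> powr -1)" for \<xi>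
   using m by (simp add: jp flip: ennreal_mult)
  have mj2: "ennreal (jap \<xi>) * ennreal (1 / (m * jap \<xi>)) = ennreal (1 / m)" for \<xi>
   using m by (simp flip: ennreal_mult)
  show "Rl (w0 - m * t) (jc (fst (?S u) t)) (jc (fst (?S u') t))
    (fst (?M V)) (fst (?M V'))"
   unfolding Rl_def
  proof (intro conjI allI)
   fix \<xi>
   have eq: "em w0 (jc p0) \<xi> + ennreal (1 / m) * Z = ennreal (jap \<xi>) * (ennreal (exp (w0 * jap \<xi>) * cmod (p0 \<xi>)) + ennreal (1 / (m * jap \<xi>)) * Z)" for Z
    unfolding em_jc_pt mj2[of \<xi>, symmetric] by (simp only: distrib_left mult.assoc)
   show "em (w0 - m * t) (jc (fst (?S u') t)) \<xi> \<le> fst (?M V') \<xi>"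
    unfolding e maj_def stp_def prod.case fst_conv eq unfolding em_jc_pt by (intro mult_left_mono P(1)) simp
   show "em (w0 - m * t) (jc (fst (?S u) t) \<ominus> jc (fst (?S u') t)) \<xi> +
      fst (?M V') \<xi> \<le> fst (?M V) \<xi>"
    unfolding e maj_def stp_def prod.case fst_conv eq unfolding em_jc_diff distrib_left[symmetric] by (intro mult_left_mono P(2)) simp
  qed (use sec[of t] mm in \<open>simp_all add: e single_measurable\<close>)
  show "Rl (w0 - m * t) (snd (?S u) t) (snd (?S u') t)
    (snd (?M V)) (snd (?M V'))"
   unfolding Rl_def
  proof (intro conjI allI)
   fix \<xi>
   show "em (w0 - m * t) (snd (?S u') t) \<xi> \<le> snd (?M V') \<xi>"
    unfolding e maj_def stp_def prod.case snd_conv em_def jm_def mult.assoc[symmetric] mj[symmetric] by (rule Q(1))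
   show "em (w0 - m * t) (snd (?S u) t \<ominus> snd (?S u') t) \<xi> +
      snd (?M V') \<xi> \<le> snd (?M V) \<xi>"
    unfolding e maj_def stp_def prod.case snd_conv em_def jm_def mult.assoc[symmetric] mj[symmetric] by (rule Q(2))
  qed (use sec[of t] mm in \<open>simp_all add: e single_measurable\<close>)
 qed (simp_all add: e sm)
qed

section \<open>Convergence of the iterates\<close>

lemma Rl_trans:
 assumes "Rl \<rho> u u' U U'" "Rl \<rho> u' u'' U' U''"
 shows "Rl \<rho> u u'' U U''"
proof -
 have "em \<rho> (u \<ominus> u'') \<xi> + U'' \<xi> \<le> U \<xi>" for \<xi>
 proof -
  have "em \<rho> (u \<ominus> u'') \<xi> \<le> em \<rho> (u \<ominus> u') \<xi> + em \<rho> (u' \<ominus> u'') \<xi>"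
   unfolding em_def using norm_triangle_ineq[of "u \<xi> - u' \<xi>" "u' \<xi> - u'' \<xi>"]
   by (simp flip: ennreal_plus distrib_left add: ennreal_leI)
  then have "em \<rho> (u \<ominus> u'') \<xi> + U'' \<xi> \<le> em \<rho> (u \<ominus> u') \<xi> + (em \<rho> (u' \<ominus> u'') \<xi> + U'' \<xi>)"
   by (simp add: add.assoc[symmetric] add_right_mono)
  also have "... \<le> em \<rho> (u \<ominus> u') \<xi> + U' \<xi>" using assms by (intro add_left_mono) (auto simp: Rl_def)
  also have "... \<le> U \<xi>" using assms by (auto simp: Rl_def)
  finally show ?thesis .
 qed
 then show ?thesis using assms by (auto simp: Rl_def)
qed

lemma Rl_le:
 assumes "Rl \<rho> u u' U U'" "\<rho> \<ge> 0"
 shows "ennreal (cmod (u \<xi> - u' \<xi>)) + U' \<xi> \<le> U \<xi>"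
 using assms cmod_le_em[OF assms(2), of "\<lambda>\<xi>. u \<xi> - u' \<xi>" \<xi>] by (auto simp: Rl_def intro: order_trans[OF add_right_mono])

text \<open>The increments of \<open>u n\<close> are at most those of \<open>Us n\<close>, which
  form a convergent telescoping series because \<open>Us n\<close> increases to a finite
  limit.\<close>

lemma Rl_convergent:
 assumes R: "\<And>n. Rl \<rho> (u (Suc n)) (u n) (Us (Suc n)) (Us n)" and up: "up U Us" and \<rho>: "\<rho> \<ge> 0" and fin: "U \<xi> < top"
 shows "convergent (\<lambda>n. u n \<xi>)"
proof -
 have le: "Us n \<xi> \<le> U \<xi>" for n using up by (auto simp: up_def intro: SUP_upper)
 define x where "x n = enn2real (Us n \<xi>)" for n
 have x: "Us n \<xi> = ennreal (x n)" "x n \<ge> 0" for n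
  using le[of n] fin by (auto simp: x_def)
 have xU: "x n \<le> enn2real (U \<xi>)" for n
  using le[of n] fin by (simp add: x_def enn2real_mono)
 have d: "cmod (u (Suc n) \<xi> - u n \<xi>) \<le> x (Suc n) - x n" for n
  using Rl_le[OF R[of n] \<rho>, of \<xi>] x(2)[of n] x(2)[of "Suc n"] unfolding x(1) by (simp flip: ennreal_plus)
 have inc: "incseq x"
 proof (intro incseq_SucI)
  fix n show "x n \<le> x (Suc n)" using d[of n] norm_ge_zero[of "u (Suc n) \<xi> - u n \<xi>"] by linarith
 qed
 obtain c where "x \<longlonglongrightarrow> c" using incseq_convergent[OF inc] xU by blast
 then have sx: "summable (\<lambda>n. x (Suc n) - x n)" by (rule telescope_summable)
 have "summable (\<lambda>n. u (Suc n) \<xi> - u n \<xi>)"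
  by (rule summable_comparison_test'[OF sx, of 0]) (rule d)
 then obtain L where "(\<lambda>n. \<Sum>k<n. u (Suc k) \<xi> - u k \<xi>) \<longlonglongrightarrow> L" by (auto simp: summable_def sums_def)
 then have "(\<lambda>n. u n \<xi> - u 0 \<xi>) \<longlonglongrightarrow> L"
  by (simp only: sum_lessThan_telescope[of "\<lambda>k. u k \<xi>"])
 then have "(\<lambda>n. (u n \<xi> - u 0 \<xi>) + u 0 \<xi>) \<longlonglongrightarrow> L + u 0 \<xi>" by (intro tendsto_intros)
 then show ?thesis by (auto simp: convergent_def)
qed

lemma Rl_chain:
 assumes "\<And>n. Rl \<rho> (u (Suc n)) (u n) (Us (Suc n)) (Us n)"
 shows "Rl \<rho> (u (Suc k + n)) (u k) (Us (Suc k + n)) (Us k)"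
proof (induction n)
 case 0
 show ?case using assms[of k] by simp
next
 case (Suc n)
 show ?case using Rl_trans[OF assms[of "Suc k + n"] Suc] by simp
qed

lemma Rl_limit:
 assumes R: "\<And>n. Rl \<rho> (u (Suc n)) (u n) (Us (Suc n)) (Us n)" and up: "up U Us"
  and [measurable]: "Borel v" and lim: "\<And>\<xi>. U \<xi> < top \<Longrightarrow> (\<lambda>n. u n \<xi>) \<longlonglongrightarrow> v \<xi>"
 shows "Rl \<rho> v (u k) U (Us k)"
proof -
 have "em \<rho> (v \<ominus> u k) \<xi> + Us k \<xi> \<le> U \<xi>" for \<xi>
 proof (cases "U \<xi> = top")
  case False
  then have lim': "(\<lambda>n. u (Suc k + n) \<xi>) \<longlonglongrightarrow> v \<xi>"
   using LIMSEQ_ignore_initial_segment[OF lim[of \<xi>], of "Suc k"] by (simp add: less_top add.commute)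
  have "(\<lambda>n. em \<rho> (u (Suc k + n) \<ominus> u k) \<xi> + Us k \<xi>) \<longlonglongrightarrow> em \<rho> (v \<ominus> u k) \<xi> + Us k \<xi>"
   unfolding em_def by (intro tendsto_intros lim')
  moreover have "em \<rho> (u (Suc k + n) \<ominus> u k) \<xi> + Us k \<xi> \<le> U \<xi>" for n
  proof -
   have "em \<rho> (u (Suc k + n) \<ominus> u k) \<xi> + Us k \<xi> \<le> Us (Suc k + n) \<xi>"
    using Rl_chain[of \<rho> u Us k n, OF R] by (simp add: Rl_def)
   also have "... \<le> U \<xi>" using up by (auto simp: up_def intro: SUP_upper)
   finally show ?thesis .
  qed
  ultimately show ?thesis by (intro tendsto_upperbound) (auto intro!: always_eventually)
 qed simp
 then show ?thesis using R[of k] up_measurable[OF up] by (auto simp: Rl_def)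
qed

text \<open>A function related to all iterates with the final majorant \<open>U\<close> differs from
  \<open>u n\<close> by at most \<open>U - Us n\<close>, which tends to zero. In the fixed point
  argument this takes the place of continuity of the Picard map.\<close>

lemma Rl_limit_unique:
 assumes R: "\<And>n. Rl \<rho> v (u n) U (Us n)" and R': "\<And>n. Rl \<rho> v' (u n) U (Us n)"
  and up: "up U Us" and \<rho>: "\<rho> \<ge> 0" and fin: "U \<xi> < top"
 shows "v \<xi> = v' \<xi>"
proof -
 have le: "Us n \<xi> \<le> U \<xi>" for n using up by (auto simp: up_def intro: SUP_upper)
 have "(\<lambda>n. Us n \<xi>) \<longlonglongrightarrow> U \<xi>" using up LIMSEQ_SUP[of "\<lambda>n. Us n \<xi>"] by (simp add: up_def)
 then have t: "(\<lambda>n. enn2real (Us n \<xi>)) \<longlonglongrightarrow> enn2real (U \<xi>)"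
  using fin by (intro tendsto_intros) auto
 have d: "cmod (w \<xi> - u n \<xi>) \<le> enn2real (U \<xi>) - enn2real (Us n \<xi>)" if "\<And>n. Rl \<rho> w (u n) U (Us n)" for w n
 proof -
  obtain x y where xy: "U \<xi> = ennreal x" "Us n \<xi> = ennreal y" "x \<ge> 0" "y \<ge> 0"
   using le[of n] fin by (metis ennreal_cases infinity_ennreal_def le_less_trans less_irrefl)
  show ?thesis using Rl_le[OF that[of n] \<rho>, of \<xi>] xy by (simp flip: ennreal_plus)
 qed
 have "cmod (v \<xi> - v' \<xi>) \<le> 2 * (enn2real (U \<xi>) - enn2real (Us n \<xi>))" for n
  using d[OF R, of n] d[OF R', of n] norm_triangle_ineq4[of "v \<xi> - u n \<xi>" "v' \<xi> - u n \<xi>"] by simp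
 moreover have "(\<lambda>n. 2 * (enn2real (U \<xi>) - enn2real (Us n \<xi>))) \<longlonglongrightarrow> 2 * (enn2real (U \<xi>) - enn2real (U \<xi>))"
  by (intro tendsto_intros t)
 ultimately have "cmod (v \<xi> - v' \<xi>) \<le> 2 * (enn2real (U \<xi>) - enn2real (U \<xi>))"
  by (intro tendsto_lowerbound) (auto intro!: always_eventually)
 then show ?thesis by simp
qed

lemma Rl_mono: "Rl \<rho> u u' U U' \<Longrightarrow> U' \<xi> \<le> U \<xi>"
 by (auto simp: Rl_def intro: order_trans[rotated] simp: add_increasing)

text \<open>The two-term inequality doubles the bound of the data, and the condition on
  \<open>m\<close> limits the nonlinear contribution to 2. This fixes the radius
  \<open>2 * K + 2\<close> of the ball that the iteration does not leave.\<close>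

lemma maj_bound:
 assumes m: "m > 0" and mC: "(ennreal (1 / m))\<^sup>2 * C \<le> 1"
  and [measurable]: "Borel X0" "Borel Y0" "Borel X" "Borel Y"
  and "Nsq l X0 \<le> K" "Nsq l Y0 \<le> K" "Nsq l (QP A g s X Y) \<le> C" "Nsq (l - 1) (QA A g X Y) \<le> C"
 shows "Nsq l (fst (maj A g s m X0 Y0 (X, Y))) \<le> 2 * K + 2" "Nsq l (snd (maj A g s m X0 Y0 (X, Y))) \<le> 2 * K + 2"
proof -
 have b: "(ennreal (1 / m))\<^sup>2 * D \<le> 1" if "D \<le> C" for D
  using mC mult_left_mono[OF that, of "(ennreal (1 / m))\<^sup>2"] by auto
 have "Nsq l (\<lambda>\<xi>. X0 \<xi> + ennreal (1 / m) * QP A g s X Y \<xi>) \<le> 2 * Nsq l X0 + 2 * ((ennreal (1 / m))\<^sup>2 * Nsq l (QP A g s X Y))"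
  by (subst Nsq_cmult[symmetric], simp) (rule Nsq_add; measurable)
 also have "... \<le> 2 * K + 2 * 1" by (intro add_mono mult_left_mono b assms) auto
 finally show "Nsq l (fst (maj A g s m X0 Y0 (X, Y))) \<le> 2 * K + 2" by (simp add: maj_def)
 have "Nsq l (\<lambda>\<xi>. Y0 \<xi> + ennreal (1 / m) * jm (-1) (QA A g X Y) \<xi>) \<le> 2 * Nsq l Y0 + 2 * ((ennreal (1 / m))\<^sup>2 * Nsq l (jm (-1) (QA A g X Y)))"
  by (subst Nsq_cmult[symmetric], simp) (rule Nsq_add; measurable)
 also have "Nsq l (jm (-1) (QA A g X Y)) = Nsq (l - 1) (QA A g X Y)" by (simp add: Nsq_jm)
 also have "2 * Nsq l Y0 + 2 * ((ennreal (1 / m))\<^sup>2 * Nsq (l - 1) (QA A g X Y)) \<le> 2 * K + 2 * 1"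
  by (intro add_mono mult_left_mono b assms) auto
 finally show "Nsq l (snd (maj A g s m X0 Y0 (X, Y))) \<le> 2 * K + 2" by (simp add: maj_def)
qed

section \<open>Conjugation symmetry, that is, real phases\<close>

lemma cj_cj [simp]: "cj (cj u) = u" by (simp add: cj_def fun_eq_iff)

lemma conv_commute: "conv u v = conv v u"
proof
 fix \<xi>
 have "(LINT \<eta>|lborel. u (\<xi> - \<eta>) * v \<eta>) = (LINT \<eta>|lborel. v (\<xi> - \<eta>) * u \<eta>)"
  by (subst lborel_integral_real_affine[of "-1" _ \<xi>]) (simp_all add: mult.commute)
 then show "conv u v \<xi> = conv v u \<xi>" by (simp add: conv_def)
qed

lemma cj_conv: "cj (conv u v) = conv (cj u) (cj v)"
proof
 fix \<xi>
 have "cnj (LINT \<eta>|lborel. u (- \<xi> - \<eta>) * v \<eta>) = (LINT \<eta>|lborel. cnj (u (- \<xi> - \<eta>) * v \<eta>))"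
  by (simp only: Bochner_Integration.integral_cnj)
 also have "... = (LINT \<eta>|lborel. cj u (\<xi> - \<eta>) * cj v \<eta>)"
  by (subst lborel_integral_real_affine[of "-1" _ 0]) (simp_all add: cj_def algebra_simps)
 finally show "cj (conv u v) \<xi> = conv (cj u) (cj v) \<xi>"
  by (simp add: cj_def[of "conv u v"] conv_def)
qed

lemma cj_dh: "cj (dh u) = dh (cj u)"
 by (auto simp: cj_def dh_def)

lemma cj_PC: "cj (PC a k) = PC a k"
proof (induction k)
 case (Suc k)
 have "cj (conv a (cj a)) = conv a (cj a)" using conv_commute[of "cj a" a] by (simp add: cj_conv)
 then show ?case using Suc by (simp add: cj_conv)
qed (use conv_commute[of "cj a" a for a] in \<open>simp add: cj_conv\<close>)

lemma cj_NP:
 assumes "cj p = p"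
 shows "cj (NP \<alpha> \<beta> g s p a) = NP \<alpha> \<beta> g s p a"
proof -
 have "cj (conv (dh p) (dh p)) = conv (dh p) (dh p)" "cj (conv (PC a g) (dh p)) = conv (PC a g) (dh p)" "cj (PC a s) = PC a s"
  using assms by (simp_all add: cj_conv cj_dh cj_PC)
 then have "cnj (conv (dh p) (dh p) (- \<xi>)) = conv (dh p) (dh p) \<xi>" "cnj (conv (PC a g) (dh p) (- \<xi>)) = conv (PC a g) (dh p) \<xi>"
  "cnj (PC a s (- \<xi>)) = PC a s \<xi>" for \<xi>
  unfolding cj_def fun_eq_iff by blast+
 then show ?thesis by (simp add: cj_def NP_def fun_eq_iff)
qed

lemma duh_0_cnj: "cnj (duh 0 y F t) = duh 0 (cnj y) (\<lambda>s. cnj (F s)) t"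
proof -
 have "cnj (LINT s|lborel. indicator {0..t} s *\<^sub>R F s) = (LINT s|lborel. cnj (indicator {0..t} s *\<^sub>R F s))"
  by (simp only: Bochner_Integration.integral_cnj)
 then show ?thesis by (simp add: duh_def Ds_def)
qed

lemma AE_finite_of_Nsq:
 assumes [measurable]: "Borel Z" and Z: "Nsq l Z < top"
 shows "AE \<xi> in lborel. Z \<xi> < top"
proof -
 have "AE \<xi> in lborel. (jm l Z \<xi>)\<^sup>2 \<noteq> \<infinity>"
  using Z by (intro nn_integral_PInf_AE) (auto simp: Nsq_def)
 then show ?thesis
 proof eventually_elim
  case (elim \<xi>)
  show ?case
  proof (rule ccontr)
   assume "\<not> Z \<xi> < top"
   then have "Z \<xi> = top" by (simp add: not_less top_unique)
   then show False using elim by (simp add: jm_def power2_eq_square ennreal_mult_top)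
  qed
 qed
qed

lemma SUP_Suc:
 fixes f :: "nat \<Rightarrow> ennreal"
 assumes "incseq f"
 shows "(SUP n. f (Suc n)) = (SUP n. f n)"
 using LIMSEQ_unique[OF LIMSEQ_Suc[OF LIMSEQ_SUP[OF assms]] LIMSEQ_SUP[of "\<lambda>n. f (Suc n)"]] assms by (auto simp: incseq_def)

text \<open>Weight, time, data and \<open>\<epsilon>\<close> are quantified inside, so that a
  threshold for \<open>m\<close> depends on the data through \<open>K\<close> only. The majorants
  belong to the conclusion because all later estimates start from them.\<close>

definition picard_solvable :: "real \<Rightarrow> ennreal \<Rightarrow> real \<Rightarrow> real \<Rightarrow> nat \<Rightarrow> nat \<Rightarrow> real \<Rightarrow> bool" where
 "picard_solvable l K \<alpha> \<beta> g s m \<longleftrightarrow> (\<forall>w0 T \<epsilon> p0 a0. 0 \<le> T \<longrightarrow> m * T \<le> w0 \<longrightarrow>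
  Borel p0 \<longrightarrow> Borel a0 \<longrightarrow>
  Nsq l (em w0 (jc p0)) \<le> K \<longrightarrow> Nsq l (em w0 a0) \<le> K \<longrightarrow>
  (\<exists>p a X Y. jmeas p \<and> jmeas a \<and>
   Borel X \<and> Borel Y \<and> Nsq l X \<le> 2 * K + 2 \<and> Nsq l Y \<le> 2 * K + 2 \<and>
   (\<forall>t\<in>{0..T}. \<forall>\<xi>. em (w0 - m * t) (jc (p t)) \<xi> \<le> X \<xi> \<and> em (w0 - m * t) (a t) \<xi> \<le> Y \<xi>) \<and>
   (AE \<xi> in lborel. duhamel \<alpha> \<beta> g s \<epsilon> T p0 a0 p a \<xi>) \<and>
   (cj p0 = p0 \<longrightarrow> (\<forall>t\<in>{0..T}. cj (p t) \<doteq> p t))))"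

lemmas picard_solvableD = picard_solvable_def[THEN iffD1, rule_format]

text \<open>The iterated majorants increase and stay in a ball, so their limit \<open>(X, Y)\<close>
  is finite almost everywhere and a fixed point of \<open>maj\<close>. Where it is finite, the
  iterated fields converge. The image of their limit under the Picard map bears the same relation to
  the shifted iterates as the limit itself, hence equals it.\<close>

theorem picard_exists:
 assumes l: "l \<ge> 1" and K: "K < top" and A: "A \<ge> 1" "\<bar>\<alpha>\<bar> \<le> A" "\<bar>\<beta>\<bar> \<le> A"
 shows "\<exists>m0>0. \<forall>m\<ge>m0. picard_solvable l K \<alpha> \<beta> g s m"
proof -
 have K': "2 * K + 2 < top" using K by (simp add: ennreal_mult_less_top)
 obtain C where C: "C < top" and CQ: "\<And>X Y. Borel X \<Longrightarrow> Borel Y \<Longrightarrow> Nsq l X \<le> 2 * K + 2 \<Longrightarrow> Nsq l Y \<le> 2 * K + 2 \<Longrightarrow>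
   Nsq l (QP (ennreal A) g s X Y) \<le> C \<and> Nsq (l - 1) (QA (ennreal A) g X Y) \<le> C"
  using Q_bound[OF l K', of "ennreal A" g s] by (auto simp: less_top)
 \<comment> \<open>\<open>m \<ge> sqrt C\<close> turns the bound \<open>C\<close> of the
   nonlinearity into \<open>C / m^2 \<le> 1\<close>; the summand 1 keeps \<open>m0\<close>
   positive.\<close>
 define m0 where "m0 = sqrt (enn2real C) + 1"
 have m0: "m0 > 0" unfolding m0_def by (intro add_nonneg_pos) auto
 show ?thesis
 proof (rule exI[of _ m0], unfold picard_solvable_def, intro conjI m0 allI impI)
  fix m w0 T \<epsilon> :: real and p0 a0 :: cfun
  assume mm0: "m \<ge> m0" and T: "0 \<le> T" "m * T \<le> w0"
   and [measurable]: "Borel p0" "Borel a0"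
   and N0: "Nsq l (em w0 (jc p0)) \<le> K" "Nsq l (em w0 a0) \<le> K"
  have m: "m > 0" using m0 mm0 by simp
  have mC: "(ennreal (1 / m))\<^sup>2 * C \<le> 1"
  proof -
   have "sqrt (enn2real C) \<le> m" using mm0 by (simp add: m0_def)
   then have "enn2real C \<le> m\<^sup>2" by (metis enn2real_nonneg real_sqrt_le_iff real_sqrt_unique abs_of_pos m real_sqrt_abs)
   then have "(1 / m)\<^sup>2 * enn2real C \<le> 1" using m by (simp add: power_divide)
   then have "ennreal ((1 / m)\<^sup>2 * enn2real C) \<le> 1" by simp
   then show ?thesis using C m by (simp add: ennreal_mult ennreal_power less_top)
  qed
  let ?S = "stp \<alpha> \<beta> g s \<epsilon> p0 a0" and ?M = "maj (ennreal A) g s m (em w0 (jc p0)) (em w0 a0)"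
  define u where "u n = (?S ^^ n) (\<lambda>_ _. 0, \<lambda>_ _. 0)" for n
  define V where "V n = (?M ^^ n) (\<lambda>_. 0, \<lambda>_. 0)" for n
  have uS: "u (Suc n) = ?S (u n)" and VS: "V (Suc n) = ?M (V n)" for n by (simp_all add: u_def V_def)
  have \<rho>: "w0 - m * t \<ge> 0" if "t \<in> {0..T}" for t
  proof -
   have "m * t \<le> m * T" using that m by (intro mult_left_mono) auto
   then show ?thesis using T by linarith
  qed
  have R0: "RR w0 m T (u 0) (u 0) (V 0) (V 0)"
   by (simp add: RR_def u_def V_def Rl_def em_def jc_def)
  have step: "RR w0 m T (?S v) (?S v') (?M W) (?M W')" if "RR w0 m T v v' W W'" for v v' W W'
   by (rule RR_step[OF m T(1) T(2) _ _ A that]) measurable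
  \<comment> \<open>As \<open>u 0\<close> and \<open>V 0\<close> vanish, the relation between the
    first two iterates only says that \<open>u 1\<close> is dominated by \<open>V 1\<close>; this is
    read off from the image of the trivial relation \<open>R0\<close>.\<close>
  have R1: "RR w0 m T (u (Suc 0)) (u 0) (V (Suc 0)) (V 0)"
   using step[OF R0] R0 Rl_dominated unfolding uS[symmetric] VS[symmetric]
   unfolding RR_def Rl_def by (auto simp: u_def V_def jc_def em_def)
  have RRn: "RR w0 m T (u (Suc n)) (u n) (V (Suc n)) (V n)" for n
  proof (induction n)
   case (Suc n)
   show ?case using step[OF Suc] by (simp only: uS VS)
  qed (rule R1)
  have Rp: "Rl (w0 - m * t) (jc (fst (u (Suc n)) t)) (jc (fst (u n) t)) (fst (V (Suc n))) (fst (V n))"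
   and Ra: "Rl (w0 - m * t) (snd (u (Suc n)) t) (snd (u n) t) (snd (V (Suc n))) (snd (V n))" if "t \<in> {0..T}" for t n
   using RRn[of n] that by (auto simp: RR_def)
  have um: "jmeas (fst (u n))" "jmeas (snd (u n))" for n
   using RRn[of n] by (auto simp: RR_def)
  note [measurable] = um
  have Vm: "Borel (fst (V n))" "Borel (snd (V n))" for n
   using Rp[of 0 n] Ra[of 0 n] T by (auto simp: Rl_def)
  define X where "X \<xi> = (SUP n. fst (V n) \<xi>)" for \<xi>
  define Y where "Y \<xi> = (SUP n. snd (V n) \<xi>)" for \<xi>
  have upX: "up X (\<lambda>n. fst (V n))" and upY: "up Y (\<lambda>n. snd (V n))"
   using Rl_mono[OF Rp[of 0]] Rl_mono[OF Ra[of 0]] Vm T by (auto simp: up_def X_def Y_def intro!: incseq_SucI)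
  note [measurable] = up_measurable[OF upX] up_measurable[OF upY]
  have NV: "Nsq l (fst (V n)) \<le> 2 * K + 2 \<and> Nsq l (snd (V n)) \<le> 2 * K + 2" for n
  proof (induction n)
   case 0
   show ?case by (simp add: V_def)
  next
   case (Suc n)
   have "V (Suc n) = ?M (fst (V n), snd (V n))" by (simp add: VS)
   moreover have "Nsq l (QP (ennreal A) g s (fst (V n)) (snd (V n))) \<le> C" "Nsq (l - 1) (QA (ennreal A) g (fst (V n)) (snd (V n))) \<le> C"
    using CQ[OF Vm] Suc by auto
   ultimately show ?case
    using maj_bound[OF m mC _ _ Vm[of n] N0] by simp
  qed
  have NX: "Nsq l X \<le> 2 * K + 2" "Nsq l Y \<le> 2 * K + 2"
   using up_Nsq[OF upX] up_Nsq[OF upY] NV by auto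
  \<comment> \<open>Where a majorant is infinite, \<open>lim\<close> may return anything; the bounds
    hold trivially there, and these frequencies form a null set.\<close>
  define p where "p t \<xi> = lim (\<lambda>n. fst (u n) t \<xi>)" for t \<xi>
  define a where "a t \<xi> = lim (\<lambda>n. snd (u n) t \<xi>)" for t \<xi>
  have pm[measurable]: "jmeas p" "jmeas a"
   unfolding p_def a_def case_prod_unfold by measurable
  have limp: "(\<lambda>n. fst (u n) t \<xi>) \<longlonglongrightarrow> p t \<xi>" if t: "t \<in> {0..T}" and X: "X \<xi> < top" for t \<xi>
  proof -
   have "convergent (\<lambda>n. jc (fst (u n) t) \<xi>)"
    by (rule Rl_convergent[where u="\<lambda>n. jc (fst (u n) t)", OF Rp[OF t] upX \<rho>[OF t] X])
   then have "convergent (\<lambda>n. jc (fst (u n) t) \<xi> * of_real (1 / jap \<xi>))"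
    by (intro convergent_mult convergent_const)
   then have "convergent (\<lambda>n. fst (u n) t \<xi>)" by (simp add: jc_def)
   then show ?thesis by (simp add: p_def convergent_LIMSEQ_iff)
  qed
  have lima: "(\<lambda>n. snd (u n) t \<xi>) \<longlonglongrightarrow> a t \<xi>" if t: "t \<in> {0..T}" and X: "Y \<xi> < top" for t \<xi>
   using Rl_convergent[where u="\<lambda>n. snd (u n) t", OF Ra[OF t] upY \<rho>[OF t] X] by (simp add: a_def convergent_LIMSEQ_iff)
  have Lp: "Rl (w0 - m * t) (jc (p t)) (jc (fst (u n) t)) X (fst (V n))" if t: "t \<in> {0..T}" for t n
   by (rule Rl_limit[where u="\<lambda>n. jc (fst (u n) t)", OF Rp[OF t] upX]) (auto simp: jc_def intro!: tendsto_intros limp t)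
  have La: "Rl (w0 - m * t) (a t) (snd (u n) t) Y (snd (V n))" if t: "t \<in> {0..T}" for t n
   by (rule Rl_limit[where u="\<lambda>n. snd (u n) t", OF Ra[OF t] upY]) (auto intro!: lima t)
  have RL: "RR w0 m T (p, a) (u n) (X, Y) (V n)" for n
   using Lp La um pm by (simp add: RR_def)
  define P where "P = fst (?S (p, a))"
  define B where "B = snd (?S (p, a))"
  \<comment> \<open>By \<open>up_Q\<close> the images \<open>maj (V n)\<close> increase to the image
    of the limit; they are the shifted sequence, which has the same supremum.\<close>
  have MX: "?M (X, Y) = (X, Y)"
  proof -
   have 1: "up (fst (?M (X, Y))) (\<lambda>n. fst (?M (fst (V n), snd (V n))))"
    unfolding maj_def prod.case fst_conv by (intro up_add up_const up_mult up_Q upX upY) measurable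
   have 2: "up (snd (?M (X, Y))) (\<lambda>n. snd (?M (fst (V n), snd (V n))))"
    unfolding maj_def prod.case snd_conv by (intro up_add up_const up_mult up_jm up_Q upX upY) measurable
   have "fst (?M (X, Y)) \<xi> = X \<xi>" "snd (?M (X, Y)) \<xi> = Y \<xi>" for \<xi>
    using 1 2 SUP_Suc[of "\<lambda>n. fst (V n) \<xi>"] SUP_Suc[of "\<lambda>n. snd (V n) \<xi>"] upX upY
    by (simp_all add: up_def VS[symmetric])
   then show ?thesis by (auto simp: prod_eq_iff)
  qed
  have RS: "RR w0 m T (P, B) (u (Suc n)) (X, Y) (V (Suc n))" for n
   using step[OF RL[of n]] MX by (simp add: P_def B_def uS VS)
  have upX': "up X (\<lambda>n. fst (V (Suc n)))" and upY': "up Y (\<lambda>n. snd (V (Suc n)))"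
  proof -
   have "(SUP n. fst (V (Suc n)) \<xi>) = X \<xi>" "(SUP n. snd (V (Suc n)) \<xi>) = Y \<xi>" for \<xi>
    using SUP_Suc[of "\<lambda>n. fst (V n) \<xi>"] SUP_Suc[of "\<lambda>n. snd (V n) \<xi>"] upX upY by (simp_all add: up_def)
   then show "up X (\<lambda>n. fst (V (Suc n)))" "up Y (\<lambda>n. snd (V (Suc n)))"
    using upX upY by (simp_all add: up_def incseq_def)
  qed
  have fp: "P t \<xi> = p t \<xi>" if t: "t \<in> {0..T}" and X: "X \<xi> < top" for t \<xi>
  proof -
   have "jc (P t) \<xi> = jc (p t) \<xi>"
    by (rule Rl_limit_unique[where u="\<lambda>n. jc (fst (u (Suc n)) t)", OF _ Lp[OF t] upX' \<rho>[OF t] X]) (use RS t in \<open>simp add: RR_def\<close>)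
   then show ?thesis by (simp add: jc_def)
  qed
  have fa: "B t \<xi> = a t \<xi>" if t: "t \<in> {0..T}" and X: "Y \<xi> < top" for t \<xi>
   by (rule Rl_limit_unique[where u="\<lambda>n. snd (u (Suc n)) t", OF _ La[OF t] upY' \<rho>[OF t] X]) (use RS t in \<open>simp add: RR_def\<close>)
  have fX: "AE \<xi> in lborel. X \<xi> < top" and fY: "AE \<xi> in lborel. Y \<xi> < top"
   using NX K' by (auto intro!: AE_finite_of_Nsq elim: le_less_trans)
  have eqs: "AE \<xi> in lborel. duhamel \<alpha> \<beta> g s \<epsilon> T p0 a0 p a \<xi>"
   using fX fY
  proof eventually_elim
   case (elim \<xi>)
   show ?case using fp[OF _ elim(1)] fa[OF _ elim(2)] by (auto simp: P_def B_def stp_def)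
  qed
  have dom: "em (w0 - m * t) (jc (p t)) \<xi> \<le> X \<xi>" "em (w0 - m * t) (a t) \<xi> \<le> Y \<xi>" if "t \<in> {0..T}" for t \<xi>
   using Rl_dominated[OF Lp[OF that]] Rl_dominated[OF La[OF that]] by auto
  have real: "\<forall>t\<in>{0..T}. cj (p t) \<doteq> p t" if c: "cj p0 = p0"
  proof
   fix t assume t: "t \<in> {0..T}"
   \<comment> \<open>The iterates are symmetric at every frequency. The limit inherits this only
     where the majorant is finite both at \<open>\<xi>\<close> and at
     \<open>- \<xi>\<close>.\<close>
   have cn: "cj (fst (u n) t) = fst (u n) t" for n t
   proof (induction n arbitrary: t)
    case 0
    show ?case by (simp add: u_def cj_def)
   next
    case (Suc n)
    have "cnj (NP \<alpha> \<beta> g s (fst (u n) r) (snd (u n) r) (- \<xi>)) = NP \<alpha> \<beta> g s (fst (u n) r) (snd (u n) r) \<xi>" for r \<xi>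
     using cj_NP[OF Suc, of \<alpha> \<beta> g s r "snd (u n) r"] unfolding cj_def fun_eq_iff by blast
    moreover have "cnj (p0 (- \<xi>)) = p0 \<xi>" for \<xi> using c unfolding cj_def fun_eq_iff by blast
    ultimately show ?case
     by (simp add: uS stp_def case_prod_unfold cj_def duh_0_cnj)
   qed
   show "cj (p t) \<doteq> p t"
    using fX AE_reflect[OF fX]
   proof eventually_elim
    case (elim \<xi>)
    have "(\<lambda>n. cnj (fst (u n) t (- \<xi>))) \<longlonglongrightarrow> cnj (p t (- \<xi>))"
     by (intro tendsto_intros limp t elim)
    moreover have "cnj (fst (u n) t (- \<xi>)) = fst (u n) t \<xi>" for n
     using cn[of n t] unfolding cj_def fun_eq_iff by blast
    ultimately have "(\<lambda>n. fst (u n) t \<xi>) \<longlonglongrightarrow> cnj (p t (- \<xi>))" by simp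
    then show ?case using limp[OF t elim(1)] LIMSEQ_unique by (auto simp: cj_def)
   qed
  qed
  show "\<exists>p a X Y. jmeas p \<and> jmeas a \<and>
   Borel X \<and> Borel Y \<and> Nsq l X \<le> 2 * K + 2 \<and> Nsq l Y \<le> 2 * K + 2 \<and>
   (\<forall>t\<in>{0..T}. \<forall>\<xi>. em (w0 - m * t) (jc (p t)) \<xi> \<le> X \<xi> \<and> em (w0 - m * t) (a t) \<xi> \<le> Y \<xi>) \<and>
   (AE \<xi> in lborel. duhamel \<alpha> \<beta> g s \<epsilon> T p0 a0 p a \<xi>) \<and>
   (cj p0 = p0 \<longrightarrow> (\<forall>t\<in>{0..T}. cj (p t) \<doteq> p t))"
   by (rule exI[of _ p], rule exI[of _ a], rule exI[of _ X], rule exI[of _ Y])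
     (use pm NX dom eqs real up_measurable[OF upX] up_measurable[OF upY] in \<open>simp\<close>)
 qed
qed

section \<open>Exponentially decaying Fourier transforms\<close>

text \<open>Dominated convergence along sequences: the mean value inequality on the convex set
  \<open>S\<close> bounds the remainder quotient by \<open>2 * w\<close>.\<close>

lemma has_vector_derivative_integral:
 fixes f f' :: cpath
 assumes S: "convex S" and t: "t \<in> S"
  and int: "\<And>t. t \<in> S \<Longrightarrow> integrable lborel (f t)" and [measurable]: "Borel (f' t)"
  and w: "integrable lborel w"
  and D: "AE \<xi> in lborel. \<forall>t\<in>S. ((\<lambda>t. f t \<xi>) has_vector_derivative f' t \<xi>) (at t within S) \<and> cmod (f' t \<xi>) \<le> w \<xi>"
 shows "((\<lambda>t. LINT \<xi>|lborel. f t \<xi>) has_vector_derivative (LINT \<xi>|lborel. f' t \<xi>)) (at t within S)"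
proof -
 have if': "integrable lborel (f' t)"
  using D t by (intro Bochner_Integration.integrable_bound[OF w]) (auto elim!: eventually_mono intro: order_trans[OF _ abs_ge_self])
 have "((\<lambda>y. (1 / norm (y - t)) *\<^sub>R ((LINT \<xi>|lborel. f y \<xi>) - ((LINT \<xi>|lborel. f t \<xi>) + (y - t) *\<^sub>R (LINT \<xi>|lborel. f' t \<xi>)))) \<longlongrightarrow> 0) (at t within S)"
  unfolding tendsto_at_iff_sequentially
 proof (intro allI impI)
  fix X assume X: "\<forall>i. X i \<in> S - {t}" and lim: "X \<longlonglongrightarrow> t"
  let ?g = "\<lambda>i \<xi>. (1 / norm (X i - t)) *\<^sub>R (f (X i) \<xi> - (f t \<xi> + (X i - t) *\<^sub>R f' t \<xi>))"
  have [measurable]: "Borel (f (X i))" "Borel (f t)" for i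
   using int[of "X i"] int[OF t] X by auto
  have "(\<lambda>i. LINT \<xi>|lborel. ?g i \<xi>) \<longlonglongrightarrow> (LINT \<xi>|(lborel::real measure). 0)"
  proof (rule integral_dominated_convergence[where w="\<lambda>\<xi>. 2 * w \<xi>"])
   show "AE \<xi> in lborel. (\<lambda>i. ?g i \<xi>) \<longlonglongrightarrow> 0"
    using D
   proof eventually_elim
    case (elim \<xi>)
    then have "((\<lambda>y. (1 / norm (y - t)) *\<^sub>R (f y \<xi> - (f t \<xi> + (y - t) *\<^sub>R f' t \<xi>))) \<longlongrightarrow> 0) (at t within S)"
     using t by (auto simp: has_vector_derivative_def has_derivative_within)
    then show ?case using X lim unfolding tendsto_at_iff_sequentially by (auto simp: comp_def)
   qed
   fix i
   show "AE \<xi> in lborel. norm (?g i \<xi>) \<le> 2 * w \<xi>"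
    using D
   proof eventually_elim
    case (elim \<xi>)
    have Xi: "X i \<in> S" "X i \<noteq> t" using X by auto
    have "norm (f (X i) \<xi> - f t \<xi>) \<le> w \<xi> * norm (X i - t)"
    proof (rule differentiable_bound[OF S _ _ Xi(1) t])
     fix x assume "x \<in> S"
     then show "((\<lambda>t. f t \<xi>) has_derivative (\<lambda>h. h *\<^sub>R f' x \<xi>)) (at x within S)"
      using elim by (auto simp: has_vector_derivative_def)
     show "onorm (\<lambda>h. h *\<^sub>R f' x \<xi>) \<le> w \<xi>"
      using elim \<open>x \<in> S\<close> by (intro onorm_le) (auto simp: mult.commute mult_left_mono)
    qed
    moreover have "norm ((X i - t) *\<^sub>R f' t \<xi>) \<le> w \<xi> * norm (X i - t)"
     using elim t by (auto simp: mult.commute intro!: mult_right_mono)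
    moreover have "norm (f (X i) \<xi> - (f t \<xi> + (X i - t) *\<^sub>R f' t \<xi>)) \<le> norm (f (X i) \<xi> - f t \<xi>) + norm ((X i - t) *\<^sub>R f' t \<xi>)"
     by (metis diff_diff_add norm_triangle_ineq4)
    ultimately have "norm (f (X i) \<xi> - (f t \<xi> + (X i - t) *\<^sub>R f' t \<xi>)) \<le> 2 * w \<xi> * norm (X i - t)" by simp
    then show ?case using Xi by (simp add: divide_le_eq)
   qed
  qed (use w in auto)
  moreover have "(LINT \<xi>|lborel. ?g i \<xi>) = (1 / norm (X i - t)) *\<^sub>R ((LINT \<xi>|lborel. f (X i) \<xi>) - ((LINT \<xi>|lborel. f t \<xi>) + (X i - t) *\<^sub>R (LINT \<xi>|lborel. f' t \<xi>)))" for i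
   using int[of "X i"] int[OF t] X if' by (simp add: scaleR_diff_right[symmetric] del: scaleR_conv_of_real)
  then have "(\<lambda>i. LINT \<xi>|lborel. ?g i \<xi>) = (\<lambda>i. (1 / norm (X i - t)) *\<^sub>R ((LINT \<xi>|lborel. f (X i) \<xi>) - ((LINT \<xi>|lborel. f t \<xi>) + (X i - t) *\<^sub>R (LINT \<xi>|lborel. f' t \<xi>))))"
   by (rule ext)
  ultimately show "((\<lambda>y. (1 / norm (y - t)) *\<^sub>R ((LINT \<xi>|lborel. f y \<xi>) - ((LINT \<xi>|lborel. f t \<xi>) + (y - t) *\<^sub>R (LINT \<xi>|lborel. f' t \<xi>)))) \<circ> X) \<longlonglongrightarrow> 0"
   by (simp only: comp_def Bochner_Integration.integral_zero)
 qed
 then show ?thesis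
  unfolding has_vector_derivative_def has_derivative_within by (auto intro!: bounded_linear_scaleR_left)
qed

section \<open>Derivatives and products under the inverse transform\<close>

lemma IF_eq: "IF h x = of_real (1 / sqrt (2 * pi)) * (LINT \<xi>|lborel. exp (\<i> * of_real (\<xi> * x)) * h \<xi>)"
 by (simp add: IF_def FT_def)

lemma has_vector_derivative_IF_time:
 fixes u F :: cpath
 assumes t: "t \<in> {0..T}"
  and int: "\<And>t. t \<in> {0..T} \<Longrightarrow> integrable lborel (u t)" and [measurable]: "Borel (F t)"
  and w: "integrable lborel w"
  and D: "AE \<xi> in lborel. \<forall>t\<in>{0..T}. ((\<lambda>t. u t \<xi>) has_vector_derivative F t \<xi>) (at t within {0..T}) \<and> cmod (F t \<xi>) \<le> w \<xi>"
 shows "((\<lambda>t. IF (u t) x) has_vector_derivative IF (F t) x) (at t within {0..T})"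
proof -
 have "((\<lambda>t. LINT \<xi>|lborel. exp (\<i> * of_real (\<xi> * x)) * u t \<xi>) has_vector_derivative (LINT \<xi>|lborel. exp (\<i> * of_real (\<xi> * x)) * F t \<xi>)) (at t within {0..T})"
 proof (rule has_vector_derivative_integral[where w=w and f'="\<lambda>t \<xi>. exp (\<i> * of_real (\<xi> * x)) * F t \<xi>"])
  show "AE \<xi> in lborel. \<forall>t\<in>{0..T}. ((\<lambda>t. exp (\<i> * of_real (\<xi> * x)) * u t \<xi>) has_vector_derivative exp (\<i> * of_real (\<xi> * x)) * F t \<xi>) (at t within {0..T})
    \<and> cmod (exp (\<i> * of_real (\<xi> * x)) * F t \<xi>) \<le> w \<xi>"
   using D by eventually_elim (auto simp: norm_mult intro!: has_vector_derivative_mult_right)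
 qed (use t int w in auto)
 then show ?thesis unfolding IF_eq by (rule has_vector_derivative_mult_right)
qed

lemma has_vector_derivative_IF_space:
 assumes h: "integrable lborel h" and dh: "integrable lborel (dh h)"
 shows "(IF h has_vector_derivative IF (dh h) x) (at x)"
proof -
 have [measurable]: "Borel h" "Borel (dh h)" using h dh by auto
 have "((\<lambda>x. LINT \<xi>|lborel. exp (\<i> * of_real (\<xi> * x)) * h \<xi>) has_vector_derivative (LINT \<xi>|lborel. exp (\<i> * of_real (\<xi> * x)) * dh h \<xi>)) (at x within UNIV)"
 proof (rule has_vector_derivative_integral[where w="\<lambda>\<xi>. cmod (dh h \<xi>)" and f'="\<lambda>x \<xi>. exp (\<i> * of_real (\<xi> * x)) * dh h \<xi>"])
  show "AE \<xi> in lborel. \<forall>x\<in>UNIV. ((\<lambda>x. exp (\<i> * of_real (\<xi> * x)) * h \<xi>) has_vector_derivative exp (\<i> * of_real (\<xi> * x)) * dh h \<xi>) (at x within UNIV)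
    \<and> cmod (exp (\<i> * of_real (\<xi> * x)) * dh h \<xi>) \<le> cmod (dh h \<xi>)"
  proof (intro AE_I2 ballI conjI)
   fix \<xi> x :: real
   have "((\<lambda>z. exp (\<i> * (of_real \<xi> * z)) * h \<xi>) has_field_derivative exp (\<i> * (of_real \<xi> * of_real x)) * (\<i> * of_real \<xi>) * h \<xi>) (at (of_real x))"
    by (auto intro!: derivative_eq_intros)
   from has_vector_derivative_real_field[OF this]
   show "((\<lambda>x. exp (\<i> * of_real (\<xi> * x)) * h \<xi>) has_vector_derivative exp (\<i> * of_real (\<xi> * x)) * dh h \<xi>) (at x within UNIV)"
    by (simp add: dh_def mult_ac)
  qed (simp add: norm_mult)
 qed (use h dh in auto)
 from has_vector_derivative_mult_right[OF this] show ?thesis unfolding IF_eq[abs_def] .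
qed

text \<open>Fubini's theorem; the factor \<open>1 / sqrt (2 * pi)\<close> in \<open>conv\<close> is
  what makes the convolution theorem hold without a constant.\<close>

lemma IF_conv:
 assumes h: "integrable lborel h" and k: "integrable lborel k"
 shows "integrable lborel (conv h k)" "IF (conv h k) x = IF h x * IF k x"
proof -
 have [measurable]: "Borel h" "Borel k" using assms by auto
 let ?c = "of_real (1 / sqrt (2 * pi))"
 have tr: "integrable lborel (\<lambda>\<xi>. h (\<xi> - \<eta>))" "(LINT \<xi>|lborel. f (\<xi> - \<eta>)) = (LINT \<xi>|lborel. f \<xi>)" for \<eta> and f :: "real \<Rightarrow> real"
  using lborel_integrable_real_affine[OF h, of 1 "-\<eta>"] lborel_integral_real_affine[of 1 f "-\<eta>"] by simp_all
 have ip: "integrable (lborel \<Otimes>\<^sub>M lborel) (\<lambda>(\<eta>, \<xi>). h (\<xi> - \<eta>) * k \<eta>)"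
 proof (rule lborel_pair.Fubini_integrable)
  show "(\<lambda>(\<eta>, \<xi>). h (\<xi> - \<eta>) * k \<eta>) \<in> borel_measurable (lborel \<Otimes>\<^sub>M lborel)" by measurable
  have "(LINT \<xi>|lborel. norm (h (\<xi> - \<eta>) * k \<eta>)) = (LINT \<xi>|lborel. norm (h \<xi>)) * norm (k \<eta>)" for \<eta>
   using tr(2)[of "\<lambda>\<xi>. norm (h \<xi>)" \<eta>] by (simp add: norm_mult)
  then show "integrable lborel (\<lambda>\<eta>. LINT \<xi>|lborel. norm (case (\<eta>, \<xi>) of (\<eta>, \<xi>) \<Rightarrow> h (\<xi> - \<eta>) * k \<eta>))"
   using k by simp
  show "AE \<eta> in lborel. integrable lborel (\<lambda>\<xi>. case (\<eta>, \<xi>) of (\<eta>, \<xi>) \<Rightarrow> h (\<xi> - \<eta>) * k \<eta>)"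
   using tr(1) by simp
 qed
 then have ip': "integrable (lborel \<Otimes>\<^sub>M lborel) (\<lambda>(\<xi>, \<eta>). h (\<xi> - \<eta>) * k \<eta>)"
  using lborel_pair.integrable_product_swap_iff[of "\<lambda>(\<xi>, \<eta>). h (\<xi> - \<eta>) * k \<eta>"] by (simp add: case_prod_unfold)
 have "integrable lborel (\<lambda>\<xi>. LINT \<eta>|lborel. h (\<xi> - \<eta>) * k \<eta>)"
  using lborel_pair.integrable_fst'[OF ip'] by simp
 then show ic: "integrable lborel (conv h k)"
  unfolding conv_def[abs_def] by (intro integrable_mult_right)
 let ?e = "\<lambda>\<xi>. exp (\<i> * of_real (\<xi> * x))"
 have ie: "integrable (lborel \<Otimes>\<^sub>M lborel) (\<lambda>(\<xi>, \<eta>). ?e \<xi> * (h (\<xi> - \<eta>) * k \<eta>))"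
  by (rule Bochner_Integration.integrable_bound[OF ip']) (auto simp: norm_mult split: prod.splits)
 have "(LINT \<xi>|lborel. ?e \<xi> * (LINT \<eta>|lborel. h (\<xi> - \<eta>) * k \<eta>)) = (LINT \<xi>|lborel. LINT \<eta>|lborel. ?e \<xi> * (h (\<xi> - \<eta>) * k \<eta>))"
  by simp
 also have "... = (LINT \<eta>|lborel. LINT \<xi>|lborel. ?e \<xi> * (h (\<xi> - \<eta>) * k \<eta>))"
  using lborel_pair.Fubini_integral[OF ie] by simp
 also have "... = (LINT \<eta>|lborel. (LINT \<xi>|lborel. ?e \<xi> * h \<xi>) * (?e \<eta> * k \<eta>))"
 proof (rule Bochner_Integration.integral_cong[OF refl])
  fix \<eta>
  have "(LINT \<xi>|lborel. ?e \<xi> * (h (\<xi> - \<eta>) * k \<eta>)) = (LINT \<xi>|lborel. ?e (\<eta> + \<xi>) * (h \<xi> * k \<eta>))"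
   using lborel_integral_real_affine[of 1 "\<lambda>\<xi>. ?e \<xi> * (h (\<xi> - \<eta>) * k \<eta>)" \<eta>] by simp
  also have "... = (LINT \<xi>|lborel. ?e \<xi> * h \<xi> * (?e \<eta> * k \<eta>))"
   by (intro Bochner_Integration.integral_cong) (auto simp: distrib_left distrib_right exp_add mult_ac)
  also have "... = (LINT \<xi>|lborel. ?e \<xi> * h \<xi>) * (?e \<eta> * k \<eta>)" by (rule integral_mult_left_zero)
  finally show "(LINT \<xi>|lborel. ?e \<xi> * (h (\<xi> - \<eta>) * k \<eta>)) = (LINT \<xi>|lborel. ?e \<xi> * h \<xi>) * (?e \<eta> * k \<eta>)" .
 qed
 also have "... = (LINT \<xi>|lborel. ?e \<xi> * h \<xi>) * (LINT \<eta>|lborel. ?e \<eta> * k \<eta>)" by (rule integral_mult_right_zero)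
 finally have "(LINT \<xi>|lborel. ?e \<xi> * (LINT \<eta>|lborel. h (\<xi> - \<eta>) * k \<eta>)) = (LINT \<xi>|lborel. ?e \<xi> * h \<xi>) * (LINT \<eta>|lborel. ?e \<eta> * k \<eta>)" .
 moreover have "(LINT \<xi>|lborel. ?e \<xi> * conv h k \<xi>) = ?c * (LINT \<xi>|lborel. ?e \<xi> * (LINT \<eta>|lborel. h (\<xi> - \<eta>) * k \<eta>))"
  unfolding conv_def mult.left_commute[of _ ?c] by (rule integral_mult_right_zero)
 ultimately show "IF (conv h k) x = IF h x * IF k x"
  unfolding IF_eq by (simp only: mult_ac)
qed

lemma IF_cj: "IF (cj h) x = cnj (IF h x)"
proof -
 have "cnj (LINT \<xi>|lborel. exp (\<i> * of_real (\<xi> * x)) * h \<xi>) = (LINT \<xi>|lborel. cnj (exp (\<i> * of_real (\<xi> * x)) * h \<xi>))"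
  by (simp only: Bochner_Integration.integral_cnj)
 also have "... = (LINT \<xi>|lborel. exp (\<i> * of_real (\<xi> * x)) * cj h \<xi>)"
  by (subst lborel_integral_real_affine[of "-1" _ 0]) (simp_all add: cj_def exp_cnj)
 finally show ?thesis by (simp add: IF_eq)
qed

lemma IF_add:
 assumes "integrable lborel h" "integrable lborel k"
 shows "IF (h \<oplus> k) x = IF h x + IF k x"
 using assms unfolding IF_eq by (simp add: distrib_left)

lemma IF_diff:
 assumes "integrable lborel h" "integrable lborel k"
 shows "IF (h \<ominus> k) x = IF h x - IF k x"
 using assms unfolding IF_eq by (simp add: right_diff_distrib)

lemma IF_cmult: "IF (\<lambda>\<xi>. c * h \<xi>) x = c * IF h x"
 unfolding IF_eq mult.left_commute[of _ c] by (simp only: integral_mult_right_zero mult.left_commute[of _ c])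

lemma IF_cong_AE:
 assumes "h \<doteq> k" "Borel h" "Borel k"
 shows "IF h = IF k"
proof
 fix x
 have "(LINT \<xi>|lborel. exp (\<i> * of_real (\<xi> * x)) * h \<xi>) = (LINT \<xi>|lborel. exp (\<i> * of_real (\<xi> * x)) * k \<xi>)"
  by (intro integral_cong_AE) (use assms in auto)
 then show "IF h x = IF k x" by (simp add: IF_eq)
qed

text \<open>The weight is purely exponential and separate from the function, so that the rate can be
  lowered. A small loss of rate then replaces every count of derivatives, which suits arguments that
  need only some positive rate.\<close>

definition Eq :: "real \<Rightarrow> nnfun \<Rightarrow> ennreal" where
 "Eq \<rho> V = (\<integral>\<^sup>+\<xi>. (ennreal (exp (\<rho> * jap \<xi>)) * V \<xi>)\<^sup>2 \<partial>lborel)"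

lemma Eq_mono_AE: "AE \<xi> in lborel. U \<xi> \<le> V \<xi> \<Longrightarrow> Eq \<rho> U \<le> Eq \<rho> V"
 unfolding Eq_def by (intro nn_integral_mono_AE) (auto intro!: power_mono mult_left_mono elim!: eventually_mono)

lemma Eq_mono: "(\<And>\<xi>. U \<xi> \<le> V \<xi>) \<Longrightarrow> Eq \<rho> U \<le> Eq \<rho> V"
 by (intro Eq_mono_AE) auto

lemma Eq_mono_rho: "\<rho>' \<le> \<rho> \<Longrightarrow> Eq \<rho>' V \<le> Eq \<rho> V"
 unfolding Eq_def by (intro nn_integral_mono power_mono mult_right_mono ennreal_leI) (auto intro: mult_right_mono)

lemma Eq_add:
 assumes [measurable]: "Borel U" "Borel V"
 shows "Eq \<rho> (U \<oplus> V) \<le> 2 * Eq \<rho> U + 2 * Eq \<rho> V"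
proof -
 have "Eq \<rho> (U \<oplus> V) \<le> (\<integral>\<^sup>+\<xi>. 2 * (ennreal (exp (\<rho> * jap \<xi>)) * U \<xi>)\<^sup>2 + 2 * (ennreal (exp (\<rho> * jap \<xi>)) * V \<xi>)\<^sup>2 \<partial>lborel)"
  unfolding Eq_def by (intro nn_integral_mono) (simp add: distrib_left ennreal_sum_sq)
 also have "... = 2 * Eq \<rho> U + 2 * Eq \<rho> V"
  unfolding Eq_def by (simp add: nn_integral_add nn_integral_cmult)
 finally show ?thesis .
qed

lemma Eq_cmult:
 assumes [measurable]: "Borel V"
 shows "Eq \<rho> (\<lambda>\<xi>. c * V \<xi>) = c\<^sup>2 * Eq \<rho> V"
 unfolding Eq_def
 by (subst nn_integral_cmult[symmetric]) (auto intro!: nn_integral_cong simp: power_mult_distrib mult_ac)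

lemma Eq_rf:
 assumes [measurable]: "Borel V"
 shows "Eq \<rho> (rf V) = Eq \<rho> V"
 unfolding Eq_def rf_def
 using nn_integral_real_affine[of "\<lambda>\<xi>. (ennreal (exp (\<rho> * jap \<xi>)) * V \<xi>)\<^sup>2" "-1" 0] by simp

lemma mult_le_exp: "\<delta> * x \<le> exp (\<delta> * x)" for x :: real
 using exp_ge_add_one_self[of "\<delta> * x"] by linarith

text \<open>With \<open>\<delta> = \<rho> - \<rho>'\<close>, the lost rate leaves the factor
  \<open>exp (- \<delta> * jap \<xi>) \<le> 1 / (\<delta> * jap \<xi>)\<close>, whose square has
  integral at most \<open>Cj / \<delta>^2\<close>; the rest is Cauchy-Schwarz.\<close>

lemma Eq_L1:
 assumes "\<rho>' < \<rho>" and [measurable]: "Borel V"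
 shows "(\<integral>\<^sup>+\<xi>. ennreal (exp (\<rho>' * jap \<xi>)) * V \<xi> \<partial>lborel)\<^sup>2 \<le> ennreal ((1 / (\<rho> - \<rho>'))\<^sup>2) * Cj * Eq \<rho> V"
proof -
 let ?\<delta> = "\<rho> - \<rho>'"
 have \<delta>: "?\<delta> > 0" using assms by simp
 have "(\<integral>\<^sup>+\<xi>. ennreal (exp (\<rho>' * jap \<xi>)) * V \<xi> \<partial>lborel) = (\<integral>\<^sup>+\<xi>. ennreal (exp (- ?\<delta> * jap \<xi>)) * (ennreal (exp (\<rho> * jap \<xi>)) * V \<xi>) \<partial>lborel)"
  by (intro nn_integral_cong) (simp add: mult.assoc[symmetric] exp_add[symmetric] algebra_simps flip: ennreal_mult)
 also have "...\<^sup>2 \<le> (\<integral>\<^sup>+\<xi>. (ennreal (exp (- ?\<delta> * jap \<xi>)))\<^sup>2 \<partial>lborel) * Eq \<rho> V"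
  unfolding Eq_def by (rule Cauchy_Schwarz_nn_integral) measurable
 also have "... \<le> (ennreal ((1 / ?\<delta>)\<^sup>2) * Cj) * Eq \<rho> V"
 proof (rule mult_right_mono)
  have "(\<integral>\<^sup>+\<xi>. (ennreal (exp (- ?\<delta> * jap \<xi>)))\<^sup>2 \<partial>lborel) \<le> (\<integral>\<^sup>+\<xi>. ennreal ((1 / ?\<delta>)\<^sup>2) * ennreal (1 / (jap \<xi>)\<^sup>2) \<partial>lborel)"
  proof (intro nn_integral_mono)
   fix \<xi>
   have "exp (- ?\<delta> * jap \<xi>) \<le> 1 / (?\<delta> * jap \<xi>)"
    using le_imp_inverse_le[OF mult_le_exp[of ?\<delta> "jap \<xi>"]] mult_pos_pos[OF \<delta> jap_pos[of \<xi>]]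
    by (simp add: exp_minus[symmetric] inverse_eq_divide[symmetric] algebra_simps)
   then have "(exp (- ?\<delta> * jap \<xi>))\<^sup>2 \<le> (1 / (?\<delta> * jap \<xi>))\<^sup>2" by (intro power_mono) auto
   then show "(ennreal (exp (- ?\<delta> * jap \<xi>)))\<^sup>2 \<le> ennreal ((1 / ?\<delta>)\<^sup>2) * ennreal (1 / (jap \<xi>)\<^sup>2)"
    by (simp add: ennreal_power ennreal_leI power_divide power_mult_distrib flip: ennreal_mult)
  qed
  also have "... = ennreal ((1 / ?\<delta>)\<^sup>2) * Cj" unfolding Cj_def by (rule nn_integral_cmult) measurable
  finally show "(\<integral>\<^sup>+\<xi>. (ennreal (exp (- ?\<delta> * jap \<xi>)))\<^sup>2 \<partial>lborel) \<le> ennreal ((1 / ?\<delta>)\<^sup>2) * Cj" .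
 qed simp
 finally show ?thesis .
qed

lemma Eq_cv:
 assumes "0 \<le> \<rho>'" "\<rho>' < \<rho>" and [measurable]: "Borel U" "Borel V"
 shows "Eq \<rho>' (cv U V) \<le> ennreal ((1 / (\<rho> - \<rho>'))\<^sup>2) * Cj * (Eq \<rho> U * Eq \<rho> V)"
proof -
 let ?e = "\<lambda>\<xi>. ennreal (exp (\<rho>' * jap \<xi>))"
 have le: "?e \<xi> * cv U V \<xi> \<le> cv (\<lambda>\<xi>. ?e \<xi> * U \<xi>) (\<lambda>\<xi>. ?e \<xi> * V \<xi>) \<xi>" for \<xi>
 proof -
  have "?e \<xi> * cv U V \<xi> = (\<integral>\<^sup>+\<eta>. ?e \<xi> * (U (\<xi> - \<eta>) * V \<eta>) \<partial>lborel)"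
   unfolding cv_def by (rule nn_integral_cmult[symmetric]) measurable
  also have "... \<le> (\<integral>\<^sup>+\<eta>. (?e (\<xi> - \<eta>) * ?e \<eta>) * (U (\<xi> - \<eta>) * V \<eta>) \<partial>lborel)"
  proof (intro nn_integral_mono mult_right_mono)
   fix \<eta>
   show "?e \<xi> \<le> ?e (\<xi> - \<eta>) * ?e \<eta>"
    using mult_left_mono[OF jap_split[of \<xi> \<eta>] assms(1)]
    by (simp add: ennreal_leI exp_add[symmetric] distrib_left flip: ennreal_mult)
  qed simp
  finally show ?thesis by (simp add: cv_def mult_ac)
 qed
 have "Eq \<rho>' (cv U V) \<le> (\<integral>\<^sup>+\<xi>. (cv (\<lambda>\<xi>. ?e \<xi> * U \<xi>) (\<lambda>\<xi>. ?e \<xi> * V \<xi>) \<xi>)\<^sup>2 \<partial>lborel)"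
  unfolding Eq_def by (intro nn_integral_mono power_mono le) auto
 also have "... \<le> (\<integral>\<^sup>+\<xi>. ?e \<xi> * U \<xi> \<partial>lborel)\<^sup>2 * Eq \<rho>' V"
  unfolding Eq_def by (rule young) measurable
 also have "... \<le> (ennreal ((1 / (\<rho> - \<rho>'))\<^sup>2) * Cj * Eq \<rho> U) * Eq \<rho> V"
  using assms by (intro mult_mono Eq_L1 Eq_mono_rho) auto
 finally show ?thesis by (simp add: mult.assoc)
qed

text \<open>From \<open>ln x \<le> x\<close> at \<open>x = \<delta> / q * jap \<xi>\<close>,
  multiplied by \<open>q\<close>. Replacing \<open>p\<close> by \<open>q = max p 1\<close> permits
  the division when \<open>p\<close> is zero.\<close>

lemma jap_powr_le_exp:
 assumes "\<delta> > 0" "p \<ge> 0"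
 obtains C :: real where "C > 0" "\<And>\<xi>. jap \<xi> powr p \<le> C * exp (\<delta> * jap \<xi>)"
proof -
 define q where "q = max p 1"
 have q: "q > 0" "p \<le> q" by (auto simp: q_def)
 have "jap \<xi> powr p \<le> exp (- q * ln (\<delta> / q)) * exp (\<delta> * jap \<xi>)" for \<xi>
 proof -
  have "jap \<xi> powr p \<le> jap \<xi> powr q" using q jap_ge1 by (intro powr_mono) auto
  also have "... = exp (q * ln (jap \<xi>))" by (simp add: powr_def)
  also have "q * ln (jap \<xi>) = q * ln (\<delta> / q * jap \<xi>) - q * ln (\<delta> / q)"
  proof -
   have "ln (\<delta> / q * jap \<xi>) = ln (\<delta> / q) + ln (jap \<xi>)"
    using assms q ln_mult_pos[of "\<delta> / q" "jap \<xi>"] by simp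
   then show ?thesis by (simp add: algebra_simps)
  qed
  also have "exp (q * ln (\<delta> / q * jap \<xi>) - q * ln (\<delta> / q)) \<le> exp (q * (\<delta> / q * jap \<xi>) - q * ln (\<delta> / q))"
  proof -
   have "\<delta> / q * jap \<xi> > 0" using assms q by (intro mult_pos_pos divide_pos_pos) auto
   then have "ln (\<delta> / q * jap \<xi>) \<le> \<delta> / q * jap \<xi>" using ln_le_minus_one[of "\<delta> / q * jap \<xi>"] by linarith
   then have "q * ln (\<delta> / q * jap \<xi>) \<le> q * (\<delta> / q * jap \<xi>)" using q by (intro mult_left_mono) auto
   then show ?thesis by (simp only: exp_le_cancel_iff diff_right_mono)
  qed
  also have "q * (\<delta> / q * jap \<xi>) = \<delta> * jap \<xi>" using q by simp
  finally show ?thesis by (simp add: exp_diff exp_minus field_simps)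
 qed
 then show thesis by (intro that[of "exp (- q * ln (\<delta> / q))"]) auto
qed

lemma Eq_jm:
 assumes "\<rho>' < \<rho>" "p \<ge> 0"
 obtains C where "C < top" "\<And>V. Borel V \<Longrightarrow> Eq \<rho>' (jm p V) \<le> C * Eq \<rho> V"
proof -
 obtain c where c: "c > 0" "\<And>\<xi>. jap \<xi> powr p \<le> c * exp ((\<rho> - \<rho>') * jap \<xi>)"
  using jap_powr_le_exp[of "\<rho> - \<rho>'" p] assms by auto
 show thesis
 proof (rule that[of "ennreal (c\<^sup>2)"])
  fix V :: nnfun assume [measurable]: "Borel V"
  have "Eq \<rho>' (jm p V) \<le> (\<integral>\<^sup>+\<xi>. ennreal (c\<^sup>2) * (ennreal (exp (\<rho> * jap \<xi>)) * V \<xi>)\<^sup>2 \<partial>lborel)"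
   unfolding Eq_def
  proof (intro nn_integral_mono)
   fix \<xi>
   have "exp (\<rho>' * jap \<xi>) * jap \<xi> powr p \<le> exp (\<rho>' * jap \<xi>) * (c * exp ((\<rho> - \<rho>') * jap \<xi>))"
    by (intro mult_left_mono c) auto
   also have "... = c * exp (\<rho> * jap \<xi>)" by (simp add: exp_add[symmetric] algebra_simps)
   finally have "ennreal (exp (\<rho>' * jap \<xi>)) * ennreal (jap \<xi> powr p) \<le> ennreal (c * exp (\<rho> * jap \<xi>))"
    by (simp add: ennreal_leI flip: ennreal_mult)
   then have "ennreal (exp (\<rho>' * jap \<xi>)) * jm p V \<xi> \<le> ennreal c * (ennreal (exp (\<rho> * jap \<xi>)) * V \<xi>)"
    using c mult_right_mono[of _ _ "V \<xi>"] by (simp add: jm_def ennreal_mult mult.assoc[symmetric])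
   then have "(ennreal (exp (\<rho>' * jap \<xi>)) * jm p V \<xi>)\<^sup>2 \<le> (ennreal c * (ennreal (exp (\<rho> * jap \<xi>)) * V \<xi>))\<^sup>2"
    by (intro power_mono) auto
   then show "(ennreal (exp (\<rho>' * jap \<xi>)) * jm p V \<xi>)\<^sup>2 \<le> ennreal (c\<^sup>2) * (ennreal (exp (\<rho> * jap \<xi>)) * V \<xi>)\<^sup>2"
    using c by (simp add: power_mult_distrib ennreal_power)
  qed
  also have "... = ennreal (c\<^sup>2) * Eq \<rho> V" unfolding Eq_def by (rule nn_integral_cmult) measurable
  finally show "Eq \<rho>' (jm p V) \<le> ennreal (c\<^sup>2) * Eq \<rho> V" .
 qed simp
qed

definition na :: "cfun \<Rightarrow> real \<Rightarrow> ennreal" where "na h \<xi> = ennreal (cmod (h \<xi>))"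

lemma na_measurable [measurable (raw)]:
 assumes [measurable]: "case_prod u \<in> borel_measurable (M \<Otimes>\<^sub>M borel)" "f \<in> borel_measurable M"
 shows "(\<lambda>t. na (u t) (f t)) \<in> borel_measurable M"
 unfolding na_def by measurable

lemma na_em: "na h = em 0 h" by (simp add: na_def em_def fun_eq_iff)

lemma na_conv: "na (conv u v) \<xi> \<le> cv (na u) (na v) \<xi>"
 unfolding na_em by (rule em_conv) simp

lemma na_cj: "na (cj u) = rf (na u)" by (simp add: na_def cj_def rf_def fun_eq_iff)

lemma na_add: "na (u \<oplus> v) \<xi> \<le> na u \<xi> + na v \<xi>"
 by (simp add: na_def norm_triangle_ineq ennreal_leI flip: ennreal_plus)

text \<open>Time-dependent Fourier transforms that are bounded, respectively dominated by a fixed function, in \<open>L2\<close> with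
 some exponential weight. The equation is obtained for almost every frequency at all times simultaneously only in the class \<open>DC\<close>.\<close>

definition BC :: "real set \<Rightarrow> cpath \<Rightarrow> bool" where
 "BC S u \<longleftrightarrow> jmeas u \<and> (\<exists>\<rho>>0. \<exists>K<top. \<forall>t\<in>S. Eq \<rho> (na (u t)) \<le> K)"

definition DC :: "real set \<Rightarrow> cpath \<Rightarrow> bool" where
 "DC S u \<longleftrightarrow> jmeas u \<and> (\<exists>\<rho>>0. \<exists>V. Borel V \<and> Eq \<rho> V < top \<and> (AE \<xi> in lborel. \<forall>t\<in>S. na (u t) \<xi> \<le> V \<xi>))"

definition CC :: "real set \<Rightarrow> cpath \<Rightarrow> bool" where
 "CC S u \<longleftrightarrow> (AE \<xi> in lborel. continuous_on S (\<lambda>t. u t \<xi>))"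

lemma DC_BC: "DC S u \<Longrightarrow> BC S u"
proof -
 assume "DC S u"
 then obtain \<rho> V where *: "jmeas u" "\<rho> > 0" "Eq \<rho> V < top" "AE \<xi> in lborel. \<forall>t\<in>S. na (u t) \<xi> \<le> V \<xi>"
  by (auto simp: DC_def)
 have "Eq \<rho> (na (u t)) \<le> Eq \<rho> V" if "t \<in> S" for t
 proof (rule Eq_mono_AE)
  show "AE \<xi> in lborel. na (u t) \<xi> \<le> V \<xi>" using *(4) by eventually_elim (use that in blast)
 qed
 with * show ?thesis by (auto simp: BC_def)
qed

lemma BC_conv:
 assumes "BC S u" "BC S v" shows "BC S (\<lambda>t. conv (u t) (v t))"
proof -
 obtain \<rho>1 K1 where 1: "jmeas u" "\<rho>1 > 0" "K1 < top" "\<And>t. t \<in> S \<Longrightarrow> Eq \<rho>1 (na (u t)) \<le> K1" using assms by (auto simp: BC_def)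
 obtain \<rho>2 K2 where 2: "jmeas v" "\<rho>2 > 0" "K2 < top" "\<And>t. t \<in> S \<Longrightarrow> Eq \<rho>2 (na (v t)) \<le> K2" using assms by (auto simp: BC_def)
 note [measurable] = 1(1) 2(1)
 define \<rho> where "\<rho> = min \<rho>1 \<rho>2"
 have \<rho>: "\<rho> > 0" "\<rho> \<le> \<rho>1" "\<rho> \<le> \<rho>2" using 1 2 by (auto simp: \<rho>_def)
 let ?K = "ennreal ((1 / (\<rho> - \<rho>/2))\<^sup>2) * Cj * (K1 * K2)"
 have "Eq (\<rho>/2) (na (conv (u t) (v t))) \<le> ?K" if t: "t \<in> S" for t
 proof -
  have "Eq (\<rho>/2) (na (conv (u t) (v t))) \<le> Eq (\<rho>/2) (cv (na (u t)) (na (v t)))" by (intro Eq_mono na_conv)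
  also have "... \<le> ennreal ((1 / (\<rho> - \<rho>/2))\<^sup>2) * Cj * (Eq \<rho> (na (u t)) * Eq \<rho> (na (v t)))"
   using \<rho> by (intro Eq_cv) auto
  also have "... \<le> ?K"
   by (intro mult_left_mono mult_mono order_trans[OF Eq_mono_rho[OF \<rho>(2)] 1(4)] order_trans[OF Eq_mono_rho[OF \<rho>(3)] 2(4)] t) auto
  finally show ?thesis .
 qed
 moreover have "?K < top" using 1 2 Cj_top by (simp add: ennreal_mult_less_top)
 moreover have "jmeas (\<lambda>t. conv (u t) (v t))" by measurable
 ultimately show ?thesis using \<rho> unfolding BC_def by (intro conjI exI[of _ "\<rho>/2"] exI[of _ ?K]) auto
qed

text \<open>The factors are dominated only almost everywhere, but the convolution integral does not
  see null sets, so the product is dominated at every frequency.\<close>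

lemma DC_conv:
 assumes "DC S u" "DC S v" shows "DC S (\<lambda>t. conv (u t) (v t))"
proof -
 obtain \<rho>1 U where 1: "jmeas u" "\<rho>1 > 0" "Borel U" "Eq \<rho>1 U < top" "AE \<xi> in lborel. \<forall>t\<in>S. na (u t) \<xi> \<le> U \<xi>" using assms by (auto simp: DC_def)
 obtain \<rho>2 V where 2: "jmeas v" "\<rho>2 > 0" "Borel V" "Eq \<rho>2 V < top" "AE \<xi> in lborel. \<forall>t\<in>S. na (v t) \<xi> \<le> V \<xi>" using assms by (auto simp: DC_def)
 note [measurable] = 1(1) 2(1) 1(3) 2(3)
 define \<rho> where "\<rho> = min \<rho>1 \<rho>2"
 have \<rho>: "\<rho> > 0" "\<rho> \<le> \<rho>1" "\<rho> \<le> \<rho>2" using 1 2 by (auto simp: \<rho>_def)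
 have "Eq (\<rho>/2) (cv U V) \<le> ennreal ((1 / (\<rho> - \<rho>/2))\<^sup>2) * Cj * (Eq \<rho> U * Eq \<rho> V)"
  using \<rho> by (intro Eq_cv) auto
 also have "... < top"
  using le_less_trans[OF Eq_mono_rho[OF \<rho>(2), of U] 1(4)] le_less_trans[OF Eq_mono_rho[OF \<rho>(3), of V] 2(4)]
  by (intro ennreal_mult_less_top[THEN iffD2] disjI2 conjI Cj_top) simp_all
 finally have E: "Eq (\<rho>/2) (cv U V) < top" .
 have "na (conv (u t) (v t)) \<xi> \<le> cv U V \<xi>" if t: "t \<in> S" for t \<xi>
 proof -
  have "na (conv (u t) (v t)) \<xi> \<le> cv (na (u t)) (na (v t)) \<xi>" by (rule na_conv)
  also have "... \<le> cv U V \<xi>"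
   unfolding cv_def
   by (rule nn_integral_mono_AE, use AE_translate_reflect[OF 1(5), of \<xi>] 2(5) in eventually_elim) (use t in \<open>auto intro!: mult_mono\<close>)
  finally show ?thesis .
 qed
 moreover have "jmeas (\<lambda>t. conv (u t) (v t))" by measurable
 moreover have "Borel (cv U V)" by measurable
 ultimately show ?thesis using \<rho> E unfolding DC_def by (intro conjI exI[of _ "\<rho>/2"] exI[of _ "cv U V"]) auto
qed

lemma Eq_AE_finite:
 assumes [measurable]: "Borel V" and "Eq \<rho> V < top"
 shows "AE \<xi> in lborel. V \<xi> < top"
proof -
 have "AE \<xi> in lborel. ennreal (exp (\<rho> * jap \<xi>)) * V \<xi> < top"
  by (rule AE_finite_of_Nsq[of _ 0]) (use assms in \<open>auto simp: Nsq_def Eq_def\<close>)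
 then show ?thesis by eventually_elim (auto simp: ennreal_mult_less_top)
qed

lemma Eq_integrable:
 assumes [measurable]: "Borel V" and "Eq \<rho> V < top" "\<rho> > 0"
 shows "integrable lborel (\<lambda>\<xi>. enn2real (V \<xi>))" "(\<integral>\<^sup>+\<xi>. V \<xi> \<partial>lborel) < top"
proof -
 have "(\<integral>\<^sup>+\<xi>. V \<xi> \<partial>lborel)\<^sup>2 \<le> ennreal ((1 / (\<rho> - 0))\<^sup>2) * Cj * Eq \<rho> V"
  using Eq_L1[of 0 \<rho> V] assms by simp
 also have "... < top" using assms Cj_top by (simp add: ennreal_mult_less_top)
 finally show fin: "(\<integral>\<^sup>+\<xi>. V \<xi> \<partial>lborel) < top" by (auto simp: power2_eq_square ennreal_mult_less_top)
 have "(\<integral>\<^sup>+\<xi>. ennreal (norm (enn2real (V \<xi>))) \<partial>lborel) = (\<integral>\<^sup>+\<xi>. V \<xi> \<partial>lborel)"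
  by (intro nn_integral_cong_AE, use Eq_AE_finite[OF assms(1,2)] in eventually_elim) (auto simp: less_top)
 then show "integrable lborel (\<lambda>\<xi>. enn2real (V \<xi>))" using fin by (auto simp: integrable_iff_bounded)
qed

text \<open>Dominated convergence in \<open>\<eta>\<close>, at each frequency where
  \<open>cv U V\<close> is finite. Bounds in norm at each time would not do: the dominating function
  must be the same for all times, which is what \<open>DC\<close> provides.\<close>

lemma CC_conv:
 assumes "DC S u" "CC S u" "DC S v" "CC S v" shows "CC S (\<lambda>t. conv (u t) (v t))"
proof -
 obtain \<rho>1 U where 1: "jmeas u" "\<rho>1 > 0" "Borel U" "Eq \<rho>1 U < top" "AE \<xi> in lborel. \<forall>t\<in>S. na (u t) \<xi> \<le> U \<xi>" using assms by (auto simp: DC_def)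
 obtain \<rho>2 V where 2: "jmeas v" "\<rho>2 > 0" "Borel V" "Eq \<rho>2 V < top" "AE \<xi> in lborel. \<forall>t\<in>S. na (v t) \<xi> \<le> V \<xi>" using assms by (auto simp: DC_def)
 note [measurable] = 1(1) 2(1) 1(3) 2(3)
 have [measurable]: "Borel (u t)" "Borel (v t)" for t
  using 1(1) 2(1) by (auto intro: section_meas)
 define \<rho> where "\<rho> = min \<rho>1 \<rho>2"
 have \<rho>: "\<rho> > 0" "\<rho> \<le> \<rho>1" "\<rho> \<le> \<rho>2" using 1 2 by (auto simp: \<rho>_def)
 have "Eq (\<rho>/2) (cv U V) \<le> ennreal ((1 / (\<rho> - \<rho>/2))\<^sup>2) * Cj * (Eq \<rho> U * Eq \<rho> V)"
  using \<rho> by (intro Eq_cv) auto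
 also have "... < top"
  using le_less_trans[OF Eq_mono_rho[OF \<rho>(2), of U] 1(4)] le_less_trans[OF Eq_mono_rho[OF \<rho>(3), of V] 2(4)]
  by (intro ennreal_mult_less_top[THEN iffD2] disjI2 conjI Cj_top) simp_all
 finally have "Eq (\<rho>/2) (cv U V) < top" .
 then have "AE \<xi> in lborel. cv U V \<xi> < top" by (rule Eq_AE_finite[rotated]) measurable
 then show ?thesis
  unfolding CC_def
 proof eventually_elim
  case (elim \<xi>)
  let ?w = "\<lambda>\<eta>. enn2real (U (\<xi> - \<eta>) * V \<eta>)"
  have fin: "AE \<eta> in lborel. U (\<xi> - \<eta>) * V \<eta> \<noteq> \<infinity>"
   using elim by (intro nn_integral_PInf_AE) (auto simp: cv_def)
  have "(\<integral>\<^sup>+\<eta>. ennreal (norm (?w \<eta>)) \<partial>lborel) = cv U V \<xi>"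
   unfolding cv_def by (intro nn_integral_cong_AE, use fin in eventually_elim) (auto simp: less_top)
  then have iw: "integrable lborel ?w" using elim by (auto simp: integrable_iff_bounded)
  have dom: "AE \<eta> in lborel. \<forall>t\<in>S. norm (u t (\<xi> - \<eta>) * v t \<eta>) \<le> ?w \<eta>"
   using AE_translate_reflect[OF 1(5), of \<xi>] 2(5) fin
  proof eventually_elim
   case (elim \<eta>)
   show ?case
   proof
    fix t assume t: "t \<in> S"
    have "ennreal (norm (u t (\<xi> - \<eta>) * v t \<eta>)) \<le> U (\<xi> - \<eta>) * V \<eta>"
     using elim t by (auto simp: norm_mult ennreal_mult na_def intro!: mult_mono)
    then show "norm (u t (\<xi> - \<eta>) * v t \<eta>) \<le> ?w \<eta>"
     using elim(3) by (metis enn2real_ennreal enn2real_mono infinity_ennreal_def less_top norm_ge_zero)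
   qed
  qed
  have con: "AE \<eta> in lborel. continuous_on S (\<lambda>t. u t (\<xi> - \<eta>) * v t \<eta>)"
   using AE_translate_reflect[OF assms(2)[unfolded CC_def], of \<xi>] assms(4)[unfolded CC_def]
   by eventually_elim (intro continuous_intros)
  have "continuous_on S (\<lambda>t. LINT \<eta>|lborel. u t (\<xi> - \<eta>) * v t \<eta>)"
   unfolding continuous_on tendsto_at_iff_sequentially
  proof (intro ballI allI impI)
   fix t X assume t: "t \<in> S" and X: "\<forall>i. X i \<in> S - {t}" and lim: "X \<longlonglongrightarrow> t"
   show "((\<lambda>t. LINT \<eta>|lborel. u t (\<xi> - \<eta>) * v t \<eta>) \<circ> X) \<longlonglongrightarrow> (LINT \<eta>|lborel. u t (\<xi> - \<eta>) * v t \<eta>)"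
    unfolding comp_def
   proof (rule integral_dominated_convergence[OF _ _ iw])
    show "AE \<eta> in lborel. (\<lambda>i. u (X i) (\<xi> - \<eta>) * v (X i) \<eta>) \<longlonglongrightarrow> u t (\<xi> - \<eta>) * v t \<eta>"
     using con
    proof eventually_elim
     case (elim \<eta>)
     then have "((\<lambda>t. u t (\<xi> - \<eta>) * v t \<eta>) \<longlongrightarrow> u t (\<xi> - \<eta>) * v t \<eta>) (at t within S)"
      using t by (auto simp: continuous_on)
     then show ?case using X lim unfolding tendsto_at_iff_sequentially by (auto simp: comp_def)
    qed
    show "AE \<eta> in lborel. norm (u (X i) (\<xi> - \<eta>) * v (X i) \<eta>) \<le> ?w \<eta>" for i
     using dom X by (auto elim!: eventually_mono)
   qed measurable
  qed
  then show ?case unfolding conv_def by (intro continuous_intros)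
 qed
qed

text \<open>Halving the exponential rate absorbs a symbol of polynomial growth. The classes leave
  the rate unspecified so that derivatives stay inside them.\<close>

lemma BC_mult:
 assumes "BC S u" and [measurable]: "Borel c" and c: "\<And>\<xi>. cmod (c \<xi>) \<le> C * jap \<xi> powr p" and p: "p \<ge> 0"
 shows "BC S (\<lambda>t \<xi>. c \<xi> * u t \<xi>)"
proof -
 obtain \<rho> K where 1: "jmeas u" "\<rho> > 0" "K < top" "\<And>t. t \<in> S \<Longrightarrow> Eq \<rho> (na (u t)) \<le> K" using assms by (auto simp: BC_def)
 note [measurable] = 1(1)
 have [measurable]: "Borel (na (u t))" for t by measurable
 obtain D where D: "D < top" "\<And>V. Borel V \<Longrightarrow> Eq (\<rho>/2) (jm p V) \<le> D * Eq \<rho> V"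
  using Eq_jm[of "\<rho>/2" \<rho> p] 1 p by auto
 have "C \<ge> 0" using order_trans[OF norm_ge_zero c[of 0]] by (simp add: jap_def)
 have "Eq (\<rho>/2) (na (\<lambda>\<xi>. c \<xi> * u t \<xi>)) \<le> (ennreal C)\<^sup>2 * (D * K)" if t: "t \<in> S" for t
 proof -
  have "na (\<lambda>\<xi>. c \<xi> * u t \<xi>) \<xi> \<le> ennreal C * jm p (na (u t)) \<xi>" for \<xi>
   using \<open>C \<ge> 0\<close> mult_right_mono[OF c[of \<xi>], of "cmod (u t \<xi>)"]
   by (simp add: na_def jm_def norm_mult ennreal_leI mult.assoc flip: ennreal_mult)
  then have "Eq (\<rho>/2) (na (\<lambda>\<xi>. c \<xi> * u t \<xi>)) \<le> Eq (\<rho>/2) (\<lambda>\<xi>. ennreal C * jm p (na (u t)) \<xi>)" by (intro Eq_mono)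
  also have "... = (ennreal C)\<^sup>2 * Eq (\<rho>/2) (jm p (na (u t)))" by (rule Eq_cmult) measurable
  also have "... \<le> (ennreal C)\<^sup>2 * (D * K)"
   by (intro mult_left_mono order_trans[OF D(2)] 1 t) auto
  finally show ?thesis .
 qed
 moreover have "(ennreal C)\<^sup>2 * (D * K) < top" using 1 D by (simp add: ennreal_mult_less_top power2_eq_square)
 moreover have "jmeas (\<lambda>t \<xi>. c \<xi> * u t \<xi>)" by measurable
 ultimately show ?thesis using 1 unfolding BC_def by (intro conjI exI[of _ "\<rho>/2"] exI[of _ "(ennreal C)\<^sup>2 * (D * K)"]) auto
qed

lemma DC_mult:
 assumes "DC S u" and [measurable]: "Borel c" and c: "\<And>\<xi>. cmod (c \<xi>) \<le> C * jap \<xi> powr p" and p: "p \<ge> 0"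
 shows "DC S (\<lambda>t \<xi>. c \<xi> * u t \<xi>)"
proof -
 obtain \<rho> V where 1: "jmeas u" "\<rho> > 0" "Borel V" "Eq \<rho> V < top" "AE \<xi> in lborel. \<forall>t\<in>S. na (u t) \<xi> \<le> V \<xi>"
  using assms by (auto simp: DC_def)
 note [measurable] = 1(1,3)
 obtain D where D: "D < top" "\<And>V. Borel V \<Longrightarrow> Eq (\<rho>/2) (jm p V) \<le> D * Eq \<rho> V"
  using Eq_jm[of "\<rho>/2" \<rho> p] 1 p by auto
 have "C \<ge> 0" using order_trans[OF norm_ge_zero c[of 0]] by (simp add: jap_def)
 let ?V = "\<lambda>\<xi>. ennreal C * jm p V \<xi>"
 have "AE \<xi> in lborel. \<forall>t\<in>S. na (\<lambda>\<xi>. c \<xi> * u t \<xi>) \<xi> \<le> ?V \<xi>"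
  using 1(5)
 proof eventually_elim
  case (elim \<xi>)
  show ?case
  proof
   fix t assume t: "t \<in> S"
   have "na (\<lambda>\<xi>. c \<xi> * u t \<xi>) \<xi> \<le> ennreal C * jm p (na (u t)) \<xi>"
    using \<open>C \<ge> 0\<close> mult_right_mono[OF c[of \<xi>], of "cmod (u t \<xi>)"]
    by (simp add: na_def jm_def norm_mult ennreal_leI mult.assoc flip: ennreal_mult)
   also have "... \<le> ?V \<xi>" unfolding jm_def using elim t by (intro mult_left_mono) auto
   finally show "na (\<lambda>\<xi>. c \<xi> * u t \<xi>) \<xi> \<le> ?V \<xi>" .
  qed
 qed
 moreover have "Eq (\<rho>/2) ?V < top"
 proof -
  have "Eq (\<rho>/2) ?V = (ennreal C)\<^sup>2 * Eq (\<rho>/2) (jm p V)" by (rule Eq_cmult) measurable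
  also have "... \<le> (ennreal C)\<^sup>2 * (D * Eq \<rho> V)" by (intro mult_left_mono D 1) auto
  also have "... < top" using 1 D by (simp add: ennreal_mult_less_top power2_eq_square)
  finally show ?thesis .
 qed
 moreover have "jmeas (\<lambda>t \<xi>. c \<xi> * u t \<xi>)" "Borel (?V)" by measurable
 ultimately show ?thesis using 1 unfolding DC_def by (intro conjI exI[of _ "\<rho>/2"] exI[of _ ?V]) auto
qed

lemma CC_mult: "CC S u \<Longrightarrow> CC S (\<lambda>t \<xi>. c \<xi> * u t \<xi>)"
 unfolding CC_def by (elim eventually_mono) (intro continuous_intros)

lemma BC_add:
 assumes "BC S u" "BC S v" shows "BC S (\<lambda>t \<xi>. u t \<xi> + v t \<xi>)"
proof -
 obtain \<rho>1 K1 where 1: "jmeas u" "\<rho>1 > 0" "K1 < top" "\<And>t. t \<in> S \<Longrightarrow> Eq \<rho>1 (na (u t)) \<le> K1" using assms by (auto simp: BC_def)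
 obtain \<rho>2 K2 where 2: "jmeas v" "\<rho>2 > 0" "K2 < top" "\<And>t. t \<in> S \<Longrightarrow> Eq \<rho>2 (na (v t)) \<le> K2" using assms by (auto simp: BC_def)
 note [measurable] = 1(1) 2(1)
 define \<rho> where "\<rho> = min \<rho>1 \<rho>2"
 have \<rho>: "\<rho> > 0" "\<rho> \<le> \<rho>1" "\<rho> \<le> \<rho>2" using 1 2 by (auto simp: \<rho>_def)
 have "Eq \<rho> (na (u t \<oplus> v t)) \<le> 2 * K1 + 2 * K2" if t: "t \<in> S" for t
 proof -
  have "Eq \<rho> (na (u t \<oplus> v t)) \<le> Eq \<rho> (na (u t) \<oplus> na (v t))" by (intro Eq_mono na_add)
  also have "... \<le> 2 * Eq \<rho> (na (u t)) + 2 * Eq \<rho> (na (v t))" by (rule Eq_add) measurable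
  also have "... \<le> 2 * K1 + 2 * K2"
   by (intro add_mono mult_left_mono order_trans[OF Eq_mono_rho[OF \<rho>(2)] 1(4)] order_trans[OF Eq_mono_rho[OF \<rho>(3)] 2(4)] t) auto
  finally show ?thesis .
 qed
 moreover have "2 * K1 + 2 * K2 < top" using 1 2 by (simp add: ennreal_mult_less_top)
 moreover have "jmeas (\<lambda>t \<xi>. u t \<xi> + v t \<xi>)" by measurable
 ultimately show ?thesis using \<rho> unfolding BC_def by (intro conjI exI[of _ \<rho>] exI[of _ "2 * K1 + 2 * K2"]) auto
qed

lemma DC_add:
 assumes "DC S u" "DC S v" shows "DC S (\<lambda>t \<xi>. u t \<xi> + v t \<xi>)"
proof -
 obtain \<rho>1 U where 1: "jmeas u" "\<rho>1 > 0" "Borel U" "Eq \<rho>1 U < top" "AE \<xi> in lborel. \<forall>t\<in>S. na (u t) \<xi> \<le> U \<xi>" using assms by (auto simp: DC_def)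
 obtain \<rho>2 V where 2: "jmeas v" "\<rho>2 > 0" "Borel V" "Eq \<rho>2 V < top" "AE \<xi> in lborel. \<forall>t\<in>S. na (v t) \<xi> \<le> V \<xi>" using assms by (auto simp: DC_def)
 note [measurable] = 1(1) 2(1) 1(3) 2(3)
 define \<rho> where "\<rho> = min \<rho>1 \<rho>2"
 have \<rho>: "\<rho> > 0" "\<rho> \<le> \<rho>1" "\<rho> \<le> \<rho>2" using 1 2 by (auto simp: \<rho>_def)
 have "Eq \<rho> (U \<oplus> V) \<le> 2 * Eq \<rho> U + 2 * Eq \<rho> V" by (rule Eq_add) measurable
 also have "... < top"
  using le_less_trans[OF Eq_mono_rho[OF \<rho>(2), of U] 1(4)] le_less_trans[OF Eq_mono_rho[OF \<rho>(3), of V] 2(4)]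
  by (simp add: ennreal_mult_less_top)
 finally have "Eq \<rho> (U \<oplus> V) < top" .
 moreover have "AE \<xi> in lborel. \<forall>t\<in>S. na (u t \<oplus> v t) \<xi> \<le> U \<xi> + V \<xi>"
  using 1(5) 2(5)
 proof eventually_elim
  case (elim \<xi>)
  show ?case
  proof
   fix t assume "t \<in> S"
   then have *: "na (u t) \<xi> + na (v t) \<xi> \<le> U \<xi> + V \<xi>" using elim by (intro add_mono) blast+
   show "na (u t \<oplus> v t) \<xi> \<le> U \<xi> + V \<xi>" by (rule order_trans[OF na_add *])
  qed
 qed
 moreover have "jmeas (\<lambda>t \<xi>. u t \<xi> + v t \<xi>)" "Borel (U \<oplus> V)" by measurable
 ultimately show ?thesis using \<rho> unfolding DC_def by (intro conjI exI[of _ \<rho>] exI[of _ "\<lambda>\<xi>. U \<xi> + V \<xi>"]) auto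
qed

lemma CC_add:
 assumes "CC S u" "CC S v" shows "CC S (\<lambda>t \<xi>. u t \<xi> + v t \<xi>)"
 using assms(1)[unfolded CC_def] assms(2)[unfolded CC_def] unfolding CC_def
 by eventually_elim (intro continuous_intros)

lemma BC_cj:
 assumes "BC S u" shows "BC S (\<lambda>t. cj (u t))"
proof -
 from assms have [measurable]: "jmeas u" by (simp add: BC_def)
 have [measurable]: "Borel (na (u t))" for t by measurable
 have "jmeas (\<lambda>t. cj (u t))" by measurable
 then show ?thesis using assms by (auto simp: BC_def na_cj Eq_rf)
qed

lemma DC_cj:
 assumes "DC S u" shows "DC S (\<lambda>t. cj (u t))"
proof -
 obtain \<rho> V where 1: "jmeas u" "\<rho> > 0" "Borel V" "Eq \<rho> V < top" "AE \<xi> in lborel. \<forall>t\<in>S. na (u t) \<xi> \<le> V \<xi>"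
  using assms by (auto simp: DC_def)
 note [measurable] = 1(1,3)
 have "AE \<xi> in lborel. \<forall>t\<in>S. na (cj (u t)) \<xi> \<le> rf V \<xi>"
  using AE_reflect[OF 1(5)] by eventually_elim (simp add: na_cj rf_def)
 moreover have "jmeas (\<lambda>t. cj (u t))" "Borel (rf V)" by measurable
 moreover have "Eq \<rho> (rf V) < top" using 1(3,4) by (simp add: Eq_rf)
 ultimately show ?thesis using 1(2) unfolding DC_def by blast
qed

lemma CC_cj:
 assumes "CC S u" shows "CC S (\<lambda>t. cj (u t))"
 using AE_reflect[OF assms[unfolded CC_def]] unfolding CC_def cj_def
 by (elim eventually_mono) (intro continuous_intros)

lemma cmod_dh_symbol: "cmod (\<i> * of_real \<xi>) \<le> 1 * jap \<xi> powr 1"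
 using abs_le_jap[of \<xi>] by (simp add: norm_mult)

lemma BC_dh: "BC S u \<Longrightarrow> BC S (\<lambda>t. dh (u t))"
 unfolding dh_def[abs_def] by (rule BC_mult[OF _ _ cmod_dh_symbol]) simp_all
lemma DC_dh: "DC S u \<Longrightarrow> DC S (\<lambda>t. dh (u t))"
 unfolding dh_def[abs_def] by (rule DC_mult[OF _ _ cmod_dh_symbol]) simp_all
lemma CC_dh: "CC S u \<Longrightarrow> CC S (\<lambda>t. dh (u t))"
 unfolding dh_def[abs_def] by (rule CC_mult)

lemma BC_PC: "BC S a \<Longrightarrow> BC S (\<lambda>t. PC (a t) k)"
 by (induction k) (auto intro!: BC_conv BC_cj)

lemma DC_PC: "DC S a \<Longrightarrow> DC S (\<lambda>t. PC (a t) k)"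
 by (induction k) (auto intro!: DC_conv DC_cj)

lemma CC_PC: "DC S a \<Longrightarrow> CC S a \<Longrightarrow> CC S (\<lambda>t. PC (a t) k)"
 by (induction k) (auto intro!: CC_conv CC_cj DC_conv DC_cj DC_PC)

lemma BC_cmult: "BC S u \<Longrightarrow> BC S (\<lambda>t \<xi>. c * u t \<xi>)"
 by (rule BC_mult[where C="cmod c" and p=0]) simp_all
lemma DC_cmult: "DC S u \<Longrightarrow> DC S (\<lambda>t \<xi>. c * u t \<xi>)"
 by (rule DC_mult[where C="cmod c" and p=0]) simp_all

lemma BC_N:
 assumes "BC S p" "BC S a"
 shows "BC S (\<lambda>t. NP \<alpha> \<beta> g s (p t) (a t))" "BC S (\<lambda>t. NA \<alpha> g (p t) (a t))"
 unfolding NP_def[abs_def] NA_def[abs_def] by (intro BC_add BC_cmult BC_conv BC_dh BC_PC assms)+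

lemma DC_N:
 assumes "DC S p" "DC S a"
 shows "DC S (\<lambda>t. NP \<alpha> \<beta> g s (p t) (a t))" "DC S (\<lambda>t. NA \<alpha> g (p t) (a t))"
 unfolding NP_def[abs_def] NA_def[abs_def] by (intro DC_add DC_cmult DC_conv DC_dh DC_PC assms)+

lemma CC_N:
 assumes "DC S p" "DC S a" "CC S p" "CC S a"
 shows "CC S (\<lambda>t. NP \<alpha> \<beta> g s (p t) (a t))" "CC S (\<lambda>t. NA \<alpha> g (p t) (a t))"
 unfolding NP_def[abs_def] NA_def[abs_def] by (intro CC_add CC_mult CC_conv CC_dh CC_PC DC_conv DC_dh DC_PC assms)+

text \<open>The time-independent case, expressed by \<open>BC\<close> on a singleton so that the
  closure properties are inherited.\<close>

definition WC :: "cfun \<Rightarrow> bool" where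
 "WC h \<longleftrightarrow> BC {0} (\<lambda>_. h)"

lemma WC_iff: "WC h \<longleftrightarrow> Borel h \<and> (\<exists>\<rho>>0. Eq \<rho> (na h) < top)"
proof -
 have "jmeas (\<lambda>_. h)" if [measurable]: "Borel h" by measurable
 then have "jmeas (\<lambda>_. h) \<longleftrightarrow> Borel h"
  using section_meas[of "\<lambda>_. h" 0] by blast
 then show ?thesis unfolding WC_def BC_def by (auto intro: le_less_trans)
qed

lemma BC_WC: "BC S u \<Longrightarrow> t \<in> S \<Longrightarrow> WC (u t)"
 unfolding WC_iff by (auto simp: BC_def section_meas intro: le_less_trans)

lemma WC_conv: "WC h \<Longrightarrow> WC k \<Longrightarrow> WC (conv h k)"
 unfolding WC_def by (rule BC_conv)
lemma WC_dh: "WC h \<Longrightarrow> WC (dh h)"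
 unfolding WC_def by (rule BC_dh)
lemma WC_cj: "WC h \<Longrightarrow> WC (cj h)"
 unfolding WC_def by (rule BC_cj)
lemma WC_PC: "WC h \<Longrightarrow> WC (PC h n)"
 unfolding WC_def by (rule BC_PC)
lemma WC_cmult: "WC h \<Longrightarrow> WC (\<lambda>\<xi>. c * h \<xi>)"
 unfolding WC_def by (rule BC_cmult)
lemma WC_add: "WC h \<Longrightarrow> WC k \<Longrightarrow> WC (h \<oplus> k)"
 unfolding WC_def by (rule BC_add)

lemma WC_measurable: "WC h \<Longrightarrow> Borel h"
 by (simp add: WC_iff)

lemma WC_integrable: "WC h \<Longrightarrow> integrable lborel h"
proof -
 assume "WC h"
 then obtain \<rho> where h: "Borel h" "\<rho> > 0" "Eq \<rho> (na h) < top" by (auto simp: WC_iff)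
 note [measurable] = h(1)
 have "(\<integral>\<^sup>+\<xi>. na h \<xi> \<partial>lborel) < top" by (rule Eq_integrable(2)[OF _ h(3,2)]) measurable
 then show ?thesis using h(1) by (simp add: integrable_iff_bounded na_def)
qed

lemma WC_L2: "WC h \<Longrightarrow> h \<in> L2"
proof -
 assume "WC h"
 then obtain \<rho> where h: "Borel h" "\<rho> > 0" "Eq \<rho> (na h) < top" by (auto simp: WC_iff)
 have "n2 h = Eq 0 (na h)" by (simp add: n2_def Eq_def na_def ennreal_power)
 also have "... \<le> Eq \<rho> (na h)" using h by (intro Eq_mono_rho) auto
 finally show ?thesis using h by (auto simp: L2_iff intro: le_less_trans)
qed

lemma DC_dominated:
 assumes "DC S u" obtains w where "integrable lborel w" "AE \<xi> in lborel. \<forall>t\<in>S. cmod (u t \<xi>) \<le> w \<xi>"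
proof -
 obtain \<rho> V where 1: "jmeas u" "\<rho> > 0" "Borel V" "Eq \<rho> V < top" "AE \<xi> in lborel. \<forall>t\<in>S. na (u t) \<xi> \<le> V \<xi>"
  using assms by (auto simp: DC_def)
 have "AE \<xi> in lborel. \<forall>t\<in>S. cmod (u t \<xi>) \<le> enn2real (V \<xi>)"
  using 1(5) Eq_AE_finite[OF 1(3,4)]
 proof eventually_elim
  case (elim \<xi>)
  show ?case
  proof
   fix t assume "t \<in> S"
   then have "enn2real (ennreal (cmod (u t \<xi>))) \<le> enn2real (V \<xi>)"
    using elim by (intro enn2real_mono) (auto simp: na_def)
   then show "cmod (u t \<xi>) \<le> enn2real (V \<xi>)" by simp
  qed
 qed
 then show thesis using Eq_integrable(1)[OF 1(3,4,2)] that by blast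
qed

section \<open>Classical solutions from the Fourier side\<close>

abbreviation spectral_ode where
 "spectral_ode \<alpha> \<beta> g s \<epsilon> T p a \<xi> \<equiv> \<forall>t\<in>{0..T}.
   ((\<lambda>r. p r \<xi>) has_vector_derivative NP \<alpha> \<beta> g s (p t) (a t) \<xi>) (at t within {0..T}) \<and>
   ((\<lambda>r. a r \<xi>) has_vector_derivative (NA \<alpha> g (p t) (a t) \<xi> - \<i> * of_real (\<epsilon> * \<xi>\<^sup>2 / 2) * a t \<xi>)) (at t within {0..T})"

text \<open>Solutions on the Fourier side. The exceptional null set of frequencies is the same for
  all times, so that at almost every frequency there is a genuine differential equation on the whole
  interval.\<close>

definition FS :: "real \<Rightarrow> real \<Rightarrow> nat \<Rightarrow> nat \<Rightarrow> real \<Rightarrow> real \<Rightarrow> cpath \<Rightarrow> cpath \<Rightarrow> bool" where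
 "FS \<alpha> \<beta> g s \<epsilon> T p a \<longleftrightarrow> DC {0..T} p \<and> CC {0..T} p \<and> DC {0..T} a \<and> CC {0..T} a \<and>
  (AE \<xi> in lborel. spectral_ode \<alpha> \<beta> g s \<epsilon> T p a \<xi>)"

lemma IF_deriv_WC:
 assumes "WC h"
 shows "(IF h has_vector_derivative IF (dh h) x) (at x)" "vector_derivative (IF h) (at x) = IF (dh h) x" "IF h differentiable (at x)"
proof -
 show *: "(IF h has_vector_derivative IF (dh h) x) (at x)"
  by (intro has_vector_derivative_IF_space WC_integrable WC_dh assms)
 then show "vector_derivative (IF h) (at x) = IF (dh h) x" by (rule vector_derivative_at)
 show "IF h differentiable (at x)" using * by (rule differentiableI_vector)
qed

lemma Dx_IF: "WC (u t) \<Longrightarrow> Dx (\<lambda>t. IF (u t)) t = IF (dh (u t))"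
 by (simp add: Dx_def fun_eq_iff IF_deriv_WC)

lemma IF_PC: "WC a \<Longrightarrow> IF (PC a k) x = of_real (((cmod (IF a x))\<^sup>2) ^ Suc k)"
proof (induction k)
 case 0
 have "IF (PC a 0) x = IF a x * cnj (IF a x)"
  using 0 by (simp add: IF_conv WC_integrable WC_cj IF_cj)
 then show ?case by (simp add: complex_norm_square del: of_real_power)
next
 case (Suc k)
 have "IF (PC a (Suc k)) x = IF (conv a (cj a)) x * IF (PC a k) x"
  using Suc by (simp add: IF_conv WC_integrable WC_cj WC_conv WC_PC)
 also have "IF (conv a (cj a)) x = of_real ((cmod (IF a x))\<^sup>2)"
  using Suc by (simp add: IF_conv WC_integrable WC_cj IF_cj complex_norm_square del: of_real_power)
 finally show ?case using Suc by simp
qed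

lemma IF_NP:
 assumes p: "WC p" and a: "WC a"
 shows "IF (NP \<alpha> \<beta> g s p a) x = - (1/2 * (IF (dh p) x)\<^sup>2 + 1/2 * of_real (power_nl \<alpha> (Suc g) ((cmod (IF a x))\<^sup>2)) * IF (dh p) x
   + of_real (power_nl \<beta> (Suc s) ((cmod (IF a x))\<^sup>2)))"
proof -
 note W = WC_conv WC_dh WC_PC WC_cmult WC_add p a
 have 1: "WC (\<lambda>\<xi>. of_real (-1/2) * conv (dh p) (dh p) \<xi>)" "WC (\<lambda>\<xi>. of_real (-\<alpha>/2) * conv (PC a g) (dh p) \<xi>)"
  "WC (\<lambda>\<xi>. of_real (-\<beta>) * PC a s \<xi>)"
  by (intro W)+
 have "IF (NP \<alpha> \<beta> g s p a) x = of_real (-1/2) * IF (conv (dh p) (dh p)) x + of_real (-\<alpha>/2) * IF (conv (PC a g) (dh p)) x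
   + of_real (-\<beta>) * IF (PC a s) x"
  unfolding NP_def[abs_def]
  by (subst IF_add, intro WC_integrable WC_add 1, intro WC_integrable 1, subst IF_add, intro WC_integrable 1, intro WC_integrable 1)
    (simp only: IF_cmult)
 also have "IF (conv (dh p) (dh p)) x = (IF (dh p) x)\<^sup>2"
  using p by (simp add: IF_conv WC_integrable WC_dh power2_eq_square)
 also have "IF (conv (PC a g) (dh p)) x = IF (PC a g) x * IF (dh p) x"
  using p a by (simp add: IF_conv WC_integrable WC_dh WC_PC)
 finally show ?thesis
  using a by (simp add: IF_PC power_nl_def algebra_simps)
qed

lemma IF_NA:
 assumes p: "WC p" and a: "WC a"
 shows "IF (NA \<alpha> g p a) x = - (IF (dh p) x * IF (dh a) x + 1/2 * IF a x * IF (dh (dh p)) x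
   + 1/2 * IF (dh (\<lambda>\<xi>. of_real \<alpha> * conv (PC a g) a \<xi>)) x)"
proof -
 note W = WC_conv WC_dh WC_PC WC_cmult WC_add p a
 have 1: "WC (\<lambda>\<xi>. of_real (-1) * conv (dh p) (dh a) \<xi>)" "WC (\<lambda>\<xi>. of_real (-1/2) * conv a (dh (dh p)) \<xi>)"
  "WC (\<lambda>\<xi>. of_real (-\<alpha>/2) * dh (conv (PC a g) a) \<xi>)"
  by (intro W)+
 have "IF (NA \<alpha> g p a) x = of_real (-1) * IF (conv (dh p) (dh a)) x + of_real (-1/2) * IF (conv a (dh (dh p))) x
   + of_real (-\<alpha>/2) * IF (dh (conv (PC a g) a)) x"
  unfolding NA_def[abs_def]
  by (subst IF_add, intro WC_integrable WC_add 1, intro WC_integrable 1, subst IF_add, intro WC_integrable 1, intro WC_integrable 1)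
    (simp only: IF_cmult)
 also have "IF (conv (dh p) (dh a)) x = IF (dh p) x * IF (dh a) x"
  using p a by (simp add: IF_conv WC_integrable WC_dh)
 also have "IF (conv a (dh (dh p))) x = IF a x * IF (dh (dh p)) x"
  using p a by (simp add: IF_conv WC_integrable WC_dh)
 also have "of_real (-\<alpha>/2) * IF (dh (conv (PC a g) a)) x = of_real (-1/2) * IF (dh (\<lambda>\<xi>. of_real \<alpha> * conv (PC a g) a \<xi>)) x"
 proof -
  have "dh (\<lambda>\<xi>. of_real \<alpha> * conv (PC a g) a \<xi>) = (\<lambda>\<xi>. of_real \<alpha> * dh (conv (PC a g) a) \<xi>)"
   by (simp add: dh_def fun_eq_iff)
  then show ?thesis by (simp add: IF_cmult)
 qed
 finally show ?thesis by (simp add: algebra_simps)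
qed

lemma g_term_IF:
 assumes "WC a"
 shows "(\<lambda>x. of_real (power_nl \<alpha> (Suc g) ((cmod (IF a x))\<^sup>2)) * IF a x) = IF (\<lambda>\<xi>. of_real \<alpha> * conv (PC a g) a \<xi>)"
proof
 fix x
 have "IF (\<lambda>\<xi>. of_real \<alpha> * conv (PC a g) a \<xi>) x = of_real \<alpha> * (IF (PC a g) x * IF a x)"
  using assms by (simp add: IF_cmult IF_conv WC_integrable WC_PC)
 then show "of_real (power_nl \<alpha> (Suc g) ((cmod (IF a x))\<^sup>2)) * IF a x = IF (\<lambda>\<xi>. of_real \<alpha> * conv (PC a g) a \<xi>) x"
  using assms by (simp add: IF_PC power_nl_def)
qed

lemma IF_schroedinger:
 assumes "WC a" and that: "WC p"
 shows "IF (\<lambda>\<xi>. NA \<alpha> g p a \<xi> - \<i> * of_real (\<epsilon> * \<xi>\<^sup>2 / 2) * a \<xi>) x = IF (NA \<alpha> g p a) x + \<i> * of_real \<epsilon> / 2 * IF (dh (dh a)) x"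
proof -
 have e: "(\<lambda>\<xi>. NA \<alpha> g p a \<xi> - \<i> * of_real (\<epsilon> * \<xi>\<^sup>2 / 2) * a \<xi>) = (\<lambda>\<xi>. NA \<alpha> g p a \<xi> + \<i> * of_real \<epsilon> / 2 * dh (dh a) \<xi>)"
  by (auto simp: dh_def fun_eq_iff power2_eq_square field_simps)
 have N: "WC (NA \<alpha> g p a)"
  unfolding NA_def[abs_def] by (intro WC_conv WC_dh WC_PC WC_cmult WC_add assms that)
 have "WC (\<lambda>\<xi>. \<i> * of_real \<epsilon> / 2 * dh (dh a) \<xi>)" by (intro WC_cmult WC_dh assms)
 then have "IF (\<lambda>\<xi>. NA \<alpha> g p a \<xi> + \<i> * of_real \<epsilon> / 2 * dh (dh a) \<xi>) x = IF (NA \<alpha> g p a) x + IF (\<lambda>\<xi>. \<i> * of_real \<epsilon> / 2 * dh (dh a) \<xi>) x"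
  by (intro IF_add WC_integrable N)
 then show ?thesis unfolding e IF_cmult .
qed

text \<open>Differentiation under the inverse transform. The right-hand sides, including the term
  with \<open>\<epsilon> * \<xi>^2 / 2\<close>, remain in \<open>DC\<close> and hence have an
  integrable bound independent of time.\<close>

lemma FS_time_deriv:
 assumes F: "FS \<alpha> \<beta> g s \<epsilon> T p a" and t: "t \<in> {0..T}"
 shows "((\<lambda>t. IF (p t) x) has_vector_derivative IF (NP \<alpha> \<beta> g s (p t) (a t)) x) (at t within {0..T})"
  and "((\<lambda>t. IF (a t) x) has_vector_derivative IF (\<lambda>\<xi>. NA \<alpha> g (p t) (a t) \<xi> - \<i> * of_real (\<epsilon> * \<xi>\<^sup>2 / 2) * a t \<xi>) x) (at t within {0..T})"
proof -
 have D: "DC {0..T} p" "DC {0..T} a" using F by (auto simp: FS_def)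
 have ode: "AE \<xi> in lborel. spectral_ode \<alpha> \<beta> g s \<epsilon> T p a \<xi>"
  using F by (simp add: FS_def)
 have i: "integrable lborel (p t)" "integrable lborel (a t)" if "t \<in> {0..T}" for t
  using that D by (auto intro!: WC_integrable BC_WC DC_BC)
 have N: "DC {0..T} (\<lambda>t. NP \<alpha> \<beta> g s (p t) (a t))" by (rule DC_N[OF D])
 have "DC {0..T} (\<lambda>t \<xi>. NA \<alpha> g (p t) (a t) \<xi> + (- \<i> * of_real (\<epsilon> * \<xi>\<^sup>2 / 2)) * a t \<xi>)"
 proof (intro DC_add DC_N D)
  show "DC {0..T} (\<lambda>t \<xi>. (- \<i> * of_real (\<epsilon> * \<xi>\<^sup>2 / 2)) * a t \<xi>)"
  proof (rule DC_mult[OF D(2), where C="\<bar>\<epsilon>\<bar>" and p=2])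
   fix \<xi>
   have "\<xi>\<^sup>2 \<le> 2 * (jap \<xi>)\<^sup>2" by (simp add: jap_sq)
   then have "\<bar>\<epsilon>\<bar> * (\<xi>\<^sup>2 / 2) \<le> \<bar>\<epsilon>\<bar> * (jap \<xi>)\<^sup>2" by (intro mult_left_mono) auto
   then show "cmod (- \<i> * of_real (\<epsilon> * \<xi>\<^sup>2 / 2)) \<le> \<bar>\<epsilon>\<bar> * jap \<xi> powr 2"
    by (simp add: norm_mult norm_divide norm_power)
  qed auto
 qed
 then have N2: "DC {0..T} (\<lambda>t \<xi>. NA \<alpha> g (p t) (a t) \<xi> - \<i> * of_real (\<epsilon> * \<xi>\<^sup>2 / 2) * a t \<xi>)" by simp
 obtain w where w: "integrable lborel w" "AE \<xi> in lborel. \<forall>t\<in>{0..T}. cmod (NP \<alpha> \<beta> g s (p t) (a t) \<xi>) \<le> w \<xi>"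
  using DC_dominated[OF N] by blast
 show "((\<lambda>t. IF (p t) x) has_vector_derivative IF (NP \<alpha> \<beta> g s (p t) (a t)) x) (at t within {0..T})"
 proof (rule has_vector_derivative_IF_time[OF t i(1) _ w(1)])
  show "AE \<xi> in lborel. \<forall>t\<in>{0..T}. ((\<lambda>t. p t \<xi>) has_vector_derivative NP \<alpha> \<beta> g s (p t) (a t) \<xi>) (at t within {0..T}) \<and> cmod (NP \<alpha> \<beta> g s (p t) (a t) \<xi>) \<le> w \<xi>"
   using ode w(2) by eventually_elim blast
  show "Borel (NP \<alpha> \<beta> g s (p t) (a t))"
   using BC_WC[OF DC_BC[OF N] t] by (rule WC_measurable)
 qed
 obtain w2 where w2: "integrable lborel w2" "AE \<xi> in lborel. \<forall>t\<in>{0..T}. cmod (NA \<alpha> g (p t) (a t) \<xi> - \<i> * of_real (\<epsilon> * \<xi>\<^sup>2 / 2) * a t \<xi>) \<le> w2 \<xi>"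
  using DC_dominated[OF N2] by blast
 show "((\<lambda>t. IF (a t) x) has_vector_derivative IF (\<lambda>\<xi>. NA \<alpha> g (p t) (a t) \<xi> - \<i> * of_real (\<epsilon> * \<xi>\<^sup>2 / 2) * a t \<xi>) x) (at t within {0..T})"
 proof (rule has_vector_derivative_IF_time[OF t i(2) _ w2(1)])
  show "AE \<xi> in lborel. \<forall>t\<in>{0..T}. ((\<lambda>t. a t \<xi>) has_vector_derivative NA \<alpha> g (p t) (a t) \<xi> - \<i> * of_real (\<epsilon> * \<xi>\<^sup>2 / 2) * a t \<xi>) (at t within {0..T})
    \<and> cmod (NA \<alpha> g (p t) (a t) \<xi> - \<i> * of_real (\<epsilon> * \<xi>\<^sup>2 / 2) * a t \<xi>) \<le> w2 \<xi>"
   using ode w2(2) by eventually_elim blast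
  show "Borel (\<lambda>\<xi>. NA \<alpha> g (p t) (a t) \<xi> - \<i> * of_real (\<epsilon> * \<xi>\<^sup>2 / 2) * a t \<xi>)"
   using BC_WC[OF DC_BC[OF N2] t] by (rule WC_measurable)
 qed
qed

theorem FS_solves_system:
 assumes T: "T > 0" and F: "FS \<alpha> \<beta> g s \<epsilon> T p a"
 shows "solves_system (power_nl \<alpha> (Suc g)) (power_nl \<beta> (Suc s)) \<epsilon> T (\<lambda>t. IF (p t)) (\<lambda>t. IF (a t))"
 unfolding solves_system_def
proof (intro ballI allI)
 fix t x assume t: "t \<in> {0..T}"
 have p: "WC (p t)" and a: "WC (a t)" using F t by (auto simp: FS_def intro: BC_WC DC_BC)
 note d = FS_time_deriv[OF F t, of x]
 have Dp: "Dx (\<lambda>t. IF (p t)) t = IF (dh (p t))" "Dx (\<lambda>t. IF (a t)) t = IF (dh (a t))"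
  using p a by (auto intro: Dx_IF)
 have DDp: "Dx (Dx (\<lambda>t. IF (p t))) t x = IF (dh (dh (p t))) x" "Dx (Dx (\<lambda>t. IF (a t))) t x = IF (dh (dh (a t))) x"
  unfolding Dx_def[of "Dx (\<lambda>t. IF (p t))"] Dx_def[of "Dx (\<lambda>t. IF (a t))"] Dp using p a by (auto intro: IF_deriv_WC WC_dh)
 have Dg: "Dx (\<lambda>t x. of_real (power_nl \<alpha> (Suc g) ((cmod (IF (a t) x))\<^sup>2)) * IF (a t) x) t x = IF (dh (\<lambda>\<xi>. of_real \<alpha> * conv (PC (a t) g) (a t) \<xi>)) x"
  unfolding Dx_def g_term_IF[OF a] by (intro IF_deriv_WC WC_cmult WC_conv WC_PC a)
 have Dt: "Dt T (\<lambda>t. IF (p t)) t x = IF (NP \<alpha> \<beta> g s (p t) (a t)) x"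
  "Dt T (\<lambda>t. IF (a t)) t x = IF (\<lambda>\<xi>. NA \<alpha> g (p t) (a t) \<xi> - \<i> * of_real (\<epsilon> * \<xi>\<^sup>2 / 2) * a t \<xi>) x"
  unfolding Dt_def using vector_derivative_within_closed_interval[OF T t d(1)] vector_derivative_within_closed_interval[OF T t d(2)] by auto
 have e1: "Dt T (\<lambda>t. IF (p t)) t x + 1/2 * (Dx (\<lambda>t. IF (p t)) t x)\<^sup>2
    + 1/2 * of_real (power_nl \<alpha> (Suc g) ((cmod (IF (a t) x))\<^sup>2)) * Dx (\<lambda>t. IF (p t)) t x
    + of_real (power_nl \<beta> (Suc s) ((cmod (IF (a t) x))\<^sup>2)) = 0"
  unfolding Dt Dp IF_NP[OF p a] by simp
 have e2: "Dt T (\<lambda>t. IF (a t)) t x + Dx (\<lambda>t. IF (p t)) t x * Dx (\<lambda>t. IF (a t)) t x + 1/2 * IF (a t) x * Dx (Dx (\<lambda>t. IF (p t))) t x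
    + 1/2 * Dx (\<lambda>t x. of_real (power_nl \<alpha> (Suc g) ((cmod (IF (a t) x))\<^sup>2)) * IF (a t) x) t x
    = \<i> * of_real \<epsilon> / 2 * Dx (Dx (\<lambda>t. IF (a t))) t x"
  unfolding Dt Dp DDp Dg IF_schroedinger[OF a p] IF_NA[OF p a] by simp
 show "(\<lambda>s. IF (p s) x) differentiable (at t within {0..T}) \<and>
   (\<lambda>s. IF (a s) x) differentiable (at t within {0..T}) \<and>
   IF (p t) differentiable (at x) \<and> Dx (\<lambda>t. IF (p t)) t differentiable (at x) \<and>
   IF (a t) differentiable (at x) \<and> Dx (\<lambda>t. IF (a t)) t differentiable (at x) \<and>
   Dt T (\<lambda>t. IF (p t)) t x + 1/2 * (Dx (\<lambda>t. IF (p t)) t x)\<^sup>2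
    + 1/2 * of_real (power_nl \<alpha> (Suc g) ((cmod (IF (a t) x))\<^sup>2)) * Dx (\<lambda>t. IF (p t)) t x
    + of_real (power_nl \<beta> (Suc s) ((cmod (IF (a t) x))\<^sup>2)) = 0 \<and>
   Dt T (\<lambda>t. IF (a t)) t x + Dx (\<lambda>t. IF (p t)) t x * Dx (\<lambda>t. IF (a t)) t x + 1/2 * IF (a t) x * Dx (Dx (\<lambda>t. IF (p t))) t x
    + 1/2 * Dx (\<lambda>t x. of_real (power_nl \<alpha> (Suc g) ((cmod (IF (a t) x))\<^sup>2)) * IF (a t) x) t x
    = \<i> * of_real \<epsilon> / 2 * Dx (Dx (\<lambda>t. IF (a t))) t x"
  using d(1)[THEN differentiableI_vector] d(2)[THEN differentiableI_vector] e1 e2 p a unfolding Dp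
  by (intro conjI) (auto intro: IF_deriv_WC(3) WC_dh)
qed

section \<open>From Duhamel's formula to the differential equation\<close>

lemma Ds_has_vector_derivative:
 assumes F: "continuous_on {0..T} F" and t: "t \<in> {0..T}"
 shows "(Ds \<kappa> F has_vector_derivative exp (\<i> * of_real (\<kappa> * t)) * F t) (at t within {0..T})"
proof -
 let ?f = "\<lambda>s. exp (\<i> * of_real (\<kappa> * s)) * F s"
 have cf: "continuous_on {0..T} ?f" by (intro continuous_intros F)
 have "Ds \<kappa> F r = integral {0..r} ?f" if "r \<in> {0..T}" for r
 proof -
  have "continuous_on {0..r} ?f" using cf that by (auto intro: continuous_on_subset)
  then have "set_integrable lborel {0..r} ?f" unfolding set_integrable_def by (intro borel_integrable_compact) auto
  then show ?thesis using set_borel_integral_eq_integral(2)[of "{0..r}" ?f] by (simp add: Ds_def set_lebesgue_integral_def)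
 qed
 moreover have "((\<lambda>r. integral {0..r} ?f) has_vector_derivative ?f t) (at t within {0..T})"
  by (rule integral_has_vector_derivative[OF cf t])
 ultimately show ?thesis
  using has_vector_derivative_transform[OF t, of "Ds \<kappa> F" "\<lambda>r. integral {0..r} ?f"] by blast
qed

lemma duh_has_vector_derivative:
 assumes F: "continuous_on {0..T} F" and t: "t \<in> {0..T}"
 shows "(duh \<kappa> y F has_vector_derivative F t - \<i> * of_real \<kappa> * duh \<kappa> y F t) (at t within {0..T})"
proof -
 have "((\<lambda>z. exp (- \<i> * (of_real \<kappa> * z))) has_field_derivative exp (- \<i> * (of_real \<kappa> * of_real t)) * (- \<i> * of_real \<kappa>)) (at (of_real t))"
  by (auto intro!: derivative_eq_intros)
 from has_vector_derivative_at_within[OF has_vector_derivative_real_field[OF this]]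
 have e: "((\<lambda>t. exp (- \<i> * of_real (\<kappa> * t))) has_vector_derivative exp (- \<i> * of_real (\<kappa> * t)) * (- \<i> * of_real \<kappa>)) (at t within {0..T})"
  by simp
 have D: "((\<lambda>t. y + Ds \<kappa> F t) has_vector_derivative 0 + exp (\<i> * of_real (\<kappa> * t)) * F t) (at t within {0..T})"
  by (intro has_vector_derivative_add has_vector_derivative_const Ds_has_vector_derivative F t)
 have "exp (- \<i> * of_real (\<kappa> * t)) * exp (\<i> * of_real (\<kappa> * t)) = 1"
  by (simp add: exp_add[symmetric])
 then have s: "exp (- \<i> * of_real (\<kappa> * t)) * (0 + exp (\<i> * of_real (\<kappa> * t)) * F t)
   + exp (- \<i> * of_real (\<kappa> * t)) * (- \<i> * of_real \<kappa>) * (y + Ds \<kappa> F t) = F t - \<i> * of_real \<kappa> * duh \<kappa> y F t"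
  by (simp add: duh_def mult.assoc[symmetric] del: mult_minus_left)
 show ?thesis
  using has_vector_derivative_mult[OF e D] unfolding s by (simp add: duh_def[abs_def])
qed

lemma duh_continuous:
 assumes [measurable]: "Borel F" and b: "\<And>t. t \<in> {0..T} \<Longrightarrow> cmod (F t) \<le> B"
 shows "continuous_on {0..T} (duh \<kappa> y F)"
proof -
 let ?f = "\<lambda>s. exp (\<i> * of_real (\<kappa> * s)) * F s"
 have si: "set_integrable lborel {0..r} ?f" if "r \<in> {0..T}" for r
  unfolding set_integrable_def
 proof (rule Bochner_Integration.integrable_bound[of lborel "\<lambda>s. indicator {0..r} s * B"])
  show "integrable lborel (\<lambda>s. indicator {0..r} s * B)"
   by (intro integrable_mult_left integrable_real_indicator) (auto simp: emeasure_lborel_Icc_eq)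
  show "AE s in lborel. norm (indicator {0..r} s *\<^sub>R ?f s) \<le> norm (indicator {0..r} s * B)"
   using that b by (intro AE_I2) (auto simp: indicator_def norm_mult intro: order_trans[OF _ abs_ge_self])
  show "(\<lambda>s. indicator {0..r} s *\<^sub>R ?f s) \<in> borel_measurable lborel" by measurable
 qed
 have eq: "Ds \<kappa> F r = integral {0..r} ?f" if "r \<in> {0..T}" for r
  using set_borel_integral_eq_integral(2)[OF si[OF that]] by (simp add: Ds_def set_lebesgue_integral_def)
 have "continuous_on {0..T} (\<lambda>r. integral {0..r} ?f)"
 proof (cases "T \<ge> 0")
  case True
  then show ?thesis using set_borel_integral_eq_integral(1)[OF si[of T]] by (intro indefinite_integral_continuous_1) auto
 qed auto
 then have "continuous_on {0..T} (Ds \<kappa> F)" by (rule continuous_on_eq) (simp add: eq)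
 then show ?thesis unfolding duh_def[abs_def] by (intro continuous_intros)
qed

text \<open>A positive lower bound \<open>\<rho>\<close> of all weights converts the majorant for
  the time-dependent weights into the fixed bound
  \<open>exp (- \<rho> * jap \<xi>) * V \<xi>\<close> of the unweighted moduli.\<close>

lemma DC_of_majorant:
 assumes "jmeas u" and [measurable]: "Borel V" and l: "l \<ge> 0" "Nsq l V < top"
  and \<rho>: "\<rho> > 0" "\<And>t. t \<in> S \<Longrightarrow> \<rho> \<le> w t" and dom: "\<And>t \<xi>. t \<in> S \<Longrightarrow> em (w t) (u t) \<xi> \<le> V \<xi>"
 shows "DC S u"
proof -
 let ?V = "\<lambda>\<xi>. ennreal (exp (- \<rho> * jap \<xi>)) * V \<xi>"
 have "Eq \<rho> ?V = Nsq 0 V"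
  unfolding Eq_def Nsq_def by (simp add: mult.assoc[symmetric] exp_add[symmetric] flip: ennreal_mult)
 also have "... \<le> Nsq l V" by (rule Nsq_mono_p[OF l(1)])
 finally have "Eq \<rho> ?V < top" using l(2) by simp
 moreover have "AE \<xi> in lborel. \<forall>t\<in>S. na (u t) \<xi> \<le> ?V \<xi>"
 proof (intro AE_I2 ballI)
  fix \<xi> t assume t: "t \<in> S"
  have "cmod (u t \<xi>) \<le> exp (- \<rho> * jap \<xi>) * (exp (w t * jap \<xi>) * cmod (u t \<xi>))"
   using mult_right_mono[OF \<rho>(2)[OF t] jap_nonneg[of \<xi>]]
   by (simp add: mult.assoc[symmetric] exp_add[symmetric] mult_le_cancel_right1)
  then have "na (u t) \<xi> \<le> ennreal (exp (- \<rho> * jap \<xi>)) * em (w t) (u t) \<xi>"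
   by (simp add: na_def em_def ennreal_leI flip: ennreal_mult)
  also have "... \<le> ?V \<xi>" by (intro mult_left_mono dom t) auto
  finally show "na (u t) \<xi> \<le> ?V \<xi>" .
 qed
 moreover have "Borel (?V)" by measurable
 ultimately show ?thesis using \<rho>(1) assms(1) unfolding DC_def by blast
qed

text \<open>Regularity in time is gained twice: domination of the nonlinearities makes the solution
  continuous in time, this makes the nonlinearities continuous by \<open>CC_N\<close>, and then
  Duhamel's formula can be differentiated.\<close>

lemma FS_of_duhamel:
 assumes D: "DC {0..T} p" "DC {0..T} a"
  and eqs: "AE \<xi> in lborel. duhamel \<alpha> \<beta> g s \<epsilon> T p0 a0 p a \<xi>"
 shows "FS \<alpha> \<beta> g s \<epsilon> T p a"
proof -
 have [measurable]: "jmeas p" "jmeas a" using D by (auto simp: DC_def)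
 obtain w where w: "integrable lborel w" "AE \<xi> in lborel. \<forall>t\<in>{0..T}. cmod (NP \<alpha> \<beta> g s (p t) (a t) \<xi>) \<le> w \<xi>"
  using DC_dominated[OF DC_N(1)[OF D]] by blast
 obtain w2 where w2: "integrable lborel w2" "AE \<xi> in lborel. \<forall>t\<in>{0..T}. cmod (NA \<alpha> g (p t) (a t) \<xi>) \<le> w2 \<xi>"
  using DC_dominated[OF DC_N(2)[OF D]] by blast
 have cp: "CC {0..T} p"
  unfolding CC_def using eqs w(2)
 proof eventually_elim
  case (elim \<xi>)
  have "continuous_on {0..T} (duh 0 (p0 \<xi>) (\<lambda>r. NP \<alpha> \<beta> g s (p r) (a r) \<xi>))"
   by (rule duh_continuous[where B="w \<xi>"]) (use elim in auto)
  then show ?case by (rule continuous_on_eq) (use elim in auto)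
 qed
 have ca: "CC {0..T} a"
  unfolding CC_def using eqs w2(2)
 proof eventually_elim
  case (elim \<xi>)
  have "continuous_on {0..T} (duh (\<epsilon> * \<xi>\<^sup>2 / 2) (a0 \<xi>) (\<lambda>r. NA \<alpha> g (p r) (a r) \<xi>))"
   by (rule duh_continuous[where B="w2 \<xi>"]) (use elim in auto)
  then show ?case by (rule continuous_on_eq) (use elim in auto)
 qed
 have "AE \<xi> in lborel. spectral_ode \<alpha> \<beta> g s \<epsilon> T p a \<xi>"
  using eqs CC_N(1)[where \<alpha>=\<alpha> and \<beta>=\<beta> and g=g and s=s, OF D cp ca, unfolded CC_def]
   CC_N(2)[where \<alpha>=\<alpha> and g=g, OF D cp ca, unfolded CC_def]
 proof eventually_elim
  case (elim \<xi>)
  show ?case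
  proof (intro ballI conjI)
   fix t assume t: "t \<in> {0..T}"
   have 1: "(duh 0 (p0 \<xi>) (\<lambda>r. NP \<alpha> \<beta> g s (p r) (a r) \<xi>) has_vector_derivative NP \<alpha> \<beta> g s (p t) (a t) \<xi>) (at t within {0..T})"
    using duh_has_vector_derivative[OF elim(2) t, of 0 "p0 \<xi>"] by simp
   show "((\<lambda>r. p r \<xi>) has_vector_derivative NP \<alpha> \<beta> g s (p t) (a t) \<xi>) (at t within {0..T})"
    by (rule has_vector_derivative_transform[OF t _ 1]) (use elim(1) in auto)
   have 2: "(duh (\<epsilon> * \<xi>\<^sup>2 / 2) (a0 \<xi>) (\<lambda>r. NA \<alpha> g (p r) (a r) \<xi>) has_vector_derivative NA \<alpha> g (p t) (a t) \<xi> - \<i> * of_real (\<epsilon> * \<xi>\<^sup>2 / 2) * a t \<xi>) (at t within {0..T})"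
    using duh_has_vector_derivative[OF elim(3) t, of "\<epsilon> * \<xi>\<^sup>2 / 2" "a0 \<xi>"] elim(1) t by simp
   show "((\<lambda>r. a r \<xi>) has_vector_derivative (NA \<alpha> g (p t) (a t) \<xi> - \<i> * of_real (\<epsilon> * \<xi>\<^sup>2 / 2) * a t \<xi>)) (at t within {0..T})"
    by (rule has_vector_derivative_transform[OF t _ 2]) (use elim(1) in auto)
  qed
 qed
 then show ?thesis using D cp ca unfolding FS_def by blast
qed

section \<open>The analytic norms\<close>

lemma ennsqrt_sq [simp]: "(ennsqrt x)\<^sup>2 = x"
 by (cases x) (auto simp: ennsqrt_def ennreal_power top_power_ennreal)

lemma ennsqrt_mono: "x \<le> y \<Longrightarrow> ennsqrt x \<le> ennsqrt y"
 by (auto simp: ennsqrt_def top_unique less_top[symmetric] intro!: ennreal_leI enn2real_mono)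

lemma ennsqrt_less_top [simp]: "ennsqrt x < top \<longleftrightarrow> x < top"
 by (auto simp: ennsqrt_def less_top)

lemma ennsqrt_power2 [simp]: "ennsqrt (x\<^sup>2) = x"
proof (cases x)
 case (real r)
 then show ?thesis by (simp add: ennsqrt_def ennreal_power)
qed (simp add: ennsqrt_def power2_eq_square)

lemma ennsqrt_tendsto_0:
 assumes "(f \<longlongrightarrow> 0) F" shows "((\<lambda>x. ennsqrt (f x)) \<longlongrightarrow> 0) F"
proof (rule order_tendstoI)
 fix a :: ennreal assume a: "0 < a"
 have "0 < a\<^sup>2" using a by (simp add: power2_eq_square ennreal_zero_less_mult_iff)
 then have "\<forall>\<^sub>F x in F. f x < a\<^sup>2" using assms by (rule order_tendstoD(2)[rotated])
 then show "\<forall>\<^sub>F x in F. ennsqrt (f x) < a"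
 proof eventually_elim
  case (elim x)
  show ?case
  proof (rule ccontr)
   assume "\<not> ennsqrt (f x) < a"
   then have "a\<^sup>2 \<le> (ennsqrt (f x))\<^sup>2" by (intro power_mono) auto
   then show False using elim by simp
  qed
 qed
qed simp

lemma H_normsq_eq:
 assumes "fourier \<psi> \<doteq> h"
 shows "H_normsq w l \<psi> = Nsq l (em w h)"
 unfolding H_normsq_def Nsq_def
proof (intro nn_integral_cong_AE, use assms in eventually_elim)
 case (elim \<xi>)
 have "(jap \<xi> powr l * (exp (w * jap \<xi>) * cmod (h \<xi>)))\<^sup>2 = jap \<xi> powr (2 * l) * exp (2 * w * jap \<xi>) * (cmod (h \<xi>))\<^sup>2"
  by (simp add: power_mult_distrib powr_power mult.commute[of l 2] exp_double[symmetric] mult.assoc)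
 then show ?case
  by (simp add: elim jm_def em_def ennreal_power flip: ennreal_mult)
qed

lemma fourier_IF_WC: "WC h \<Longrightarrow> fourier (IF h) \<doteq> h"
 by (intro fourier_IF WC_L2 WC_integrable)

lemma IF_WC_L2: "WC h \<Longrightarrow> IF h \<in> L2"
 by (intro IF_L2 WC_L2 WC_integrable)

text \<open>A majorant for the slower rate \<open>M / 2\<close> leaves the factor \<open>exp (- M / 2 * t * jap \<xi>)\<close>, whose square integral in
 time gains the half derivative of the second part of the norm.\<close>

locale majorized =
 fixes w0 M T l :: real and u :: cpath and V :: nnfun
 assumes M: "M > 0" and l: "l \<ge> 0" and V [measurable]: "Borel V"
  and dom: "AE \<xi> in lborel. \<forall>t\<in>{0..T}. em (w0 - M / 2 * t) (u t) \<xi> \<le> V \<xi>"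
  and WC: "\<And>t. t \<in> {0..T} \<Longrightarrow> WC (u t)"
begin

lemma em_decay:
 assumes "em (w0 - M / 2 * t) (u t) \<xi> \<le> V \<xi>"
 shows "em (weight w0 M t) (u t) \<xi> \<le> ennreal (exp (- M / 2 * t * jap \<xi>)) * V \<xi>"
proof -
 have "exp (weight w0 M t * jap \<xi>) = exp (- M / 2 * t * jap \<xi>) * exp ((w0 - M / 2 * t) * jap \<xi>)"
  unfolding exp_add[symmetric] weight_def by (simp add: field_simps)
 then have "em (weight w0 M t) (u t) \<xi> = ennreal (exp (- M / 2 * t * jap \<xi>)) * em (w0 - M / 2 * t) (u t) \<xi>"
  by (simp add: em_def mult.assoc flip: ennreal_mult)
 then show ?thesis using assms by (simp add: mult_left_mono)
qed

lemma em_weight_le: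
 assumes "em (w0 - M / 2 * t) (u t) \<xi> \<le> V \<xi>" "t \<ge> 0"
 shows "em (weight w0 M t) (u t) \<xi> \<le> V \<xi>"
proof -
 have "exp (- M / 2 * t * jap \<xi>) \<le> 1" using M assms(2) by simp
 then have "ennreal (exp (- M / 2 * t * jap \<xi>)) * V \<xi> \<le> ennreal 1 * V \<xi>"
  by (intro mult_right_mono ennreal_leI) auto
 then show ?thesis using em_decay[OF assms(1)] by simp
qed

lemma normsq_IF: "t \<in> {0..T} \<Longrightarrow> H_normsq w k (IF (u t)) = Nsq k (em w (u t))"
 by (intro H_normsq_eq fourier_IF_WC WC)

lemma normsq_bound: "t \<in> {0..T} \<Longrightarrow> H_normsq (weight w0 M t) l (IF (u t)) \<le> Nsq l V"
 unfolding normsq_IF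
proof (intro Nsq_mono_AE)
 assume t: "t \<in> {0..T}"
 show "AE \<xi> in lborel. em (weight w0 M t) (u t) \<xi> \<le> V \<xi>"
  using dom by eventually_elim (use t in \<open>auto intro: em_weight_le\<close>)
qed

lemma time_integral:
 "(\<integral>\<^sup>+s. ennreal (exp (- M * jap \<xi> * s)) * indicator {0..T} s \<partial>lborel) \<le> ennreal (1 / (M * jap \<xi>))"
proof (cases "T \<ge> 0")
 case True
 have "(\<integral>\<^sup>+s. ennreal (exp (- M * jap \<xi> * s)) * indicator {0..T} s \<partial>lborel)
   = ennreal (- exp (- M * jap \<xi> * T) / (M * jap \<xi>) - (- exp (- M * jap \<xi> * 0) / (M * jap \<xi>)))"
  by (rule nn_integral_FTC_Icc[OF _ _ _ True]) (use M in \<open>auto intro!: derivative_eq_intros\<close>)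
 also have "... \<le> ennreal (1 / (M * jap \<xi>))"
  using M by (intro ennreal_leI) simp
 finally show ?thesis .
qed simp

text \<open>After exchanging the integrals, the integral over time of
  \<open>exp (- M * jap \<xi> * s)\<close> is at most \<open>1 / (M * jap \<xi>)\<close>, which
  reduces the exponent \<open>2 * (l + 1/2)\<close> of \<open>jap\<close> to
  \<open>2 * l\<close>.\<close>

lemma time_norm_bound:
 "(\<integral>\<^sup>+s\<in>{0..T}. H_normsq (weight w0 M s) (l + 1/2) (IF (u s)) \<partial>lborel) \<le> ennreal (1 / M) * Nsq l V"
proof -
 have pt: "H_normsq (weight w0 M s) (l + 1/2) (IF (u s)) * indicator {0..T} s
   \<le> (\<integral>\<^sup>+\<xi>. (jm (l + 1/2) V \<xi>)\<^sup>2 * (ennreal (exp (- M * jap \<xi> * s)) * indicator {0..T} s) \<partial>lborel)" for s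
 proof (cases "s \<in> {0..T}")
  case True
  have "H_normsq (weight w0 M s) (l + 1/2) (IF (u s)) \<le> (\<integral>\<^sup>+\<xi>. (jm (l + 1/2) V \<xi>)\<^sup>2 * ennreal (exp (- M * jap \<xi> * s)) \<partial>lborel)"
   unfolding normsq_IF[OF True] Nsq_def
  proof (intro nn_integral_mono_AE, use dom in eventually_elim)
   case (elim \<xi>)
   have "(jm (l + 1/2) (em (weight w0 M s) (u s)) \<xi>)\<^sup>2 \<le> (ennreal (jap \<xi> powr (l + 1/2)) * (ennreal (exp (- M / 2 * s * jap \<xi>)) * V \<xi>))\<^sup>2"
    unfolding jm_def using elim True by (intro power_mono mult_left_mono em_decay) auto
   also have "... = (jm (l + 1/2) V \<xi>)\<^sup>2 * (ennreal (exp (- M / 2 * s * jap \<xi>)))\<^sup>2"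
    by (simp add: jm_def power_mult_distrib mult_ac)
   also have "(ennreal (exp (- M / 2 * s * jap \<xi>)))\<^sup>2 = ennreal (exp (- M * jap \<xi> * s))"
    by (simp add: ennreal_power exp_double[symmetric] mult_ac)
   finally show ?case .
  qed
  then show ?thesis using True by simp
 qed simp
 have "(\<integral>\<^sup>+s\<in>{0..T}. H_normsq (weight w0 M s) (l + 1/2) (IF (u s)) \<partial>lborel)
  \<le> (\<integral>\<^sup>+s. \<integral>\<^sup>+\<xi>. (jm (l + 1/2) V \<xi>)\<^sup>2 * (ennreal (exp (- M * jap \<xi> * s)) * indicator {0..T} s) \<partial>lborel \<partial>lborel)"
  by (intro nn_integral_mono pt)
 also have "... = (\<integral>\<^sup>+\<xi>. \<integral>\<^sup>+s. (jm (l + 1/2) V \<xi>)\<^sup>2 * (ennreal (exp (- M * jap \<xi> * s)) * indicator {0..T} s) \<partial>lborel \<partial>lborel)"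
  by (rule lborel_pair.Fubini'[symmetric]) measurable
 also have "... = (\<integral>\<^sup>+\<xi>. (jm (l + 1/2) V \<xi>)\<^sup>2 * (\<integral>\<^sup>+s. ennreal (exp (- M * jap \<xi> * s)) * indicator {0..T} s \<partial>lborel) \<partial>lborel)"
  by (intro nn_integral_cong nn_integral_cmult) measurable
 also have "... \<le> (\<integral>\<^sup>+\<xi>. (jm (l + 1/2) V \<xi>)\<^sup>2 * ennreal (1 / (M * jap \<xi>)) \<partial>lborel)"
  by (intro nn_integral_mono mult_left_mono time_integral) auto
 also have "... = (\<integral>\<^sup>+\<xi>. ennreal (1 / M) * (jm l V \<xi>)\<^sup>2 \<partial>lborel)"
 proof (intro nn_integral_cong)
  fix \<xi>
  have "(jap \<xi> powr (l + 1/2))\<^sup>2 * (1 / (M * jap \<xi>)) = 1 / M * (jap \<xi> powr l)\<^sup>2"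
   by (simp add: powr_add power_mult_distrib powr_half_sqrt)
  then have "ennreal ((jap \<xi> powr (l + 1/2))\<^sup>2) * ennreal (1 / (M * jap \<xi>)) = ennreal (1 / M) * ennreal ((jap \<xi> powr l)\<^sup>2)"
   using M by (simp flip: ennreal_mult)
  then have "(ennreal ((jap \<xi> powr (l + 1/2))\<^sup>2) * ennreal (1 / (M * jap \<xi>))) * (V \<xi>)\<^sup>2 = (ennreal (1 / M) * ennreal ((jap \<xi> powr l)\<^sup>2)) * (V \<xi>)\<^sup>2" by simp
  then show "(jm (l + 1/2) V \<xi>)\<^sup>2 * ennreal (1 / (M * jap \<xi>)) = ennreal (1 / M) * (jm l V \<xi>)\<^sup>2"
   by (simp add: jm_def power_mult_distrib ennreal_power mult_ac)
 qed
 also have "... = ennreal (1 / M) * Nsq l V"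
  unfolding Nsq_def by (rule nn_integral_cmult) measurable
 finally show ?thesis .
qed

text \<open>The factor 2 is \<open>2 * M\<close> from the definition of the norm times the
  \<open>1 / M\<close> gained by integration in time.\<close>

lemma triple_norm_bound: "triple_norm w0 M l T (\<lambda>t. IF (u t)) \<le> ennsqrt (2 * Nsq l V)"
 unfolding triple_norm_def
proof (intro ennsqrt_mono max.boundedI)
 have "(SUP s\<in>{0..T}. H_normsq (weight w0 M s) l (IF (u s))) \<le> Nsq l V"
  by (intro SUP_least normsq_bound)
 also have "... \<le> 2 * Nsq l V" using mult_right_mono[of 1 2 "Nsq l V"] by simp
 finally show "(SUP s\<in>{0..T}. H_normsq (weight w0 M s) l (IF (u s))) \<le> 2 * Nsq l V" .
 have "ennreal (2 * M) * (\<integral>\<^sup>+s\<in>{0..T}. H_normsq (weight w0 M s) (l + 1/2) (IF (u s)) \<partial>lborel) \<le> ennreal (2 * M) * (ennreal (1 / M) * Nsq l V)"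
  by (intro mult_left_mono time_norm_bound) auto
 also have "... = ennreal (2 * M * (1 / M)) * Nsq l V"
  using M by (subst ennreal_mult) (auto simp: mult.assoc)
 also have "... = 2 * Nsq l V" using M by simp
 finally show "ennreal (2 * M) * (\<integral>\<^sup>+s\<in>{0..T}. H_normsq (weight w0 M s) (l + 1/2) (IF (u s)) \<partial>lborel) \<le> 2 * Nsq l V" .
qed

text \<open>\<open>lifted\<close> involves two choices by \<open>SOME\<close>, so its transform is
  known only up to a null set; \<open>h\<close> is the explicit version. Continuity in time is
  dominated convergence in frequency, with the bound \<open>4 * (jm l V \<xi>)^2\<close>, whose 4 is
  the square of the two copies of \<open>V\<close>, one for each of the two times.\<close>

lemma Y_space_mem:
 assumes fin: "Nsq l V < top" and C: "CC {0..T} u"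
 shows "(\<lambda>t. IF (u t)) \<in> Y_space (weight w0 M) T l"
proof -
 let ?w = "weight w0 M"
 define h where "h t \<xi> = of_real (exp (?w t * jap \<xi>)) * u t \<xi>" for t \<xi>
 define hf where "hf t \<xi> = of_real (exp (?w t * jap \<xi>)) * fourier (IF (u t)) \<xi>" for t \<xi>
 have um[measurable]: "Borel (u t)" if "t \<in> {0..T}" for t using WC[OF that] by (rule WC_measurable)
 have hm: "Borel (h t)" if "t \<in> {0..T}" for t
  unfolding h_def using um[OF that] by measurable
 have em_h: "em 0 (h t) = em (?w t) (u t)" for t by (simp add: em_def h_def norm_mult fun_eq_iff)
 have IL: "IF (u t) \<in> L2" if "t \<in> {0..T}" for t using WC[OF that] by (rule IF_WC_L2)
 have hfh: "hf t \<doteq> h t" if "t \<in> {0..T}" for t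
  using fourier_IF_WC[OF WC[OF that]] by eventually_elim (simp add: hf_def h_def)
 have Nh: "Nsq l (em 0 (h t)) < top" if "t \<in> {0..T}" for t
  using normsq_bound[OF that] fin unfolding em_h normsq_IF[OF that] by simp
 have hL: "h t \<in> L2" if "t \<in> {0..T}" for t
 proof -
  have "n2 (h t) = Nsq 0 (em 0 (h t))" by (simp add: n2_def Nsq_def em_def ennreal_power)
  also have "... \<le> Nsq l (em 0 (h t))" by (rule Nsq_mono_p[OF l])
  finally show ?thesis using Nh[OF that] hm[OF that] by (simp add: L2_iff)
 qed
 have hfL: "hf t \<in> L2" if "t \<in> {0..T}" for t
 proof -
  have "Borel (hf t)"
   unfolding hf_def using fourier_measurable[OF IL[OF that]] by measurable
  then show ?thesis using n2_cong_AE[OF hfh[OF that]] hL[OF that] by (simp add: L2_iff)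
 qed
 have lift: "lifted ?w (\<lambda>t. IF (u t)) t = inv_fourier (hf t)" for t by (simp add: lifted_def hf_def[abs_def])
 have L: "lifted ?w (\<lambda>t. IF (u t)) t \<in> L2" "AE \<xi> in lborel. fourier (lifted ?w (\<lambda>t. IF (u t)) t) \<xi> = h t \<xi>" if "t \<in> {0..T}" for t
 proof -
  show "lifted ?w (\<lambda>t. IF (u t)) t \<in> L2" unfolding lift by (rule inv_fourier_props[OF hfL[OF that]])
  show "AE \<xi> in lborel. fourier (lifted ?w (\<lambda>t. IF (u t)) t) \<xi> = h t \<xi>"
   unfolding lift using inv_fourier_props(2)[OF hfL[OF that]] hfh[OF that] by eventually_elim simp
 qed
 have cont: "((\<lambda>t. H_norm 0 l (\<lambda>x. lifted ?w (\<lambda>t. IF (u t)) t x - lifted ?w (\<lambda>t. IF (u t)) s x)) \<longlongrightarrow> 0) (at s within {0..T})"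
  if s: "s \<in> {0..T}" for s
  unfolding tendsto_at_iff_sequentially
 proof (intro allI impI)
  fix X assume X: "\<forall>i. X i \<in> {0..T} - {s}" and lim: "X \<longlonglongrightarrow> s"
  have XT: "X i \<in> {0..T}" for i using X by auto
  have eq: "H_normsq 0 l (\<lambda>x. lifted ?w (\<lambda>t. IF (u t)) (X i) x - lifted ?w (\<lambda>t. IF (u t)) s x) = (\<integral>\<^sup>+\<xi>. (jm l (em 0 (h (X i) \<ominus> h s)) \<xi>)\<^sup>2 \<partial>lborel)" for i
   unfolding Nsq_def[symmetric]
  proof (rule H_normsq_eq)
   show "AE \<xi> in lborel. fourier (\<lambda>x. lifted ?w (\<lambda>t. IF (u t)) (X i) x - lifted ?w (\<lambda>t. IF (u t)) s x) \<xi> = h (X i) \<xi> - h s \<xi>"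
    using fourier_diff[OF L(1)[OF XT] L(1)[OF s], of i] L(2)[OF XT, of i] L(2)[OF s] by eventually_elim simp
  qed
  note [measurable] = hm[OF XT] hm[OF s]
  have "(\<lambda>i. \<integral>\<^sup>+\<xi>. (jm l (em 0 (h (X i) \<ominus> h s)) \<xi>)\<^sup>2 \<partial>lborel) \<longlonglongrightarrow> (\<integral>\<^sup>+\<xi>. 0 \<partial>(lborel :: real measure))"
  proof (rule nn_integral_dominated_convergence[where w="\<lambda>\<xi>. 4 * (jm l V \<xi>)\<^sup>2"])
   show "(\<lambda>\<xi>. (jm l (em 0 (h (X i) \<ominus> h s)) \<xi>)\<^sup>2) \<in> borel_measurable lborel" for i by measurable
   show "(\<integral>\<^sup>+\<xi>. 4 * (jm l V \<xi>)\<^sup>2 \<partial>lborel) < \<infinity>"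
    using fin by (subst nn_integral_cmult) (auto simp: Nsq_def[symmetric] ennreal_mult_less_top)
   show "AE \<xi> in lborel. (jm l (em 0 (h (X i) \<ominus> h s)) \<xi>)\<^sup>2 \<le> 4 * (jm l V \<xi>)\<^sup>2" for i
    using dom
   proof eventually_elim
    case (elim \<xi>)
    have b: "em 0 (h t) \<xi> \<le> V \<xi>" if "t \<in> {0..T}" for t
     unfolding em_h using elim that by (intro em_weight_le) auto
    have "em 0 (h (X i) \<ominus> h s) \<xi> \<le> em 0 (h (X i)) \<xi> + em 0 (h s) \<xi>"
     by (simp add: em_def norm_triangle_ineq4 ennreal_leI flip: ennreal_plus)
    also have "... \<le> V \<xi> + V \<xi>" by (intro add_mono b XT s)
    finally have "jm l (em 0 (h (X i) \<ominus> h s)) \<xi> \<le> 2 * jm l V \<xi>"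
     by (simp add: jm_def mult_left_mono mult_2 flip: distrib_left)
    then have "(jm l (em 0 (h (X i) \<ominus> h s)) \<xi>)\<^sup>2 \<le> (2 * jm l V \<xi>)\<^sup>2" by (intro power_mono) auto
    then show ?case by (simp add: power_mult_distrib)
   qed
   show "AE \<xi> in lborel. (\<lambda>i. (jm l (em 0 (h (X i) \<ominus> h s)) \<xi>)\<^sup>2) \<longlonglongrightarrow> 0"
    using C[unfolded CC_def]
   proof eventually_elim
    case (elim \<xi>)
    have "continuous_on {0..T} (\<lambda>t. h t \<xi>)" unfolding h_def weight_def by (intro continuous_intros elim)
    then have "((\<lambda>t. h t \<xi>) \<longlongrightarrow> h s \<xi>) (at s within {0..T})" using s by (auto simp: continuous_on)
    then have hl: "(\<lambda>i. h (X i) \<xi>) \<longlonglongrightarrow> h s \<xi>" using X lim unfolding tendsto_at_iff_sequentially by (auto simp: comp_def)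
    have "(\<lambda>i. ennreal ((jap \<xi> powr l * cmod (h (X i) \<xi> - h s \<xi>))\<^sup>2)) \<longlonglongrightarrow> ennreal ((jap \<xi> powr l * cmod (h s \<xi> - h s \<xi>))\<^sup>2)"
     by (intro tendsto_intros hl)
    then show ?case by (simp add: jm_def em_def ennreal_power flip: ennreal_mult)
   qed
  qed (auto intro: measurable_compose)
  then have "(\<lambda>i. ennsqrt (\<integral>\<^sup>+\<xi>. (jm l (em 0 (h (X i) \<ominus> h s)) \<xi>)\<^sup>2 \<partial>lborel)) \<longlonglongrightarrow> 0"
   by (intro ennsqrt_tendsto_0) simp
  then show "((\<lambda>t. H_norm 0 l (\<lambda>x. lifted ?w (\<lambda>t. IF (u t)) t x - lifted ?w (\<lambda>t. IF (u t)) s x)) \<circ> X) \<longlonglongrightarrow> 0"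
   by (simp add: comp_def H_norm_def eq)
 qed
 have "(\<lambda>t. IF (u t)) \<in> C_H ?w T l"
  unfolding C_H_def
 proof (intro CollectI conjI ballI)
  fix t assume t: "t \<in> {0..T}"
  show "IF (u t) \<in> L2" by (rule IL[OF t])
  show "(\<lambda>\<xi>. of_real (exp (?w t * jap \<xi>)) * fourier (IF (u t)) \<xi>) \<in> L2"
   using hfL[OF t] by (simp add: hf_def[abs_def])
  show "lifted ?w (\<lambda>t. IF (u t)) t \<in> H_space 0 l"
   using L(1)[OF t] Nh[OF t] H_normsq_eq[OF L(2)[OF t], of 0 l] by (simp add: H_space_def H_norm_def)
 qed (rule cont)
 moreover have "(\<lambda>t. IF (u t)) \<in> L2_H ?w T (l + 1/2)"
  unfolding L2_H_def
 proof (intro CollectI conjI)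
  show "AE t in lborel. t \<in> {0..T} \<longrightarrow> IF (u t) \<in> L2" using IL by auto
  show "(\<integral>\<^sup>+t\<in>{0..T}. H_normsq (?w t) (l + 1/2) (IF (u t)) \<partial>lborel) < top"
   using time_norm_bound fin by (auto simp: ennreal_mult_less_top intro: le_less_trans)
 qed
 ultimately show ?thesis by (simp add: Y_space_def)
qed

end

section \<open>The Fourier side of classical solutions\<close>

lemma IF_inj: "WC h \<Longrightarrow> WC k \<Longrightarrow> IF h \<doteq> IF k \<Longrightarrow> h \<doteq> k"
proof -
 assume h: "WC h" and k: "WC k" and e: "IF h \<doteq> IF k"
 have "fourier (IF h) = fourier (IF k)" by (intro fourier_cong_AE e IF_WC_L2 h k)
 then show ?thesis using fourier_IF_WC[OF h] fourier_IF_WC[OF k] by (auto elim: eventually_elim2)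
qed

lemma conv_cong_AE:
 assumes u: "u \<doteq> u'" and v: "v \<doteq> v'"
  and [measurable]: "Borel u" "Borel u'" "Borel v" "Borel v'"
 shows "conv u v = conv u' v'"
proof
 fix \<xi>
 have "(LINT \<eta>|lborel. u (\<xi> - \<eta>) * v \<eta>) = (LINT \<eta>|lborel. u' (\<xi> - \<eta>) * v' \<eta>)"
  by (rule integral_cong_AE) (measurable, use AE_translate_reflect[OF u, of \<xi>] v in eventually_elim, simp)
 then show "conv u v \<xi> = conv u' v' \<xi>" by (simp add: conv_def)
qed

text \<open>All terms are built from convolutions, which turn equality almost everywhere into
  equality at every frequency. This allows a version to be exchanged at uncountably many times
  without collecting null sets.\<close>

lemma N_cong_AE:
 assumes p: "p \<doteq> p'" and a: "a \<doteq> a'"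
  and m[measurable]: "Borel p" "Borel p'" "Borel a" "Borel a'"
 shows "NP \<alpha> \<beta> g s p a = NP \<alpha> \<beta> g s p' a'" "NA \<alpha> g p a = NA \<alpha> g p' a'"
proof -
 have dp: "dh p \<doteq> dh p'" using p by eventually_elim (simp add: dh_def)
 have ddp: "dh (dh p) \<doteq> dh (dh p')" using p by eventually_elim (simp add: dh_def)
 have da: "dh a \<doteq> dh a'" using a by eventually_elim (simp add: dh_def)
 have ca: "cj a \<doteq> cj a'" using AE_reflect[OF a] by eventually_elim (simp add: cj_def)
 have caa: "conv a (cj a) = conv a' (cj a')" by (rule conv_cong_AE[OF a ca]) measurable
 have P: "PC a k = PC a' k" for k by (induction k) (simp_all add: caa)
 have 1: "conv (dh p) (dh p) = conv (dh p') (dh p')" by (rule conv_cong_AE[OF dp dp]) measurable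
 have 2: "conv (PC a g) (dh p) = conv (PC a' g) (dh p')" by (rule conv_cong_AE[OF _ dp]) (simp_all add: P single_measurable)
 have 3: "conv (dh p) (dh a) = conv (dh p') (dh a')" by (rule conv_cong_AE[OF dp da]) measurable
 have 4: "conv a (dh (dh p)) = conv a' (dh (dh p'))" by (rule conv_cong_AE[OF a ddp]) measurable
 have 5: "conv (PC a g) a = conv (PC a' g) a'" by (rule conv_cong_AE[OF _ a]) (simp_all add: P single_measurable)
 show "NP \<alpha> \<beta> g s p a = NP \<alpha> \<beta> g s p' a'" unfolding NP_def[abs_def] 1 2 by (simp only: P)
 show "NA \<alpha> g p a = NA \<alpha> g p' a'" unfolding NA_def[abs_def] 3 4 5 ..
qed

text \<open>Integration in time leads from \<open>BC\<close> to \<open>DC\<close>: the integral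
  \<open>V\<close> of the moduli over the whole time interval dominates all partial integrals, and
  it is in L2 by Cauchy-Schwarz in time and Tonelli. Where \<open>V\<close> is finite, the integral
  is continuous in its upper limit.\<close>

lemma BC_time_integral:
 assumes G: "BC {0..T} G" and T: "T \<ge> 0"
 shows "DC {0..T} (\<lambda>t \<xi>. Ds 0 (\<lambda>s. G s \<xi>) t)" "CC {0..T} (\<lambda>t \<xi>. Ds 0 (\<lambda>s. G s \<xi>) t)"
proof -
 obtain \<rho> K where 1: "jmeas G" "\<rho> > 0" "K < top" "\<And>t. t \<in> {0..T} \<Longrightarrow> Eq \<rho> (na (G t)) \<le> K"
  using G by (auto simp: BC_def)
 note [measurable] = 1(1)
 define V where "V \<xi> = (\<integral>\<^sup>+s. na (G s) \<xi> * indicator {0..T} s \<partial>lborel)" for \<xi>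
 have Vm[measurable]: "Borel V" unfolding V_def[abs_def] by measurable
 have V2: "(V \<xi>)\<^sup>2 \<le> ennreal T * (\<integral>\<^sup>+s. (na (G s) \<xi>)\<^sup>2 * indicator {0..T} s \<partial>lborel)" for \<xi>
 proof -
  have "V \<xi> = (\<integral>\<^sup>+s. indicator {0..T} s * (na (G s) \<xi> * indicator {0..T} s) \<partial>lborel)"
   unfolding V_def by (intro nn_integral_cong) (auto simp: indicator_def)
  also have "...\<^sup>2 \<le> (\<integral>\<^sup>+s. (indicator {0..T} s)\<^sup>2 \<partial>lborel) * (\<integral>\<^sup>+s. (na (G s) \<xi> * indicator {0..T} s)\<^sup>2 \<partial>lborel)"
   by (rule Cauchy_Schwarz_nn_integral) measurable
  also have "(\<integral>\<^sup>+s. (indicator {0..T} s)\<^sup>2 \<partial>lborel) = (\<integral>\<^sup>+s. indicator {0..T} s \<partial>(lborel :: real measure))"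
   by (intro nn_integral_cong) (auto simp: indicator_def)
  also have "... = ennreal T" using T by (simp add: emeasure_lborel_Icc_eq)
  also have "(\<integral>\<^sup>+s. (na (G s) \<xi> * indicator {0..T} s)\<^sup>2 \<partial>lborel) = (\<integral>\<^sup>+s. (na (G s) \<xi>)\<^sup>2 * indicator {0..T} s \<partial>lborel)"
   by (intro nn_integral_cong) (auto simp: indicator_def)
  finally show ?thesis .
 qed
 have "Eq \<rho> V \<le> (\<integral>\<^sup>+\<xi>. ennreal T * (\<integral>\<^sup>+s. (ennreal (exp (\<rho> * jap \<xi>)) * na (G s) \<xi>)\<^sup>2 * indicator {0..T} s \<partial>lborel) \<partial>lborel)"
  unfolding Eq_def
 proof (intro nn_integral_mono)
  fix \<xi>
  have "(ennreal (exp (\<rho> * jap \<xi>)) * V \<xi>)\<^sup>2 \<le> (ennreal (exp (\<rho> * jap \<xi>)))\<^sup>2 * (ennreal T * (\<integral>\<^sup>+s. (na (G s) \<xi>)\<^sup>2 * indicator {0..T} s \<partial>lborel))"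
   unfolding power_mult_distrib by (intro mult_left_mono V2) auto
  also have "... = ennreal T * ((ennreal (exp (\<rho> * jap \<xi>)))\<^sup>2 * (\<integral>\<^sup>+s. (na (G s) \<xi>)\<^sup>2 * indicator {0..T} s \<partial>lborel))"
   by (simp only: mult_ac)
  also have "(ennreal (exp (\<rho> * jap \<xi>)))\<^sup>2 * (\<integral>\<^sup>+s. (na (G s) \<xi>)\<^sup>2 * indicator {0..T} s \<partial>lborel) = (\<integral>\<^sup>+s. (ennreal (exp (\<rho> * jap \<xi>)) * na (G s) \<xi>)\<^sup>2 * indicator {0..T} s \<partial>lborel)"
   unfolding power_mult_distrib mult.assoc by (rule nn_integral_cmult[symmetric]) measurable
  finally show "(ennreal (exp (\<rho> * jap \<xi>)) * V \<xi>)\<^sup>2 \<le> ennreal T * (\<integral>\<^sup>+s. (ennreal (exp (\<rho> * jap \<xi>)) * na (G s) \<xi>)\<^sup>2 * indicator {0..T} s \<partial>lborel)" .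
 qed
 also have "... = ennreal T * (\<integral>\<^sup>+\<xi>. \<integral>\<^sup>+s. (ennreal (exp (\<rho> * jap \<xi>)) * na (G s) \<xi>)\<^sup>2 * indicator {0..T} s \<partial>lborel \<partial>lborel)"
  by (rule nn_integral_cmult) measurable
 also have "(\<integral>\<^sup>+\<xi>. \<integral>\<^sup>+s. (ennreal (exp (\<rho> * jap \<xi>)) * na (G s) \<xi>)\<^sup>2 * indicator {0..T} s \<partial>lborel \<partial>lborel)
   = (\<integral>\<^sup>+s. \<integral>\<^sup>+\<xi>. (ennreal (exp (\<rho> * jap \<xi>)) * na (G s) \<xi>)\<^sup>2 * indicator {0..T} s \<partial>lborel \<partial>lborel)"
  by (rule lborel_pair.Fubini'[symmetric]) measurable
 also have "... \<le> (\<integral>\<^sup>+s. K * indicator {0..T} s \<partial>lborel)"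
 proof (intro nn_integral_mono)
  fix s :: real
  have "(\<integral>\<^sup>+\<xi>. (ennreal (exp (\<rho> * jap \<xi>)) * na (G s) \<xi>)\<^sup>2 * indicator {0..T} s \<partial>lborel) = Eq \<rho> (na (G s)) * indicator {0..T} s"
   unfolding Eq_def by (rule nn_integral_multc) measurable
  also have "... \<le> K * indicator {0..T} s" using 1(4)[of s] by (auto simp: indicator_def)
  finally show "(\<integral>\<^sup>+\<xi>. (ennreal (exp (\<rho> * jap \<xi>)) * na (G s) \<xi>)\<^sup>2 * indicator {0..T} s \<partial>lborel) \<le> K * indicator {0..T} s" .
 qed
 also have "... = K * ennreal T" using T by (subst nn_integral_cmult) (auto simp: emeasure_lborel_Icc_eq)
 finally have "Eq \<rho> V \<le> ennreal T * (K * ennreal T)" by (simp add: mult_left_mono)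
 also have "... < top" using 1(3) by (simp add: ennreal_mult_less_top)
 finally have EV: "Eq \<rho> V < top" .
 have D: "na (\<lambda>\<xi>. Ds 0 (\<lambda>s. G s \<xi>) t) \<xi> \<le> V \<xi>" if t: "t \<in> {0..T}" for t \<xi>
 proof (cases "integrable lborel (\<lambda>s. indicator {0..t} s *\<^sub>R (exp (\<i> * of_real (0 * s)) * G s \<xi>))")
  case True
  then have "na (\<lambda>\<xi>. Ds 0 (\<lambda>s. G s \<xi>) t) \<xi> \<le> (\<integral>\<^sup>+s. ennreal (norm (indicator {0..t} s *\<^sub>R (exp (\<i> * of_real (0 * s)) * G s \<xi>))) \<partial>lborel)"
   unfolding na_def Ds_def by (rule integral_norm_bound_ennreal)
  also have "... \<le> V \<xi>" unfolding V_def using t by (intro nn_integral_mono) (auto simp: indicator_def na_def)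
  finally show ?thesis .
 qed (simp add: na_def Ds_def not_integrable_integral_eq)
 have jm: "jmeas (\<lambda>t \<xi>. Ds 0 (\<lambda>s. G s \<xi>) t)"
 proof -
  have "jmeas (\<lambda>t \<xi>. duh 0 0 (\<lambda>s. G s \<xi>) t)" by measurable
  then show ?thesis by (simp add: duh_def)
 qed
 have AED: "AE \<xi> in lborel. \<forall>t\<in>{0..T}. na (\<lambda>\<xi>. Ds 0 (\<lambda>s. G s \<xi>) t) \<xi> \<le> V \<xi>"
  using D by (intro AE_I2) blast
 show "DC {0..T} (\<lambda>t \<xi>. Ds 0 (\<lambda>s. G s \<xi>) t)"
  using jm 1(2) Vm EV AED unfolding DC_def by blast
 show "CC {0..T} (\<lambda>t \<xi>. Ds 0 (\<lambda>s. G s \<xi>) t)"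
  unfolding CC_def using Eq_AE_finite[OF Vm EV]
 proof eventually_elim
  case (elim \<xi>)
  have int: "integrable lborel (\<lambda>s. indicator {0..r} s *\<^sub>R G s \<xi>)" if "r \<in> {0..T}" for r
  proof (rule integrableI_bounded)
   have "(\<integral>\<^sup>+s. ennreal (norm (indicator {0..r} s *\<^sub>R G s \<xi>)) \<partial>lborel) \<le> V \<xi>"
    unfolding V_def using that by (intro nn_integral_mono) (auto simp: indicator_def na_def)
   then show "(\<integral>\<^sup>+s. ennreal (norm (indicator {0..r} s *\<^sub>R G s \<xi>)) \<partial>lborel) < \<infinity>" using elim by simp
  qed measurable
  have eq: "Ds 0 (\<lambda>s. G s \<xi>) r = integral {0..r} (\<lambda>s. G s \<xi>)" if "r \<in> {0..T}" for r
   using set_borel_integral_eq_integral(2)[of "{0..r}" "\<lambda>s. G s \<xi>"] int[OF that]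
   by (simp add: Ds_def set_lebesgue_integral_def set_integrable_def)
  have "continuous_on {0..T} (\<lambda>r. integral {0..r} (\<lambda>s. G s \<xi>))"
   using set_borel_integral_eq_integral(1)[of "{0..T}" "\<lambda>s. G s \<xi>"] int[of T] T
   by (intro indefinite_integral_continuous_1) (auto simp: set_integrable_def)
  then show ?case by (rule continuous_on_eq) (simp add: eq)
 qed
qed

lemma BC_L1_bound:
 assumes G: "BC S G"
 obtains B :: real where "\<And>t. t \<in> S \<Longrightarrow> (LINT \<xi>|lborel. cmod (G t \<xi>)) \<le> B" "B \<ge> 0"
proof -
 obtain \<rho> K where 1: "jmeas G" "\<rho> > 0" "K < top" "\<And>t. t \<in> S \<Longrightarrow> Eq \<rho> (na (G t)) \<le> K"
  using G by (auto simp: BC_def)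
 note [measurable] = 1(1)
 define C where "C = ennreal ((1 / (\<rho> - 0))\<^sup>2) * Cj * K"
 have C: "C < top" unfolding C_def using 1(3) by (simp add: ennreal_mult_less_top Cj_top)
 have "(LINT \<xi>|lborel. cmod (G t \<xi>)) \<le> enn2real (ennsqrt C)" if t: "t \<in> S" for t
 proof -
  have i: "integrable lborel (G t)" by (intro WC_integrable BC_WC[OF G t])
  have "(\<integral>\<^sup>+\<xi>. na (G t) \<xi> \<partial>lborel)\<^sup>2 \<le> ennreal ((1 / (\<rho> - 0))\<^sup>2) * Cj * Eq \<rho> (na (G t))"
   using Eq_L1[of 0 \<rho> "na (G t)"] 1(2) by simp
  also have "... \<le> C" unfolding C_def by (intro mult_left_mono 1(4) t) auto
  finally have "ennsqrt ((\<integral>\<^sup>+\<xi>. na (G t) \<xi> \<partial>lborel)\<^sup>2) \<le> ennsqrt C" by (rule ennsqrt_mono)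
  then have "(\<integral>\<^sup>+\<xi>. na (G t) \<xi> \<partial>lborel) \<le> ennsqrt C" by simp
  moreover have "(\<integral>\<^sup>+\<xi>. na (G t) \<xi> \<partial>lborel) = ennreal (LINT \<xi>|lborel. cmod (G t \<xi>))"
   unfolding na_def using i by (intro nn_integral_eq_integral) auto
  ultimately have "enn2real (ennreal (LINT \<xi>|lborel. cmod (G t \<xi>))) \<le> enn2real (ennsqrt C)"
   using C by (intro enn2real_mono) auto
  then show ?thesis by simp
 qed
 then show thesis by (intro that[of "enn2real (ennsqrt C)"]) auto
qed

lemma IF_time_integral:
 assumes G: "BC {0..T} G" and t: "t \<in> {0..T}"
 shows "set_integrable lborel {0..t} (\<lambda>s. IF (G s) x)"
  and "IF (\<lambda>\<xi>. Ds 0 (\<lambda>s. G s \<xi>) t) x = (LINT s:{0..t}|lborel. IF (G s) x)"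
proof -
 have [measurable]: "jmeas G" using G by (auto simp: BC_def)
 obtain B :: real where B: "\<And>t. t \<in> {0..T} \<Longrightarrow> (LINT \<xi>|lborel. cmod (G t \<xi>)) \<le> B" "B \<ge> 0"
  using BC_L1_bound[OF G] by blast
 have ii: "integrable lborel (\<lambda>s. indicator {0..t} s * B)"
  by (intro integrable_mult_left integrable_real_indicator) (auto simp: emeasure_lborel_Icc_eq)
 have i: "integrable lborel (G s)" if "s \<in> {0..t}" for s
  using t that by (intro WC_integrable BC_WC[OF G]) auto
 have IFB: "cmod (IF (G s) x) \<le> B" if "s \<in> {0..t}" for s
  using IF_bounded_measurable(2)[OF i[OF that], of x] B(1)[of s] that t by auto
 show "set_integrable lborel {0..t} (\<lambda>s. IF (G s) x)"
  unfolding set_integrable_def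
  by (rule Bochner_Integration.integrable_bound[OF ii])
    (use IFB B(2) in \<open>auto simp: indicator_def intro!: AE_I2\<close>)
 let ?e = "\<lambda>\<xi>. exp (\<i> * of_real (\<xi> * x))"
 let ?H = "\<lambda>(s, \<xi>). ?e \<xi> * (indicator {0..t} s *\<^sub>R G s \<xi>)"
 have ip: "integrable (lborel \<Otimes>\<^sub>M lborel) ?H"
 proof (rule lborel_pair.Fubini_integrable)
  show "?H \<in> borel_measurable (lborel \<Otimes>\<^sub>M lborel)" by measurable
  show "integrable lborel (\<lambda>s. LINT \<xi>|lborel. norm (?H (s, \<xi>)))"
  proof (rule Bochner_Integration.integrable_bound[OF ii])
   show "(\<lambda>s. LINT \<xi>|lborel. norm (?H (s, \<xi>))) \<in> borel_measurable lborel" by measurable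
   show "AE s in lborel. norm (LINT \<xi>|lborel. norm (?H (s, \<xi>))) \<le> norm (indicator {0..t} s * B)"
   proof (intro AE_I2)
    fix s
    show "norm (LINT \<xi>|lborel. norm (?H (s, \<xi>))) \<le> norm (indicator {0..t} s * B)"
     using B t by (cases "s \<in> {0..t}") (auto simp: norm_mult abs_of_nonneg integral_nonneg_AE)
   qed
  qed
  show "AE s in lborel. integrable lborel (\<lambda>\<xi>. ?H (s, \<xi>))"
  proof (intro AE_I2)
   fix s
   show "integrable lborel (\<lambda>\<xi>. ?H (s, \<xi>))"
    using i[of s] by (cases "s \<in> {0..t}") auto
  qed
 qed
 have "?e \<xi> * Ds 0 (\<lambda>s. G s \<xi>) t = (LINT s|lborel. ?H (s, \<xi>))" for \<xi>
  unfolding Ds_def prod.case by (subst integral_mult_right_zero) simp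
 then have "(LINT \<xi>|lborel. ?e \<xi> * Ds 0 (\<lambda>s. G s \<xi>) t) = (LINT \<xi>|lborel. LINT s|lborel. ?H (s, \<xi>))"
  by (simp only:)
 also have "... = (LINT s|lborel. LINT \<xi>|lborel. ?H (s, \<xi>))"
  by (rule lborel_pair.Fubini_integral) (use ip in \<open>simp add: case_prod_unfold\<close>)
 also have "... = (LINT s|lborel. indicator {0..t} s *\<^sub>R (LINT \<xi>|lborel. ?e \<xi> * G s \<xi>))"
  by (rule Bochner_Integration.integral_cong[OF refl]) (auto simp: indicator_def)
 finally have e: "(LINT \<xi>|lborel. ?e \<xi> * Ds 0 (\<lambda>s. G s \<xi>) t) = (LINT s|lborel. indicator {0..t} s *\<^sub>R (LINT \<xi>|lborel. ?e \<xi> * G s \<xi>))" .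
 have "(LINT s:{0..t}|lborel. IF (G s) x) = (LINT s|lborel. of_real (1 / sqrt (2 * pi)) * (indicator {0..t} s *\<^sub>R (LINT \<xi>|lborel. ?e \<xi> * G s \<xi>)))"
  unfolding set_lebesgue_integral_def IF_eq by (rule Bochner_Integration.integral_cong[OF refl]) auto
 also have "... = of_real (1 / sqrt (2 * pi)) * (LINT s|lborel. indicator {0..t} s *\<^sub>R (LINT \<xi>|lborel. ?e \<xi> * G s \<xi>))"
  by (rule integral_mult_right_zero)
 finally show "IF (\<lambda>\<xi>. Ds 0 (\<lambda>s. G s \<xi>) t) x = (LINT s:{0..t}|lborel. IF (G s) x)"
  unfolding IF_eq[of "\<lambda>\<xi>. Ds 0 (\<lambda>s. G s \<xi>) t"] e by simp
qed

text \<open>The fundamental theorem of calculus at each \<open>x\<close>, written with inverse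
  transforms on both sides by \<open>IF_time_integral\<close>; injectivity of the inverse transform
  gives the equation for the frequencies. The exceptional null set may depend on
  \<open>t\<close>.\<close>

lemma integral_equation_of_derivative:
 assumes G: "BC {0..T} G" and u: "\<And>t. t \<in> {0..T} \<Longrightarrow> WC (u t)"
  and d: "\<And>t x. t \<in> {0..T} \<Longrightarrow> ((\<lambda>t. IF (u t) x) has_vector_derivative IF (G t) x) (at t within {0..T})"
  and t: "t \<in> {0..T}"
 shows "AE \<xi> in lborel. u t \<xi> = u 0 \<xi> + Ds 0 (\<lambda>s. G s \<xi>) t"
proof -
 have W: "WC (\<lambda>\<xi>. Ds 0 (\<lambda>s. G s \<xi>) t)"
  using BC_WC[OF DC_BC[OF BC_time_integral(1)[OF G]] t] t by simp
 have "IF (u t) x = IF (\<lambda>\<xi>. u 0 \<xi> + Ds 0 (\<lambda>s. G s \<xi>) t) x" for x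
 proof -
  have "((\<lambda>s. IF (G s) x) has_integral (IF (u t) x - IF (u 0) x)) {0..t}"
   using t d by (intro fundamental_theorem_of_calculus) (auto intro: has_vector_derivative_within_subset[of _ _ _ "{0..T}"])
  moreover have "((\<lambda>s. IF (G s) x) has_integral (LINT s:{0..t}|lborel. IF (G s) x)) {0..t}"
   using set_borel_integral_eq_integral[OF IF_time_integral(1)[OF G t, of x]] by (auto simp: has_integral_integrable_integral)
  ultimately have "IF (u t) x = IF (u 0) x + (LINT s:{0..t}|lborel. IF (G s) x)"
   using has_integral_unique by (metis add.commute diff_add_cancel)
  also have "... = IF (u 0) x + IF (\<lambda>\<xi>. Ds 0 (\<lambda>s. G s \<xi>) t) x" by (simp only: IF_time_integral(2)[OF G t])
  also have "... = IF (\<lambda>\<xi>. u 0 \<xi> + Ds 0 (\<lambda>s. G s \<xi>) t) x"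
   using t by (intro IF_add[symmetric] WC_integrable W u) auto
  finally show ?thesis .
 qed
 then have AEx: "IF (u t) \<doteq> IF (\<lambda>\<xi>. u 0 \<xi> + Ds 0 (\<lambda>s. G s \<xi>) t)" by simp
 have 0: "0 \<in> {0..T}" using t by auto
 show ?thesis by (rule IF_inj[OF u[OF t] WC_add[OF u[OF 0] W] AEx])
qed

lemma continuous_AE_eq:
 fixes f h :: cfun
 assumes "continuous_on UNIV f" "continuous_on UNIV h" "f \<doteq> h"
 shows "f = h"
proof
 fix x
 have "closed {x. f x = h x}" by (intro closed_Collect_eq assms)
 moreover have "AE x in lebesgue. x \<in> {x. f x = h x}"
  using assms(3) by (simp add: AE_completion)
 ultimately show "f x = h x" using mem_closed_if_AE_lebesgue[of "{x. f x = h x}" x] by simp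
qed

text \<open>The integral equation is known for almost every frequency at each fixed time; its right-hand side is a version
 of the solution that satisfies it at all times.\<close>

lemma FS_of_integral_equation:
 assumes p: "BC {0..T} p" and a: "BC {0..T} a" and T: "T \<ge> 0"
  and ep: "\<And>t. t \<in> {0..T} \<Longrightarrow> AE \<xi> in lborel. p t \<xi> = p 0 \<xi> + Ds 0 (\<lambda>r. NP \<alpha> \<beta> g s (p r) (a r) \<xi>) t"
  and ea: "\<And>t. t \<in> {0..T} \<Longrightarrow> AE \<xi> in lborel. a t \<xi> = a 0 \<xi> + Ds 0 (\<lambda>r. NA \<alpha> g (p r) (a r) \<xi> + (- \<i> * of_real (\<epsilon> * \<xi>\<^sup>2 / 2)) * a r \<xi>) t"
  and Ga: "BC {0..T} (\<lambda>r \<xi>. NA \<alpha> g (p r) (a r) \<xi> + (- \<i> * of_real (\<epsilon> * \<xi>\<^sup>2 / 2)) * a r \<xi>)"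
 shows "\<exists>P A. FS \<alpha> \<beta> g s \<epsilon> T P A \<and> (\<forall>t\<in>{0..T}. (p t \<doteq> P t) \<and> (a t \<doteq> A t))"
proof -
 let ?Ga = "\<lambda>r \<xi>. NA \<alpha> g (p r) (a r) \<xi> + (- \<i> * of_real (\<epsilon> * \<xi>\<^sup>2 / 2)) * a r \<xi>"
 let ?Gp = "\<lambda>r \<xi>. NP \<alpha> \<beta> g s (p r) (a r) \<xi>"
 define P where "P t \<xi> = p 0 \<xi> + Ds 0 (\<lambda>r. ?Gp r \<xi>) t" for t \<xi>
 define A where "A t \<xi> = a 0 \<xi> + Ds 0 (\<lambda>r. ?Ga r \<xi>) t" for t \<xi>
 have Gp: "BC {0..T} ?Gp" by (rule BC_N(1)[OF p a])
 have T0: "0 \<in> {0..T}" using T by simp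
 have const: "DC {0..T} (\<lambda>_. h)" "CC {0..T} (\<lambda>_. h)" if h: "WC h" for h
 proof -
  obtain \<rho> where r: "\<rho> > 0" "Eq \<rho> (na h) < top" and [measurable]: "Borel h"
   using h by (auto simp: WC_iff)
  have "jmeas (\<lambda>_. h)" "Borel (na h)" by measurable
  then show "DC {0..T} (\<lambda>_. h)" unfolding DC_def using r by (intro conjI exI[of _ \<rho>] exI[of _ "na h"]) auto
  show "CC {0..T} (\<lambda>_. h)" by (simp add: CC_def)
 qed
 have DP: "DC {0..T} P" unfolding P_def[abs_def] by (intro DC_add const BC_WC[OF p T0] BC_time_integral[OF Gp T])
 have CP: "CC {0..T} P" unfolding P_def[abs_def] by (intro CC_add const BC_WC[OF p T0] BC_time_integral[OF Gp T])
 have DA: "DC {0..T} A" unfolding A_def[abs_def] by (intro DC_add const BC_WC[OF a T0] BC_time_integral[OF Ga T])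
 have CA: "CC {0..T} A" unfolding A_def[abs_def] by (intro CC_add const BC_WC[OF a T0] BC_time_integral[OF Ga T])
 have eP: "p t \<doteq> P t" if "t \<in> {0..T}" for t using ep[OF that] by (simp add: P_def)
 have eA: "a t \<doteq> A t" if "t \<in> {0..T}" for t using ea[OF that] by (simp add: A_def)
 have jm: "jmeas p" "jmeas a" "jmeas P" "jmeas A" using p a DP DA by (auto simp: BC_def DC_def)
 note [measurable] = jm
 \<comment> \<open>Equality at every frequency and every time, so the nonlinear terms carry over to
   the new version at once.\<close>
 have NN: "NP \<alpha> \<beta> g s (p t) (a t) = NP \<alpha> \<beta> g s (P t) (A t)" "NA \<alpha> g (p t) (a t) = NA \<alpha> g (P t) (A t)" if t: "t \<in> {0..T}" for t
  by (rule N_cong_AE[OF eP[OF t] eA[OF t]]; intro section_meas jm)+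
 have "AE t in lborel. AE \<xi> in lborel. t \<in> {0..T} \<longrightarrow> a t \<xi> = A t \<xi>"
 proof (rule AE_I2)
  fix t
  show "AE \<xi> in lborel. t \<in> {0..T} \<longrightarrow> a t \<xi> = A t \<xi>"
   using eA[of t] by (cases "t \<in> {0..T}") simp_all
 qed
 \<comment> \<open>The linear term is no convolution, hence only equal almost everywhere at each
   time. By Tonelli, at almost every frequency it agrees for almost all times, which suffices under
   the time integral.\<close>
 then have swap: "AE \<xi> in lborel. AE t in lborel. t \<in> {0..T} \<longrightarrow> a t \<xi> = A t \<xi>"
 proof (rule lborel_pair.AE_commute[THEN iffD1, rotated])
  have "(\<lambda>x. cmod (a (fst x) (snd x) - A (fst x) (snd x))) \<in> borel_measurable (lborel \<Otimes>\<^sub>M lborel)" by measurable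
  then have "{x \<in> space (lborel \<Otimes>\<^sub>M lborel). \<not> (0 \<le> fst x) \<or> \<not> (fst x \<le> T) \<or> cmod (a (fst x) (snd x) - A (fst x) (snd x)) \<le> 0} \<in> sets (lborel \<Otimes>\<^sub>M lborel)"
   by measurable
  also have "{x \<in> space (lborel \<Otimes>\<^sub>M lborel). \<not> (0 \<le> fst x) \<or> \<not> (fst x \<le> T) \<or> cmod (a (fst x) (snd x) - A (fst x) (snd x)) \<le> 0}
   = {x \<in> space (lborel \<Otimes>\<^sub>M lborel). fst x \<in> {0..T} \<longrightarrow> a (fst x) (snd x) = A (fst x) (snd x)}"
   by auto
  finally show "{x \<in> space (lborel \<Otimes>\<^sub>M lborel). fst x \<in> {0..T} \<longrightarrow> a (fst x) (snd x) = A (fst x) (snd x)} \<in> sets (lborel \<Otimes>\<^sub>M lborel)" .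
 qed
 have Ds_cong: "Ds 0 F t = Ds 0 F' t" if "AE r in lborel. r \<in> {0..T} \<longrightarrow> F r = F' r" "t \<in> {0..T}"
  "Borel F" "Borel F'" for F F' t
  unfolding Ds_def
 proof (rule integral_cong_AE)
  show "AE x in lborel. indicator {0..t} x *\<^sub>R (exp (\<i> * of_real (0 * x)) * F x) = indicator {0..t} x *\<^sub>R (exp (\<i> * of_real (0 * x)) * F' x)"
   using that(1) by eventually_elim (use that(2) in \<open>auto simp: indicator_def\<close>)
 qed (use that(3,4) in measurable)
 have PA: "AE \<xi> in lborel. \<forall>t\<in>{0..T}. P t \<xi> = p 0 \<xi> + Ds 0 (\<lambda>r. NP \<alpha> \<beta> g s (P r) (A r) \<xi>) t \<and>
   A t \<xi> = a 0 \<xi> + Ds 0 (\<lambda>r. NA \<alpha> g (P r) (A r) \<xi> + (- \<i> * of_real (\<epsilon> * \<xi>\<^sup>2 / 2)) * A r \<xi>) t"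
  using swap
 proof eventually_elim
  case (elim \<xi>)
  show ?case
  proof (intro ballI conjI)
   fix t assume t: "t \<in> {0..T}"
   have "Ds 0 (\<lambda>r. ?Gp r \<xi>) t = Ds 0 (\<lambda>r. NP \<alpha> \<beta> g s (P r) (A r) \<xi>) t"
   proof (rule Ds_cong[OF _ t])
    show "AE r in lborel. r \<in> {0..T} \<longrightarrow> NP \<alpha> \<beta> g s (p r) (a r) \<xi> = NP \<alpha> \<beta> g s (P r) (A r) \<xi>"
     by (intro AE_I2 impI) (simp only: NN)
   qed measurable
   then show "P t \<xi> = p 0 \<xi> + Ds 0 (\<lambda>r. NP \<alpha> \<beta> g s (P r) (A r) \<xi>) t" by (simp add: P_def)
   have "Ds 0 (\<lambda>r. ?Ga r \<xi>) t = Ds 0 (\<lambda>r. NA \<alpha> g (P r) (A r) \<xi> + (- \<i> * of_real (\<epsilon> * \<xi>\<^sup>2 / 2)) * A r \<xi>) t"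
   proof (rule Ds_cong[OF _ t])
    show "AE r in lborel. r \<in> {0..T} \<longrightarrow> ?Ga r \<xi> = NA \<alpha> g (P r) (A r) \<xi> + (- \<i> * of_real (\<epsilon> * \<xi>\<^sup>2 / 2)) * A r \<xi>"
     using elim by eventually_elim (simp add: NN)
   qed measurable
   then show "A t \<xi> = a 0 \<xi> + Ds 0 (\<lambda>r. NA \<alpha> g (P r) (A r) \<xi> + (- \<i> * of_real (\<epsilon> * \<xi>\<^sup>2 / 2)) * A r \<xi>) t" by (simp add: A_def)
  qed
 qed
 have cN: "CC {0..T} (\<lambda>t. NP \<alpha> \<beta> g s (P t) (A t))" "CC {0..T} (\<lambda>t \<xi>. NA \<alpha> g (P t) (A t) \<xi> + (- \<i> * of_real (\<epsilon> * \<xi>\<^sup>2 / 2)) * A t \<xi>)"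
  by (rule CC_N(1)[OF DP DA CP CA], rule CC_add[OF CC_N(2)[OF DP DA CP CA] CC_mult[OF CA]])
 have "AE \<xi> in lborel. spectral_ode \<alpha> \<beta> g s \<epsilon> T P A \<xi>"
  using PA cN(1)[unfolded CC_def] cN(2)[unfolded CC_def]
 proof eventually_elim
  case (elim \<xi>)
  show ?case
  proof (intro ballI conjI)
   fix t assume t: "t \<in> {0..T}"
   have D: "((\<lambda>t. y + Ds 0 F t) has_vector_derivative F t) (at t within {0..T})" if "continuous_on {0..T} F" for y F
    using has_vector_derivative_add[OF has_vector_derivative_const Ds_has_vector_derivative[OF that t, of 0]] by simp
   show "((\<lambda>r. P r \<xi>) has_vector_derivative NP \<alpha> \<beta> g s (P t) (A t) \<xi>) (at t within {0..T})"
    by (rule has_vector_derivative_transform[OF t _ D[OF elim(2), of "p 0 \<xi>"]]) (use elim(1) in blast)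
   have "((\<lambda>r. A r \<xi>) has_vector_derivative NA \<alpha> g (P t) (A t) \<xi> + (- \<i> * of_real (\<epsilon> * \<xi>\<^sup>2 / 2)) * A t \<xi>) (at t within {0..T})"
    by (rule has_vector_derivative_transform[OF t _ D[OF elim(3), of "a 0 \<xi>"]]) (use elim(1) in blast)
   then show "((\<lambda>r. A r \<xi>) has_vector_derivative (NA \<alpha> g (P t) (A t) \<xi> - \<i> * of_real (\<epsilon> * \<xi>\<^sup>2 / 2) * A t \<xi>)) (at t within {0..T})"
    by simp
  qed
 qed
 then have "FS \<alpha> \<beta> g s \<epsilon> T P A" using DP CP DA CA unfolding FS_def by blast
 then show ?thesis using eP eA by blast
qed

section \<open>Jointly measurable versions of paths in the class\<close>

lemma C_H_normsq_diff:
 assumes \<psi>: "\<psi> \<in> C_H w T l"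
 defines "h \<equiv> (\<lambda>t \<xi>. of_real (exp (w t * jap \<xi>)) * fourier (\<psi> t) \<xi>)"
 shows "\<And>t. t \<in> {0..T} \<Longrightarrow> h t \<in> L2" "\<And>t. t \<in> {0..T} \<Longrightarrow> Nsq l (em 0 (h t)) < top"
  "\<And>s. s \<in> {0..T} \<Longrightarrow> ((\<lambda>t. Nsq l (em 0 (h t \<ominus> h s))) \<longlongrightarrow> 0) (at s within {0..T})"
proof -
 show hL: "h t \<in> L2" if "t \<in> {0..T}" for t using \<psi> that by (auto simp: C_H_def h_def)
 have lift: "lifted w \<psi> t = inv_fourier (h t)" for t by (simp add: lifted_def h_def)
 have L: "lifted w \<psi> t \<in> L2" "fourier (lifted w \<psi> t) \<doteq> h t" if "t \<in> {0..T}" for t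
  using inv_fourier_props[OF hL[OF that]] by (auto simp: lift)
 show "Nsq l (em 0 (h t)) < top" if "t \<in> {0..T}" for t
 proof -
  have "lifted w \<psi> t \<in> H_space 0 l" using \<psi> that by (simp add: C_H_def)
  then show ?thesis using H_normsq_eq[OF L(2)[OF that], of 0 l] by (simp add: H_space_def H_norm_def)
 qed
 show "((\<lambda>t. Nsq l (em 0 (h t \<ominus> h s))) \<longlongrightarrow> 0) (at s within {0..T})" if s: "s \<in> {0..T}" for s
 proof -
  have e: "Nsq l (em 0 (h t \<ominus> h s)) = (H_norm 0 l (lifted w \<psi> t \<ominus> lifted w \<psi> s))\<^sup>2" if t: "t \<in> {0..T}" for t
  proof -
   have "AE \<xi> in lborel. fourier (lifted w \<psi> t \<ominus> lifted w \<psi> s) \<xi> = h t \<xi> - h s \<xi>"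
    using fourier_diff[OF L(1)[OF t] L(1)[OF s]] L(2)[OF t] L(2)[OF s] by eventually_elim simp
   from H_normsq_eq[OF this, of 0 l] show ?thesis by (simp add: H_norm_def)
  qed
  have "((\<lambda>t. H_norm 0 l (lifted w \<psi> t \<ominus> lifted w \<psi> s)) \<longlongrightarrow> 0) (at s within {0..T})"
   using \<psi> s by (auto simp: C_H_def)
  then have "((\<lambda>t. (H_norm 0 l (lifted w \<psi> t \<ominus> lifted w \<psi> s))\<^sup>2) \<longlongrightarrow> 0) (at s within {0..T})"
  proof (intro order_tendstoI)
   fix c :: ennreal assume lim: "((\<lambda>t. H_norm 0 l (lifted w \<psi> t \<ominus> lifted w \<psi> s)) \<longlongrightarrow> 0) (at s within {0..T})" and "0 < c"
   then have "0 < min c 1" by simp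
   then have "\<forall>\<^sub>F t in at s within {0..T}. H_norm 0 l (lifted w \<psi> t \<ominus> lifted w \<psi> s) < min c 1"
    by (rule order_tendstoD(2)[OF lim])
   then show "\<forall>\<^sub>F t in at s within {0..T}. (H_norm 0 l (lifted w \<psi> t \<ominus> lifted w \<psi> s))\<^sup>2 < c"
   proof eventually_elim
    case (elim t)
    let ?x = "H_norm 0 l (lifted w \<psi> t \<ominus> lifted w \<psi> s)"
    have "?x * ?x \<le> ?x * 1" using elim by (intro mult_left_mono) auto
    then show ?case using elim by (auto simp: power2_eq_square intro: le_less_trans)
   qed
  qed simp
  then show ?thesis
   by (rule Lim_transform_eventually) (auto simp: eventually_at_filter e intro!: always_eventually)
 qed
qed

text \<open>Continuity with values in \<open>L2\<close> does not provide joint measurability: the version is the limit of a fast sequence of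
 step functions in time, which exists by uniform continuity.\<close>

lemma C_H_version:
 assumes \<psi>: "\<psi> \<in> C_H w T l" and l: "l \<ge> 0" and T: "T \<ge> 0"
  and w: "Borel w" "\<rho>0 > 0" "\<And>t. t \<in> {0..T} \<Longrightarrow> \<rho>0 \<le> w t"
 shows "\<exists>u. BC {0..T} u \<and> (\<forall>t\<in>{0..T}. fourier (\<psi> t) \<doteq> u t)"
proof -
 define h where "h t \<xi> = of_real (exp (w t * jap \<xi>)) * fourier (\<psi> t) \<xi>" for t \<xi>
 note C = C_H_normsq_diff[OF \<psi>, folded h_def[abs_def]]
 have hL: "h t \<in> L2" if "t \<in> {0..T}" for t using C(1)[OF that] by (simp add: h_def[abs_def])
 have hfin: "Nsq l (em 0 (h t)) < top" if "t \<in> {0..T}" for t using C(2)[OF that] by (simp add: h_def[abs_def])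
 define d where "d t s = Nsq l (em 0 (h t \<ominus> h s))" for t s
 have dlim: "((\<lambda>t. d t s) \<longlongrightarrow> 0) (at s within {0..T})" if "s \<in> {0..T}" for s
  using C(3)[OF that] by (simp add: d_def h_def)
 have hm[measurable]: "Borel (h t)" if "t \<in> {0..T}" for t using hL[OF that] by (rule L2_measurable)
 have dsym: "d t s = d s t" for t s
 proof -
  have "em 0 (h t \<ominus> h s) = em 0 (h s \<ominus> h t)" by (simp add: em_def fun_eq_iff norm_minus_commute)
  then show ?thesis by (simp add: d_def)
 qed
 have tri: "Nsq l (em 0 (u \<oplus> v)) \<le> 2 * Nsq l (em 0 u) + 2 * Nsq l (em 0 v)"
  if [measurable]: "Borel u" "Borel v" for u v
 proof -
  have "Nsq l (em 0 (u \<oplus> v)) \<le> Nsq l (\<lambda>\<xi>. em 0 u \<xi> + em 0 v \<xi>)"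
   by (intro Nsq_mono) (simp add: em_def norm_triangle_ineq ennreal_leI flip: ennreal_plus)
  also have "... \<le> 2 * Nsq l (em 0 u) + 2 * Nsq l (em 0 v)" by (rule Nsq_add) measurable
  finally show ?thesis .
 qed
 have dtri: "d t s \<le> 2 * d t r + 2 * d r s" if "t \<in> {0..T}" "s \<in> {0..T}" "r \<in> {0..T}" for t s r
  using tri[of "\<lambda>\<xi>. h t \<xi> - h r \<xi>" "\<lambda>\<xi>. h r \<xi> - h s \<xi>"] hm that by (simp add: d_def)
 \<comment> \<open>Uniform continuity on a compact interval for \<open>d\<close>, which satisfies
   the triangle inequality only with factors 2; hence the quarter of \<open>e\<close> in the local
   estimate. \<open>D\<close> is a Lebesgue number of the covering by the local balls.\<close>
 have unif: "\<exists>\<delta>>0. \<forall>t\<in>{0..T}. \<forall>s\<in>{0..T}. \<bar>t - s\<bar> < \<delta> \<longrightarrow> d t s \<le> ennreal e" if e: "e > 0" for e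
 proof -
  have "\<exists>\<delta>>0. \<forall>t\<in>{0..T}. \<bar>t - r\<bar> < \<delta> \<longrightarrow> d t r \<le> ennreal (e / 4)" if r: "r \<in> {0..T}" for r
  proof -
   have "\<forall>\<^sub>F t in at r within {0..T}. d t r < ennreal (e / 4)"
    using e by (intro order_tendstoD(2)[OF dlim[OF r]]) simp
   then obtain \<delta> where \<delta>: "\<delta> > 0" "\<And>t. t \<in> {0..T} \<Longrightarrow> t \<noteq> r \<Longrightarrow> dist t r < \<delta> \<Longrightarrow> d t r < ennreal (e / 4)"
    unfolding eventually_at by blast
   have "d r r = 0" by (simp add: d_def em_def[abs_def])
   then have "\<forall>t\<in>{0..T}. \<bar>t - r\<bar> < \<delta> \<longrightarrow> d t r \<le> ennreal (e / 4)"
    using \<delta>(2) by (metis dist_real_def less_imp_le zero_le)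
   then show ?thesis using \<delta>(1) by blast
  qed
  then obtain \<delta> where \<delta>: "\<And>r. r \<in> {0..T} \<Longrightarrow> \<delta> r > 0" "\<And>r t. r \<in> {0..T} \<Longrightarrow> t \<in> {0..T} \<Longrightarrow> \<bar>t - r\<bar> < \<delta> r \<Longrightarrow> d t r \<le> ennreal (e / 4)"
   by metis
  obtain D where D: "D > 0" "\<And>x. x \<in> {0..T} \<Longrightarrow> \<exists>G\<in>(\<lambda>r. ball r (\<delta> r)) ` {0..T}. ball x D \<subseteq> G"
  proof -
   have cov: "{0..T} \<subseteq> \<Union>((\<lambda>r. ball r (\<delta> r)) ` {0..T})"
   proof
    fix x assume "x \<in> {0..T}"
    moreover from this have "x \<in> ball x (\<delta> x)" using \<delta>(1) by (intro centre_in_ball[THEN iffD2])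
    ultimately show "x \<in> \<Union>((\<lambda>r. ball r (\<delta> r)) ` {0..T})" by blast
   qed
   have op: "open G" if "G \<in> (\<lambda>r. ball r (\<delta> r)) ` {0..T}" for G using that by blast
   show thesis by (rule Heine_Borel_lemma[OF compact_Icc cov op]) (auto intro: that)
  qed
  show ?thesis
  proof (intro exI[of _ D] conjI D(1) ballI impI)
   fix t s assume ts: "t \<in> {0..T}" "s \<in> {0..T}" "\<bar>t - s\<bar> < D"
   obtain r where r: "r \<in> {0..T}" "ball s D \<subseteq> ball r (\<delta> r)" using D(2)[OF ts(2)] by blast
   have "t \<in> ball s D" "s \<in> ball s D" using ts D(1) by (auto simp: dist_real_def abs_minus_commute)
   then have "\<bar>t - r\<bar> < \<delta> r" "\<bar>s - r\<bar> < \<delta> r" using r(2) by (auto simp: dist_real_def abs_minus_commute subset_eq)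
   then have "d t r \<le> ennreal (e / 4)" "d s r \<le> ennreal (e / 4)" using \<delta>(2) r(1) ts by auto
   then have "2 * d t r + 2 * d r s \<le> 2 * ennreal (e / 4) + 2 * ennreal (e / 4)"
    using dsym[of r s] by (intro add_mono mult_left_mono) auto
   also have "... = ennreal e" using e by (simp flip: ennreal_numeral ennreal_mult ennreal_plus)
   finally show "d t s \<le> ennreal e" using dtri[OF ts(1,2) r(1)] by (rule order_trans[rotated])
  qed
 qed
 \<comment> \<open>Grid of mesh \<open>1 / (n + 1)\<close> and the index of the grid point to the
   left of \<open>t\<close>. The truncations to \<open>[0, T]\<close> keep all grid points in the
   interval and make \<open>kk n\<close> a measurable function on the whole line.\<close>
 define c where "c n k = min T (real k / real (Suc n))" for n k :: nat
 define kk where "kk n t = nat \<lfloor>max 0 (min T t) * real (Suc n)\<rfloor>" for n :: nat and t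
 have cT: "c n k \<in> {0..T}" for n k using T by (simp add: c_def)
 have ck: "\<bar>t - c n (kk n t)\<bar> < 2 / real (Suc n)" if t: "t \<in> {0..T}" for n t
 proof -
  have k: "real (kk n t) = of_int \<lfloor>t * real (Suc n)\<rfloor>"
   using t by (simp add: kk_def)
  have "real (kk n t) \<le> t * real (Suc n)" "t * real (Suc n) < real (kk n t) + 1" unfolding k by linarith+
  then have "real (kk n t) / real (Suc n) \<le> t" "t < real (kk n t) / real (Suc n) + 1 / real (Suc n)"
   by (simp_all add: field_simps del: of_nat_Suc)
  moreover have "c n (kk n t) = real (kk n t) / real (Suc n)" using calculation t by (simp add: c_def)
  moreover have "1 / real (Suc n) \<le> 2 / real (Suc n)" by (simp add: divide_right_mono)
  ultimately show ?thesis by linarith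
 qed
 have kkb: "kk n t \<le> nat \<lceil>T * real (Suc n)\<rceil>" if t: "t \<in> {0..T}" for n t
 proof -
  have "t * real (Suc n) \<le> T * real (Suc n)" using t by (intro mult_right_mono) auto
  then have "\<lfloor>t * real (Suc n)\<rfloor> \<le> \<lceil>T * real (Suc n)\<rceil>" by linarith
  then show ?thesis using t unfolding kk_def by (intro nat_mono) simp
 qed
 have "\<exists>N. \<forall>t\<in>{0..T}. d (c N (kk N t)) t \<le> ennreal e" if e: "e > 0" for e
 proof -
  obtain \<delta> where \<delta>: "\<delta> > 0" "\<And>t s. t \<in> {0..T} \<Longrightarrow> s \<in> {0..T} \<Longrightarrow> \<bar>t - s\<bar> < \<delta> \<Longrightarrow> d t s \<le> ennreal e"
   using unif[OF e] by blast
  obtain N :: nat where N: "inverse (real (Suc N)) < \<delta> / 2" using reals_Archimedean[of "\<delta> / 2"] \<delta>(1) by auto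
  have "2 / real (Suc N) < \<delta>" using N by (simp add: inverse_eq_divide field_simps del: of_nat_Suc)
  then have "d (c N (kk N t)) t \<le> ennreal e" if "t \<in> {0..T}" for t
   using ck[OF that, of N] cT that by (intro \<delta>(2)) (auto simp: abs_minus_commute)
  then show ?thesis by blast
 qed
 then have "\<forall>j. \<exists>N. \<forall>t\<in>{0..T}. d (c N (kk N t)) t \<le> ennreal ((1/2)^j)" by simp
 then obtain N where N: "\<And>j t. t \<in> {0..T} \<Longrightarrow> d (c (N j) (kk (N j) t)) t \<le> ennreal ((1/2)^j)" by metis
 define v where "v j t \<xi> = h (c (N j) (kk (N j) t)) \<xi>" for j t \<xi>
 have vm[measurable]: "jmeas (v j)" for j
 proof -
  have kkm: "(\<lambda>p. kk (N j) (fst p)) \<in> measurable (borel \<Otimes>\<^sub>M (borel :: real measure)) (count_space UNIV)"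
   unfolding kk_def by measurable
  have "(\<lambda>p. (\<lambda>k p. h (c (N j) k) (snd p)) (kk (N j) (fst p)) p) \<in> borel_measurable (borel \<Otimes>\<^sub>M borel)"
   by (rule measurable_compose_countable[OF _ kkm]) (use hm[OF cT] in measurable)
  then show ?thesis by (simp add: v_def[abs_def] case_prod_unfold)
 qed
 define g where "g t \<xi> = lim (\<lambda>j. v j t \<xi>)" for t \<xi>
 have gm[measurable]: "jmeas g" unfolding g_def case_prod_unfold by measurable
 have vh: "AE \<xi> in lborel. (\<lambda>j. v j t \<xi>) \<longlonglongrightarrow> h t \<xi>" if t: "t \<in> {0..T}" for t
 proof (rule AE_tendsto_of_summable_n2)
  show "Borel (v j t)" for j using vm by (rule section_meas)
  show "Borel (h t)" by (rule hm[OF t])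
  fix j
  have "n2 (v j t \<ominus> h t) = Nsq 0 (em 0 (v j t \<ominus> h t))" by (simp add: n2_def Nsq_def em_def ennreal_power)
  also have "... \<le> d (c (N j) (kk (N j) t)) t" unfolding d_def v_def by (rule Nsq_mono_p[OF l])
  also have "... \<le> ennreal ((1/2)^j)" by (rule N[OF t])
  finally show "n2 (v j t \<ominus> h t) \<le> ennreal ((1/2)^j)" .
 qed
 have gh: "g t \<doteq> h t" if t: "t \<in> {0..T}" for t
  using vh[OF t] by eventually_elim (simp add: g_def limI)
 define u where "u t \<xi> = of_real (exp (- w t * jap \<xi>)) * g t \<xi>" for t \<xi>
 have um: "jmeas u" unfolding u_def case_prod_unfold using w(1) by measurable
 have uf: "fourier (\<psi> t) \<doteq> u t" if t: "t \<in> {0..T}" for t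
  using gh[OF t]
 proof eventually_elim
  case (elim \<xi>)
  have "complex_of_real (exp (- w t * jap \<xi>)) * complex_of_real (exp (w t * jap \<xi>)) = 1"
   by (simp flip: of_real_mult exp_add)
  then show ?case by (simp add: u_def elim h_def mult.assoc[symmetric])
 qed
 \<comment> \<open>The uniform bound comes from the coarsest approximation: every \<open>h t\<close>
   is within squared distance 1 of one of the finitely many grid values of step
   \<open>N 0\<close>.\<close>
 define m where "m = nat \<lceil>T * real (Suc (N 0))\<rceil>"
 define K where "K = 2 + 2 * (\<Sum>k\<le>m. Nsq l (em 0 (h (c (N 0) k))))"
 have "(\<Sum>k\<le>i. Nsq l (em 0 (h (c (N 0) k)))) < top" for i
  by (induction i) (simp_all add: hfin[OF cT])
 then have "K < top" by (simp add: K_def ennreal_mult_less_top)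
 moreover have "Eq \<rho>0 (na (u t)) \<le> K" if t: "t \<in> {0..T}" for t
 proof -
  have "Eq \<rho>0 (na (u t)) \<le> Nsq 0 (em 0 (h t))"
   unfolding Eq_def Nsq_def
  proof (intro nn_integral_mono_AE, use gh[OF t] in eventually_elim)
   case (elim \<xi>)
   have "exp (\<rho>0 * jap \<xi>) * exp (- w t * jap \<xi>) \<le> 1"
    using mult_right_mono[OF w(3)[OF t] jap_nonneg[of \<xi>]] by (simp flip: exp_add)
   then have "exp (\<rho>0 * jap \<xi>) * exp (- w t * jap \<xi>) * cmod (h t \<xi>) \<le> 1 * cmod (h t \<xi>)"
    by (intro mult_right_mono) auto
   then have "ennreal (exp (\<rho>0 * jap \<xi>)) * na (u t) \<xi> \<le> em 0 (h t) \<xi>"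
    by (simp add: na_def u_def elim em_def norm_mult ennreal_leI mult.assoc flip: ennreal_mult)
   then show ?case by (intro power_mono) auto
  qed
  also have "... \<le> Nsq l (em 0 (h t))" by (rule Nsq_mono_p[OF l])
  also have "... \<le> 2 * d t (c (N 0) (kk (N 0) t)) + 2 * Nsq l (em 0 (h (c (N 0) (kk (N 0) t))))"
   using tri[of "\<lambda>\<xi>. h t \<xi> - h (c (N 0) (kk (N 0) t)) \<xi>" "h (c (N 0) (kk (N 0) t))"] hm[OF t] hm[OF cT] by (simp add: d_def)
  also have "... \<le> 2 * 1 + 2 * (\<Sum>k\<le>m. Nsq l (em 0 (h (c (N 0) k))))"
  proof (intro add_mono mult_left_mono)
   show "d t (c (N 0) (kk (N 0) t)) \<le> 1" using N[OF t, of 0] dsym by simp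
   show "Nsq l (em 0 (h (c (N 0) (kk (N 0) t)))) \<le> (\<Sum>k\<le>m. Nsq l (em 0 (h (c (N 0) k))))"
    using kkb[OF t, of "N 0"] by (intro member_le_sum) (auto simp: m_def)
  qed auto
  finally show ?thesis by (simp add: K_def)
 qed
 ultimately have "BC {0..T} u" using um w(2) unfolding BC_def by blast
 then show ?thesis using uf by blast
qed

text \<open>At each time the solution is almost everywhere the inverse transform of a version of its
  transform; both are continuous in \<open>x\<close>, hence equal. The system, holding at every
  \<open>x\<close>, then says that these inverse transforms have time derivatives given by the
  nonlinearities, and the integral equation follows.\<close>

theorem X_solution_FS:
 assumes X: "X_solution (power_nl \<alpha> (Suc g)) (power_nl \<beta> (Suc s)) \<epsilon> w T l \<phi>0 a0 \<phi> a"
  and l: "l \<ge> 0" and T: "T > 0" and w: "Borel w" "\<rho>0 > 0" "\<And>t. t \<in> {0..T} \<Longrightarrow> \<rho>0 \<le> w t"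
 shows "\<exists>P A. FS \<alpha> \<beta> g s \<epsilon> T P A \<and> (\<forall>t\<in>{0..T}. \<phi> t = IF (P t) \<and> a t = IF (A t))"
proof -
 have CH: "\<phi> \<in> C_H w T (l + 1)" "a \<in> C_H w T l"
  using X by (auto simp: X_solution_def X_space_def Y_space_def)
 have sol: "solves_system (power_nl \<alpha> (Suc g)) (power_nl \<beta> (Suc s)) \<epsilon> T \<phi> a"
  using X by (simp add: X_solution_def)
 obtain p where p: "BC {0..T} p" and pf: "\<And>t. t \<in> {0..T} \<Longrightarrow> fourier (\<phi> t) \<doteq> p t"
  using C_H_version[OF CH(1) _ _ w] l T by auto
 obtain b where b: "BC {0..T} b" and bf: "\<And>t. t \<in> {0..T} \<Longrightarrow> fourier (a t) \<doteq> b t"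
  using C_H_version[OF CH(2) _ _ w] l T by auto
 have Wp: "WC (p t)" and Wb: "WC (b t)" if "t \<in> {0..T}" for t using BC_WC[OF p that] BC_WC[OF b that] by auto
 have eqIF: "\<psi> = IF h" if L: "\<psi> \<in> L2" and f: "fourier \<psi> \<doteq> h" and h: "WC h" and d: "\<And>x. \<psi> differentiable (at x)" for \<psi> h
 proof (rule continuous_AE_eq)
  show "continuous_on UNIV \<psi>" using d by (auto intro!: continuous_at_imp_continuous_on differentiable_imp_continuous_within)
  show "continuous_on UNIV (IF h)"
   using IF_deriv_WC(3)[OF h] by (auto intro!: continuous_at_imp_continuous_on differentiable_imp_continuous_within)
  show "\<psi> \<doteq> IF h" by (rule IF_fourier[OF L WC_measurable[OF h] f WC_integrable[OF h]])
 qed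
 have \<phi>: "\<phi> t = IF (p t)" and a: "a t = IF (b t)" if t: "t \<in> {0..T}" for t
 proof -
  have L: "\<phi> t \<in> L2" "a t \<in> L2" using CH t by (simp_all add: C_H_def)
  have d: "\<phi> t differentiable (at x)" "a t differentiable (at x)" for x using sol t by (simp_all add: solves_system_def)
  show "\<phi> t = IF (p t)" by (rule eqIF[OF L(1) pf[OF t] Wp[OF t] d(1)])
  show "a t = IF (b t)" by (rule eqIF[OF L(2) bf[OF t] Wb[OF t] d(2)])
 qed
 let ?Ga = "\<lambda>r \<xi>. NA \<alpha> g (p r) (b r) \<xi> + (- \<i> * of_real (\<epsilon> * \<xi>\<^sup>2 / 2)) * b r \<xi>"
 have Ga: "BC {0..T} ?Ga"
 proof (intro BC_add BC_N p b)
  show "BC {0..T} (\<lambda>r \<xi>. (- \<i> * of_real (\<epsilon> * \<xi>\<^sup>2 / 2)) * b r \<xi>)"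
  proof (rule BC_mult[OF b, where C="\<bar>\<epsilon>\<bar>" and p=2])
   fix \<xi>
   have "\<xi>\<^sup>2 \<le> 2 * (jap \<xi>)\<^sup>2" by (simp add: jap_sq)
   then have "\<bar>\<epsilon>\<bar> * (\<xi>\<^sup>2 / 2) \<le> \<bar>\<epsilon>\<bar> * (jap \<xi>)\<^sup>2" by (intro mult_left_mono) auto
   then show "cmod (- \<i> * of_real (\<epsilon> * \<xi>\<^sup>2 / 2)) \<le> \<bar>\<epsilon>\<bar> * jap \<xi> powr 2"
    by (simp add: norm_mult norm_divide norm_power)
  qed auto
 qed
 have hvd: "((\<lambda>r. f r) has_vector_derivative vector_derivative f (at t within {0..T})) (at t within {0..T})"
  if "f differentiable (at t within {0..T})" for f :: cfun and t
  using that by (simp add: vector_derivative_works)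
 have D: "((\<lambda>t. IF (p t) x) has_vector_derivative IF (NP \<alpha> \<beta> g s (p t) (b t)) x) (at t within {0..T})"
  "((\<lambda>t. IF (b t) x) has_vector_derivative IF (?Ga t) x) (at t within {0..T})" if t: "t \<in> {0..T}" for t x
 proof -
  have Dp: "Dx \<phi> t = IF (dh (p t))" "Dx a t = IF (dh (b t))"
   unfolding Dx_def \<phi>[OF t] a[OF t] using IF_deriv_WC(2) Wp[OF t] Wb[OF t] by auto
  have DDp: "Dx (Dx \<phi>) t x = IF (dh (dh (p t))) x" "Dx (Dx a) t x = IF (dh (dh (b t))) x"
   unfolding Dx_def[of "Dx \<phi>"] Dx_def[of "Dx a"] Dp using Wp[OF t] Wb[OF t] by (auto intro: IF_deriv_WC WC_dh)
  have Dg: "Dx (\<lambda>t x. of_real (power_nl \<alpha> (Suc g) ((cmod (a t x))\<^sup>2)) * a t x) t x = IF (dh (\<lambda>\<xi>. of_real \<alpha> * conv (PC (b t) g) (b t) \<xi>)) x"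
   unfolding Dx_def a[OF t] g_term_IF[OF Wb[OF t]] by (intro IF_deriv_WC WC_cmult WC_conv WC_PC Wb t)
  have S: "(\<lambda>r. \<phi> r x) differentiable (at t within {0..T})" "(\<lambda>r. a r x) differentiable (at t within {0..T})"
   "Dt T \<phi> t x + 1/2 * (Dx \<phi> t x)\<^sup>2 + 1/2 * of_real (power_nl \<alpha> (Suc g) ((cmod (a t x))\<^sup>2)) * Dx \<phi> t x
    + of_real (power_nl \<beta> (Suc s) ((cmod (a t x))\<^sup>2)) = 0"
   "Dt T a t x + Dx \<phi> t x * Dx a t x + 1/2 * a t x * Dx (Dx \<phi>) t x
    + 1/2 * Dx (\<lambda>t x. of_real (power_nl \<alpha> (Suc g) ((cmod (a t x))\<^sup>2)) * a t x) t x = \<i> * of_real \<epsilon> / 2 * Dx (Dx a) t x"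
   using sol t unfolding solves_system_def by blast+
  have e1: "Dt T \<phi> t x = IF (NP \<alpha> \<beta> g s (p t) (b t)) x"
   using S(3) unfolding IF_NP[OF Wp[OF t] Wb[OF t]] Dp a[OF t] by (simp add: algebra_simps add_eq_0_iff)
  have Ga_eq: "?Ga t = (\<lambda>\<xi>. NA \<alpha> g (p t) (b t) \<xi> - \<i> * of_real (\<epsilon> * \<xi>\<^sup>2 / 2) * b t \<xi>)" by simp
  have e2: "Dt T a t x = IF (?Ga t) x"
   using S(4) unfolding Ga_eq IF_schroedinger[OF Wb[OF t] Wp[OF t]] IF_NA[OF Wp[OF t] Wb[OF t]] Dp DDp Dg unfolding a[OF t]
   by (simp add: algebra_simps)
  have 1: "((\<lambda>r. \<phi> r x) has_vector_derivative IF (NP \<alpha> \<beta> g s (p t) (b t)) x) (at t within {0..T})"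
   using hvd[OF S(1)] e1 by (simp add: Dt_def)
  have 2: "((\<lambda>r. a r x) has_vector_derivative IF (?Ga t) x) (at t within {0..T})"
   using hvd[OF S(2)] e2 by (simp add: Dt_def)
  show "((\<lambda>t. IF (p t) x) has_vector_derivative IF (NP \<alpha> \<beta> g s (p t) (b t)) x) (at t within {0..T})"
   by (rule has_vector_derivative_transform[OF t _ 1]) (simp add: \<phi>)
  show "((\<lambda>t. IF (b t) x) has_vector_derivative IF (?Ga t) x) (at t within {0..T})"
   by (rule has_vector_derivative_transform[OF t _ 2]) (simp add: a)
 qed
 have ep: "AE \<xi> in lborel. p t \<xi> = p 0 \<xi> + Ds 0 (\<lambda>r. NP \<alpha> \<beta> g s (p r) (b r) \<xi>) t" if "t \<in> {0..T}" for t
  by (rule integral_equation_of_derivative[OF BC_N(1)[OF p b] Wp D(1) that])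
 have ea: "AE \<xi> in lborel. b t \<xi> = b 0 \<xi> + Ds 0 (\<lambda>r. ?Ga r \<xi>) t" if "t \<in> {0..T}" for t
  by (rule integral_equation_of_derivative[OF Ga Wb D(2) that])
 obtain P A where PA: "FS \<alpha> \<beta> g s \<epsilon> T P A" "\<And>t. t \<in> {0..T} \<Longrightarrow> p t \<doteq> P t" "\<And>t. t \<in> {0..T} \<Longrightarrow> b t \<doteq> A t"
  using FS_of_integral_equation[OF p b _ ep ea Ga] T by fastforce
 have W: "WC (P t)" "WC (A t)" if "t \<in> {0..T}" for t
  using PA(1) that by (auto simp: FS_def intro: BC_WC DC_BC)
 have "IF (p t) = IF (P t)" "IF (b t) = IF (A t)" if t: "t \<in> {0..T}" for t
  by (intro IF_cong_AE PA(2,3) t WC_measurable Wp Wb W)+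
 then show ?thesis using PA(1) \<phi> a by auto
qed

section \<open>Stability\<close>

text \<open>Polynomials with nonnegative coefficients are convex on majorants. With \<open>U = V + D\<close> and \<open>W = V + D / \<theta>\<close> this
 bounds the variation of a nonlinearity between \<open>V\<close> and \<open>V + D\<close> by \<open>\<theta>\<close> times its value at \<open>W\<close>.\<close>

definition Cvx :: "ennreal \<Rightarrow> ennreal \<Rightarrow> nnfun \<Rightarrow> nnfun \<Rightarrow> nnfun \<Rightarrow> bool" where
 "Cvx c \<theta> U V W \<longleftrightarrow> Borel U \<and> Borel V \<and> Borel W \<and>
  (\<forall>\<xi>. U \<xi> \<le> c * V \<xi> + \<theta> * W \<xi> \<and> V \<xi> \<le> W \<xi>)"

text \<open>The mixed products are controlled by
  \<open>v1 * w2 + w1 * v2 \<le> v1 * v2 + w1 * w2\<close>, which holds because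
  \<open>v1 \<le> w1\<close> and \<open>v2 \<le> w2\<close>; the terms then recombine by
  \<open>c + \<theta> = 1\<close>.\<close>

lemma convex_mult_ennreal:
 fixes c \<theta> u1 :: ennreal
 assumes c: "c + \<theta> = 1" and u: "u1 \<le> c * v1 + \<theta> * w1" "u2 \<le> c * v2 + \<theta> * w2" and "v1 \<le> w1" "v2 \<le> w2"
 shows "u1 * u2 \<le> c * (v1 * v2) + \<theta> * (w1 * w2)"
proof -
 obtain d1 d2 where d: "w1 = v1 + d1" "w2 = v2 + d2"
  using assms(4,5) by (auto simp: le_iff_add)
 have x: "v1 * w2 + w1 * v2 \<le> v1 * v2 + w1 * w2"
  unfolding d by (simp add: distrib_left distrib_right add_ac add_increasing2 add_left_mono)
 have "u1 * u2 \<le> (c * v1 + \<theta> * w1) * (c * v2 + \<theta> * w2)"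
  by (intro mult_mono u) auto
 also have "... = c * c * (v1 * v2) + (c * \<theta>) * (v1 * w2 + w1 * v2) + \<theta> * \<theta> * (w1 * w2)"
  by (simp add: distrib_left distrib_right mult_ac add_ac)
 also have "... \<le> c * c * (v1 * v2) + (c * \<theta>) * (v1 * v2 + w1 * w2) + \<theta> * \<theta> * (w1 * w2)"
  by (intro add_right_mono add_left_mono mult_left_mono x) auto
 also have "... = c * (c + \<theta>) * (v1 * v2) + \<theta> * (c + \<theta>) * (w1 * w2)"
  by (simp add: distrib_left distrib_right mult_ac add_ac)
 finally show ?thesis by (simp add: c)
qed

lemma Cvx_cv:
 assumes c: "c + \<theta> = 1" and U: "Cvx c \<theta> U V W" and U': "Cvx c \<theta> U' V' W'"
 shows "Cvx c \<theta> (cv U U') (cv V V') (cv W W')"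
proof -
 have [measurable]: "Borel U" "Borel V" "Borel W"
  "Borel U'" "Borel V'" "Borel W'"
  using U U' by (auto simp: Cvx_def)
 have "cv U U' \<xi> \<le> c * cv V V' \<xi> + \<theta> * cv W W' \<xi>" for \<xi>
 proof -
  have "cv U U' \<xi> \<le> (\<integral>\<^sup>+\<eta>. c * (V (\<xi> - \<eta>) * V' \<eta>) + \<theta> * (W (\<xi> - \<eta>) * W' \<eta>) \<partial>lborel)"
   unfolding cv_def using U U' by (intro nn_integral_mono convex_mult_ennreal c) (auto simp: Cvx_def)
  also have "... = c * cv V V' \<xi> + \<theta> * cv W W' \<xi>"
   unfolding cv_def by (simp add: nn_integral_add nn_integral_cmult)
  finally show ?thesis .
 qed
 moreover have "cv V V' \<xi> \<le> cv W W' \<xi>" for \<xi>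
  using U U' by (intro cv_mono) (auto simp: Cvx_def)
 ultimately show ?thesis by (simp add: Cvx_def)
qed

lemma Cvx_rf: "Cvx c \<theta> U V W \<Longrightarrow> Cvx c \<theta> (rf U) (rf V) (rf W)"
 by (auto simp: Cvx_def rf_def[of U] rf_def[of V] rf_def[of W] intro!: rf_measurable)

lemma Cvx_mult:
 assumes U: "Cvx c \<theta> U V W" and [measurable]: "Borel B"
 shows "Cvx c \<theta> (\<lambda>\<xi>. B \<xi> * U \<xi>) (\<lambda>\<xi>. B \<xi> * V \<xi>) (\<lambda>\<xi>. B \<xi> * W \<xi>)"
proof -
 have [measurable]: "Borel U" "Borel V" "Borel W"
  using U by (auto simp: Cvx_def)
 have "B \<xi> * U \<xi> \<le> c * (B \<xi> * V \<xi>) + \<theta> * (B \<xi> * W \<xi>)" for \<xi>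
 proof -
  have "B \<xi> * U \<xi> \<le> B \<xi> * (c * V \<xi> + \<theta> * W \<xi>)"
   using U by (intro mult_left_mono) (auto simp: Cvx_def)
  then show ?thesis by (simp add: distrib_left mult_ac)
 qed
 moreover have "B \<xi> * V \<xi> \<le> B \<xi> * W \<xi>" for \<xi> using U by (intro mult_left_mono) (auto simp: Cvx_def)
 ultimately show ?thesis by (simp add: Cvx_def)
qed

lemma Cvx_add:
 assumes U: "Cvx c \<theta> U V W" and U': "Cvx c \<theta> U' V' W'"
 shows "Cvx c \<theta> (U \<oplus> U') (V \<oplus> V') (W \<oplus> W')"
proof -
 have [measurable]: "Borel U" "Borel V" "Borel W"
  "Borel U'" "Borel V'" "Borel W'"
  using U U' by (auto simp: Cvx_def)
 have "U \<xi> + U' \<xi> \<le> c * (V \<xi> + V' \<xi>) + \<theta> * (W \<xi> + W' \<xi>)" for \<xi>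
 proof -
  have "U \<xi> + U' \<xi> \<le> (c * V \<xi> + \<theta> * W \<xi>) + (c * V' \<xi> + \<theta> * W' \<xi>)"
   using U U' by (intro add_mono) (auto simp: Cvx_def)
  then show ?thesis by (simp add: distrib_left add_ac)
 qed
 moreover have "V \<xi> + V' \<xi> \<le> W \<xi> + W' \<xi>" for \<xi> using U U' by (intro add_mono) (auto simp: Cvx_def)
 ultimately show ?thesis by (simp add: Cvx_def)
qed

lemma Cvx_jm: "Cvx c \<theta> U V W \<Longrightarrow> Cvx c \<theta> (jm q U) (jm q V) (jm q W)"
 unfolding jm_def[abs_def] by (intro Cvx_mult) auto

lemma Cvx_PV: "c + \<theta> = 1 \<Longrightarrow> Cvx c \<theta> U V W \<Longrightarrow> Cvx c \<theta> (PV U k) (PV V k) (PV W k)"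
 by (induction k) (auto intro!: Cvx_cv Cvx_rf)

lemma Cvx_Q:
 assumes c: "c + \<theta> = 1" and X: "Cvx c \<theta> X X' X''" and Y: "Cvx c \<theta> Y Y' Y''"
 shows "Cvx c \<theta> (QP A g s X Y) (QP A g s X' Y') (QP A g s X'' Y'')"
  and "Cvx c \<theta> (QA A g X Y) (QA A g X' Y') (QA A g X'' Y'')"
 unfolding QP_def[abs_def] QA_def[abs_def]
 by (intro Cvx_mult Cvx_add Cvx_cv Cvx_PV Cvx_jm c X Y; simp)+

lemma Rl_intro:
 assumes [measurable]: "Borel u" "Borel u'"
  "Borel V" "Borel D"
  and "\<And>\<xi>. em \<rho> u' \<xi> \<le> V \<xi>" "\<And>\<xi>. em \<rho> (u \<ominus> u') \<xi> \<le> D \<xi>"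
 shows "Rl \<rho> u u' (V \<oplus> D) V"
 using assms by (simp add: Rl_def add.commute add_left_mono)

text \<open>\<open>Rl\<close> and convexity bound the same quantity, and \<open>V\<close> is
  cancelled from both sides. This is possible only where \<open>V\<close> is finite, hence the value
  \<open>top\<close> elsewhere.\<close>

lemma Cvx_Rl_bound:
 assumes R: "Rl \<rho> u u' U V" and C: "Cvx c \<theta> U V W" and c: "c \<le> 1"
 shows "em \<rho> (u \<ominus> u') \<xi> \<le> (if V \<xi> = top then top else \<theta> * W \<xi>)"
proof (cases "V \<xi> = top")
 case False
 have "em \<rho> (u \<ominus> u') \<xi> + V \<xi> \<le> U \<xi>" using R by (simp add: Rl_def)
 also have "U \<xi> \<le> c * V \<xi> + \<theta> * W \<xi>" using C by (simp add: Cvx_def)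
 also have "... \<le> 1 * V \<xi> + \<theta> * W \<xi>" by (intro add_right_mono mult_right_mono c) auto
 finally have "V \<xi> + em \<rho> (u \<ominus> u') \<xi> \<le> V \<xi> + \<theta> * W \<xi>" by (simp add: add.commute)
 then show ?thesis using False by (simp add: ennreal_add_left_cancel_le)
qed simp

definition Ndom :: "real \<Rightarrow> real \<Rightarrow> nat \<Rightarrow> nat \<Rightarrow> nnfun \<Rightarrow> nnfun \<Rightarrow> nnfun \<Rightarrow> nnfun \<Rightarrow>
  nnfun \<Rightarrow> nnfun \<Rightarrow> bool" where
 "Ndom \<alpha> \<beta> g s VX VY DX DY EP EA \<longleftrightarrow> (\<forall>\<rho> p p' a a'. \<rho> \<ge> 0 \<longrightarrow> Borel p \<longrightarrow> Borel p' \<longrightarrow>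
    Borel a \<longrightarrow> Borel a' \<longrightarrow>
    (\<forall>\<xi>. em \<rho> (jc p') \<xi> \<le> VX \<xi> \<and> em \<rho> a' \<xi> \<le> VY \<xi> \<and>
      em \<rho> (jc p \<ominus> jc p') \<xi> \<le> DX \<xi> \<and> em \<rho> (a \<ominus> a') \<xi> \<le> DY \<xi>) \<longrightarrow>
    (\<forall>\<xi>. em \<rho> (NP \<alpha> \<beta> g s p a \<ominus> NP \<alpha> \<beta> g s p' a') \<xi> \<le> EP \<xi> \<and>
       em \<rho> (NA \<alpha> g p a \<ominus> NA \<alpha> g p' a') \<xi> \<le> EA \<xi>))"

text \<open>A Lipschitz estimate in scaled form: differences of size \<open>\<theta>\<close> lead to
  differences of size \<open>\<theta>\<close> of the nonlinearities, squared since
  \<open>Nsq\<close> is a squared norm. \<open>C\<close> does not depend on \<open>\<theta>\<close>,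
  and \<open>EP\<close>, \<open>EA\<close> serve all weights at once.\<close>

definition N_lipschitz :: "real \<Rightarrow> ennreal \<Rightarrow> real \<Rightarrow> real \<Rightarrow> nat \<Rightarrow> nat \<Rightarrow> ennreal \<Rightarrow> bool" where
 "N_lipschitz l K \<alpha> \<beta> g s C \<longleftrightarrow> (\<forall>\<theta>>0. \<forall>VX VY DX DY. \<theta> \<le> 1 \<longrightarrow>
  Borel VX \<longrightarrow> Borel VY \<longrightarrow> Borel DX \<longrightarrow> Borel DY \<longrightarrow>
  Nsq l VX \<le> K \<longrightarrow> Nsq l VY \<le> K \<longrightarrow> Nsq l DX \<le> ennreal (\<theta>\<^sup>2) * K \<longrightarrow> Nsq l DY \<le> ennreal (\<theta>\<^sup>2) * K \<longrightarrow>
  (\<exists>EP EA. Borel EP \<and> Borel EA \<and>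
   Nsq l EP \<le> ennreal (\<theta>\<^sup>2) * C \<and> Nsq (l - 1) EA \<le> ennreal (\<theta>\<^sup>2) * C \<and>
   Ndom \<alpha> \<beta> g s VX VY DX DY EP EA))"

lemmas N_lipschitzD = N_lipschitz_def[THEN iffD1, rule_format]

text \<open>The majorants \<open>W = V + D / \<theta>\<close> stay in a ball of squared radius
  \<open>4 * K\<close> for every \<open>\<theta>\<close>, since \<open>D\<close> has squared norm at
  most \<open>\<theta>^2 * K\<close>. \<open>Q_bound\<close> on that ball gives \<open>C\<close>,
  and convexity contributes the factor \<open>\<theta>\<close>.\<close>

lemma N_difference:
 assumes l: "l \<ge> 1" and K: "K < top" and A: "A \<ge> 1" "\<bar>\<alpha>\<bar> \<le> A" "\<bar>\<beta>\<bar> \<le> A"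
 shows "\<exists>C<top. N_lipschitz l K \<alpha> \<beta> g s C"
proof -
 have "4 * K < top" using K by (simp add: ennreal_mult_less_top)
 then obtain C where C: "C < top" and Q: "\<And>X Y. Borel X \<Longrightarrow> Borel Y \<Longrightarrow>
   Nsq l X \<le> 4 * K \<Longrightarrow> Nsq l Y \<le> 4 * K \<Longrightarrow> Nsq l (QP (ennreal A) g s X Y) \<le> C \<and> Nsq (l - 1) (QA (ennreal A) g X Y) \<le> C"
  using Q_bound[OF l, of "4 * K" "ennreal A" g s] by auto
 show ?thesis
 proof (rule exI[of _ C], unfold N_lipschitz_def, intro conjI C allI impI)
  fix \<theta> :: real and VX VY DX DY :: nnfun
  assume \<theta>: "0 < \<theta>" "\<theta> \<le> 1"
   and [measurable]: "Borel VX" "Borel VY" "Borel DX" "Borel DY"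
   and V: "Nsq l VX \<le> K" "Nsq l VY \<le> K" and D: "Nsq l DX \<le> ennreal (\<theta>\<^sup>2) * K" "Nsq l DY \<le> ennreal (\<theta>\<^sup>2) * K"
  define c where "c = ennreal (1 - \<theta>)"
  define W where "W V D \<xi> = V \<xi> + ennreal (1 / \<theta>) * D \<xi>" for V D :: nnfun and \<xi> :: real
  have [measurable]: "Borel (W V D)" if [measurable]: "Borel V" "Borel D" for V D
   unfolding W_def by measurable
  have c: "c + ennreal \<theta> = 1" "c \<le> 1" using \<theta> by (simp_all add: c_def flip: ennreal_plus)
  have W: "Cvx c (ennreal \<theta>) (V \<oplus> D) V (W V D)" if [measurable]: "Borel V" "Borel D" for V D
  proof -
   have "V \<xi> + D \<xi> = c * V \<xi> + ennreal \<theta> * W V D \<xi>" for \<xi>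
   proof -
    have "c * V \<xi> + ennreal \<theta> * W V D \<xi> = (c + ennreal \<theta>) * V \<xi> + ennreal (\<theta> * (1 / \<theta>)) * D \<xi>"
     unfolding W_def using \<theta> by (simp add: distrib_left distrib_right add.assoc mult.assoc[symmetric] flip: ennreal_mult)
    then show ?thesis using \<theta> c by simp
   qed
   then show ?thesis by (simp add: Cvx_def) (simp add: W_def)
  qed
  have NW: "Nsq l (W V D) \<le> 4 * K" if [measurable]: "Borel V" "Borel D"
   and v: "Nsq l V \<le> K" and d: "Nsq l D \<le> ennreal (\<theta>\<^sup>2) * K" for V D
  proof -
   have "Nsq l (\<lambda>\<xi>. ennreal (1 / \<theta>) * D \<xi>) \<le> (ennreal (1 / \<theta>))\<^sup>2 * (ennreal (\<theta>\<^sup>2) * K)"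
    unfolding Nsq_cmult[OF that(2)] by (intro mult_left_mono d) auto
   also have "... = K" using \<theta> by (simp add: ennreal_power mult.assoc[symmetric] power_divide flip: ennreal_mult)
   finally have "Nsq l (W V D) \<le> 2 * K + 2 * K"
    unfolding W_def[abs_def] by (intro order_trans[OF Nsq_add] add_mono mult_left_mono v) auto
   also have "... = 4 * K" by (simp flip: distrib_right)
   finally show ?thesis .
  qed
  have CW: "Cvx c (ennreal \<theta>) (VX \<oplus> DX) VX (W VX DX)" "Cvx c (ennreal \<theta>) (VY \<oplus> DY) VY (W VY DY)"
   by (rule W; simp)+
  note CQ = Cvx_Q[OF c(1) CW]
  \<comment> \<open>The value \<open>top\<close> is taken only on a null set, because the nonlinear
    majorants at \<open>VX\<close>, \<open>VY\<close> have finite norm.\<close>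
  define EP where "EP \<xi> = (if QP (ennreal A) g s VX VY \<xi> = top then top else ennreal \<theta> * QP (ennreal A) g s (W VX DX) (W VY DY) \<xi>)" for \<xi>
  define EA where "EA \<xi> = (if QA (ennreal A) g VX VY \<xi> = top then top else ennreal \<theta> * QA (ennreal A) g (W VX DX) (W VY DY) \<xi>)" for \<xi>
  have [measurable]: "Borel EP" "Borel EA"
   unfolding EP_def EA_def by measurable
  have QW: "Nsq l (QP (ennreal A) g s (W VX DX) (W VY DY)) \<le> C" "Nsq (l - 1) (QA (ennreal A) g (W VX DX) (W VY DY)) \<le> C"
   using Q[OF _ _ NW NW, of VX DX VY DY] V D by auto
  have "K \<le> 4 * K" using mult_right_mono[of 1 4 K] by simp
  then have "Nsq l VX \<le> 4 * K" "Nsq l VY \<le> 4 * K" using V by (blast intro: order_trans)+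
  then have "Nsq l (QP (ennreal A) g s VX VY) < top" "Nsq (l - 1) (QA (ennreal A) g VX VY) < top"
   using Q[of VX VY] C by (auto intro: le_less_trans)
  then have f: "AE \<xi> in lborel. QP (ennreal A) g s VX VY \<xi> \<noteq> top" "AE \<xi> in lborel. QA (ennreal A) g VX VY \<xi> \<noteq> top"
   using AE_finite_of_Nsq[of "QP (ennreal A) g s VX VY" l] AE_finite_of_Nsq[of "QA (ennreal A) g VX VY" "l - 1"] by (simp_all add: less_top)
  have sq: "(ennreal \<theta>)\<^sup>2 = ennreal (\<theta>\<^sup>2)" using \<theta> by (simp add: ennreal_power)
  have "Nsq l EP \<le> Nsq l (\<lambda>\<xi>. ennreal \<theta> * QP (ennreal A) g s (W VX DX) (W VY DY) \<xi>)"
   by (rule Nsq_mono_AE) (use f(1) in \<open>eventually_elim, simp add: EP_def\<close>)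
  also have "... \<le> ennreal (\<theta>\<^sup>2) * C" by (subst Nsq_cmult) (auto simp: sq intro!: mult_left_mono QW)
  finally have EP: "Nsq l EP \<le> ennreal (\<theta>\<^sup>2) * C" .
  have "Nsq (l - 1) EA \<le> Nsq (l - 1) (\<lambda>\<xi>. ennreal \<theta> * QA (ennreal A) g (W VX DX) (W VY DY) \<xi>)"
   by (rule Nsq_mono_AE) (use f(2) in \<open>eventually_elim, simp add: EA_def\<close>)
  also have "... \<le> ennreal (\<theta>\<^sup>2) * C" by (subst Nsq_cmult) (auto simp: sq intro!: mult_left_mono QW)
  finally have EA: "Nsq (l - 1) EA \<le> ennreal (\<theta>\<^sup>2) * C" .
  show "\<exists>EP EA. Borel EP \<and> Borel EA \<and>
   Nsq l EP \<le> ennreal (\<theta>\<^sup>2) * C \<and> Nsq (l - 1) EA \<le> ennreal (\<theta>\<^sup>2) * C \<and>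
   Ndom \<alpha> \<beta> g s VX VY DX DY EP EA"
  proof (rule exI[of _ EP], rule exI[of _ EA], intro conjI EP EA, simp, simp, unfold Ndom_def, intro allI impI)
   fix \<rho> :: real and p p' a a' \<xi>
   assume \<rho>: "0 \<le> \<rho>" and [measurable]: "Borel p" "Borel p'"
    "Borel a" "Borel a'"
    and b: "\<forall>\<xi>. em \<rho> (jc p') \<xi> \<le> VX \<xi> \<and> em \<rho> a' \<xi> \<le> VY \<xi> \<and>
      em \<rho> (jc p \<ominus> jc p') \<xi> \<le> DX \<xi> \<and> em \<rho> (a \<ominus> a') \<xi> \<le> DY \<xi>"
   have R: "Rl \<rho> (jc p) (jc p') (VX \<oplus> DX) VX" "Rl \<rho> a a' (VY \<oplus> DY) VY"
    by (rule Rl_intro; use b in simp)+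
   show "em \<rho> (NP \<alpha> \<beta> g s p a \<ominus> NP \<alpha> \<beta> g s p' a') \<xi> \<le> EP \<xi> \<and>
       em \<rho> (NA \<alpha> g p a \<ominus> NA \<alpha> g p' a') \<xi> \<le> EA \<xi>"
    unfolding EP_def EA_def
    by (intro conjI Cvx_Rl_bound[OF Rl_NP[OF \<rho> R _ _ A] CQ(1) c(2)] Cvx_Rl_bound[OF Rl_NA[OF \<rho> R _ _ A] CQ(2) c(2)]) simp_all
  qed
 qed
qed

text \<open>The gain of \<open>Ds_nn_bound\<close> for a given solution of the differential
  equation. The factor \<open>e\<close> has modulus one and removes \<open>\<kappa>\<close>, so the
  bound does not depend on it; then the mean value inequality compares with \<open>\<phi>\<close>, a
  primitive of the bound of the forcing.\<close>

lemma ode_bound: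
 fixes y F :: cfun
 assumes m: "m > 0" and j: "j > 0" and t: "t \<in> {0..\<tau>}"
  and y: "\<And>t. t \<in> {0..\<tau>} \<Longrightarrow> (y has_vector_derivative (F t - \<i> * of_real \<kappa> * y t)) (at t within {0..\<tau>})"
  and F: "\<And>t. t \<in> {0..\<tau>} \<Longrightarrow> ennreal (exp ((\<rho>0 - m * t) * j) * cmod (F t)) \<le> G"
 shows "ennreal (exp ((\<rho>0 - m * t) * j) * cmod (y t)) \<le> ennreal (exp (\<rho>0 * j) * cmod (y 0)) + ennreal (1 / (m * j)) * G"
proof (cases "G = top \<or> t = 0")
 case True
 then show ?thesis using m j by (auto simp: ennreal_mult_top add_increasing2)
next
 case False
 with t have t0: "0 < t" "t \<le> \<tau>" by auto
 obtain G' where G: "G = ennreal G'" "G' \<ge> 0" using False by (cases G) auto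
 define e where "e s = exp (\<i> * of_real (\<kappa> * s))" for s
 have e: "(e has_vector_derivative (\<i> * of_real \<kappa> * e s)) (at s)" for s
 proof -
  have "((\<lambda>z. exp (\<i> * of_real \<kappa> * z)) has_field_derivative (\<i> * of_real \<kappa> * exp (\<i> * of_real \<kappa> * of_real s))) (at (of_real s))"
   by (auto intro!: derivative_eq_intros)
  from has_vector_derivative_real_field[OF this] show ?thesis by (simp add: e_def[abs_def] mult_ac)
 qed
 have ne: "cmod (e s) = 1" for s by (simp add: e_def)
 define \<phi> where "\<phi> s = G' * exp (- ((\<rho>0 - m * s) * j)) / (m * j)" for s
 have \<phi>: "(\<phi> has_vector_derivative G' * exp (- ((\<rho>0 - m * s) * j))) (at s)" for s
  unfolding \<phi>_def has_real_derivative_iff_has_vector_derivative[symmetric]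
  using m j by (auto intro!: derivative_eq_intros simp: field_simps)
 have z: "((\<lambda>s. e s * y s) has_vector_derivative e s * F s) (at s within {0..\<tau>})" if "s \<in> {0..\<tau>}" for s
 proof -
  have "((\<lambda>s. e s * y s) has_vector_derivative e s * (F s - \<i> * of_real \<kappa> * y s) + \<i> * of_real \<kappa> * e s * y s) (at s within {0..\<tau>})"
   by (intro has_vector_derivative_mult y that has_vector_derivative_at_within[OF e])
  then show ?thesis by (simp add: algebra_simps)
 qed
 have "cmod (e t * y t - e 0 * y 0) \<le> \<phi> t - \<phi> 0"
 proof (rule differentiable_bound_general[where f' = "\<lambda>s. e s * F s" and \<phi>' = "\<lambda>s. G' * exp (- ((\<rho>0 - m * s) * j))"])
  show "0 < t" by (rule t0)
  have "continuous_on {0..\<tau>} (\<lambda>s. e s * y s)"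
   unfolding continuous_on_eq_continuous_within using z has_vector_derivative_continuous by blast
  then show "continuous_on {0..t} (\<lambda>s. e s * y s)" by (rule continuous_on_subset) (use t0 in auto)
  show "continuous_on {0..t} \<phi>"
   unfolding continuous_on_eq_continuous_within using has_vector_derivative_continuous[OF has_vector_derivative_at_within[OF \<phi>]] by blast
  fix s assume s: "0 < s" "s < t"
  then have "s \<in> interior {0..\<tau>}" "s \<in> {0..\<tau>}" using t0 by auto
  then show "((\<lambda>s. e s * y s) has_vector_derivative e s * F s) (at s)"
   using z[of s] at_within_interior by metis
  show "(\<phi> has_vector_derivative G' * exp (- ((\<rho>0 - m * s) * j))) (at s)" by (rule \<phi>)
  have "ennreal (exp ((\<rho>0 - m * s) * j) * cmod (F s)) \<le> ennreal G'" using F[of s] \<open>s \<in> {0..\<tau>}\<close> G by simp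
  then have "exp ((\<rho>0 - m * s) * j) * cmod (F s) \<le> G'" using G by simp
  then have "(exp ((\<rho>0 - m * s) * j) * cmod (F s)) * exp (- ((\<rho>0 - m * s) * j)) \<le> G' * exp (- ((\<rho>0 - m * s) * j))"
   by (rule mult_right_mono) simp
  moreover have "(exp ((\<rho>0 - m * s) * j) * cmod (F s)) * exp (- ((\<rho>0 - m * s) * j)) = cmod (F s)"
   by (simp add: exp_minus)
  ultimately show "cmod (e s * F s) \<le> G' * exp (- ((\<rho>0 - m * s) * j))"
   by (simp only: norm_mult ne)
 qed
 moreover have "\<phi> 0 \<ge> 0" using G m j by (simp add: \<phi>_def)
 moreover have "cmod (e t * y t) \<le> cmod (e 0 * y 0) + cmod (e t * y t - e 0 * y 0)"
  by (metis norm_triangle_sub)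
 ultimately have "cmod (y t) \<le> cmod (y 0) + \<phi> t" by (simp add: norm_mult ne)
 then have "exp ((\<rho>0 - m * t) * j) * cmod (y t) \<le> exp ((\<rho>0 - m * t) * j) * (cmod (y 0) + \<phi> t)"
  by (rule mult_left_mono) simp
 also have "... = exp ((\<rho>0 - m * t) * j) * cmod (y 0) + 1 / (m * j) * G'"
  by (simp add: \<phi>_def distrib_left exp_minus)
 also have "... \<le> exp (\<rho>0 * j) * cmod (y 0) + 1 / (m * j) * G'"
  using m j t0 by (intro add_right_mono mult_right_mono) auto
 finally show ?thesis using G m j by (simp add: ennreal_leI flip: ennreal_plus ennreal_mult)
qed

text \<open>Raising the majorant to \<open>top\<close> on a null set changes none of its norms and
  makes the bound hold everywhere, as the relations \<open>Rl\<close> and \<open>Ndom\<close>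
  demand.\<close>

lemma AE_majorant_everywhere:
 assumes [measurable]: "Borel V" and ae: "AE \<xi> in lborel. P \<xi> (V \<xi>)" and top: "\<And>\<xi>. P \<xi> (top :: ennreal)"
 obtains V' where "Borel V'" "\<And>p. Nsq p V' = Nsq p V" "\<And>\<xi>. P \<xi> (V' \<xi>)"
proof -
 obtain N where N: "N \<in> null_sets lborel" "{\<xi>\<in>space lborel. \<not> P \<xi> (V \<xi>)} \<subseteq> N" using ae by (auto simp: eventually_ae_filter)
 then have [measurable]: "N \<in> sets borel" by auto
 define V' where "V' \<xi> = (if \<xi> \<in> N then top else V \<xi>)" for \<xi>
 have ae': "V' \<doteq> V" using AE_not_in[OF N(1)] by eventually_elim (simp add: V'_def)
 have "Borel V'" unfolding V'_def by measurable
 moreover have "Nsq p V' = Nsq p V" for p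
  by (intro antisym Nsq_mono_AE) (use ae' in \<open>eventually_elim, simp\<close>)+
 moreover have "P \<xi> (V' \<xi>)" for \<xi> using N(2) top by (auto simp: V'_def)
 ultimately show thesis by (rule that)
qed

text \<open>The term \<open>Z\<close> is the consistency error from replacing \<open>\<epsilon>1\<close> by \<open>\<epsilon>2\<close>. The squared size \<open>\<theta>\<^sup>2\<close> of the
 difference is halved repeatedly, until the data and \<open>Z\<close> dominate.\<close>

definition diff_est :: "real \<Rightarrow> ennreal \<Rightarrow> real \<Rightarrow> real \<Rightarrow> nat \<Rightarrow> nat \<Rightarrow> real \<Rightarrow> bool" where
 "diff_est l K \<alpha> \<beta> g s m \<longleftrightarrow> (\<forall>\<tau> \<rho>0 \<epsilon>1 \<epsilon>2 p1 a1 p2 a2 VX VY Z R.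
  0 \<le> \<tau> \<longrightarrow> m * \<tau> \<le> \<rho>0 \<longrightarrow> FS \<alpha> \<beta> g s \<epsilon>1 \<tau> p1 a1 \<longrightarrow> FS \<alpha> \<beta> g s \<epsilon>2 \<tau> p2 a2 \<longrightarrow>
  Borel VX \<longrightarrow> Borel VY \<longrightarrow> Borel Z \<longrightarrow>
  Nsq l VX \<le> K \<longrightarrow> Nsq l VY \<le> K \<longrightarrow> Nsq (l - 1) Z \<le> R \<longrightarrow>
  (AE \<xi> in lborel. \<forall>t\<in>{0..\<tau>}. em (\<rho>0 - m * t) (jc (p1 t)) \<xi> \<le> VX \<xi> \<and> em (\<rho>0 - m * t) (jc (p2 t)) \<xi> \<le> VX \<xi>) \<longrightarrow>
  (AE \<xi> in lborel. \<forall>t\<in>{0..\<tau>}. em (\<rho>0 - m * t) (a1 t) \<xi> \<le> VY \<xi> \<and> em (\<rho>0 - m * t) (a2 t) \<xi> \<le> VY \<xi>) \<longrightarrow>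
  (AE \<xi> in lborel. \<forall>t\<in>{0..\<tau>}. em (\<rho>0 - m * t) (\<lambda>\<xi>. of_real ((\<epsilon>1 - \<epsilon>2) * \<xi>\<^sup>2 / 2) * a2 t \<xi>) \<xi> \<le> Z \<xi>) \<longrightarrow>
  Nsq l (em \<rho>0 (jc (p1 0) \<ominus> jc (p2 0))) \<le> R \<longrightarrow>
  Nsq l (em \<rho>0 (\<lambda>\<xi>. a1 0 \<xi> - a2 0 \<xi>)) \<le> R \<longrightarrow>
  (\<forall>\<theta>>0. \<theta> \<le> 1 \<longrightarrow> 3 * R \<le> ennreal (\<theta>\<^sup>2) * K \<longrightarrow>
   (\<exists>DX DY. Borel DX \<and> Borel DY \<and>
     Nsq l DX \<le> ennreal (\<theta>\<^sup>2) * (4 * K) \<and> Nsq l DY \<le> ennreal (\<theta>\<^sup>2) * (4 * K) \<and>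
     (\<forall>\<xi>. \<forall>t\<in>{0..\<tau>}. em (\<rho>0 - m * t) (jc (p1 t) \<ominus> jc (p2 t)) \<xi> \<le> DX \<xi>) \<and>
     (\<forall>\<xi>. \<forall>t\<in>{0..\<tau>}. em (\<rho>0 - m * t) (a1 t \<ominus> a2 t) \<xi> \<le> DY \<xi>))))"

lemmas diff_estD = diff_est_def[THEN iffD1, rule_format]

text \<open>No smallness of the difference is known in advance, so the argument starts at
  \<open>\<theta> = 1\<close> from the triangle inequality. Each pass through the equation
  multiplies the squared size of the nonlinear part by a factor that is small for large
  \<open>m\<close>, and data and consistency error add a multiple of \<open>R\<close>.\<close>

lemma difference_estimate:
 assumes l: "l \<ge> 1" and K: "K < top" "K \<ge> 1" and A: "A \<ge> 1" "\<bar>\<alpha>\<bar> \<le> A" "\<bar>\<beta>\<bar> \<le> A"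
 shows "\<exists>m0>0. \<forall>m\<ge>m0. diff_est l K \<alpha> \<beta> g s m"
proof -
 have "4 * K < top" using K by (simp add: ennreal_mult_less_top)
 from N_difference[OF l this A, of g s] obtain C where C: "C < top" and ND: "N_lipschitz l (4 * K) \<alpha> \<beta> g s C"
  by blast
 obtain c where c: "C = ennreal c" "c \<ge> 0" using C by (cases C) auto
 \<comment> \<open>\<open>m \<ge> 1\<close> gives \<open>(1 / m)^2 \<le> 1\<close>, and together
   with \<open>m \<ge> 8 * c\<close> it gives \<open>8 * c / m^2 \<le> 1\<close>, the halving in
   \<open>small\<close>.\<close>
 define m0 where "m0 = max 1 (8 * c)"
 show ?thesis
 proof (rule exI[of _ m0], unfold diff_est_def, intro conjI allI impI)
  show "m0 > 0" by (simp add: m0_def)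
  fix m \<tau> \<rho>0 \<epsilon>1 \<epsilon>2 p1 a1 p2 a2 VX VY Z R \<theta>
  assume m: "m0 \<le> m" and \<tau>: "0 \<le> \<tau>" "m * \<tau> \<le> \<rho>0" and F1: "FS \<alpha> \<beta> g s \<epsilon>1 \<tau> p1 a1" and F2: "FS \<alpha> \<beta> g s \<epsilon>2 \<tau> p2 a2"
   and [measurable]: "Borel VX" "Borel VY" "Borel Z"
   and N: "Nsq l VX \<le> K" "Nsq l VY \<le> K" "Nsq (l - 1) Z \<le> R"
   and bX: "AE \<xi> in lborel. \<forall>t\<in>{0..\<tau>}. em (\<rho>0 - m * t) (jc (p1 t)) \<xi> \<le> VX \<xi> \<and> em (\<rho>0 - m * t) (jc (p2 t)) \<xi> \<le> VX \<xi>"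
   and bY: "AE \<xi> in lborel. \<forall>t\<in>{0..\<tau>}. em (\<rho>0 - m * t) (a1 t) \<xi> \<le> VY \<xi> \<and> em (\<rho>0 - m * t) (a2 t) \<xi> \<le> VY \<xi>"
   and bZ: "AE \<xi> in lborel. \<forall>t\<in>{0..\<tau>}. em (\<rho>0 - m * t) (\<lambda>\<xi>. of_real ((\<epsilon>1 - \<epsilon>2) * \<xi>\<^sup>2 / 2) * a2 t \<xi>) \<xi> \<le> Z \<xi>"
   and I: "Nsq l (em \<rho>0 (jc (p1 0) \<ominus> jc (p2 0))) \<le> R" "Nsq l (em \<rho>0 (\<lambda>\<xi>. a1 0 \<xi> - a2 0 \<xi>)) \<le> R"
   and \<theta>: "0 < \<theta>" "\<theta> \<le> 1" "3 * R \<le> ennreal (\<theta>\<^sup>2) * K"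
  have m1: "m \<ge> 1" "8 * c \<le> m" using m by (auto simp: m0_def)
  have \<rho>: "\<rho>0 - m * t \<ge> 0" if "t \<in> {0..\<tau>}" for t
  proof -
   have "m * t \<le> m * \<tau>" using that m1 by (intro mult_left_mono) auto
   then show ?thesis using \<tau> by linarith
  qed
  have D: "DC {0..\<tau>} p1" "DC {0..\<tau>} p2" "DC {0..\<tau>} a1" "DC {0..\<tau>} a2" using F1 F2 by (auto simp: FS_def)
  then have jm: "jmeas p1" "jmeas p2" "jmeas a1" "jmeas a2" by (auto simp: DC_def)
  have [measurable]: "Borel (p1 t)" "Borel (p2 t)"
   "Borel (a1 t)" "Borel (a2 t)" for t
   using jm by (auto intro: section_meas)
  obtain WX where [measurable]: "Borel WX" and WX: "\<And>p. Nsq p WX = Nsq p VX"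
   "\<And>\<xi>. \<forall>t\<in>{0..\<tau>}. em (\<rho>0 - m * t) (jc (p1 t)) \<xi> \<le> WX \<xi> \<and> em (\<rho>0 - m * t) (jc (p2 t)) \<xi> \<le> WX \<xi>"
   using AE_majorant_everywhere[where P = "\<lambda>\<xi> v. \<forall>t\<in>{0..\<tau>}. em (\<rho>0 - m * t) (jc (p1 t)) \<xi> \<le> v \<and> em (\<rho>0 - m * t) (jc (p2 t)) \<xi> \<le> v", OF _ bX] by auto
  obtain WY where [measurable]: "Borel WY" and WY: "\<And>p. Nsq p WY = Nsq p VY"
   "\<And>\<xi>. \<forall>t\<in>{0..\<tau>}. em (\<rho>0 - m * t) (a1 t) \<xi> \<le> WY \<xi> \<and> em (\<rho>0 - m * t) (a2 t) \<xi> \<le> WY \<xi>"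
   using AE_majorant_everywhere[where P = "\<lambda>\<xi> v. \<forall>t\<in>{0..\<tau>}. em (\<rho>0 - m * t) (a1 t) \<xi> \<le> v \<and> em (\<rho>0 - m * t) (a2 t) \<xi> \<le> v", OF _ bY] by auto
  have K4: "K \<le> 4 * K" using mult_right_mono[of 1 4 K] by simp
  have W4: "Nsq l WX \<le> 4 * K" "Nsq l WY \<le> 4 * K" using N K4 WX WY by (auto intro: order_trans)
  define good where "good \<theta> \<longleftrightarrow> (\<exists>DX DY. Borel DX \<and> Borel DY \<and>
     Nsq l DX \<le> ennreal (\<theta>\<^sup>2) * (4 * K) \<and> Nsq l DY \<le> ennreal (\<theta>\<^sup>2) * (4 * K) \<and>
     (\<forall>\<xi>. \<forall>t\<in>{0..\<tau>}. em (\<rho>0 - m * t) (jc (p1 t) \<ominus> jc (p2 t)) \<xi> \<le> DX \<xi>) \<and>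
     (\<forall>\<xi>. \<forall>t\<in>{0..\<tau>}. em (\<rho>0 - m * t) (a1 t \<ominus> a2 t) \<xi> \<le> DY \<xi>))" for \<theta>
  have good1: "good 1"
  proof -
   have N2: "Nsq l (W \<oplus> W) \<le> 4 * K" if [measurable]: "Borel W" and "Nsq l W \<le> K" for W
   proof -
    have "Nsq l (W \<oplus> W) \<le> 2 * K + 2 * K"
     by (intro order_trans[OF Nsq_add] add_mono mult_left_mono that) auto
    then show ?thesis by (simp flip: distrib_right)
   qed
   have "\<forall>\<xi>. \<forall>t\<in>{0..\<tau>}. em (\<rho>0 - m * t) (jc (p1 t) \<ominus> jc (p2 t)) \<xi> \<le> WX \<xi> + WX \<xi>"
    "\<forall>\<xi>. \<forall>t\<in>{0..\<tau>}. em (\<rho>0 - m * t) (a1 t \<ominus> a2 t) \<xi> \<le> WY \<xi> + WY \<xi>"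
    using WX(2) WY(2) by (blast intro: order_trans[OF em_minus_le add_mono])+
   then show ?thesis
    unfolding good_def
    by (intro exI[of _ "\<lambda>\<xi>. WX \<xi> + WX \<xi>"] exI[of _ "\<lambda>\<xi>. WY \<xi> + WY \<xi>"]) (use N WX(1) WY(1) N2[of WX] N2[of WY] in simp)
  qed
  have step: "good \<theta>" if g: "good \<theta>'" and \<theta>': "0 < \<theta>'" "\<theta>' \<le> 1" "\<theta>'\<^sup>2 \<le> 2 * \<theta>\<^sup>2" and \<theta>: "3 * R \<le> ennreal (\<theta>\<^sup>2) * K" for \<theta> \<theta>'
  proof -
   obtain DX DY where [measurable]: "Borel DX" "Borel DY" and
    ND': "Nsq l DX \<le> ennreal (\<theta>'\<^sup>2) * (4 * K)" "Nsq l DY \<le> ennreal (\<theta>'\<^sup>2) * (4 * K)" and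
    bD: "\<And>\<xi> t. t\<in>{0..\<tau>} \<Longrightarrow> em (\<rho>0 - m * t) (jc (p1 t) \<ominus> jc (p2 t)) \<xi> \<le> DX \<xi>"
     "\<And>\<xi> t. t\<in>{0..\<tau>} \<Longrightarrow> em (\<rho>0 - m * t) (a1 t \<ominus> a2 t) \<xi> \<le> DY \<xi>"
    using g unfolding good_def by blast
   obtain EP EA where [measurable]: "Borel EP" "Borel EA" and
    NE: "Nsq l EP \<le> ennreal (\<theta>'\<^sup>2) * C" "Nsq (l - 1) EA \<le> ennreal (\<theta>'\<^sup>2) * C" and
    bE: "Ndom \<alpha> \<beta> g s WX WY DX DY EP EA"
    using N_lipschitzD[OF ND \<theta>'(1,2) _ _ _ _ W4 ND'] by auto
   have NN: "em (\<rho>0 - m * t) (NP \<alpha> \<beta> g s (p1 t) (a1 t) \<ominus> NP \<alpha> \<beta> g s (p2 t) (a2 t)) \<xi> \<le> EP \<xi> \<and>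
       em (\<rho>0 - m * t) (NA \<alpha> g (p1 t) (a1 t) \<ominus> NA \<alpha> g (p2 t) (a2 t)) \<xi> \<le> EA \<xi>" if "t \<in> {0..\<tau>}" for t \<xi>
    using bE[unfolded Ndom_def, rule_format, OF \<rho>[OF that], of "p1 t" "p2 t" "a1 t" "a2 t"] WX(2) WY(2) bD that by simp
   define IP where "IP = em \<rho>0 (jc (p1 0) \<ominus> jc (p2 0))"
   define IA where "IA = em \<rho>0 (\<lambda>\<xi>. a1 0 \<xi> - a2 0 \<xi>)"
   define GX where "GX \<xi> = IP \<xi> + ennreal (1 / m) * EP \<xi>" for \<xi>
   define GY where "GY \<xi> = IA \<xi> + ennreal (1 / m) * jm (-1) (EA \<oplus> Z) \<xi>" for \<xi>
   have [measurable]: "Borel IP" "Borel IA"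
    unfolding IP_def IA_def em_def by measurable
   have [measurable]: "Borel GX" "Borel GY"
    unfolding GX_def GY_def by measurable
   have ode: "AE \<xi> in lborel. \<forall>t\<in>{0..\<tau>}. em (\<rho>0 - m * t) (jc (p1 t) \<ominus> jc (p2 t)) \<xi> \<le> GX \<xi>"
    "AE \<xi> in lborel. \<forall>t\<in>{0..\<tau>}. em (\<rho>0 - m * t) (a1 t \<ominus> a2 t) \<xi> \<le> GY \<xi>"
   proof -
    have d1: "AE \<xi> in lborel. spectral_ode \<alpha> \<beta> g s \<epsilon>1 \<tau> p1 a1 \<xi>"
     using F1 by (simp add: FS_def)
    have d2: "AE \<xi> in lborel. spectral_ode \<alpha> \<beta> g s \<epsilon>2 \<tau> p2 a2 \<xi>"
     using F2 by (simp add: FS_def)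
    show "AE \<xi> in lborel. \<forall>t\<in>{0..\<tau>}. em (\<rho>0 - m * t) (jc (p1 t) \<ominus> jc (p2 t)) \<xi> \<le> GX \<xi>"
     using d1 d2
    proof eventually_elim
     fix \<xi> assume d1: "spectral_ode \<alpha> \<beta> g s \<epsilon>1 \<tau> p1 a1 \<xi>"
      and d2: "spectral_ode \<alpha> \<beta> g s \<epsilon>2 \<tau> p2 a2 \<xi>"
     show "\<forall>t\<in>{0..\<tau>}. em (\<rho>0 - m * t) (jc (p1 t) \<ominus> jc (p2 t)) \<xi> \<le> GX \<xi>"
     proof
      fix t assume t: "t \<in> {0..\<tau>}"
      have "ennreal (exp ((\<rho>0 - m * t) * jap \<xi>) * cmod (p1 t \<xi> - p2 t \<xi>)) \<le>
        ennreal (exp (\<rho>0 * jap \<xi>) * cmod (p1 0 \<xi> - p2 0 \<xi>)) + ennreal (1 / (m * jap \<xi>)) * EP \<xi>"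
      proof (rule ode_bound[where F = "\<lambda>t. NP \<alpha> \<beta> g s (p1 t) (a1 t) \<xi> - NP \<alpha> \<beta> g s (p2 t) (a2 t) \<xi>" and \<kappa> = 0, OF _ jap_pos t])
       show "m > 0" using m1 by simp
       fix r assume r: "r \<in> {0..\<tau>}"
       show "((\<lambda>t. p1 t \<xi> - p2 t \<xi>) has_vector_derivative
         NP \<alpha> \<beta> g s (p1 r) (a1 r) \<xi> - NP \<alpha> \<beta> g s (p2 r) (a2 r) \<xi> - \<i> * of_real 0 * (p1 r \<xi> - p2 r \<xi>)) (at r within {0..\<tau>})"
        using has_vector_derivative_diff[of "\<lambda>r. p1 r \<xi>" _ _ "\<lambda>r. p2 r \<xi>"] d1 d2 r by simp
       show "ennreal (exp ((\<rho>0 - m * r) * jap \<xi>) * cmod (NP \<alpha> \<beta> g s (p1 r) (a1 r) \<xi> - NP \<alpha> \<beta> g s (p2 r) (a2 r) \<xi>)) \<le> EP \<xi>"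
        using NN[OF r, of \<xi>] by (simp add: em_def)
      qed
      from mult_left_mono[OF this, of "ennreal (jap \<xi>)"]
      show "em (\<rho>0 - m * t) (jc (p1 t) \<ominus> jc (p2 t)) \<xi> \<le> GX \<xi>"
       using m1 by (simp add: GX_def IP_def em_jc_diff em_def distrib_left mult.assoc[symmetric] flip: ennreal_mult)
     qed
    qed
    show "AE \<xi> in lborel. \<forall>t\<in>{0..\<tau>}. em (\<rho>0 - m * t) (a1 t \<ominus> a2 t) \<xi> \<le> GY \<xi>"
     using d1 d2 bZ
    proof eventually_elim
     fix \<xi> assume d1: "spectral_ode \<alpha> \<beta> g s \<epsilon>1 \<tau> p1 a1 \<xi>"
      and d2: "spectral_ode \<alpha> \<beta> g s \<epsilon>2 \<tau> p2 a2 \<xi>"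
      and z: "\<forall>t\<in>{0..\<tau>}. em (\<rho>0 - m * t) (\<lambda>\<xi>. of_real ((\<epsilon>1 - \<epsilon>2) * \<xi>\<^sup>2 / 2) * a2 t \<xi>) \<xi> \<le> Z \<xi>"
     show "\<forall>t\<in>{0..\<tau>}. em (\<rho>0 - m * t) (a1 t \<ominus> a2 t) \<xi> \<le> GY \<xi>"
     proof
      fix t assume t: "t \<in> {0..\<tau>}"
      \<comment> \<open>The difference of the amplitudes obeys the equation with
        \<open>\<epsilon>1\<close>; the discrepancy between the two dispersive terms acts on
        \<open>a2\<close> alone and joins the forcing.\<close>
      let ?F = "\<lambda>t. (NA \<alpha> g (p1 t) (a1 t) \<xi> - NA \<alpha> g (p2 t) (a2 t) \<xi>) - \<i> * (of_real ((\<epsilon>1 - \<epsilon>2) * \<xi>\<^sup>2 / 2) * a2 t \<xi>)"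
      have "ennreal (exp ((\<rho>0 - m * t) * jap \<xi>) * cmod (a1 t \<xi> - a2 t \<xi>)) \<le>
        ennreal (exp (\<rho>0 * jap \<xi>) * cmod (a1 0 \<xi> - a2 0 \<xi>)) + ennreal (1 / (m * jap \<xi>)) * (EA \<xi> + Z \<xi>)"
      proof (rule ode_bound[where F = ?F and \<kappa> = "\<epsilon>1 * \<xi>\<^sup>2 / 2", OF _ jap_pos t])
       show "m > 0" using m1 by simp
       fix r assume r: "r \<in> {0..\<tau>}"
       have "((\<lambda>t. a1 t \<xi> - a2 t \<xi>) has_vector_derivative
         (NA \<alpha> g (p1 r) (a1 r) \<xi> - \<i> * of_real (\<epsilon>1 * \<xi>\<^sup>2 / 2) * a1 r \<xi>)
         - (NA \<alpha> g (p2 r) (a2 r) \<xi> - \<i> * of_real (\<epsilon>2 * \<xi>\<^sup>2 / 2) * a2 r \<xi>)) (at r within {0..\<tau>})"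
        using d1 d2 r by (intro has_vector_derivative_diff) auto
       moreover have "(NA \<alpha> g (p1 r) (a1 r) \<xi> - \<i> * of_real (\<epsilon>1 * \<xi>\<^sup>2 / 2) * a1 r \<xi>)
         - (NA \<alpha> g (p2 r) (a2 r) \<xi> - \<i> * of_real (\<epsilon>2 * \<xi>\<^sup>2 / 2) * a2 r \<xi>) =
         ?F r - \<i> * of_real (\<epsilon>1 * \<xi>\<^sup>2 / 2) * (a1 r \<xi> - a2 r \<xi>)"
        by (simp add: algebra_simps diff_divide_distrib)
       ultimately show "((\<lambda>t. a1 t \<xi> - a2 t \<xi>) has_vector_derivative
         ?F r - \<i> * of_real (\<epsilon>1 * \<xi>\<^sup>2 / 2) * (a1 r \<xi> - a2 r \<xi>)) (at r within {0..\<tau>})" by (simp only:)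
       have "ennreal (exp ((\<rho>0 - m * r) * jap \<xi>) * cmod (?F r)) \<le>
         ennreal (exp ((\<rho>0 - m * r) * jap \<xi>) * cmod (NA \<alpha> g (p1 r) (a1 r) \<xi> - NA \<alpha> g (p2 r) (a2 r) \<xi>)) +
         ennreal (exp ((\<rho>0 - m * r) * jap \<xi>) * cmod (\<i> * (of_real ((\<epsilon>1 - \<epsilon>2) * \<xi>\<^sup>2 / 2) * a2 r \<xi>)))"
        by (simp only: ennreal_plus[symmetric] mult_nonneg_nonneg exp_ge_zero norm_ge_zero distrib_left[symmetric])
          (intro ennreal_leI mult_left_mono norm_triangle_ineq4 exp_ge_zero)
       also have "... \<le> EA \<xi> + Z \<xi>"
        using NN[OF r, of \<xi>] z r by (intro add_mono) (auto simp: em_def norm_mult)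
       finally show "ennreal (exp ((\<rho>0 - m * r) * jap \<xi>) * cmod (?F r)) \<le> EA \<xi> + Z \<xi>" .
      qed
      also have "ennreal (1 / (m * jap \<xi>)) * (EA \<xi> + Z \<xi>) = ennreal (1 / m) * jm (-1) (EA \<oplus> Z) \<xi>"
       using m1 by (simp add: jm_def powr_minus mult.assoc[symmetric] divide_inverse flip: ennreal_mult)
      finally show "em (\<rho>0 - m * t) (a1 t \<ominus> a2 t) \<xi> \<le> GY \<xi>"
       by (simp add: GY_def IA_def em_def)
     qed
    qed
   qed
   define T where "T = ennreal (\<theta>\<^sup>2) * K"
   have small: "4 * ((ennreal (1 / m))\<^sup>2 * (ennreal (\<theta>'\<^sup>2) * C)) \<le> T"
   proof -
    have "8 * c * 1 \<le> m * m" using m1 c by (intro mult_mono) auto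
    then have "8 * c / m\<^sup>2 \<le> 1" using m1 by (simp add: power2_eq_square)
    then have "\<theta>'\<^sup>2 * (8 * c / m\<^sup>2) \<le> (2 * \<theta>\<^sup>2) * 1" using \<theta>' c by (intro mult_mono) auto
    moreover have "4 * ((1 / m)\<^sup>2 * (\<theta>'\<^sup>2 * c)) = \<theta>'\<^sup>2 * (8 * c / m\<^sup>2) / 2" by (simp add: power_divide)
    ultimately have le: "4 * ((1 / m)\<^sup>2 * (\<theta>'\<^sup>2 * c)) \<le> \<theta>\<^sup>2"
     using divide_right_mono[of "\<theta>'\<^sup>2 * (8 * c / m\<^sup>2)" "2 * \<theta>\<^sup>2 * 1" 2] by simp
    have "4 * ((ennreal (1 / m))\<^sup>2 * (ennreal (\<theta>'\<^sup>2) * C)) = ennreal (4 * ((1 / m)\<^sup>2 * (\<theta>'\<^sup>2 * c)))"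
     using m1 c by (simp add: ennreal_power ennreal_mult)
    also have "... \<le> ennreal (\<theta>\<^sup>2) * 1" using le by (simp add: ennreal_leI)
    also have "... \<le> T" unfolding T_def by (intro mult_left_mono K) auto
    finally show ?thesis .
   qed
   have R: "3 * R \<le> T" using \<theta> by (simp add: T_def)
   let ?S = "(ennreal (1 / m))\<^sup>2 * (ennreal (\<theta>'\<^sup>2) * C)"
   have m2: "(ennreal (1 / m))\<^sup>2 \<le> 1" using m1 by (simp add: ennreal_power power_le_one flip: ennreal_1)
   have NGX: "Nsq l GX \<le> ennreal (\<theta>\<^sup>2) * (4 * K)"
   proof -
    have "Nsq l GX \<le> 2 * Nsq l IP + 2 * ((ennreal (1 / m))\<^sup>2 * Nsq l EP)"
     unfolding GX_def[abs_def] by (rule order_trans[OF Nsq_add]) (simp_all add: Nsq_cmult)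
    also have "... \<le> 2 * R + 2 * ?S"
     using I NE by (intro add_mono mult_left_mono) (auto simp: IP_def)
    also have "... \<le> 3 * R + 4 * ?S" by (intro add_mono mult_right_mono) auto
    also have "... \<le> T + T" by (intro add_mono R small)
    also have "... \<le> 4 * T" using mult_right_mono[of 2 4 T] by (simp add: mult_2)
    finally show ?thesis by (simp add: T_def mult_ac)
   qed
   have NGY: "Nsq l GY \<le> ennreal (\<theta>\<^sup>2) * (4 * K)"
   proof -
    have "Nsq l GY \<le> 2 * Nsq l IA + 2 * ((ennreal (1 / m))\<^sup>2 * Nsq (l - 1) (EA \<oplus> Z))"
     unfolding GY_def[abs_def] by (rule order_trans[OF Nsq_add]) (simp_all add: Nsq_cmult Nsq_jm)
    also have "... \<le> 2 * R + 2 * ((ennreal (1 / m))\<^sup>2 * (2 * (ennreal (\<theta>'\<^sup>2) * C) + 2 * R))"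
     using I by (intro add_mono mult_left_mono order_trans[OF Nsq_add] NE N) (auto simp: IA_def)
    also have "... = 2 * R + (4 * ?S + (ennreal (1 / m))\<^sup>2 * (4 * R))"
     by (simp add: distrib_left mult_ac)
    also have "... \<le> 2 * R + (4 * ?S + 1 * (4 * R))" by (intro add_left_mono mult_right_mono m2) auto
    \<comment> \<open>The data contribute \<open>2 * R\<close> and the consistency error
      \<open>4 * R\<close>; the hypothesis on \<open>3 * R\<close> is used twice.\<close>
    also have "... = 3 * R + 3 * R + 4 * ?S" by (simp add: add_ac flip: distrib_right)
    also have "... \<le> T + T + T" by (intro add_mono R small)
    also have "... = 3 * T"
    proof -
     have "(3::ennreal) = 1 + 1 + 1" by simp
     then show ?thesis by (simp only: distrib_right mult_1_left)
    qed
    also have "... \<le> 4 * T" by (intro mult_right_mono) auto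
    finally show ?thesis by (simp add: T_def mult_ac)
   qed
   obtain HX where "Borel HX" "\<And>p. Nsq p HX = Nsq p GX"
    "\<And>\<xi>. \<forall>t\<in>{0..\<tau>}. em (\<rho>0 - m * t) (jc (p1 t) \<ominus> jc (p2 t)) \<xi> \<le> HX \<xi>"
    using AE_majorant_everywhere[where P = "\<lambda>\<xi> v. \<forall>t\<in>{0..\<tau>}. em (\<rho>0 - m * t) (jc (p1 t) \<ominus> jc (p2 t)) \<xi> \<le> v", OF _ ode(1)] by auto
   moreover obtain HY where "Borel HY" "\<And>p. Nsq p HY = Nsq p GY"
    "\<And>\<xi>. \<forall>t\<in>{0..\<tau>}. em (\<rho>0 - m * t) (a1 t \<ominus> a2 t) \<xi> \<le> HY \<xi>"
    using AE_majorant_everywhere[where P = "\<lambda>\<xi> v. \<forall>t\<in>{0..\<tau>}. em (\<rho>0 - m * t) (a1 t \<ominus> a2 t) \<xi> \<le> v", OF _ ode(2)] by auto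
   ultimately show "good \<theta>"
    unfolding good_def using NGX NGY by (intro exI[of _ HX] exI[of _ HY]) simp
  qed
  have all: "good \<theta>" if "0 < \<theta>" "\<theta> \<le> 1" "(1/2) ^ n \<le> \<theta>\<^sup>2" "3 * R \<le> ennreal (\<theta>\<^sup>2) * K" for n \<theta>
   using that
  proof (induction n arbitrary: \<theta>)
   case 0
   then have "\<theta> = 1" using power_le_one[of \<theta> 2] by (auto simp: abs_square_eq_1 intro: antisym)
   then show ?case using good1 by simp
  next
   case (Suc n)
   \<comment> \<open>One step back doubles \<open>\<theta>^2\<close>; the minimum with 1 keeps the
     size admissible for \<open>N_lipschitz\<close>.\<close>
   define \<theta>' where "\<theta>' = min 1 (sqrt 2 * \<theta>)"
   have "0 < \<theta>'" "\<theta>' \<le> 1" using Suc.prems by (auto simp: \<theta>'_def)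
   moreover have sq: "\<theta>'\<^sup>2 = min 1 (2 * \<theta>\<^sup>2)"
   proof (cases "sqrt 2 * \<theta> \<le> 1")
    case True
    then have "(sqrt 2 * \<theta>)\<^sup>2 \<le> 1" using Suc.prems by (intro power_le_one) auto
    then show ?thesis using True by (simp add: \<theta>'_def power_mult_distrib)
   next
    case False
    then have "(sqrt 2 * \<theta>)\<^sup>2 \<ge> 1" by (intro one_le_power) auto
    then show ?thesis using False by (simp add: \<theta>'_def power_mult_distrib)
   qed
   moreover have "(1/2) ^ n \<le> \<theta>'\<^sup>2" using Suc.prems power_le_one[of "1/2::real" n] by (simp add: sq)
   moreover have "\<theta>\<^sup>2 \<le> \<theta>'\<^sup>2" using Suc.prems power_le_one[of \<theta> 2] by (simp add: sq)
   then have "3 * R \<le> ennreal (\<theta>'\<^sup>2) * K"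
    using Suc.prems(4) by (meson ennreal_leI mult_right_mono order_trans zero_le)
   ultimately show ?case using Suc.IH[of \<theta>'] step[of \<theta>' \<theta>] Suc.prems by simp
  qed
  obtain n where "(1/2::real) ^ n < \<theta>\<^sup>2" using real_arch_pow_inv[of "\<theta>\<^sup>2" "1/2"] \<theta> by auto
  then have "good \<theta>" using all \<theta> by (meson less_imp_le)
  then show "\<exists>DX DY. Borel DX \<and> Borel DY \<and>
     Nsq l DX \<le> ennreal (\<theta>\<^sup>2) * (4 * K) \<and> Nsq l DY \<le> ennreal (\<theta>\<^sup>2) * (4 * K) \<and>
     (\<forall>\<xi>. \<forall>t\<in>{0..\<tau>}. em (\<rho>0 - m * t) (jc (p1 t) \<ominus> jc (p2 t)) \<xi> \<le> DX \<xi>) \<and>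
     (\<forall>\<xi>. \<forall>t\<in>{0..\<tau>}. em (\<rho>0 - m * t) (a1 t \<ominus> a2 t) \<xi> \<le> DY \<xi>)"
   by (simp only: good_def)
 qed
qed

section \<open>Uniqueness on the Fourier side\<close>

lemma Nsq_eq_0:
 assumes [measurable]: "Borel V" and "Nsq p V = 0"
 shows "AE \<xi> in lborel. V \<xi> = 0"
proof -
 have "AE \<xi> in lborel. (jm p V \<xi>)\<^sup>2 = 0"
  using assms(2) unfolding Nsq_def by (subst (asm) nn_integral_0_iff_AE) auto
 then show ?thesis
 proof eventually_elim
  fix \<xi> assume "(jm p V \<xi>)\<^sup>2 = 0"
  moreover have "ennreal (jap \<xi> powr p) \<noteq> 0" by (simp add: ennreal_eq_0_iff)
  ultimately show "V \<xi> = 0" by (simp add: jm_def)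
 qed
qed

text \<open>Half of the exponential rate pays for the \<open>l + 1\<close> powers of
  \<open>jap\<close> in the norm of order \<open>l\<close> of \<open>jc\<close>; the other half
  remains as weight.\<close>

lemma DC_majorant:
 assumes u: "DC S u" and l: "l \<ge> 0"
 obtains r V where "r > 0" "Borel V" "Nsq l V < top"
  "AE \<xi> in lborel. \<forall>t\<in>S. em r (jc (u t)) \<xi> \<le> V \<xi> \<and> em r (u t) \<xi> \<le> V \<xi>"
proof -
 obtain \<rho> W where W: "\<rho> > 0" and [measurable]: "Borel W" and E: "Eq \<rho> W < top"
  and dom: "AE \<xi> in lborel. \<forall>t\<in>S. na (u t) \<xi> \<le> W \<xi>"
  using u by (auto simp: DC_def)
 obtain C where C: "C < top" "\<And>V. Borel V \<Longrightarrow> Eq (\<rho> / 2) (jm (l + 1) V) \<le> C * Eq \<rho> V"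
  using Eq_jm[of "\<rho> / 2" \<rho> "l + 1"] W l by auto
 define V where "V \<xi> = ennreal (exp (\<rho> / 2 * jap \<xi>)) * jm 1 W \<xi>" for \<xi>
 have Vm: "Borel V" unfolding V_def by measurable
 have "Nsq l V = Eq (\<rho> / 2) (jm (l + 1) W)"
  unfolding Nsq_def Eq_def V_def jm_def by (simp add: powr_add ennreal_mult mult_ac)
 also have "... < top" using C(2)[of W] C(1) E by (auto simp: ennreal_mult_less_top intro: le_less_trans)
 finally have N: "Nsq l V < top" .
 have "AE \<xi> in lborel. \<forall>t\<in>S. em (\<rho> / 2) (jc (u t)) \<xi> \<le> V \<xi> \<and> em (\<rho> / 2) (u t) \<xi> \<le> V \<xi>"
  using dom
 proof eventually_elim
  fix \<xi> assume d: "\<forall>t\<in>S. na (u t) \<xi> \<le> W \<xi>"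
  show "\<forall>t\<in>S. em (\<rho> / 2) (jc (u t)) \<xi> \<le> V \<xi> \<and> em (\<rho> / 2) (u t) \<xi> \<le> V \<xi>"
  proof
   fix t assume t: "t \<in> S"
   have "em (\<rho> / 2) (jc (u t)) \<xi> = ennreal (exp (\<rho> / 2 * jap \<xi>)) * (ennreal (jap \<xi>) * na (u t) \<xi>)"
    by (simp add: em_def jc_def na_def norm_mult flip: ennreal_mult)
   also have "... \<le> V \<xi>" unfolding V_def jm_def using d t by (intro mult_left_mono mult_mono) auto
   finally have 1: "em (\<rho> / 2) (jc (u t)) \<xi> \<le> V \<xi>" .
   then show "em (\<rho> / 2) (jc (u t)) \<xi> \<le> V \<xi> \<and> em (\<rho> / 2) (u t) \<xi> \<le> V \<xi>" using em_le_em_jc[of "\<rho> / 2" "u t" \<xi>] by simp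
  qed
 qed
 then show thesis using that[of "\<rho> / 2" V] W Vm N by auto
qed

text \<open>The system is autonomous; the shift lets the difference estimate start again at a later
  time with the full rate.\<close>

lemma FS_shift:
 assumes F: "FS \<alpha> \<beta> g s \<epsilon> T p a" and t: "0 \<le> t0" "t0 + \<tau> \<le> T"
 shows "FS \<alpha> \<beta> g s \<epsilon> \<tau> (\<lambda>t. p (t0 + t)) (\<lambda>t. a (t0 + t))"
proof -
 have in_T: "t0 + t \<in> {0..T}" if "t \<in> {0..\<tau>}" for t using that t by auto
 have DC: "DC {0..\<tau>} (\<lambda>t. u (t0 + t))" if "DC {0..T} u" for u
 proof -
  obtain \<rho> W where [measurable]: "jmeas u" and W: "\<rho> > 0" "Borel W" "Eq \<rho> W < top"
   and dom: "AE \<xi> in lborel. \<forall>t\<in>{0..T}. na (u t) \<xi> \<le> W \<xi>"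
   using \<open>DC {0..T} u\<close> by (auto simp: DC_def)
  have "jmeas (\<lambda>t. u (t0 + t))" by measurable
  moreover have "AE \<xi> in lborel. \<forall>t\<in>{0..\<tau>}. na (u (t0 + t)) \<xi> \<le> W \<xi>"
   using dom by eventually_elim (use in_T in blast)
  ultimately show ?thesis using W unfolding DC_def by blast
 qed
 have CC: "CC {0..\<tau>} (\<lambda>t. u (t0 + t))" if "CC {0..T} u" for u
 proof -
  have "AE \<xi> in lborel. continuous_on {0..T} (\<lambda>t. u t \<xi>)" using that by (simp add: CC_def)
  then have "AE \<xi> in lborel. continuous_on {0..\<tau>} (\<lambda>t. u (t0 + t) \<xi>)"
  proof eventually_elim
   fix \<xi> assume c: "continuous_on {0..T} (\<lambda>t. u t \<xi>)"
   show "continuous_on {0..\<tau>} (\<lambda>t. u (t0 + t) \<xi>)"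
   proof (rule continuous_on_compose2[OF c])
    show "continuous_on {0..\<tau>} ((+) t0)" by (intro continuous_intros)
    show "(+) t0 ` {0..\<tau>} \<subseteq> {0..T}" using in_T by blast
   qed
  qed
  then show ?thesis by (simp add: CC_def)
 qed
 have vd: "((\<lambda>r. f (t0 + r)) has_vector_derivative f') (at r within {0..\<tau>})"
  if "(f has_vector_derivative f') (at (t0 + r) within {0..T})" "r \<in> {0..\<tau>}" for f :: cfun and f' r
 proof -
  have 1: "((\<lambda>r. t0 + r) has_vector_derivative 1) (at r within {0..\<tau>})"
   by (auto intro!: derivative_eq_intros)
  have 2: "(f has_vector_derivative f') (at (t0 + r) within (\<lambda>r. t0 + r) ` {0..\<tau>})"
   by (rule has_vector_derivative_within_subset[OF that(1)]) (use in_T in blast)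
  show ?thesis using vector_diff_chain_within[OF 1 2] by (simp add: o_def)
 qed
 have ode: "AE \<xi> in lborel. spectral_ode \<alpha> \<beta> g s \<epsilon> T p a \<xi>"
  using F by (simp add: FS_def)
 have "AE \<xi> in lborel. \<forall>t\<in>{0..\<tau>}.
   ((\<lambda>r. p (t0 + r) \<xi>) has_vector_derivative NP \<alpha> \<beta> g s (p (t0 + t)) (a (t0 + t)) \<xi>) (at t within {0..\<tau>}) \<and>
   ((\<lambda>r. a (t0 + r) \<xi>) has_vector_derivative (NA \<alpha> g (p (t0 + t)) (a (t0 + t)) \<xi> - \<i> * of_real (\<epsilon> * \<xi>\<^sup>2 / 2) * a (t0 + t) \<xi>)) (at t within {0..\<tau>})"
  using ode
 proof (rule eventually_mono, intro ballI conjI)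
  fix \<xi> r assume d: "spectral_ode \<alpha> \<beta> g s \<epsilon> T p a \<xi>"
   and r: "r \<in> {0..\<tau>}"
  show "((\<lambda>r. p (t0 + r) \<xi>) has_vector_derivative NP \<alpha> \<beta> g s (p (t0 + r)) (a (t0 + r)) \<xi>) (at r within {0..\<tau>})"
   by (rule vd[OF _ r]) (use d in_T[OF r] in blast)
  show "((\<lambda>r. a (t0 + r) \<xi>) has_vector_derivative (NA \<alpha> g (p (t0 + r)) (a (t0 + r)) \<xi> - \<i> * of_real (\<epsilon> * \<xi>\<^sup>2 / 2) * a (t0 + r) \<xi>)) (at r within {0..\<tau>})"
   by (rule vd[OF _ r]) (use d in_T[OF r] in blast)
 qed
 then show ?thesis using F DC CC by (simp add: FS_def)
qed

text \<open>The available decay rate \<open>r\<close> may be small, so that the difference estimate is applied on time steps of length \<open>r / m\<close>.\<close>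

lemma FS_unique:
 assumes F1: "FS \<alpha> \<beta> g s \<epsilon> T p1 a1" and F2: "FS \<alpha> \<beta> g s \<epsilon> T p2 a2"
  and i: "AE \<xi> in lborel. p1 0 \<xi> = p2 0 \<xi>" "AE \<xi> in lborel. a1 0 \<xi> = a2 0 \<xi>"
  and t: "t \<in> {0..T}"
 shows "p1 t \<doteq> p2 t" "a1 t \<doteq> a2 t"
proof -
 have D: "DC {0..T} p1" "DC {0..T} p2" "DC {0..T} a1" "DC {0..T} a2" using F1 F2 by (auto simp: FS_def)
 then have jm: "jmeas p1" "jmeas p2" "jmeas a1" "jmeas a2" by (auto simp: DC_def)
 have [measurable]: "Borel (p1 t)" "Borel (p2 t)"
  "Borel (a1 t)" "Borel (a2 t)" for t
  using jm by (auto intro: section_meas)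
 define good where "good u V r \<longleftrightarrow> r > 0 \<and> Borel V \<and> Nsq 1 V < top \<and>
   (AE \<xi> in lborel. \<forall>t\<in>{0..T}. em r (jc (u t)) \<xi> \<le> V \<xi> \<and> em r (u t) \<xi> \<le> V \<xi>)" for u V and r :: real
 have ex: "\<exists>V r. good u V r" if du: "DC {0..T} u" for u
 proof -
  obtain r V where "r > 0" "Borel V" "Nsq 1 V < top"
   "AE \<xi> in lborel. \<forall>t\<in>{0..T}. em r (jc (u t)) \<xi> \<le> V \<xi> \<and> em r (u t) \<xi> \<le> V \<xi>"
   by (rule DC_majorant[OF du zero_le_one])
  then show ?thesis unfolding good_def by blast
 qed
 obtain V1 r1 V2 r2 V3 r3 V4 r4 where V: "good p1 V1 r1" "good p2 V2 r2" "good a1 V3 r3" "good a2 V4 r4"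
  using ex[OF D(1)] ex[OF D(2)] ex[OF D(3)] ex[OF D(4)] by (elim exE) (rule that)
 then have [measurable]: "Borel V1" "Borel V2" "Borel V3" "Borel V4"
  by (auto simp: good_def)
 define V where "V \<xi> = (V1 \<xi> + V2 \<xi>) + (V3 \<xi> + V4 \<xi>)" for \<xi>
 define r where "r = min (min r1 r2) (min r3 r4)"
 have Vm[measurable]: "Borel V" unfolding V_def by measurable
 have r: "r > 0" "r \<le> r1" "r \<le> r2" "r \<le> r3" "r \<le> r4" using V by (auto simp: r_def good_def)
 have Vle: "V1 \<xi> \<le> V \<xi>" "V2 \<xi> \<le> V \<xi>" "V3 \<xi> \<le> V \<xi>" "V4 \<xi> \<le> V \<xi>" for \<xi>
  by (simp_all add: V_def add_increasing add_increasing2)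
 have VN: "Nsq 1 V < top"
 proof -
  have fin: "Nsq 1 (U \<oplus> W) < top" if [measurable]: "Borel U" "Borel W"
   and "Nsq 1 U < top" "Nsq 1 W < top" for U W
   by (rule le_less_trans[OF Nsq_add]) (use that in \<open>auto simp: ennreal_mult_less_top\<close>)
  show ?thesis unfolding V_def using V by (intro fin) (auto simp: good_def)
 qed
 have dom: "AE \<xi> in lborel. \<forall>t\<in>{0..T}. em r' (jc (u t)) \<xi> \<le> V \<xi> \<and> em r' (u t) \<xi> \<le> V \<xi>"
  if "good u W r0" "\<And>\<xi>. W \<xi> \<le> V \<xi>" "r' \<le> r0" for u W r0 r'
 proof -
  have "AE \<xi> in lborel. \<forall>t\<in>{0..T}. em r0 (jc (u t)) \<xi> \<le> W \<xi> \<and> em r0 (u t) \<xi> \<le> W \<xi>"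
   using that(1) by (simp add: good_def)
  then show ?thesis
   by eventually_elim (use that(2) em_mono_weight[OF that(3)] in \<open>blast intro: order_trans\<close>)
 qed
 have domV: "AE \<xi> in lborel. \<forall>t\<in>{0..T}. em r (jc (p1 t)) \<xi> \<le> V \<xi> \<and> em r (p1 t) \<xi> \<le> V \<xi>"
  "AE \<xi> in lborel. \<forall>t\<in>{0..T}. em r (jc (p2 t)) \<xi> \<le> V \<xi> \<and> em r (p2 t) \<xi> \<le> V \<xi>"
  "AE \<xi> in lborel. \<forall>t\<in>{0..T}. em r (jc (a1 t)) \<xi> \<le> V \<xi> \<and> em r (a1 t) \<xi> \<le> V \<xi>"
  "AE \<xi> in lborel. \<forall>t\<in>{0..T}. em r (jc (a2 t)) \<xi> \<le> V \<xi> \<and> em r (a2 t) \<xi> \<le> V \<xi>"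
  by (rule dom[OF V(1) Vle(1) r(2)] dom[OF V(2) Vle(2) r(3)] dom[OF V(3) Vle(3) r(4)] dom[OF V(4) Vle(4) r(5)])+
 define K where "K = Nsq 1 V + 1"
 have K: "K < top" "K \<ge> 1" using VN by (auto simp: K_def)
 have A: "\<bar>\<alpha>\<bar> + \<bar>\<beta>\<bar> + 1 \<ge> 1" "\<bar>\<alpha>\<bar> \<le> \<bar>\<alpha>\<bar> + \<bar>\<beta>\<bar> + 1" "\<bar>\<beta>\<bar> \<le> \<bar>\<alpha>\<bar> + \<bar>\<beta>\<bar> + 1" by auto
 from difference_estimate[OF _ K A, of 1 g s] obtain m where m: "m > 0" and est: "diff_est 1 K \<alpha> \<beta> g s m"
  by auto
 define eq where "eq t \<longleftrightarrow> (p1 t \<doteq> p2 t) \<and> (a1 t \<doteq> a2 t)" for t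
 have Nsq0: "Nsq 1 (em \<rho> (u \<ominus> u')) \<le> 0" if "u \<doteq> u'" for \<rho> u u'
 proof -
  have "Nsq 1 (em \<rho> (u \<ominus> u')) \<le> Nsq 1 (\<lambda>_. 0)"
   by (rule Nsq_mono_AE) (use that in \<open>eventually_elim, simp add: em_def\<close>)
  then show ?thesis by simp
 qed
 \<comment> \<open>With equal data and equal \<open>\<epsilon>\<close>, the difference estimate
   holds with \<open>R = 0\<close> for every \<open>\<theta>\<close>, which forces the difference to
   vanish.\<close>
 have small_0: "V = 0" if "\<And>\<theta>. 0 < \<theta> \<Longrightarrow> \<theta> \<le> 1 \<Longrightarrow> V \<le> ennreal (\<theta>\<^sup>2) * (4 * K)" for V :: ennreal
 proof -
  have K4: "4 * K < top" using K by (simp add: ennreal_mult_less_top)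
  then obtain k where k: "4 * K = ennreal k" "k \<ge> 0" by (cases "4 * K") auto
  have "((\<lambda>n. ennreal ((1 / real (Suc n))\<^sup>2 * k)) \<longlonglongrightarrow> ennreal (0\<^sup>2 * k))"
   by (intro tendsto_ennrealI tendsto_intros LIMSEQ_inverse_real_of_nat[unfolded inverse_eq_divide])
  moreover have "V \<le> ennreal ((1 / real (Suc n))\<^sup>2 * k)" for n
   using that[of "1 / real (Suc n)"] k by (simp add: ennreal_mult)
  ultimately have "V \<le> ennreal (0\<^sup>2 * k)" by (intro LIMSEQ_le_const) auto
  then show ?thesis by simp
 qed
 \<comment> \<open>The condition \<open>m * \<tau> \<le> r\<close> keeps the weight
   \<open>r - m * t\<close> nonnegative. The majorant \<open>V\<close> is valid at rate
   \<open>r\<close> for all times, so the admissible step length is the same at every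
   \<open>t0\<close>.\<close>
 have step: "eq (t0 + \<tau>)" if e: "eq t0" and t0: "0 \<le> t0" "0 \<le> \<tau>" "m * \<tau> \<le> r" "t0 + \<tau> \<le> T" for t0 \<tau>
 proof -
  have in_T: "t0 + t \<in> {0..T}" if "t \<in> {0..\<tau>}" for t using that t0 by auto
  have le: "r - m * t \<le> r" if "t \<in> {0..\<tau>}" for t using that m by auto
  have dX: "AE \<xi> in lborel. \<forall>t\<in>{0..\<tau>}. em (r - m * t) (jc (p1 (t0 + t))) \<xi> \<le> V \<xi> \<and> em (r - m * t) (jc (p2 (t0 + t))) \<xi> \<le> V \<xi>"
   using domV(1) domV(2) by eventually_elim (use in_T em_mono_weight[OF le] in \<open>blast intro: order_trans\<close>)
  have dY: "AE \<xi> in lborel. \<forall>t\<in>{0..\<tau>}. em (r - m * t) (a1 (t0 + t)) \<xi> \<le> V \<xi> \<and> em (r - m * t) (a2 (t0 + t)) \<xi> \<le> V \<xi>"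
   using domV(3) domV(4) by eventually_elim (use in_T em_mono_weight[OF le] in \<open>blast intro: order_trans\<close>)
  have e': "jc (p1 t0) \<doteq> jc (p2 t0)" "a1 t0 \<doteq> a2 t0"
   using e by (auto simp: eq_def jc_def)
  have NK: "Nsq 1 V \<le> K" by (simp add: K_def)
  have *: "\<exists>DX DY. Borel DX \<and> Borel DY \<and>
     Nsq 1 DX \<le> ennreal (\<theta>\<^sup>2) * (4 * K) \<and> Nsq 1 DY \<le> ennreal (\<theta>\<^sup>2) * (4 * K) \<and>
     (\<forall>\<xi>. \<forall>t\<in>{0..\<tau>}. em (r - m * t) (jc (p1 (t0 + t)) \<ominus> jc (p2 (t0 + t))) \<xi> \<le> DX \<xi>) \<and>
     (\<forall>\<xi>. \<forall>t\<in>{0..\<tau>}. em (r - m * t) (a1 (t0 + t) \<ominus> a2 (t0 + t)) \<xi> \<le> DY \<xi>)" if \<theta>: "0 < \<theta>" "\<theta> \<le> 1" for \<theta>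
   by (rule diff_estD[OF est, where Z = "\<lambda>_. 0" and R = 0, OF t0(2,3) FS_shift[OF F1 t0(1,4)] FS_shift[OF F2 t0(1,4)] Vm Vm _ NK NK _ dX dY _ _ _ \<theta>])
     (use Nsq0[OF e'(1), of r] Nsq0[OF e'(2), of r] in \<open>simp_all add: em_def\<close>)
  have \<tau>: "\<tau> \<in> {0..\<tau>}" using t0 by simp
  have bd: "Nsq 1 (em (r - m * \<tau>) (jc (p1 (t0 + \<tau>)) \<ominus> jc (p2 (t0 + \<tau>)))) \<le> ennreal (\<theta>\<^sup>2) * (4 * K) \<and>
    Nsq 1 (em (r - m * \<tau>) (a1 (t0 + \<tau>) \<ominus> a2 (t0 + \<tau>))) \<le> ennreal (\<theta>\<^sup>2) * (4 * K)" if \<theta>: "0 < \<theta>" "\<theta> \<le> 1" for \<theta>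
  proof -
   obtain DX DY where DD: "Nsq 1 DX \<le> ennreal (\<theta>\<^sup>2) * (4 * K)" "Nsq 1 DY \<le> ennreal (\<theta>\<^sup>2) * (4 * K)"
    "\<And>\<xi>. em (r - m * \<tau>) (jc (p1 (t0 + \<tau>)) \<ominus> jc (p2 (t0 + \<tau>))) \<xi> \<le> DX \<xi>"
    "\<And>\<xi>. em (r - m * \<tau>) (a1 (t0 + \<tau>) \<ominus> a2 (t0 + \<tau>)) \<xi> \<le> DY \<xi>"
    using *[OF \<theta>] \<tau> by blast
   show ?thesis
    by (intro conjI order_trans[OF Nsq_mono DD(1)] order_trans[OF Nsq_mono DD(2)] DD(3,4))
  qed
  have z: "Nsq 1 (em (r - m * \<tau>) (jc (p1 (t0 + \<tau>)) \<ominus> jc (p2 (t0 + \<tau>)))) = 0"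
   "Nsq 1 (em (r - m * \<tau>) (a1 (t0 + \<tau>) \<ominus> a2 (t0 + \<tau>))) = 0"
   by (rule small_0, use bd in blast)+
  have "AE \<xi> in lborel. em (r - m * \<tau>) (jc (p1 (t0 + \<tau>)) \<ominus> jc (p2 (t0 + \<tau>))) \<xi> = 0"
   "AE \<xi> in lborel. em (r - m * \<tau>) (a1 (t0 + \<tau>) \<ominus> a2 (t0 + \<tau>)) \<xi> = 0"
   by (rule Nsq_eq_0[OF _ z(1)] Nsq_eq_0[OF _ z(2)]; measurable)+
  then show ?thesis
   unfolding eq_def by (simp add: em_def jc_def mult_le_0_iff)
 qed
 \<comment> \<open>Induction on the number of steps of length \<open>r / m\<close>.\<close>
 have "eq t" if "t \<in> {0..T}" "m * t \<le> real n * r" for n t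
  using that
 proof (induction n arbitrary: t)
  case 0
  then have "t = 0" using m by (simp add: mult_le_0_iff)
  then show ?case using i by (simp add: eq_def)
 next
  case (Suc n)
  show ?case
  proof (cases "m * t \<le> real n * r")
   case False
   define t0 where "t0 = real n * r / m"
   have t0: "m * t0 = real n * r" "0 \<le> t0" using m r by (simp_all add: t0_def)
   with False have "m * t0 < m * t" by simp
   then have lt: "t0 < t" using m by simp
   have e: "eq t0" using lt t0 Suc by auto
   have "m * (t - t0) \<le> r" using Suc.prems t0 by (simp add: algebra_simps)
   then show ?thesis using step[OF e t0(2), of "t - t0"] lt Suc.prems by auto
  qed (use Suc in auto)
 qed
 moreover obtain n where "m * t / r \<le> real n" using real_arch_simple by blast
 then have "m * t \<le> real n * r" using r by (simp add: divide_le_eq)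
 ultimately have "eq t" using t by blast
 then show "p1 t \<doteq> p2 t" "a1 t \<doteq> a2 t" by (auto simp: eq_def)
qed

theorem X_solution_unique:
 assumes X: "X_solution (power_nl \<alpha> (Suc g)) (power_nl \<beta> (Suc s)) \<epsilon> w T l \<phi>0 a0 \<phi> a"
  and X': "X_solution (power_nl \<alpha> (Suc g)) (power_nl \<beta> (Suc s)) \<epsilon> w T l \<phi>0 a0 \<phi>' a'"
  and l: "l \<ge> 0" and T: "T > 0" and w: "Borel w" "\<rho>0 > 0" "\<And>t. t \<in> {0..T} \<Longrightarrow> \<rho>0 \<le> w t"
  and t: "t \<in> {0..T}"
 shows "\<phi>' t = \<phi> t" "a' t = a t"
proof -
 obtain P A where F: "FS \<alpha> \<beta> g s \<epsilon> T P A" and e: "\<And>t. t \<in> {0..T} \<Longrightarrow> \<phi> t = IF (P t)" "\<And>t. t \<in> {0..T} \<Longrightarrow> a t = IF (A t)"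
  using X_solution_FS[OF X l T w] by blast
 obtain P' A' where F': "FS \<alpha> \<beta> g s \<epsilon> T P' A'" and e': "\<And>t. t \<in> {0..T} \<Longrightarrow> \<phi>' t = IF (P' t)" "\<And>t. t \<in> {0..T} \<Longrightarrow> a' t = IF (A' t)"
  using X_solution_FS[OF X' l T w] by blast
 have W: "WC (P t)" "WC (A t)" "WC (P' t)" "WC (A' t)" if "t \<in> {0..T}" for t
  using F F' that by (auto simp: FS_def intro: BC_WC DC_BC)
 have 0: "(0::real) \<in> {0..T}" using T by simp
 have d: "AE x in lborel. \<phi> 0 x = \<phi>0 x" "AE x in lborel. \<phi>' 0 x = \<phi>0 x" "AE x in lborel. a 0 x = a0 x" "AE x in lborel. a' 0 x = a0 x"
  using X X' by (auto simp: X_solution_def)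
 have "IF (P 0) \<doteq> IF (P' 0)"
  using d(1) d(2) by eventually_elim (simp add: e(1)[OF 0, symmetric] e'(1)[OF 0, symmetric] e(2)[OF 0, symmetric] e'(2)[OF 0, symmetric])
 then have p0: "AE \<xi> in lborel. P 0 \<xi> = P' 0 \<xi>" by (rule IF_inj[OF W(1)[OF 0] W(3)[OF 0]])
 have "IF (A 0) \<doteq> IF (A' 0)"
  using d(3) d(4) by eventually_elim (simp add: e(1)[OF 0, symmetric] e'(1)[OF 0, symmetric] e(2)[OF 0, symmetric] e'(2)[OF 0, symmetric])
 then have a0: "AE \<xi> in lborel. A 0 \<xi> = A' 0 \<xi>" by (rule IF_inj[OF W(2)[OF 0] W(4)[OF 0]])
 note q = FS_unique[OF F F' p0 a0 t]
 show "\<phi>' t = \<phi> t" "a' t = a t"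
  unfolding e[OF t] e'[OF t]
  by (rule sym, rule IF_cong_AE; use q W[OF t] WC_measurable in blast)+
qed

section \<open>Existence and convergence\<close>

lemma fourier_real:
 assumes \<psi>: "\<psi> \<in> L2" and real: "\<And>x. \<psi> x \<in> \<real>"
 shows "fourier \<psi> \<doteq> cj (fourier \<psi>)"
proof (rule fourier_unique[OF \<psi>])
 note [measurable] = fourier_measurable[OF \<psi>] truncated_fourier_measurable[OF \<psi>]
 show "Borel (cj (fourier \<psi>))" by measurable
 have tr: "truncated_fourier R \<psi> \<xi> = cnj (truncated_fourier R \<psi> (- \<xi>))" for R \<xi>
 proof -
  have "cnj (LINT x:{-R..R}|lborel. exp (- \<i> * of_real (x * - \<xi>)) * \<psi> x)
    = (LINT x:{-R..R}|lborel. cnj (exp (- \<i> * of_real (x * - \<xi>)) * \<psi> x))"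
   unfolding set_lebesgue_integral_def by (simp flip: Bochner_Integration.integral_cnj)
  also have "... = (LINT x:{-R..R}|lborel. exp (- \<i> * of_real (x * \<xi>)) * \<psi> x)"
   using real by (simp add: exp_cnj Reals_cnj_iff)
  finally show ?thesis by (simp add: truncated_fourier_def)
 qed
 have "n2 (truncated_fourier R \<psi> \<ominus> cj (fourier \<psi>)) = n2 (truncated_fourier R \<psi> \<ominus> fourier \<psi>)" for R
 proof -
  have "truncated_fourier R \<psi> \<xi> - cj (fourier \<psi>) \<xi> = cnj (truncated_fourier R \<psi> (- \<xi>) - fourier \<psi> (- \<xi>))" for \<xi>
   unfolding tr[of R \<xi>] by (simp add: cj_def)
  then have "n2 (truncated_fourier R \<psi> \<ominus> cj (fourier \<psi>)) = n2 (\<lambda>\<xi>. truncated_fourier R \<psi> (- \<xi>) - fourier \<psi> (- \<xi>))"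
   unfolding n2_def by (simp only: complex_mod_cnj)
  then show ?thesis using n2_reflect[of "\<lambda>\<xi>. truncated_fourier R \<psi> \<xi> - fourier \<psi> \<xi>"] by simp
 qed
 then show "((\<lambda>R. n2 (truncated_fourier R \<psi> \<ominus> cj (fourier \<psi>))) \<longlongrightarrow> 0) at_top"
  using fourier_tendsto[OF \<psi>] by simp
qed

lemma duh_0: "duh \<kappa> y F 0 = y"
proof -
 have "Ds \<kappa> F 0 = 0"
  unfolding Ds_def by (rule integral_eq_zero_AE) (use AE_lborel_singleton[of 0] in eventually_elim, simp)
 then show ?thesis by (simp add: duh_def)
qed

text \<open>The majorants at rate \<open>m\<close> accompany the solution: membership in the class,
  the convergence estimate and the constants are all derived from them rather than from the
  solution.\<close>

definition spectral_solution ::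
 "real \<Rightarrow> real \<Rightarrow> nat \<Rightarrow> nat \<Rightarrow> real \<Rightarrow> real \<Rightarrow> real \<Rightarrow> real \<Rightarrow> real \<Rightarrow> ennreal \<Rightarrow> cfun \<Rightarrow> cfun \<Rightarrow>
  cpath \<Rightarrow> cpath \<Rightarrow> nnfun \<Rightarrow> nnfun \<Rightarrow> bool" where
 "spectral_solution \<alpha> \<beta> g s \<epsilon> m w0 T l B \<phi>0 a0 p a X Y \<longleftrightarrow>
   FS \<alpha> \<beta> g s \<epsilon> T p a \<and> Borel X \<and> Borel Y \<and> Nsq l X \<le> B \<and> Nsq l Y \<le> B \<and>
   (\<forall>t\<in>{0..T}. \<forall>\<xi>. em (w0 - m * t) (jc (p t)) \<xi> \<le> X \<xi> \<and> em (w0 - m * t) (a t) \<xi> \<le> Y \<xi>) \<and>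
   (AE \<xi> in lborel. fourier \<phi>0 \<xi> = p 0 \<xi>) \<and> (AE \<xi> in lborel. fourier a0 \<xi> = a 0 \<xi>) \<and>
   (\<forall>t\<in>{0..T}. cj (p t) \<doteq> p t)"

definition solvable :: "real \<Rightarrow> ennreal \<Rightarrow> real \<Rightarrow> real \<Rightarrow> nat \<Rightarrow> nat \<Rightarrow> real \<Rightarrow> bool" where
 "solvable l K \<alpha> \<beta> g s m \<longleftrightarrow> (\<forall>w0 T \<epsilon> \<phi>0 a0. 0 \<le> T \<longrightarrow> m * T < w0 \<longrightarrow> \<phi>0 \<in> L2 \<longrightarrow> a0 \<in> L2 \<longrightarrow> (\<forall>x. \<phi>0 x \<in> \<real>) \<longrightarrow>
  H_normsq w0 (l + 1) \<phi>0 \<le> K \<longrightarrow> H_normsq w0 l a0 \<le> K \<longrightarrow>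
  (\<exists>p a X Y. spectral_solution \<alpha> \<beta> g s \<epsilon> m w0 T l (2 * K + 2) \<phi>0 a0 p a X Y))"

lemma spectral_solution_exists:
 assumes l: "l \<ge> 1" and K: "K < top"
 shows "\<exists>m0>0. \<forall>m\<ge>m0. solvable l K \<alpha> \<beta> g s m"
proof -
 have A: "\<bar>\<alpha>\<bar> + \<bar>\<beta>\<bar> + 1 \<ge> 1" "\<bar>\<alpha>\<bar> \<le> \<bar>\<alpha>\<bar> + \<bar>\<beta>\<bar> + 1" "\<bar>\<beta>\<bar> \<le> \<bar>\<alpha>\<bar> + \<bar>\<beta>\<bar> + 1" by auto
 obtain m0 where "m0 > 0" and m0: "\<And>m. m0 \<le> m \<Longrightarrow> picard_solvable l K \<alpha> \<beta> g s m"
  using picard_exists[OF l K A, of g s] by blast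
 show ?thesis
 proof (rule exI[of _ m0], unfold solvable_def, intro conjI \<open>m0 > 0\<close> allI impI)
  fix m w0 T \<epsilon> :: real and \<phi>0 a0 :: cfun
  assume m: "m0 \<le> m" and T: "0 \<le> T" "m * T < w0" and L: "\<phi>0 \<in> L2" "a0 \<in> L2" and real: "\<forall>x. \<phi>0 x \<in> \<real>"
   and N: "H_normsq w0 (l + 1) \<phi>0 \<le> K" "H_normsq w0 l a0 \<le> K"
  note [measurable] = fourier_measurable[OF L(1)] fourier_measurable[OF L(2)]
  \<comment> \<open>The transform of a real function is symmetric only almost everywhere, because of
    the choice in \<open>fourier\<close>; averaging with the conjugate reflection yields a version
    that is symmetric everywhere, as the reality statement of the iteration demands.\<close>
  define p0 where "p0 \<xi> = (fourier \<phi>0 \<xi> + cj (fourier \<phi>0) \<xi>) / 2" for \<xi>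
  have [measurable]: "Borel p0" unfolding p0_def by measurable
  have cj: "cj p0 = p0" by (simp add: fun_eq_iff cj_def p0_def add.commute)
  have p0: "fourier \<phi>0 \<doteq> p0"
   using fourier_real[OF L(1)] real by (auto simp: p0_def elim!: eventually_mono)
  have 1: "Nsq l (em w0 (jc p0)) \<le> K"
   using N(1) unfolding H_normsq_eq[OF p0] em_jc Nsq_jm by (simp add: add.commute)
  have 2: "Nsq l (em w0 (fourier a0)) \<le> K"
   using N(2) by (subst H_normsq_eq[symmetric, where \<psi> = a0]) auto
  obtain p a X Y where jm: "jmeas p" "jmeas a" and
   XY: "Borel X" "Borel Y" "Nsq l X \<le> 2 * K + 2" "Nsq l Y \<le> 2 * K + 2" and
   dom: "\<forall>t\<in>{0..T}. \<forall>\<xi>. em (w0 - m * t) (jc (p t)) \<xi> \<le> X \<xi> \<and> em (w0 - m * t) (a t) \<xi> \<le> Y \<xi>" and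
   eqs: "AE \<xi> in lborel. duhamel \<alpha> \<beta> g s \<epsilon> T p0 (fourier a0) p a \<xi>" and
   cjp: "\<forall>t\<in>{0..T}. cj (p t) \<doteq> p t"
   using picard_solvableD[OF m0[OF m] T(1) less_imp_le[OF T(2)] _ _ 1 2, where \<epsilon> = \<epsilon>] cj by auto
  have fin: "Nsq l X < top" "Nsq l Y < top" using XY K by (auto simp: ennreal_mult_less_top intro: le_less_trans)
  have w: "w0 - m * T > 0" "w0 - m * T \<le> w0 - m * t" if "t \<in> {0..T}" for t
   using T that m \<open>m0 > 0\<close> by auto
  have DC: "DC {0..T} p" "DC {0..T} a"
  proof -
   have wT: "w0 - m * T > 0" using T by simp
   show "DC {0..T} p"
    by (rule DC_of_majorant[OF jm(1) XY(1) _ fin(1) wT w(2)]) (use l dom order_trans[OF em_le_em_jc] in \<open>auto\<close>)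
   show "DC {0..T} a"
    by (rule DC_of_majorant[OF jm(2) XY(2) _ fin(2) wT w(2)]) (use l dom in \<open>auto\<close>)
  qed
  have 0: "AE \<xi> in lborel. p 0 \<xi> = p0 \<xi> \<and> a 0 \<xi> = fourier a0 \<xi>"
   using eqs by eventually_elim (use T in \<open>auto simp: duh_0\<close>)
  have i: "AE \<xi> in lborel. fourier \<phi>0 \<xi> = p 0 \<xi>" "AE \<xi> in lborel. fourier a0 \<xi> = a 0 \<xi>"
   by (use p0 0 in eventually_elim, simp) (use 0 in eventually_elim, simp)
  show "\<exists>p a X Y. spectral_solution \<alpha> \<beta> g s \<epsilon> m w0 T l (2 * K + 2) \<phi>0 a0 p a X Y"
   using FS_of_duhamel[OF DC eqs] XY dom i cjp unfolding spectral_solution_def by blast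
 qed
qed

lemma spectral_solution_WC:
 assumes "spectral_solution \<alpha> \<beta> g s \<epsilon> m w0 T l B \<phi>0 a0 p a X Y" "t \<in> {0..T}"
 shows "WC (p t)" "WC (a t)"
 using assms by (auto simp: spectral_solution_def FS_def intro: BC_WC DC_BC)

text \<open>Majorants at rate \<open>M / 2\<close> are used with the weight of rate
  \<open>M\<close>, which places the inverse transforms in the class; uniqueness is the comparison
  with arbitrary solutions by \<open>X_solution_unique\<close>.\<close>

lemma spectral_solution_X_solution:
 assumes S: "spectral_solution \<alpha> \<beta> g s \<epsilon> (M / 2) w0 T l B \<phi>0 a0 p a X Y" and B: "B < top"
  and L: "\<phi>0 \<in> L2" "a0 \<in> L2" and l: "l \<ge> 1" and M: "M > 0" and T: "T > 0" "T < w0 / M"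
 shows "unique_X_solution (power_nl \<alpha> (Suc g)) (power_nl \<beta> (Suc s)) \<epsilon> (weight w0 M) T l \<phi>0 a0 (\<lambda>t. IF (p t)) (\<lambda>t. IF (a t))"
proof -
 have F: "FS \<alpha> \<beta> g s \<epsilon> T p a" and [measurable]: "Borel X" "Borel Y"
  and N: "Nsq l X \<le> B" "Nsq l Y \<le> B"
  and dom: "\<And>t \<xi>. t \<in> {0..T} \<Longrightarrow> em (w0 - M / 2 * t) (jc (p t)) \<xi> \<le> X \<xi>" "\<And>t \<xi>. t \<in> {0..T} \<Longrightarrow> em (w0 - M / 2 * t) (a t) \<xi> \<le> Y \<xi>"
  and i: "AE \<xi> in lborel. fourier \<phi>0 \<xi> = p 0 \<xi>" "AE \<xi> in lborel. fourier a0 \<xi> = a 0 \<xi>"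
  and real: "\<And>t. t \<in> {0..T} \<Longrightarrow> cj (p t) \<doteq> p t"
  using S unfolding spectral_solution_def by blast+
 note W = spectral_solution_WC[OF S]
 have CC: "CC {0..T} p" "CC {0..T} a" using F by (auto simp: FS_def)
 have fin: "Nsq l X < top" "Nsq l Y < top" using N B by (auto intro: le_less_trans)
 \<comment> \<open>\<open>X\<close> majorises \<open>jap\<close> times the transform of the phase,
   so \<open>jm (-1) X\<close> majorises the transform itself, and order \<open>l\<close> of
   \<open>X\<close> becomes order \<open>l + 1\<close>.\<close>
 interpret P: majorized w0 M T "l + 1" p "jm (-1) X"
  by unfold_locales (use l M dom(1) W(1) in \<open>auto intro!: em_le_jm_minus_one\<close>)
 interpret Q: majorized w0 M T l a Y
  by unfold_locales (use l M dom(2) W(2) in auto)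
 have "(\<lambda>t. IF (p t)) \<in> Y_space (weight w0 M) T (l + 1)"
  by (rule P.Y_space_mem[OF _ CC(1)]) (use fin in \<open>simp add: Nsq_jm\<close>)
 moreover have "(\<lambda>t. IF (a t)) \<in> Y_space (weight w0 M) T l"
  by (rule Q.Y_space_mem[OF fin(2) CC(2)])
 moreover have "solves_system (power_nl \<alpha> (Suc g)) (power_nl \<beta> (Suc s)) \<epsilon> T (\<lambda>t. IF (p t)) (\<lambda>t. IF (a t))"
  by (rule FS_solves_system[OF T(1) F])
 moreover have "\<phi>0 \<doteq> IF (p 0)" "a0 \<doteq> IF (a 0)"
  using W[of 0] T by (auto intro!: IF_fourier L i WC_measurable WC_integrable)
 then have "IF (p 0) \<doteq> \<phi>0" "IF (a 0) \<doteq> a0" by (auto simp: eq_commute)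
 ultimately have X: "X_solution (power_nl \<alpha> (Suc g)) (power_nl \<beta> (Suc s)) \<epsilon> (weight w0 M) T l \<phi>0 a0 (\<lambda>t. IF (p t)) (\<lambda>t. IF (a t))"
  by (simp add: X_solution_def X_space_def)
 have re: "IF (p t) x \<in> \<real>" if t: "t \<in> {0..T}" for t x
 proof -
  note [measurable] = WC_measurable[OF W(1)[OF t]]
  have "IF (cj (p t)) = IF (p t)" by (rule IF_cong_AE[OF real[OF t]]) measurable
  then show ?thesis by (simp add: Reals_cnj_iff flip: IF_cj)
 qed
 have MT: "M * T < w0" using T M by (simp add: field_simps)
 \<comment> \<open>The weight is decreasing, so its value at \<open>T\<close> is the positive lower
   bound from which an arbitrary solution obtains its exponential rate.\<close>
 have w: "Borel (weight w0 M)" "0 < w0 - M * T" "\<And>t. t \<in> {0..T} \<Longrightarrow> w0 - M * T \<le> weight w0 M t"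
  using MT M by (simp_all add: weight_def[abs_def])
 have l0: "l \<ge> 0" using l by simp
 have "\<phi>' t = IF (p t) \<and> a' t = IF (a t)"
  if X': "X_solution (power_nl \<alpha> (Suc g)) (power_nl \<beta> (Suc s)) \<epsilon> (weight w0 M) T l \<phi>0 a0 \<phi>' a'" and t: "t \<in> {0..T}" for \<phi>' a' t
  by (intro conjI; rule X_solution_unique[OF X X' l0 T(1) w(1,2) _ t]; rule w(3))
 then show ?thesis unfolding unique_X_solution_def using X re by simp
qed

section \<open>The error estimate\<close>

lemma WC_diff: "WC h \<Longrightarrow> WC k \<Longrightarrow> WC (h \<ominus> k)"
 using WC_add[of h "\<lambda>\<xi>. - 1 * k \<xi>"] WC_cmult[of k "- 1"] by simp

text \<open>When \<open>R\<close> is large compared with \<open>B\<close>, the sum of the two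
  majorants is bound enough. Otherwise \<open>difference_estimate\<close> applies with the smallest
  admissible \<open>\<theta>\<close>, so that its conclusion becomes a multiple of
  \<open>R\<close>.\<close>

lemma spectral_difference:
 assumes S1: "spectral_solution \<alpha> \<beta> g s \<epsilon> m w0 T l B \<phi>1 b1 p1 a1 X1 Y1"
  and S2: "spectral_solution \<alpha> \<beta> g s 0 m w0 T (l + 1) B \<phi>2 b2 p2 a2 X2 Y2"
  and E: "diff_est l (4 * B) \<alpha> \<beta> g s m" and B: "B < top" "B \<ge> 1"
  and T: "0 \<le> T" "m * T \<le> w0" and \<epsilon>: "0 < \<epsilon>"
  and R: "H_normsq w0 (l + 1) (\<phi>1 \<ominus> \<phi>2) \<le> R" "H_normsq w0 l (b1 \<ominus> b2) \<le> R" "ennreal (\<epsilon>\<^sup>2) * B \<le> R"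
  and L: "\<phi>1 \<in> L2" "\<phi>2 \<in> L2" "b1 \<in> L2" "b2 \<in> L2"
 shows "\<exists>DX DY. Borel DX \<and> Borel DY \<and>
     Nsq l DX \<le> 12 * R \<and> Nsq l DY \<le> 12 * R \<and>
     (\<forall>\<xi>. \<forall>t\<in>{0..T}. em (w0 - m * t) (jc (p1 t) \<ominus> jc (p2 t)) \<xi> \<le> DX \<xi>) \<and>
     (\<forall>\<xi>. \<forall>t\<in>{0..T}. em (w0 - m * t) (a1 t \<ominus> a2 t) \<xi> \<le> DY \<xi>)"
proof -
 have F1: "FS \<alpha> \<beta> g s \<epsilon> T p1 a1" and [measurable]: "Borel X1" "Borel Y1"
  and N1: "Nsq l X1 \<le> B" "Nsq l Y1 \<le> B"
  and dom1: "\<And>t \<xi>. t \<in> {0..T} \<Longrightarrow> em (w0 - m * t) (jc (p1 t)) \<xi> \<le> X1 \<xi>" "\<And>t \<xi>. t \<in> {0..T} \<Longrightarrow> em (w0 - m * t) (a1 t) \<xi> \<le> Y1 \<xi>"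
  and i1: "AE \<xi> in lborel. fourier \<phi>1 \<xi> = p1 0 \<xi>" "AE \<xi> in lborel. fourier b1 \<xi> = a1 0 \<xi>"
  using S1 unfolding spectral_solution_def by blast+
 have F2: "FS \<alpha> \<beta> g s 0 T p2 a2" and [measurable]: "Borel X2" "Borel Y2"
  and N2: "Nsq (l + 1) X2 \<le> B" "Nsq (l + 1) Y2 \<le> B"
  and dom2: "\<And>t \<xi>. t \<in> {0..T} \<Longrightarrow> em (w0 - m * t) (jc (p2 t)) \<xi> \<le> X2 \<xi>" "\<And>t \<xi>. t \<in> {0..T} \<Longrightarrow> em (w0 - m * t) (a2 t) \<xi> \<le> Y2 \<xi>"
  and i2: "AE \<xi> in lborel. fourier \<phi>2 \<xi> = p2 0 \<xi>" "AE \<xi> in lborel. fourier b2 \<xi> = a2 0 \<xi>"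
  using S2 unfolding spectral_solution_def by blast+
 define VX where "VX \<xi> = X1 \<xi> + X2 \<xi>" for \<xi>
 define VY where "VY \<xi> = Y1 \<xi> + Y2 \<xi>" for \<xi>
 \<comment> \<open>Two derivatives of the limit amplitude: order \<open>l - 1\<close> of
   \<open>Z\<close> is order \<open>l + 1\<close> of \<open>Y2\<close>, which is available because
   the limit solution has one order more.\<close>
 define Z where "Z \<xi> = ennreal \<epsilon> * jm 2 Y2 \<xi>" for \<xi>
 have Vm[measurable]: "Borel VX" "Borel VY" "Borel Z"
  unfolding VX_def VY_def Z_def by measurable
 have N2': "Nsq l X2 \<le> B" "Nsq l Y2 \<le> B" using N2 Nsq_mono_p[of l "l + 1"] by (auto intro: order_trans)
 have sum4: "Nsq l (U \<oplus> V) \<le> 4 * B" if [measurable]: "Borel U" "Borel V"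
  and "Nsq l U \<le> B" "Nsq l V \<le> B" for U V
 proof -
  have "Nsq l (U \<oplus> V) \<le> 2 * B + 2 * B" by (intro order_trans[OF Nsq_add] add_mono mult_left_mono that) auto
  then show ?thesis by (simp flip: distrib_right)
 qed
 have NV: "Nsq l VX \<le> 4 * B" "Nsq l VY \<le> 4 * B" unfolding VX_def VY_def by (intro sum4 N1 N2'; simp)+
 have NZ: "Nsq (l - 1) Z \<le> R"
 proof -
  have "Nsq (l - 1) Z = ennreal (\<epsilon>\<^sup>2) * Nsq (l + 1) Y2"
   unfolding Z_def using \<epsilon> by (subst Nsq_cmult) (simp_all add: Nsq_jm ennreal_power add.commute)
  also have "... \<le> ennreal (\<epsilon>\<^sup>2) * B" by (intro mult_left_mono N2) auto
  finally show ?thesis using R(3) by simp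
 qed
 have bX: "em (w0 - m * t) (jc (p1 t)) \<xi> \<le> VX \<xi> \<and> em (w0 - m * t) (jc (p2 t)) \<xi> \<le> VX \<xi>" if "t \<in> {0..T}" for t \<xi>
  using dom1(1)[OF that, of \<xi>] dom2(1)[OF that, of \<xi>] by (simp add: VX_def add_increasing add_increasing2)
 have bY: "em (w0 - m * t) (a1 t) \<xi> \<le> VY \<xi> \<and> em (w0 - m * t) (a2 t) \<xi> \<le> VY \<xi>" if "t \<in> {0..T}" for t \<xi>
  using dom1(2)[OF that, of \<xi>] dom2(2)[OF that, of \<xi>] by (simp add: VY_def add_increasing add_increasing2)
 have bZ: "em (w0 - m * t) (\<lambda>\<xi>. of_real ((\<epsilon> - 0) * \<xi>\<^sup>2 / 2) * a2 t \<xi>) \<xi> \<le> Z \<xi>" if "t \<in> {0..T}" for t \<xi>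
 proof -
  have "\<epsilon> * \<xi>\<^sup>2 / 2 \<le> \<epsilon> * jap \<xi> powr 2"
   using \<epsilon> by (simp add: powr_numeral jap_sq)
  then have "(\<epsilon> * \<xi>\<^sup>2 / 2) * cmod (a2 t \<xi>) \<le> (\<epsilon> * jap \<xi> powr 2) * cmod (a2 t \<xi>)" by (rule mult_right_mono) simp
  moreover have "cmod (of_real ((\<epsilon> - 0) * \<xi>\<^sup>2 / 2) * a2 t \<xi>) = (\<epsilon> * \<xi>\<^sup>2 / 2) * cmod (a2 t \<xi>)"
   unfolding norm_mult norm_of_real using \<epsilon> by simp
  ultimately have "exp ((w0 - m * t) * jap \<xi>) * cmod (of_real ((\<epsilon> - 0) * \<xi>\<^sup>2 / 2) * a2 t \<xi>)
    \<le> exp ((w0 - m * t) * jap \<xi>) * ((\<epsilon> * jap \<xi> powr 2) * cmod (a2 t \<xi>))"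
   by (simp only: mult_left_mono exp_ge_zero)
  then have "em (w0 - m * t) (\<lambda>\<xi>. of_real ((\<epsilon> - 0) * \<xi>\<^sup>2 / 2) * a2 t \<xi>) \<xi>
    \<le> ennreal (exp ((w0 - m * t) * jap \<xi>) * ((\<epsilon> * jap \<xi> powr 2) * cmod (a2 t \<xi>)))"
   unfolding em_def by (rule ennreal_leI)
  also have "... = ennreal \<epsilon> * jm 2 (em (w0 - m * t) (a2 t)) \<xi>"
   using \<epsilon> by (simp add: jm_def em_def mult_ac flip: ennreal_mult)
  also have "... \<le> Z \<xi>"
   unfolding Z_def jm_def using dom2(2)[OF that] by (intro mult_left_mono) auto
  finally show ?thesis .
 qed
 have IX: "Nsq l (em w0 (jc (p1 0) \<ominus> jc (p2 0))) \<le> R"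
 proof -
  have "AE \<xi> in lborel. fourier (\<phi>1 \<ominus> \<phi>2) \<xi> = p1 0 \<xi> - p2 0 \<xi>"
   using fourier_diff[OF L(1,2)] i1(1) i2(1) by eventually_elim simp
  from R(1)[unfolded H_normsq_eq[OF this]] show ?thesis
   unfolding jc_diff[symmetric] em_jc Nsq_jm by (simp add: add.commute)
 qed
 have IY: "Nsq l (em w0 (\<lambda>\<xi>. a1 0 \<xi> - a2 0 \<xi>)) \<le> R"
 proof -
  have "AE \<xi> in lborel. fourier (b1 \<ominus> b2) \<xi> = a1 0 \<xi> - a2 0 \<xi>"
   using fourier_diff[OF L(3,4)] i1(2) i2(2) by eventually_elim simp
  from R(2)[unfolded H_normsq_eq[OF this]] show ?thesis .
 qed
 show ?thesis
 proof (cases "3 * R \<le> 4 * B")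
  case False
  then have "4 * B \<le> 12 * R" using mult_right_mono[of 3 12 R] by (simp add: not_le)
  then have "Nsq l VX \<le> 12 * R" "Nsq l VY \<le> 12 * R" using NV by (blast intro: order_trans)+
  moreover have "em (w0 - m * t) (jc (p1 t) \<ominus> jc (p2 t)) \<xi> \<le> VX \<xi>" if "t \<in> {0..T}" for t \<xi>
   unfolding VX_def by (rule order_trans[OF em_minus_le add_mono[OF dom1(1)[OF that] dom2(1)[OF that]]])
  moreover have "em (w0 - m * t) (a1 t \<ominus> a2 t) \<xi> \<le> VY \<xi>" if "t \<in> {0..T}" for t \<xi>
   unfolding VY_def by (rule order_trans[OF em_minus_le add_mono[OF dom1(2)[OF that] dom2(2)[OF that]]])
  ultimately show ?thesis using Vm by blast
 next
  case True
  obtain b where b: "B = ennreal b" "b \<ge> 1" using B by (cases B) auto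
  have "R \<le> 3 * R" using mult_right_mono[of 1 3 R] by simp
  also have "... \<le> 4 * B" by (rule True)
  also have "... < top" using B by (simp add: ennreal_mult_less_top)
  finally have "R < top" .
  then obtain q where q: "R = ennreal q" "q \<ge> 0" by (cases R) auto
  \<comment> \<open>The consistency error keeps \<open>R\<close> positive, so that
    \<open>\<theta>\<close> is positive even if the data coincide.\<close>
  have "ennreal (\<epsilon>\<^sup>2 * b) \<le> ennreal q" using R(3) b q by (simp add: ennreal_mult)
  moreover have "0 < \<epsilon>\<^sup>2 * b" using \<epsilon> b by simp
  ultimately have q0: "q > 0" using q by (auto simp: ennreal_le_iff2)
  have qb: "3 * q \<le> 4 * b" using True b q by (simp add: ennreal_mult[symmetric] ennreal_numeral[symmetric] del: ennreal_numeral)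
  \<comment> \<open>Chosen so that \<open>\<theta>^2 * (4 * B) = 3 * R\<close>; the bound
    \<open>\<theta>^2 * (4 * (4 * B))\<close> of \<open>diff_est\<close> is then
    \<open>12 * R\<close>.\<close>
  define \<theta> where "\<theta> = sqrt (3 * q / (4 * b))"
  have \<theta>: "0 < \<theta>" "\<theta> \<le> 1" "\<theta>\<^sup>2 = 3 * q / (4 * b)" using q0 qb b by (simp_all add: \<theta>_def)
  have 3: "3 * R = ennreal (\<theta>\<^sup>2) * (4 * B)"
   unfolding \<theta>(3) b q using b q by (simp flip: ennreal_mult ennreal_numeral)
  have "ennreal (\<theta>\<^sup>2) * (4 * (4 * B)) = 4 * (ennreal (\<theta>\<^sup>2) * (4 * B))" by (simp add: mult_ac)
  also have "... = 4 * (3 * R)" by (simp only: 3)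
  also have "... = 12 * R" by (simp flip: mult.assoc)
  finally have 12: "ennreal (\<theta>\<^sup>2) * (4 * (4 * B)) = 12 * R" .
  have "3 * R \<le> ennreal (\<theta>\<^sup>2) * (4 * B)" by (simp add: 3)
  from diff_estD[OF E T F1 F2 Vm NV NZ _ _ _ IX IY \<theta>(1,2) this] show ?thesis
   unfolding 12 using bX bY bZ by simp
 qed
qed

lemma triple_norm_cong:
 assumes "\<And>t. t \<in> {0..T} \<Longrightarrow> \<psi> t = \<psi>' t"
 shows "triple_norm w0 M l T \<psi> = triple_norm w0 M l T \<psi>'"
proof -
 have "(\<integral>\<^sup>+s\<in>{0..T}. H_normsq (weight w0 M s) (l + 1/2) (\<psi> s) \<partial>lborel) = (\<integral>\<^sup>+s\<in>{0..T}. H_normsq (weight w0 M s) (l + 1/2) (\<psi>' s) \<partial>lborel)"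
  by (rule nn_integral_cong) (use assms in \<open>auto simp: indicator_def\<close>)
 moreover have "(SUP s\<in>{0..T}. H_normsq (weight w0 M s) l (\<psi> s)) = (SUP s\<in>{0..T}. H_normsq (weight w0 M s) l (\<psi>' s))"
  by (rule SUP_cong) (use assms in auto)
 ultimately show ?thesis by (simp only: triple_norm_def)
qed

text \<open>The difference of two inverse transforms is the inverse transform of the difference, and
  the locale \<open>majorized\<close> applies to it with \<open>D\<close> as majorant.\<close>

lemma triple_norm_IF_diff:
 assumes W: "\<And>t. t \<in> {0..T} \<Longrightarrow> WC (u t)" "\<And>t. t \<in> {0..T} \<Longrightarrow> WC (v t)"
  and M: "M > 0" and l: "l \<ge> 0" and D: "Borel D" "Nsq l D \<le> N"
  and dom: "\<And>t \<xi>. t \<in> {0..T} \<Longrightarrow> em (w0 - M / 2 * t) (u t \<ominus> v t) \<xi> \<le> D \<xi>"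
 shows "triple_norm w0 M l T (\<lambda>t x. IF (u t) x - IF (v t) x) \<le> ennsqrt (2 * N)"
proof -
 interpret majorized w0 M T l "\<lambda>t \<xi>. u t \<xi> - v t \<xi>" D
  by unfold_locales (use assms in \<open>auto intro!: WC_diff\<close>)
 have "triple_norm w0 M l T (\<lambda>t x. IF (u t) x - IF (v t) x) = triple_norm w0 M l T (\<lambda>t. IF (u t \<ominus> v t))"
  by (rule triple_norm_cong) (use W in \<open>auto simp: IF_diff WC_integrable\<close>)
 also have "... \<le> ennsqrt (2 * Nsq l D)" by (rule triple_norm_bound)
 also have "... \<le> ennsqrt (2 * N)" by (intro ennsqrt_mono mult_left_mono D) auto
 finally show ?thesis .
qed

lemma error_estimate:
 assumes S1: "spectral_solution \<alpha> \<beta> g s \<epsilon> (M / 2) w0 T l B \<phi>1 b1 p1 a1 X1 Y1"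
  and S2: "spectral_solution \<alpha> \<beta> g s 0 (M / 2) w0 T (l + 1) B \<phi>2 b2 p2 a2 X2 Y2"
  and E: "diff_est l (4 * B) \<alpha> \<beta> g s (M / 2)" and B: "B < top" "B \<ge> 1"
  and T: "0 \<le> T" "M / 2 * T \<le> w0" and M: "M > 0" and l: "l \<ge> 0" and \<epsilon>: "0 < \<epsilon>"
  and L: "\<phi>1 \<in> L2" "\<phi>2 \<in> L2" "b1 \<in> L2" "b2 \<in> L2"
 shows "triple_norm w0 M (l + 1) T (\<lambda>t x. IF (p1 t) x - IF (p2 t) x) + triple_norm w0 M l T (\<lambda>t x. IF (a1 t) x - IF (a2 t) x)
  \<le> 2 * ennsqrt (24 * B) * (H_norm w0 (l + 1) (\<phi>1 \<ominus> \<phi>2) + H_norm w0 l (b1 \<ominus> b2) + ennreal \<epsilon>)"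
  (is "?t1 + ?t2 \<le> 2 * _ * (?n1 + ?n2 + _)")
proof -
 define n where "n = ?n1 + ?n2 + ennreal \<epsilon>"
 \<comment> \<open>As \<open>B \<ge> 1\<close>, this dominates the squares of both data norms, and
   also \<open>\<epsilon>^2 * B\<close>, the size of the consistency error.\<close>
 define R where "R = B * n\<^sup>2"
 have R: "x\<^sup>2 \<le> R" "x\<^sup>2 * B \<le> R" if "x \<le> n" for x
 proof -
  have *: "x\<^sup>2 * B \<le> n\<^sup>2 * B" by (intro mult_right_mono power_mono that) auto
  then show "x\<^sup>2 * B \<le> R" by (simp add: R_def mult.commute)
  have "x\<^sup>2 * 1 \<le> x\<^sup>2 * B" by (intro mult_left_mono B) auto
  then show "x\<^sup>2 \<le> R" using * by (simp add: R_def mult.commute)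
 qed
 have n: "?n1 \<le> n" "?n2 \<le> n" "ennreal \<epsilon> \<le> n" by (simp_all add: n_def add_increasing add_increasing2)
 have R1: "H_normsq w0 (l + 1) (\<phi>1 \<ominus> \<phi>2) \<le> R" "H_normsq w0 l (b1 \<ominus> b2) \<le> R"
  using R(1)[OF n(1)] R(1)[OF n(2)] by (simp_all add: H_norm_def)
 have R2: "ennreal (\<epsilon>\<^sup>2) * B \<le> R" using R(2)[OF n(3)] \<epsilon> by (simp add: ennreal_power)
 obtain DX DY where Dm[measurable]: "Borel DX" "Borel DY" and N: "Nsq l DX \<le> 12 * R" "Nsq l DY \<le> 12 * R"
  and dX: "\<And>\<xi> t. t\<in>{0..T} \<Longrightarrow> em (w0 - M / 2 * t) (jc (p1 t) \<ominus> jc (p2 t)) \<xi> \<le> DX \<xi>"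
  and dY: "\<And>\<xi> t. t\<in>{0..T} \<Longrightarrow> em (w0 - M / 2 * t) (a1 t \<ominus> a2 t) \<xi> \<le> DY \<xi>"
  using spectral_difference[OF S1 S2 E B T \<epsilon> R1 R2 L] by blast
 note W1 = spectral_solution_WC[OF S1] and W2 = spectral_solution_WC[OF S2]
 \<comment> \<open>The 24 is the 2 from \<open>triple_norm_bound\<close> times the 12 from
   \<open>spectral_difference\<close>.\<close>
 have "2 * (12 * R) = (ennsqrt (24 * B) * n)\<^sup>2"
  by (simp add: R_def power_mult_distrib mult.assoc[symmetric])
 then have sq: "ennsqrt (2 * (12 * R)) = ennsqrt (24 * B) * n" by simp
 have "?t1 \<le> ennsqrt (2 * (12 * R))"
  by (rule triple_norm_IF_diff[OF W1(1) W2(1) M, where D = "jm (-1) DX"])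
   (use l N(1) dX in \<open>auto simp: Nsq_jm jc_diff intro!: em_le_jm_minus_one\<close>)
 moreover have "?t2 \<le> ennsqrt (2 * (12 * R))"
  by (rule triple_norm_IF_diff[OF W1(2) W2(2) M l Dm(2) N(2) dY])
 ultimately have "?t1 + ?t2 \<le> ennsqrt (24 * B) * n + ennsqrt (24 * B) * n"
  unfolding sq by (rule add_mono)
 then show ?thesis by (simp add: n_def mult_2 distrib_right)
qed

theorem theorem1p2:
  fixes \<alpha> \<beta> :: real and \<gamma> \<sigma> :: nat
    and w0 l :: real
    and \<phi>0 a0 :: "real \<Rightarrow> complex"
    and \<phi>0e a0e :: "real \<Rightarrow> real \<Rightarrow> complex"
    and g f :: "real \<Rightarrow> real"
    and r0 :: "real \<Rightarrow> ennreal"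
  defines "g \<equiv> power_nl \<alpha> \<gamma>" and "f \<equiv> power_nl \<beta> \<sigma>"
    and "r0 \<equiv> (\<lambda>\<epsilon>. H_norm w0 (l + 1) (\<lambda>x. \<phi>0e \<epsilon> x - \<phi>0 x) + H_norm w0 l (\<lambda>x. a0e \<epsilon> x - a0 x))"
  assumes "\<gamma> > 0" and "\<sigma> > 0"
    and "w0 > 0" and "l > 1"
    and "\<phi>0 \<in> H_space w0 (l + 2)" and "a0 \<in> H_space w0 (l + 1)"
    and "\<forall>\<epsilon>\<in>{0<..1}. \<phi>0e \<epsilon> \<in> H_space w0 (l + 1) \<and> a0e \<epsilon> \<in> H_space w0 l"
    and "\<exists>B::real. \<forall>\<epsilon>\<in>{0<..1}. H_norm w0 (l + 1) (\<phi>0e \<epsilon>) \<le> ennreal B \<and> H_norm w0 l (a0e \<epsilon>) \<le> ennreal B"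
    and "\<forall>x. \<phi>0 x \<in> \<real>" and "\<forall>\<epsilon>\<in>{0<..1}. \<forall>x. \<phi>0e \<epsilon> x \<in> \<real>"
    and "(r0 \<longlongrightarrow> 0) (at_right 0)"
  shows "\<exists>M0>0. \<forall>M\<ge>M0. \<forall>T. 0 < T \<and> T < w0 / M \<longrightarrow>
    (\<exists>\<phi>e ae \<phi> a.
       (\<forall>\<epsilon>\<in>{0<..1}.
          unique_X_solution g f \<epsilon> (weight w0 M) T l (\<phi>0e \<epsilon>) (a0e \<epsilon>) (\<phi>e \<epsilon>) (ae \<epsilon>)) \<and>
       unique_X_solution g f 0 (weight w0 M) T (l + 1) \<phi>0 a0 \<phi> a \<and>
       (\<exists>C::real. C > 0 \<and> (\<forall>\<epsilon>\<in>{0<..1}.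
          triple_norm w0 M (l + 1) T (\<lambda>t x. \<phi>e \<epsilon> t x - \<phi> t x) +
          triple_norm w0 M l T (\<lambda>t x. ae \<epsilon> t x - a t x)
          \<le> ennreal C * (r0 \<epsilon> + ennreal \<epsilon>))))"
proof -
 obtain g' where \<gamma>: "\<gamma> = Suc g'" using assms(4) gr0_implies_Suc by blast
 obtain s where \<sigma>: "\<sigma> = Suc s" using assms(5) gr0_implies_Suc by blast
 obtain b :: real where b: "\<And>\<epsilon>. \<epsilon> \<in> {0<..1} \<Longrightarrow> H_norm w0 (l + 1) (\<phi>0e \<epsilon>) \<le> ennreal b \<and> H_norm w0 l (a0e \<epsilon>) \<le> ennreal b"
  using assms(11) by blast
 have L: "\<phi>0 \<in> L2" "a0 \<in> L2" and Le: "\<And>\<epsilon>. \<epsilon> \<in> {0<..1} \<Longrightarrow> \<phi>0e \<epsilon> \<in> L2" "\<And>\<epsilon>. \<epsilon> \<in> {0<..1} \<Longrightarrow> a0e \<epsilon> \<in> L2"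
  using assms(8-10) by (auto simp: H_space_def)
 \<comment> \<open>One bound for the family in order \<open>l\<close> and for the limit data in
   order \<open>l + 1\<close>, so that both existence statements give majorants below the same
   \<open>B\<close>.\<close>
 define K where "K = (ennreal b)\<^sup>2 + (H_normsq w0 (l + 2) \<phi>0 + H_normsq w0 (l + 1) a0)"
 have fin: "H_normsq w0 (l + 2) \<phi>0 < top" "H_normsq w0 (l + 1) a0 < top"
  using assms(8,9) by (simp_all add: H_space_def H_norm_def)
 have K: "K < top" using fin by (simp add: K_def power_less_top_ennreal)
 have K1: "H_normsq w0 (l + 1) (\<phi>0e \<epsilon>) \<le> K" "H_normsq w0 l (a0e \<epsilon>) \<le> K" if "\<epsilon> \<in> {0<..1}" for \<epsilon>
 proof -
  have "(H_norm w0 (l + 1) (\<phi>0e \<epsilon>))\<^sup>2 \<le> (ennreal b)\<^sup>2" "(H_norm w0 l (a0e \<epsilon>))\<^sup>2 \<le> (ennreal b)\<^sup>2"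
   using b[OF that] by (auto intro: power_mono)
  then show "H_normsq w0 (l + 1) (\<phi>0e \<epsilon>) \<le> K" "H_normsq w0 l (a0e \<epsilon>) \<le> K"
   by (simp_all add: H_norm_def K_def add_increasing2)
 qed
 have K2: "H_normsq w0 (l + 1 + 1) \<phi>0 \<le> K" "H_normsq w0 (l + 1) a0 \<le> K"
  by (simp_all add: K_def add_increasing add_increasing2 add.assoc)
 define B where "B = 2 * K + 2"
 have B: "B < top" "B \<ge> 1" "4 * B < top" "4 * B \<ge> 1"
 proof -
  show B: "B < top" "B \<ge> 1" using K by (simp_all add: B_def ennreal_mult_less_top add_increasing)
  show "4 * B < top" using B by (simp add: ennreal_mult_less_top)
  show "4 * B \<ge> 1" using mult_mono[of 1 4 1 B] B by simp
 qed
 have l: "l \<ge> 1" "l + 1 \<ge> 1" using assms(7) by auto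
 have A: "\<bar>\<alpha>\<bar> + \<bar>\<beta>\<bar> + 1 \<ge> 1" "\<bar>\<alpha>\<bar> \<le> \<bar>\<alpha>\<bar> + \<bar>\<beta>\<bar> + 1" "\<bar>\<beta>\<bar> \<le> \<bar>\<alpha>\<bar> + \<bar>\<beta>\<bar> + 1" by auto
 obtain m1 where m1: "m1 > 0" "\<And>m. m1 \<le> m \<Longrightarrow> solvable l K \<alpha> \<beta> g' s m"
  using spectral_solution_exists[OF l(1) K, of \<alpha> \<beta> g' s] by blast
 obtain m2 where m2: "m2 > 0" "\<And>m. m2 \<le> m \<Longrightarrow> solvable (l + 1) K \<alpha> \<beta> g' s m"
  using spectral_solution_exists[OF l(2) K, of \<alpha> \<beta> g' s] by blast
 obtain m3 where m3: "m3 > 0" "\<And>m. m3 \<le> m \<Longrightarrow> diff_est l (4 * B) \<alpha> \<beta> g' s m"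
  using difference_estimate[OF l(1) B(3,4) A, of g' s] by blast
 \<comment> \<open>All three thresholds concern the rate \<open>m = M / 2\<close> of the
   construction, hence the factor 2. They depend on the data through \<open>K\<close> only, so
   neither on \<open>\<epsilon>\<close> nor on \<open>T\<close>.\<close>
 define M0 where "M0 = 2 * max m1 (max m2 m3)"
 show ?thesis
 proof (rule exI[of _ M0], intro conjI allI impI)
  show "M0 > 0" using m1(1) by (simp add: M0_def)
  fix M T assume M: "M0 \<le> M" and T: "0 < T \<and> T < w0 / M"
  have m: "m1 \<le> M / 2" "m2 \<le> M / 2" "m3 \<le> M / 2" using M by (simp_all add: M0_def)
  have Mp: "M > 0" using m(1) m1(1) by linarith
  have MT: "M / 2 * T < w0"
  proof -
   have "M * T < w0" using T Mp by (simp add: field_simps)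
   moreover have "0 < M * T" using T Mp by simp
   ultimately show ?thesis by simp
  qed
  have T0: "0 \<le> T" using T by simp
  obtain p a X Y where S: "spectral_solution \<alpha> \<beta> g' s 0 (M / 2) w0 T (l + 1) B \<phi>0 a0 p a X Y"
   using m2(2)[OF m(2)] T0 MT L assms(12) K2 unfolding solvable_def B_def by blast
  have "\<forall>\<epsilon>. \<exists>pe ae Xe Ye. \<epsilon> \<in> {0<..1} \<longrightarrow> spectral_solution \<alpha> \<beta> g' s \<epsilon> (M / 2) w0 T l B (\<phi>0e \<epsilon>) (a0e \<epsilon>) pe ae Xe Ye"
   using m1(2)[OF m(1)] T0 MT Le K1 assms(13) unfolding solvable_def B_def by blast
  then obtain pe ae Xe Ye where Se: "\<And>\<epsilon>. \<epsilon> \<in> {0<..1} \<Longrightarrow>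
    spectral_solution \<alpha> \<beta> g' s \<epsilon> (M / 2) w0 T l B (\<phi>0e \<epsilon>) (a0e \<epsilon>) (pe \<epsilon>) (ae \<epsilon>) (Xe \<epsilon>) (Ye \<epsilon>)"
   by metis
  have "2 * ennsqrt (24 * B) < top" using B(1) by (simp add: ennreal_mult_less_top)
  then obtain c where c: "2 * ennsqrt (24 * B) = ennreal c" "c \<ge> 0" by (cases "2 * ennsqrt (24 * B)") auto
  \<comment> \<open>The summand 1 makes the constant positive; \<open>c\<close> depends only on
    \<open>B\<close>.\<close>
  define C where "C = c + 1"
  have C: "C > 0" "2 * ennsqrt (24 * B) \<le> ennreal C" using c by (simp_all add: C_def)
  show "\<exists>\<phi>e ae \<phi> a.
    (\<forall>\<epsilon>\<in>{0<..1}.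
     unique_X_solution g f \<epsilon> (weight w0 M) T l (\<phi>0e \<epsilon>) (a0e \<epsilon>) (\<phi>e \<epsilon>) (ae \<epsilon>)) \<and>
    unique_X_solution g f 0 (weight w0 M) T (l + 1) \<phi>0 a0 \<phi> a \<and>
    (\<exists>C::real. C > 0 \<and> (\<forall>\<epsilon>\<in>{0<..1}.
     triple_norm w0 M (l + 1) T (\<lambda>t x. \<phi>e \<epsilon> t x - \<phi> t x) +
     triple_norm w0 M l T (\<lambda>t x. ae \<epsilon> t x - a t x)
     \<le> ennreal C * (r0 \<epsilon> + ennreal \<epsilon>)))"
  proof (rule exI[of _ "\<lambda>\<epsilon> t. IF (pe \<epsilon> t)"], rule exI[of _ "\<lambda>\<epsilon> t. IF (ae \<epsilon> t)"], rule exI[of _ "\<lambda>t. IF (p t)"], rule exI[of _ "\<lambda>t. IF (a t)"],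
    intro conjI ballI exI[of _ C])
   show "C > 0" by (rule C(1))
   show "unique_X_solution g f 0 (weight w0 M) T (l + 1) \<phi>0 a0 (\<lambda>t. IF (p t)) (\<lambda>t. IF (a t))"
    unfolding g_def f_def \<gamma> \<sigma> by (rule spectral_solution_X_solution[OF S B(1) L l(2) Mp]) (use T in auto)
   fix \<epsilon> :: real assume \<epsilon>: "\<epsilon> \<in> {0<..1}"
   show "unique_X_solution g f \<epsilon> (weight w0 M) T l (\<phi>0e \<epsilon>) (a0e \<epsilon>) (\<lambda>t. IF (pe \<epsilon> t)) (\<lambda>t. IF (ae \<epsilon> t))"
    unfolding g_def f_def \<gamma> \<sigma> by (rule spectral_solution_X_solution[OF Se[OF \<epsilon>] B(1) Le[OF \<epsilon>] l(1) Mp]) (use T in auto)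
   have "triple_norm w0 M (l + 1) T (\<lambda>t x. IF (pe \<epsilon> t) x - IF (p t) x) + triple_norm w0 M l T (\<lambda>t x. IF (ae \<epsilon> t) x - IF (a t) x)
     \<le> 2 * ennsqrt (24 * B) * (r0 \<epsilon> + ennreal \<epsilon>)"
    unfolding r0_def
    by (rule error_estimate[OF Se[OF \<epsilon>] S m3(2)[OF m(3)] B(1,2) T0 less_imp_le[OF MT] Mp _ _ Le(1)[OF \<epsilon>] L(1) Le(2)[OF \<epsilon>] L(2)])
     (use \<epsilon> l in auto)
   also have "... \<le> ennreal C * (r0 \<epsilon> + ennreal \<epsilon>)" by (intro mult_right_mono C) auto
   finally show "triple_norm w0 M (l + 1) T (\<lambda>t x. IF (pe \<epsilon> t) x - IF (p t) x) + triple_norm w0 M l T (\<lambda>t x. IF (ae \<epsilon> t) x - IF (a t) x)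
     \<le> ennreal C * (r0 \<epsilon> + ennreal \<epsilon>)" .
  qed
 qed
qed

end
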